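(* Let $T$ be a rigid module in $\operatorname{Sub} Q_J$. Then $\Sigma(T)\leqslant r-r_K$, where $\Sigma(T)$ denotes the number of pairwise non-isomorphic indecomposable direct summands of $T$.
   Context: Let $\Delta$ be a Dynkin diagram of type $A$, $D$ or $E$ with vertex set $I$; let $r$ be the number of positive roots of $\Delta$. Let $J\subseteq I$ be non-empty and $K=I\setminus J$. $\Delta_K$ is the full subdiagram of $\Delta$ with vertex set $K$ and $r_K$ is its number of positive roots (the sum over its connected components). $\Lambda$ is the preprojective algebra of $\Delta$ over $\mathbb{C}$ (choose an orientation of $\Delta$, add to each arrow $a:i\to j$ a reverse arrow $a^*:j\to i$, and take the path algebra modulo the ideal generated by $\sum_a (a^*a-aa^* )$). Modules are finite-dimensional. $Q_i$ is the injective hull of the simple $\Lambda$-module $S_i$, and $Q_J=\bigoplus_{j\in J}Q_j$. $\operatorname{Sub} Q_J$ is the full subcategory of $\operatorname{mod}\Lambda$ of modules isomorphic to a submodule of a finite direct sum of copies of $Q_J$. A $\Lambda$-module $T$ is rigid if $\operatorname{Ext}^1_\Lambda(T,T)=0$. *)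

theory Defs
  imports Complex_Main "HOL-Algebra.Module" "HOL-Algebra.QuotRing"
begin

section \<open>Dynkin diagrams and their positive roots\<close>

text \<open>
  A diagram is a vertex set \<open>V\<close> with a symmetric adjacency relation
  \<open>E \<subseteq> V \<times> V\<close>. The standard diagrams carry the Bourbaki labelling on \<open>{1..n}\<close>;
  each edge is listed once and the relation is symmetrized in \<open>ADE_diagram\<close>.
\<close>

definition A_edges :: "nat \<Rightarrow> (nat \<times> nat) set" where
  "A_edges n = {(i, i + 1) | i. 1 \<le> i \<and> i + 1 \<le> n}"

definition D_edges :: "nat \<Rightarrow> (nat \<times> nat) set" where
  "D_edges n = {(i, i + 1) | i. 1 \<le> i \<and> i + 1 \<le> n - 1} \<union> {(n - 2, n)}"

definition E_edges :: "nat \<Rightarrow> (nat \<times> nat) set" where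
  "E_edges n = {(1, 3), (2, 4)} \<union> {(i, i + 1) | i. 3 \<le> i \<and> i + 1 \<le> n}"

definition diagram_iso ::
  "'i set \<Rightarrow> ('i \<times> 'i) set \<Rightarrow> 'j set \<Rightarrow> ('j \<times> 'j) set \<Rightarrow> bool" where
  "diagram_iso V E W F \<longleftrightarrow>
     (\<exists>\<phi>. bij_betw \<phi> V W \<and> (\<forall>x\<in>V. \<forall>y\<in>V. (x, y) \<in> E \<longleftrightarrow> (\<phi> x, \<phi> y) \<in> F))"

definition ADE_diagram :: "'i set \<Rightarrow> ('i \<times> 'i) set \<Rightarrow> bool" where
  "ADE_diagram V E \<longleftrightarrow> E \<subseteq> V \<times> V \<and>
     (\<exists>n F. ((1 \<le> n \<and> F = A_edges n) \<or> (4 \<le> n \<and> F = D_edges n) \<or>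
             (n \<in> {6, 7, 8} \<and> F = E_edges n)) \<and>
            diagram_iso V E {1..n} (F \<union> F\<inverse>))"

definition full_subdiagram :: "('i \<times> 'i) set \<Rightarrow> 'i set \<Rightarrow> ('i \<times> 'i) set" where
  "full_subdiagram E K = E \<inter> K \<times> K"

definition cartan :: "('i \<times> 'i) set \<Rightarrow> 'i \<Rightarrow> 'i \<Rightarrow> int" where
  "cartan E i j = (if i = j then 2 else if (i, j) \<in> E then -1 else 0)"

definition simple_root :: "'i \<Rightarrow> 'i \<Rightarrow> int" where
  "simple_root i = (\<lambda>k. if k = i then 1 else 0)"

definition simple_reflection ::
  "'i set \<Rightarrow> ('i \<times> 'i) set \<Rightarrow> 'i \<Rightarrow> ('i \<Rightarrow> int) \<Rightarrow> ('i \<Rightarrow> int)" where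
  "simple_reflection V E i x =
     (\<lambda>k. x k - (\<Sum>j\<in>V. cartan E i j * x j) * simple_root i k)"

text \<open>
  The roots are the Weyl group translates of the simple roots. The diagram may be
  disconnected: the reflections belonging to different components commute and each
  fixes the roots of the other components, so the root system is the disjoint union
  of those of the components, and the numbers of positive roots add up.
\<close>

inductive_set roots :: "'i set \<Rightarrow> ('i \<times> 'i) set \<Rightarrow> ('i \<Rightarrow> int) set"
  for V :: "'i set" and E :: "('i \<times> 'i) set" where
  simple: "i \<in> V \<Longrightarrow> simple_root i \<in> roots V E"
| reflect: "x \<in> roots V E \<Longrightarrow> i \<in> V \<Longrightarrow> simple_reflection V E i x \<in> roots V E"

definition positive_roots :: "'i set \<Rightarrow> ('i \<times> 'i) set \<Rightarrow> ('i \<Rightarrow> int) set" where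
  "positive_roots V E = {x \<in> roots V E. \<forall>i. 0 \<le> x i}"

definition num_positive_roots :: "'i set \<Rightarrow> ('i \<times> 'i) set \<Rightarrow> nat" where
  "num_positive_roots V E = card (positive_roots V E)"


section \<open>Left modules over a ring\<close>

text \<open>
  The locale \<open>module\<close> requires a commutative ring of scalars, so left modules are
  introduced anew on the library's record type. The fields \<open>mult\<close> and \<open>one\<close> of that
  record play no role.
\<close>

locale left_module = R?: ring R + M?: abelian_group M
  for R :: "('r, 'x) ring_scheme" (structure) and M :: "('r, 'm) module" (structure) +
  assumes smult_closed:
      "\<lbrakk>a \<in> carrier R; x \<in> carrier M\<rbrakk> \<Longrightarrow> a \<odot>\<^bsub>M\<^esub> x \<in> carrier M"
    and smult_l_distr:
      "\<lbrakk>a \<in> carrier R; b \<in> carrier R; x \<in> carrier M\<rbrakk> \<Longrightarrow>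
       (a \<oplus>\<^bsub>R\<^esub> b) \<odot>\<^bsub>M\<^esub> x = a \<odot>\<^bsub>M\<^esub> x \<oplus>\<^bsub>M\<^esub> b \<odot>\<^bsub>M\<^esub> x"
    and smult_r_distr:
      "\<lbrakk>a \<in> carrier R; x \<in> carrier M; y \<in> carrier M\<rbrakk> \<Longrightarrow>
       a \<odot>\<^bsub>M\<^esub> (x \<oplus>\<^bsub>M\<^esub> y) = a \<odot>\<^bsub>M\<^esub> x \<oplus>\<^bsub>M\<^esub> a \<odot>\<^bsub>M\<^esub> y"
    and smult_assoc:
      "\<lbrakk>a \<in> carrier R; b \<in> carrier R; x \<in> carrier M\<rbrakk> \<Longrightarrow>
       (a \<otimes>\<^bsub>R\<^esub> b) \<odot>\<^bsub>M\<^esub> x = a \<odot>\<^bsub>M\<^esub> (b \<odot>\<^bsub>M\<^esub> x)"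
    and smult_one:
      "x \<in> carrier M \<Longrightarrow> \<one>\<^bsub>R\<^esub> \<odot>\<^bsub>M\<^esub> x = x"

definition mod_hom ::
  "('r, 'x) ring_scheme \<Rightarrow> ('r, 'm) module \<Rightarrow> ('r, 'n) module \<Rightarrow> ('m \<Rightarrow> 'n) set" where
  "mod_hom R M N =
     {f \<in> carrier M \<rightarrow> carrier N.
        (\<forall>x\<in>carrier M. \<forall>y\<in>carrier M. f (x \<oplus>\<^bsub>M\<^esub> y) = f x \<oplus>\<^bsub>N\<^esub> f y) \<and>
        (\<forall>a\<in>carrier R. \<forall>x\<in>carrier M. f (a \<odot>\<^bsub>M\<^esub> x) = a \<odot>\<^bsub>N\<^esub> f x)}"

definition mod_isomorphic ::
  "('r, 'x) ring_scheme \<Rightarrow> ('r, 'm) module \<Rightarrow> ('r, 'n) module \<Rightarrow> bool" where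
  "mod_isomorphic R M N \<longleftrightarrow> (\<exists>f\<in>mod_hom R M N. bij_betw f (carrier M) (carrier N))"

abbreviation restrict_module :: "('r, 'm) module \<Rightarrow> 'm set \<Rightarrow> ('r, 'm) module" where
  "restrict_module M U \<equiv> M\<lparr>carrier := U\<rparr>"

text \<open>The direct sum of a family; only used for a finite index set \<open>X\<close>.\<close>

definition direct_sum :: "'k set \<Rightarrow> ('k \<Rightarrow> ('r, 'm) module) \<Rightarrow> ('r, 'k \<Rightarrow> 'm) module" where
  "direct_sum X M =
     \<lparr>carrier = (\<Pi>\<^sub>E k\<in>X. carrier (M k)),
      mult = undefined, one = undefined,
      zero = (\<lambda>k\<in>X. \<zero>\<^bsub>M k\<^esub>),
      add = (\<lambda>x y. \<lambda>k\<in>X. x k \<oplus>\<^bsub>M k\<^esub> y k),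
      smult = (\<lambda>a x. \<lambda>k\<in>X. a \<odot>\<^bsub>M k\<^esub> x k)\<rparr>"

definition direct_sum2 :: "('r, 'm) module \<Rightarrow> ('r, 'n) module \<Rightarrow> ('r, 'm \<times> 'n) module" where
  "direct_sum2 M N =
     \<lparr>carrier = carrier M \<times> carrier N,
      mult = undefined, one = undefined,
      zero = (\<zero>\<^bsub>M\<^esub>, \<zero>\<^bsub>N\<^esub>),
      add = (\<lambda>x y. (fst x \<oplus>\<^bsub>M\<^esub> fst y, snd x \<oplus>\<^bsub>N\<^esub> snd y)),
      smult = (\<lambda>a x. (a \<odot>\<^bsub>M\<^esub> fst x, a \<odot>\<^bsub>N\<^esub> snd x))\<rparr>"

definition complementary ::
  "('r, 'x) ring_scheme \<Rightarrow> ('r, 'm) module \<Rightarrow> 'm set \<Rightarrow> 'm set \<Rightarrow> bool" where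
  "complementary R M U W \<longleftrightarrow>
     submodule U R M \<and> submodule W R M \<and>
     U \<inter> W = {\<zero>\<^bsub>M\<^esub>} \<and> U <+>\<^bsub>M\<^esub> W = carrier M"

definition indecomposable :: "('r, 'x) ring_scheme \<Rightarrow> ('r, 'm) module \<Rightarrow> bool" where
  "indecomposable R M \<longleftrightarrow>
     carrier M \<noteq> {\<zero>\<^bsub>M\<^esub>} \<and>
     (\<forall>U W. complementary R M U W \<longrightarrow> U = {\<zero>\<^bsub>M\<^esub>} \<or> W = {\<zero>\<^bsub>M\<^esub>})"

definition indecomposable_summands ::
  "('r, 'x) ring_scheme \<Rightarrow> ('r, 'm) module \<Rightarrow> 'm set set" where
  "indecomposable_summands R M =
     {U. (\<exists>W. complementary R M U W) \<and> indecomposable R (restrict_module M U)}"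

definition indecomposable_summand_classes ::
  "('r, 'x) ring_scheme \<Rightarrow> ('r, 'm) module \<Rightarrow> 'm set set set" where
  "indecomposable_summand_classes R M =
     indecomposable_summands R M //
       {(U, W). U \<in> indecomposable_summands R M \<and> W \<in> indecomposable_summands R M \<and>
                mod_isomorphic R (restrict_module M U) (restrict_module M W)}"

text \<open>The number usually written \<open>\<Sigma>(M)\<close>.\<close>

definition num_indecomposable_summands ::
  "('r, 'x) ring_scheme \<Rightarrow> ('r, 'm) module \<Rightarrow> nat" where
  "num_indecomposable_summands R M = card (indecomposable_summand_classes R M)"


subsection \<open>Yoneda extensions\<close>

text \<open>
  Elements of \<open>Ext\<^sup>1(N, M)\<close> are the equivalence classes of short exact sequences
  \<open>0 \<rightarrow> M \<rightarrow> L \<rightarrow> N \<rightarrow> 0\<close>, its zero element is the class of the split sequence.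
  The carrier of \<open>L\<close> is a union of translates of \<open>M\<close> indexed by \<open>N\<close>, hence in bijection
  with \<open>M \<times> N\<close>; so it is enough to consider middle terms with elements in the type
  \<open>'m \<times> 'n\<close>.
\<close>

type_synonym ('r, 'm, 'n) extension =
  "('r, 'm \<times> 'n) module \<times> ('m \<Rightarrow> 'm \<times> 'n) \<times> ('m \<times> 'n \<Rightarrow> 'n)"

definition extensions ::
  "('r, 'x) ring_scheme \<Rightarrow> ('r, 'n) module \<Rightarrow> ('r, 'm) module \<Rightarrow> ('r, 'm, 'n) extension set" where
  "extensions R N M =
     {(L, f, g). left_module R L \<and> f \<in> mod_hom R M L \<and> g \<in> mod_hom R L N \<and>
        inj_on f (carrier M) \<and>
        f ` carrier M = {x \<in> carrier L. g x = \<zero>\<^bsub>N\<^esub>} \<and>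
        g ` carrier L = carrier N}"

definition extension_equiv ::
  "('r, 'x) ring_scheme \<Rightarrow> ('r, 'n) module \<Rightarrow> ('r, 'm) module \<Rightarrow> ('r, 'm, 'n) extension rel" where
  "extension_equiv R N M =
     {((L, f, g), (L', f', g')).
        (L, f, g) \<in> extensions R N M \<and> (L', f', g') \<in> extensions R N M \<and>
        (\<exists>h\<in>mod_hom R L L'. bij_betw h (carrier L) (carrier L') \<and>
           (\<forall>x\<in>carrier M. h (f x) = f' x) \<and> (\<forall>y\<in>carrier L. g' (h y) = g y))}"

definition Ext1 ::
  "('r, 'x) ring_scheme \<Rightarrow> ('r, 'n) module \<Rightarrow> ('r, 'm) module \<Rightarrow> ('r, 'm, 'n) extension set set" where
  "Ext1 R N M = extensions R N M // extension_equiv R N M"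

definition Ext1_zero ::
  "('r, 'x) ring_scheme \<Rightarrow> ('r, 'n) module \<Rightarrow> ('r, 'm) module \<Rightarrow> ('r, 'm, 'n) extension set" where
  "Ext1_zero R N M =
     extension_equiv R N M `` {(direct_sum2 M N, \<lambda>x. (x, \<zero>\<^bsub>N\<^esub>), snd)}"

definition rigid :: "('r, 'x) ring_scheme \<Rightarrow> ('r, 'm) module \<Rightarrow> bool" where
  "rigid R M \<longleftrightarrow> Ext1 R M M = {Ext1_zero R M M}"


subsection \<open>Injective hulls\<close>

text \<open>
  The test modules have elements in the type of the elements of \<open>R\<close>. This is no
  restriction: the left ideals of \<open>R\<close> and \<open>R\<close> itself are among them, so that by Baer's
  criterion \<open>Q\<close> is injective with respect to all \<open>R\<close>-modules.
\<close>

definition injective_module :: "('r, 'x) ring_scheme \<Rightarrow> ('r, 'q) module \<Rightarrow> bool" where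
  "injective_module R Q \<longleftrightarrow> left_module R Q \<and>
     (\<forall>(M :: ('r, 'r) module) (N :: ('r, 'r) module) f g.
        left_module R M \<and> left_module R N \<and>
        f \<in> mod_hom R M N \<and> inj_on f (carrier M) \<and> g \<in> mod_hom R M Q \<longrightarrow>
        (\<exists>h\<in>mod_hom R N Q. \<forall>x\<in>carrier M. h (f x) = g x))"

definition injective_hull ::
  "('r, 'x) ring_scheme \<Rightarrow> ('r, 's) module \<Rightarrow> ('r, 'q) module \<Rightarrow> bool" where
  "injective_hull R S Q \<longleftrightarrow> injective_module R Q \<and>
     (\<exists>f\<in>mod_hom R S Q. inj_on f (carrier S) \<and>
        (\<forall>U. submodule U R Q \<and> U \<inter> f ` carrier S = {\<zero>\<^bsub>Q\<^esub>} \<longrightarrow> U = {\<zero>\<^bsub>Q\<^esub>}))"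


section \<open>The preprojective algebra\<close>

definition orientation :: "('i \<times> 'i) set \<Rightarrow> ('i \<times> 'i) set \<Rightarrow> bool" where
  "orientation E \<Omega> \<longleftrightarrow> \<Omega> \<union> \<Omega>\<inverse> = E \<and> \<Omega> \<inter> \<Omega>\<inverse> = {}"

text \<open>
  An arrow \<open>a : i \<rightarrow> j\<close> of the oriented diagram is the pair \<open>(i, j) \<in> \<Omega>\<close>, and its reverse
  \<open>a\<^sup>* : j \<rightarrow> i\<close> is \<open>(j, i)\<close>. As the diagrams have no multiple edges, a path of the double
  quiver is determined by the non-empty list of the vertices it visits, in the order of
  travel; \<open>[i]\<close> is the trivial path at \<open>i\<close>.
\<close>

definition double_paths :: "'i set \<Rightarrow> ('i \<times> 'i) set \<Rightarrow> 'i list set" where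
  "double_paths V \<Omega> =
     {w. w \<noteq> [] \<and> set w \<subseteq> V \<and> successively (\<lambda>i j. (i, j) \<in> \<Omega> \<union> \<Omega>\<inverse>) w}"

text \<open>
  Elements of the path algebra are finitely supported functions on paths. Paths are
  composed like functions, \<open>p q\<close> meaning first \<open>q\<close>, then \<open>p\<close>: the factorizations of a path
  \<open>w\<close> are obtained by cutting it at its \<open>k\<close>-th vertex, the initial part \<open>take (k + 1) w\<close>
  being the right factor.
\<close>

definition path_algebra :: "'i set \<Rightarrow> ('i \<times> 'i) set \<Rightarrow> ('i list \<Rightarrow> complex) ring" where
  "path_algebra V \<Omega> =
     \<lparr>carrier = {f. finite {w. f w \<noteq> 0} \<and> {w. f w \<noteq> 0} \<subseteq> double_paths V \<Omega>},
      mult = (\<lambda>f g w. \<Sum>k<length w. f (drop k w) * g (take (k + 1) w)),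
      one = (\<lambda>w. if \<exists>i\<in>V. w = [i] then 1 else 0),
      zero = (\<lambda>w. 0),
      add = (\<lambda>f g w. f w + g w)\<rparr>"

text \<open>The reverse of the arrow \<open>a\<close> is \<open>prod.swap a\<close>.\<close>

definition arrow :: "'i \<times> 'i \<Rightarrow> 'i list \<Rightarrow> complex" where
  "arrow a = (\<lambda>w. if w = [fst a, snd a] then 1 else 0)"

definition preprojective_ideal ::
  "'i set \<Rightarrow> ('i \<times> 'i) set \<Rightarrow> ('i list \<Rightarrow> complex) set" where
  "preprojective_ideal V \<Omega> =
     (let P = path_algebra V \<Omega> in
      Idl\<^bsub>P\<^esub> {\<Oplus>\<^bsub>P\<^esub>a\<in>\<Omega>.
                 (arrow (prod.swap a) \<otimes>\<^bsub>P\<^esub> arrow a) \<ominus>\<^bsub>P\<^esub>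
                 (arrow a \<otimes>\<^bsub>P\<^esub> arrow (prod.swap a))})"

definition preprojective_algebra ::
  "'i set \<Rightarrow> ('i \<times> 'i) set \<Rightarrow> ('i list \<Rightarrow> complex) set ring" where
  "preprojective_algebra V \<Omega> = path_algebra V \<Omega> Quot preprojective_ideal V \<Omega>"

text \<open>The image of \<open>c \<in> \<complex>\<close> in the preprojective algebra.\<close>

definition preprojective_scalar ::
  "'i set \<Rightarrow> ('i \<times> 'i) set \<Rightarrow> complex \<Rightarrow> ('i list \<Rightarrow> complex) set" where
  "preprojective_scalar V \<Omega> c =
     preprojective_ideal V \<Omega> +>\<^bsub>path_algebra V \<Omega>\<^esub> (\<lambda>w. c * \<one>\<^bsub>path_algebra V \<Omega>\<^esub> w)"

text \<open>
  The category \<open>mod \<Lambda>\<close>: left modules spanned over \<open>\<complex>\<close> by finitely many elements.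
\<close>

definition fd_module ::
  "'i set \<Rightarrow> ('i \<times> 'i) set \<Rightarrow> (('i list \<Rightarrow> complex) set, 'm) module \<Rightarrow> bool" where
  "fd_module V \<Omega> M \<longleftrightarrow> left_module (preprojective_algebra V \<Omega>) M \<and>
     (\<exists>B. finite B \<and> B \<subseteq> carrier M \<and>
        (\<forall>x\<in>carrier M. \<exists>c. x = (\<Oplus>\<^bsub>M\<^esub>b\<in>B. preprojective_scalar V \<Omega> (c b) \<odot>\<^bsub>M\<^esub> b)))"

text \<open>
  The simple module at the vertex \<open>i\<close> is \<open>\<complex>\<close>, on which the trivial path at \<open>i\<close> acts as the
  identity and every other path as zero. All representatives \<open>f\<close> of an element \<open>X\<close> of the
  preprojective algebra have the same coefficient at the trivial path, as the elements of
  the ideal are supported on paths of length at least 2.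
\<close>

definition simple_module :: "'i \<Rightarrow> (('i list \<Rightarrow> complex) set, complex) module" where
  "simple_module i =
     \<lparr>carrier = UNIV, mult = undefined, one = undefined, zero = 0, add = (+),
      smult = (\<lambda>X z. the_elem ((\<lambda>f. f [i]) ` X) * z)\<rparr>"

text \<open>
  \<open>T \<in> Sub Q\<^sub>J\<close>, where \<open>Q j\<close> is the chosen injective hull of the simple module at \<open>j\<close>.
\<close>

definition in_Sub ::
  "'i set \<Rightarrow> ('i \<times> 'i) set \<Rightarrow> ('i \<Rightarrow> (('i list \<Rightarrow> complex) set, 'q) module) \<Rightarrow> 'i set \<Rightarrow>
   (('i list \<Rightarrow> complex) set, 'm) module \<Rightarrow> bool" where
  "in_Sub V \<Omega> Q J T \<longleftrightarrow> fd_module V \<Omega> T \<and>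
     (\<exists>(n :: nat) U.
        submodule U (preprojective_algebra V \<Omega>) (direct_sum {..<n} (\<lambda>_. direct_sum J Q)) \<and>
        mod_isomorphic (preprojective_algebra V \<Omega>) T
          (restrict_module (direct_sum {..<n} (\<lambda>_. direct_sum J Q)) U))"

end

theory Submission
  imports Defs "HOL-Library.Function_Algebras"
begin

text \<open>
  Let r and r_K be the numbers of positive roots of the two diagrams. The bound is the length of a
  word: a reduced word of the longest element of the Weyl group of \<Delta>_K extends to a reduced word
  of the longest element of the Weyl group of \<Delta>, and the added part \<open>w\<close> has r - r_K letters
  (\<open>longest_word\<close>). Regard a \<Lambda>-module as a representation of the double quiver. Reading \<open>w\<close> from
  left to right, divide out at each letter \<open>i\<close> the largest submodule that is a sum of copies of
  the simple module at \<open>i\<close>. Along a word of the longest element this process consumes every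
  finite-dimensional representation, because the filtration depends only on the braid class of the
  word and every vertex can be made the last letter; so the remaining quotient has zero socle, and
  such a quotient vanishes because the quadratic form of \<Delta> is positive definite
  (\<open>socle_zero_imp_zero\<close>). A module in \<open>Sub Q_J\<close> has no simple submodule at a vertex of \<open>K\<close>, so
  that the letters of the first word do nothing and \<open>w\<close> alone consumes it (\<open>socle_word\<close>,
  \<open>in_Sub_no_socle\<close>).

  The multiplicities found on the way form a vector of length r - r_K, the string of the module,
  which is additive on direct sums. A rigid module is determined up to isomorphism by its string
  (\<open>rigid_determined_by_string\<close>). Inductively, the quotient by the first socle is again rigid
  (\<open>ext_orth_soc_quot\<close>), hence known, and two rigid modules with the same quotient and socles of
  the same dimension are joined by an affine line of modules. By rigidity all but finitely many
  points of the line are isomorphic to one end, and also all but finitely many to the other end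
  (\<open>line_isomorphic\<close>); so the ends are isomorphic. This takes the place of the argument with two
  dense orbits in an irreducible variety.

  Suppose now that a rigid module had n > r - r_K pairwise non-isomorphic indecomposable summands.
  A pigeonhole argument (\<open>nat_dependence\<close>) gives two direct sums of them, not both zero and
  without a common summand, with equal strings. Both are rigid, so they are isomorphic, against
  the uniqueness of decompositions into indecomposables (\<open>card_rigid_family\<close>).

  Vanishing of \<open>Ext1\<close> enters only through cocycles: families of linear maps, one for each arrow,
  that satisfy the linearized mesh relations. A cocycle on a module defines a Yoneda extension of
  the module by itself, and a splitting of that extension exhibits the cocycle as a coboundary
  (\<open>rigid_coboundary\<close>).
\<close>

section \<open>Linear maps on complex subspaces\<close>

text \<open>
  Complex scalars on abelian groups, without norm or topology: functions into such a type are
  again of this kind, so coefficient spaces, spaces of maps and direct sums over varying index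
  sets need no new types.
\<close>

class cvector = ab_group_add +
  fixes cscale :: "complex \<Rightarrow> 'a \<Rightarrow> 'a"  (infixr "*\<^sub>C" 75)
  assumes cscale_add_right: "a *\<^sub>C (x + y) = a *\<^sub>C x + a *\<^sub>C y"
    and cscale_add_left: "(a + b) *\<^sub>C x = a *\<^sub>C x + b *\<^sub>C x"
    and cscale_cscale: "a *\<^sub>C b *\<^sub>C x = (a * b) *\<^sub>C x"
    and cscale_one: "1 *\<^sub>C x = x"

instantiation complex :: cvector
begin
definition cscale_complex_def [simp]: "cscale a (x :: complex) = a * x"
instance by standard (simp_all add: algebra_simps)
end

instantiation "fun" :: (type, cvector) cvector
begin
definition cscale_fun_def: "cscale a f = (\<lambda>x. a *\<^sub>C f x)"
instance by standard
  (simp_all add: cscale_fun_def fun_eq_iff cscale_add_right cscale_add_left cscale_cscale cscale_one)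
end

global_interpretation cv: vector_space "cscale :: complex \<Rightarrow> 'a \<Rightarrow> 'a::cvector"
  by standard (simp_all add: cscale_add_right cscale_add_left cscale_cscale cscale_one)

global_interpretation cvp: vector_space_pair
  "cscale :: complex \<Rightarrow> 'a \<Rightarrow> 'a::cvector" "cscale :: complex \<Rightarrow> 'b \<Rightarrow> 'b::cvector"
  by standard

lemma cscale_apply: "(a *\<^sub>C f) x = a *\<^sub>C f x"
  by (simp add: cscale_fun_def)

lemma sum_fun_apply: "sum f A x = (\<Sum>a\<in>A. f a x)"
  by (induction A rule: infinite_finite_induct) auto

text \<open>
  All vector spaces are subspaces of a type, and a linear map is constrained on its subspace only.
\<close>

definition lin_on :: "'a::cvector set \<Rightarrow> ('a \<Rightarrow> 'b::cvector) \<Rightarrow> bool" where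
  "lin_on S f \<longleftrightarrow> (\<forall>x\<in>S. \<forall>y\<in>S. f (x + y) = f x + f y) \<and> (\<forall>c. \<forall>x\<in>S. f (c *\<^sub>C x) = c *\<^sub>C f x)"

lemma lin_on_add: "lin_on S f \<Longrightarrow> x \<in> S \<Longrightarrow> y \<in> S \<Longrightarrow> f (x + y) = f x + f y"
  and lin_on_scale: "lin_on S f \<Longrightarrow> x \<in> S \<Longrightarrow> f (c *\<^sub>C x) = c *\<^sub>C f x"
  by (auto simp: lin_on_def)

lemma lin_on_zero: "lin_on S f \<Longrightarrow> cv.subspace S \<Longrightarrow> f 0 = 0"
  by (metis cv.scale_zero_left cv.subspace_0 lin_on_scale)

lemma lin_on_minus: "lin_on S f \<Longrightarrow> x \<in> S \<Longrightarrow> f (- x) = - f x"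
  using lin_on_scale[of S f x "-1"] by simp

lemma lin_on_diff: "lin_on S f \<Longrightarrow> cv.subspace S \<Longrightarrow> x \<in> S \<Longrightarrow> y \<in> S \<Longrightarrow> f (x - y) = f x - f y"
  using lin_on_add[of S f x "- y"] lin_on_minus[of S f y] cv.subspace_neg by fastforce

lemma lin_on_sum:
  assumes "lin_on S f" "cv.subspace S" "\<And>a. a \<in> A \<Longrightarrow> g a \<in> S"
  shows "f (\<Sum>a\<in>A. g a) = (\<Sum>a\<in>A. f (g a))"
  using assms(3)
proof (induction A rule: infinite_finite_induct)
  case (insert a A)
  then have "(\<Sum>a\<in>A. g a) \<in> S" using assms(2) by (intro cv.subspace_sum) auto
  then show ?case using insert assms lin_on_add by fastforce
qed (auto simp: lin_on_zero[OF assms(1,2)])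

lemma lin_on_subset: "lin_on S f \<Longrightarrow> T \<subseteq> S \<Longrightarrow> lin_on T f"
  unfolding lin_on_def by blast

lemma lin_on_cong: "lin_on S f \<Longrightarrow> cv.subspace S \<Longrightarrow> (\<And>x. x \<in> S \<Longrightarrow> g x = f x) \<Longrightarrow> lin_on S g"
  by (auto simp: lin_on_def cv.subspace_add cv.subspace_scale)

lemma lin_on_comp: "lin_on S f \<Longrightarrow> (\<And>x. x \<in> S \<Longrightarrow> f x \<in> T) \<Longrightarrow> lin_on T g \<Longrightarrow> lin_on S (\<lambda>x. g (f x))"
  by (auto simp: lin_on_def)

lemma lin_on_id: "lin_on S (\<lambda>x. x)"
  by (auto simp: lin_on_def)

lemma lin_on_const0: "lin_on S (\<lambda>x. 0)"
  by (auto simp: lin_on_def)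

lemma lin_on_plus: "lin_on S f \<Longrightarrow> lin_on S g \<Longrightarrow> lin_on S (\<lambda>x. f x + g x)"
  by (auto simp: lin_on_def cscale_add_right algebra_simps)

lemma lin_on_minus_fun: "lin_on S f \<Longrightarrow> lin_on S g \<Longrightarrow> lin_on S (\<lambda>x. f x - g x)"
  by (auto simp: lin_on_def cv.scale_right_diff_distrib algebra_simps)

lemma lin_on_cmult: "lin_on S f \<Longrightarrow> lin_on S (\<lambda>x. c *\<^sub>C f x)"
  by (auto simp: lin_on_def cscale_add_right cscale_cscale mult.commute)

lemma lin_on_sum_fun: "(\<And>a. a \<in> A \<Longrightarrow> lin_on S (f a)) \<Longrightarrow> lin_on S (\<lambda>x. \<Sum>a\<in>A. f a x)"
  by (induction A rule: infinite_finite_induct) (auto intro: lin_on_const0 lin_on_plus)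

lemma linear_lin_on: "Vector_Spaces.linear cscale cscale f \<Longrightarrow> lin_on S f"
  by (auto simp: Vector_Spaces.linear_iff lin_on_def)

lemma subspace_lin_image:
  assumes "lin_on S f" "cv.subspace S"
  shows "cv.subspace (f ` S)"
  unfolding cv.subspace_def
proof (intro conjI ballI allI)
  show "0 \<in> f ` S" using assms lin_on_zero cv.subspace_0 by (metis image_eqI)
next
  fix x y assume "x \<in> f ` S" "y \<in> f ` S"
  then show "x + y \<in> f ` S" using assms by (auto simp: lin_on_add[symmetric] cv.subspace_add)
next
  fix c x assume "x \<in> f ` S"
  then show "c *\<^sub>C x \<in> f ` S" using assms by (auto simp: lin_on_scale[symmetric] cv.subspace_scale)
qed

lemma subspace_lin_vimage:
  assumes "lin_on S f" "cv.subspace S" "cv.subspace T"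
  shows "cv.subspace {x\<in>S. f x \<in> T}"
  unfolding cv.subspace_def
  using assms by (auto simp: lin_on_zero lin_on_add lin_on_scale cv.subspace_add cv.subspace_scale cv.subspace_0)

lemma subspace_lin_ker: "lin_on S f \<Longrightarrow> cv.subspace S \<Longrightarrow> cv.subspace {x\<in>S. f x = 0}"
  using subspace_lin_vimage[of S f "{0}"] by simp

lemma lin_on_inj_iff:
  assumes "lin_on S f" "cv.subspace S"
  shows "inj_on f S \<longleftrightarrow> (\<forall>x\<in>S. f x = 0 \<longrightarrow> x = 0)"
proof
  assume "inj_on f S" then show "\<forall>x\<in>S. f x = 0 \<longrightarrow> x = 0"
    using lin_on_zero[OF assms] cv.subspace_0[OF assms(2)] by (metis inj_onD)
next
  assume *: "\<forall>x\<in>S. f x = 0 \<longrightarrow> x = 0"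
  show "inj_on f S"
  proof (rule inj_onI)
    fix x y assume "x \<in> S" "y \<in> S" "f x = f y"
    then have "x - y \<in> S" "f (x - y) = 0" using lin_on_diff[OF assms] assms(2) cv.subspace_diff by auto
    then show "x = y" using * by force
  qed
qed

lemma lin_on_inv_into:
  assumes "lin_on S f" "cv.subspace S" "inj_on f S"
  shows "lin_on (f ` S) (inv_into S f)"
  using assms by (auto simp: lin_on_def inv_into_f_f lin_on_add[symmetric, OF assms(1)]
    lin_on_scale[symmetric, OF assms(1)] cv.subspace_add cv.subspace_scale)

definition fd :: "'a::cvector set \<Rightarrow> bool" where
  "fd S \<longleftrightarrow> (\<exists>B. finite B \<and> S \<subseteq> cv.span B)"

lemma fd_subset: "fd T \<Longrightarrow> S \<subseteq> T \<Longrightarrow> fd S"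
  unfolding fd_def by blast

lemma fd_basis:
  assumes "fd S"
  obtains B where "B \<subseteq> S" "finite B" "cv.independent B" "S \<subseteq> cv.span B" "card B = cv.dim S"
proof -
  obtain C where C: "finite C" "S \<subseteq> cv.span C" using assms by (auto simp: fd_def)
  obtain B where B: "B \<subseteq> S" "cv.independent B" "S \<subseteq> cv.span B" "card B = cv.dim S"
    by (rule cv.basis_exists)
  then have "finite B" using cv.independent_span_bound[OF C(1) B(2)] C by auto
  then show ?thesis using that B by blast
qed

lemma fd_finite_independent: "fd S \<Longrightarrow> cv.independent B \<Longrightarrow> B \<subseteq> S \<Longrightarrow> finite B"
  unfolding fd_def using cv.independent_span_bound by (meson order_trans)

lemma fd_lin_image:
  assumes "fd S" "cv.subspace S" "lin_on S f" shows "fd (f ` S)"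
proof -
  obtain B where B: "B \<subseteq> S" "finite B" "S \<subseteq> cv.span B" using fd_basis[OF assms(1)] by metis
  have "f ` S \<subseteq> cv.span (f ` B)"
  proof
    fix y assume "y \<in> f ` S"
    then obtain x where x: "x \<in> cv.span B" "y = f x" using B by auto
    have "x \<in> S \<and> f x \<in> cv.span (f ` B)"
      using x(1)
    proof (induction rule: cv.span_induct_alt)
      case base then show ?case using lin_on_zero[OF assms(3,2)] cv.subspace_0[OF assms(2)] by (simp add: cv.span_zero)
    next
      case (step c x y)
      then have "x \<in> S" using B by auto
      moreover have "f (c *\<^sub>C x + y) = c *\<^sub>C f x + f y"
        using lin_on_add[OF assms(3)] lin_on_scale[OF assms(3)] \<open>x \<in> S\<close> step assms(2) cv.subspace_scale by metis
      moreover have "f x \<in> cv.span (f ` B)" using step cv.span_base by blast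
      moreover have "c *\<^sub>C x + y \<in> S" using step assms(2) \<open>x \<in> S\<close> by (simp add: cv.subspace_add cv.subspace_scale)
      ultimately show ?case using step by (simp add: cv.span_add cv.span_scale)
    qed
    then show "y \<in> cv.span (f ` B)" using x by simp
  qed
  then show ?thesis using B(2) unfolding fd_def by blast
qed

lemma fd_inj_vimage:
  assumes "cv.subspace S" "lin_on S f" "inj_on f S" "fd (f ` S)" shows "fd S"
proof -
  have "fd (inv_into S f ` f ` S)"
    by (rule fd_lin_image[OF assms(4) subspace_lin_image[OF assms(2,1)] lin_on_inv_into[OF assms(2,1,3)]])
  moreover have "inv_into S f ` f ` S = S" using assms(3) by (simp add: inv_into_image_cancel)
  ultimately show ?thesis by simp
qed

lemma dim_mono_fd: "fd T \<Longrightarrow> S \<subseteq> T \<Longrightarrow> cv.dim S \<le> cv.dim T"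
  by (metis fd_basis cv.dim_le_card order_trans)

lemma dim_zero_iff:
  assumes "fd S" "cv.subspace S" shows "cv.dim S = 0 \<longleftrightarrow> S = {0}"
proof
  assume "cv.dim S = 0"
  then obtain B where "B \<subseteq> S" "finite B" "S \<subseteq> cv.span B" "card B = 0" using fd_basis[OF assms(1)] by metis
  then have "S \<subseteq> {0}" by auto
  then show "S = {0}" using cv.subspace_0[OF assms(2)] by auto
next
  assume "S = {0}" then have "cv.dim S \<le> card ({} :: 'a set)" by (intro cv.dim_le_card) auto
  then show "cv.dim S = 0" by simp
qed

lemma subspace_dim_eq:
  assumes "fd T" "cv.subspace S" "S \<subseteq> T" "cv.dim S = cv.dim T" shows "S = T"
proof -
  have fS: "fd S" using assms fd_subset by blast
  obtain B where B: "B \<subseteq> S" "finite B" "cv.independent B" "S \<subseteq> cv.span B" "card B = cv.dim S"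
    using fd_basis[OF fS] .
  obtain C where C: "B \<subseteq> C" "C \<subseteq> T" "cv.independent C" "T \<subseteq> cv.span C"
    using cv.maximal_independent_subset_extend[of B T] B assms(3) by (metis order_trans)
  have "finite C" using fd_finite_independent[OF assms(1) C(3,2)] .
  moreover have "card C = card B" using cv.basis_card_eq_dim[OF C(2,4,3)] B(5) assms(4) by simp
  ultimately have "B = C" using C(1) by (metis card_subset_eq)
  then have "T \<subseteq> cv.span B" using C by simp
  moreover have "cv.span B \<subseteq> S" using B(1) assms(2) by (simp add: cv.span_minimal)
  ultimately show ?thesis using assms(3) by auto
qed

lemma lin_extend:
  assumes "cv.subspace S" "lin_on S f"
  obtains g where "Vector_Spaces.linear cscale cscale g" "\<And>x. x \<in> S \<Longrightarrow> g x = f x"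
proof -
  obtain B where B: "B \<subseteq> S" "cv.independent B" "S \<subseteq> cv.span B" by (rule cv.basis_exists)
  obtain g where g: "Vector_Spaces.linear cscale cscale g" "\<forall>x\<in>B. g x = f x"
    using cvp.linear_independent_extend[OF B(2)] by blast
  have "x \<in> S \<and> g x = f x" if "x \<in> cv.span B" for x
    using that
  proof (induction rule: cv.span_induct_alt)
    case base then show ?case using lin_on_zero[OF assms(2,1)] lin_on_zero[OF linear_lin_on[OF g(1)] assms(1)]
        cv.subspace_0[OF assms(1)] by simp
  next
    case (step c x y)
    then have x: "x \<in> S" using B by auto
    then have x': "c *\<^sub>C x \<in> S" using assms(1) by (simp add: cv.subspace_scale)
    have "g (c *\<^sub>C x + y) = c *\<^sub>C g x + g y"
      using g(1) by (simp add: Vector_Spaces.linear_iff)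
    moreover have "f (c *\<^sub>C x + y) = c *\<^sub>C f x + f y"
      using lin_on_add[OF assms(2)] lin_on_scale[OF assms(2)] x x' step by metis
    ultimately show ?case using step g x x' assms(1) by (simp add: cv.subspace_add)
  qed
  then show ?thesis using that g B by blast
qed

lemma rank_nullity:
  assumes "fd S" "cv.subspace S" "lin_on S f"
  shows "cv.dim S = cv.dim (f ` S) + cv.dim {x\<in>S. f x = 0}"
proof -
  let ?K = "{x\<in>S. f x = 0}"
  have K: "cv.subspace ?K" "fd ?K" using subspace_lin_ker[OF assms(3,2)] fd_subset[OF assms(1)] by auto
  obtain B where B: "B \<subseteq> ?K" "finite B" "cv.independent B" "?K \<subseteq> cv.span B" "card B = cv.dim ?K"
    using fd_basis[OF K(2)] .
  obtain C where C: "B \<subseteq> C" "C \<subseteq> S" "cv.independent C" "S \<subseteq> cv.span C"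
    using cv.maximal_independent_subset_extend[of B S] B by (metis (no_types, lifting) mem_Collect_eq subset_iff)
  have finC: "finite C" using fd_finite_independent[OF assms(1) C(3,2)] .
  have cardC: "card C = cv.dim S" using cv.basis_card_eq_dim[OF C(2,4,3)] .
  define D where "D = C - B"
  have finD: "finite D" and DS: "D \<subseteq> S" using finC C D_def by auto
  have f_sum: "f (\<Sum>d\<in>A. u d *\<^sub>C d) = (\<Sum>d\<in>A. u d *\<^sub>C f d)" if "A \<subseteq> S" for A u
  proof -
    have "f (\<Sum>d\<in>A. u d *\<^sub>C d) = (\<Sum>d\<in>A. f (u d *\<^sub>C d))"
      using that assms(2) by (intro lin_on_sum[OF assms(3,2)]) (auto simp: cv.subspace_scale)
    then show ?thesis using that lin_on_scale[OF assms(3)] by (auto intro!: sum.cong)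
  qed
  have indep: "\<forall>d\<in>D. u d = 0" if "(\<Sum>d\<in>D. u d *\<^sub>C f d) = 0" for u
  proof -
    let ?v = "\<Sum>d\<in>D. u d *\<^sub>C d"
    have "?v \<in> ?K" using that f_sum[OF DS] DS assms(2) by (auto intro!: cv.subspace_sum cv.subspace_scale)
    then have "?v \<in> cv.span B" using B by auto
    then obtain w where w: "?v = (\<Sum>b\<in>B. w b *\<^sub>C b)" using cv.span_finite[OF B(2)] by auto
    define z where "z = (\<lambda>c. if c \<in> B then - w c else u c)"
    have "(\<Sum>c\<in>C. z c *\<^sub>C c) = (\<Sum>c\<in>D. z c *\<^sub>C c) + (\<Sum>c\<in>B. z c *\<^sub>C c)"
      unfolding D_def by (rule sum.subset_diff[OF C(1) finC])
    also have "(\<Sum>c\<in>D. z c *\<^sub>C c) = ?v" unfolding z_def D_def by (rule sum.cong) auto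
    also have "(\<Sum>c\<in>B. z c *\<^sub>C c) = - ?v" unfolding w sum_negf[symmetric] z_def by (rule sum.cong) auto
    finally have "(\<Sum>c\<in>C. z c *\<^sub>C c) = 0" by simp
    then have "\<forall>c\<in>C. z c = 0" using C(3) finC cv.independent_explicit_finite_subsets by blast
    then show ?thesis by (force simp: D_def z_def split: if_splits)
  qed
  have inj: "inj_on f D"
  proof (rule inj_onI, rule ccontr)
    fix x y assume xy: "x \<in> D" "y \<in> D" "f x = f y" "x \<noteq> y"
    have "(\<Sum>d\<in>D. (if d = x then 1 else if d = y then -1 else 0) *\<^sub>C f d)
       = (\<Sum>d\<in>D. (if d = x then f x else 0) + (if d = y then - f y else 0))"
      using xy by (intro sum.cong) auto
    also have "\<dots> = 0" using xy finD by (simp add: sum.distrib)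
    finally show False using indep[of "\<lambda>d. if d = x then 1 else if d = y then -1 else 0"] xy(1) by auto
  qed
  have ind: "cv.independent (f ` D)"
  proof (rule cv.independent_if_scalars_zero)
    fix u x assume "(\<Sum>x\<in>f ` D. u x *\<^sub>C x) = 0" "x \<in> f ` D"
    then show "u x = 0" using indep[of "\<lambda>d. u (f d)"] inj by (auto simp: sum.reindex)
  qed (use finD in simp)
  have "f ` S \<subseteq> cv.span (f ` D)"
  proof
    fix y assume "y \<in> f ` S"
    then obtain x where x: "x \<in> S" "y = f x" by auto
    then obtain u where u: "x = (\<Sum>c\<in>C. u c *\<^sub>C c)" using C(4) cv.span_finite[OF finC] by auto
    have "y = (\<Sum>c\<in>C. u c *\<^sub>C f c)" using f_sum[OF C(2)] u x by simp
    also have "\<dots> \<in> cv.span (f ` D)"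
    proof (rule cv.span_sum)
      fix c assume "c \<in> C"
      show "u c *\<^sub>C f c \<in> cv.span (f ` D)"
      proof (cases "c \<in> B")
        case True then have "f c = 0" using B by auto
        then show ?thesis by (simp add: cv.span_zero)
      next
        case False then have "f c \<in> f ` D" using \<open>c \<in> C\<close> D_def by blast
        then show ?thesis by (intro cv.span_scale cv.span_base)
      qed
    qed
    finally show "y \<in> cv.span (f ` D)" .
  qed
  then have "cv.dim (f ` S) = card (f ` D)" using cv.basis_card_eq_dim[of "f ` D" "f ` S"] ind DS by (metis image_mono)
  also have "\<dots> = card C - card B" using inj card_image card_Diff_subset[OF B(2) C(1)] D_def by fastforce
  finally show ?thesis using cardC B(5) card_mono[OF finC C(1)] by linarith
qed

lemma dim_inj_image: "fd S \<Longrightarrow> cv.subspace S \<Longrightarrow> lin_on S f \<Longrightarrow> inj_on f S \<Longrightarrow> cv.dim (f ` S) = cv.dim S"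
proof -
  assume a: "fd S" "cv.subspace S" "lin_on S f" "inj_on f S"
  then have "{x\<in>S. f x = 0} = {0}" using lin_on_inj_iff[OF a(3,2)] lin_on_zero[OF a(3,2)] cv.subspace_0[OF a(2)] by auto
  moreover have "cv.dim {0} = 0" by (subst dim_zero_iff) (auto simp: fd_def intro!: exI[of _ "{}"])
  ultimately show ?thesis using rank_nullity[OF a(1-3)] by simp
qed

lemma inj_endo_surj:
  assumes "fd S" "cv.subspace S" "lin_on S f" "f ` S \<subseteq> S" "inj_on f S" shows "f ` S = S"
  using subspace_dim_eq[OF assms(1) subspace_lin_image[OF assms(3,2)] assms(4)] dim_inj_image[OF assms(1,2,3,5)] by simp

lemma surj_endo_inj:
  assumes "fd S" "cv.subspace S" "lin_on S f" "f ` S = S" shows "inj_on f S"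
proof -
  have "cv.dim {x\<in>S. f x = 0} = 0" using rank_nullity[OF assms(1-3)] assms(4) by simp
  then have "{x\<in>S. f x = 0} = {0}" using dim_zero_iff subspace_lin_ker[OF assms(3,2)] fd_subset[OF assms(1)]
    by (metis (no_types, lifting) mem_Collect_eq subsetI)
  then show ?thesis using lin_on_inj_iff[OF assms(3,2)] by auto
qed

lemma dim_eq_iso:
  assumes "fd S" "cv.subspace S" "fd T" "cv.subspace T" "cv.dim S = cv.dim T"
  obtains f where "lin_on S f" "bij_betw f S T"
proof -
  obtain B where B: "B \<subseteq> S" "finite B" "cv.independent B" "S \<subseteq> cv.span B" "card B = cv.dim S"
    using fd_basis[OF assms(1)] .
  obtain C where C: "C \<subseteq> T" "finite C" "cv.independent C" "T \<subseteq> cv.span C" "card C = cv.dim T"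
    using fd_basis[OF assms(3)] .
  obtain f where "Vector_Spaces.linear cscale cscale f" "f ` S = T" "inj_on f S"
    using cvp.finite_basis_to_basis_subspace_isomorphism[OF assms(2,4,5) B(2,1,3,4,5) C(2,1,3,4,5)] by blast
  then show ?thesis using that linear_lin_on unfolding bij_betw_def by blast
qed

text \<open>
  The projection onto a complement of \<open>V\<close> along \<open>V\<close>; its image serves as the quotient of \<open>S\<close> by
  \<open>V\<close> without leaving the type.
\<close>

lemma complement_projection:
  assumes "cv.subspace S" "cv.subspace V" "V \<subseteq> S"
  obtains p where "lin_on S p" "p ` S \<subseteq> S" "\<And>x. x \<in> S \<Longrightarrow> p x = 0 \<longleftrightarrow> x \<in> V"
    "\<And>x. x \<in> S \<Longrightarrow> x - p x \<in> V" "\<And>x. x \<in> S \<Longrightarrow> p (p x) = p x"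
proof -
  obtain B where B: "B \<subseteq> V" "cv.independent B" "V \<subseteq> cv.span B" by (rule cv.basis_exists)
  obtain C where C: "B \<subseteq> C" "C \<subseteq> S" "cv.independent C" "S \<subseteq> cv.span C"
    using cv.maximal_independent_subset_extend[of B S] B assms(3) by (metis order_trans)
  obtain p where p: "Vector_Spaces.linear cscale cscale p" "\<forall>x\<in>C. p x = (if x \<in> B then 0 else x)"
    using cvp.linear_independent_extend[OF C(3), of "\<lambda>x. if x \<in> B then 0 else x"] by blast
  have lin: "p (c *\<^sub>C x + y) = c *\<^sub>C p x + p y" for c x y using p(1) by (simp add: Vector_Spaces.linear_iff)
  have p0: "p 0 = 0" using lin[of "-1" 0 0] by simp
  have ker: "p x = 0" if "x \<in> V" for x
  proof -
    have "x \<in> cv.span B" using that B by auto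
    then show ?thesis
      by (induction rule: cv.span_induct_alt) (use p(2) C(1) in \<open>auto simp: p0 lin\<close>)
  qed
  have main: "x \<in> S \<and> p x \<in> S \<and> x - p x \<in> V" if "x \<in> cv.span C" for x
    using that
  proof (induction rule: cv.span_induct_alt)
    case base then show ?case using p0 assms cv.subspace_0 by auto
  next
    case (step c x y)
    have "x \<in> S" using step C by auto
    moreover have "p x \<in> S" using p(2) step \<open>x \<in> S\<close> cv.subspace_0[OF assms(1)] by auto
    moreover have "x - p x \<in> V" using p(2) step B(1) cv.subspace_0[OF assms(2)] by auto
    ultimately show ?case using step assms
      by (auto simp: lin add_diff_add cv.scale_right_diff_distrib[symmetric]
           intro!: cv.subspace_add cv.subspace_scale)
  qed
  have mainS: "x \<in> S \<Longrightarrow> p x \<in> S \<and> x - p x \<in> V" for x using main C(4) by blast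
  show ?thesis
  proof (rule that[of p])
    show "lin_on S p" using linear_lin_on[OF p(1)] .
    show "p ` S \<subseteq> S" using mainS by auto
    show "p x = 0 \<longleftrightarrow> x \<in> V" if "x \<in> S" for x using ker[of x] mainS[OF that] by auto
    show "x - p x \<in> V" if "x \<in> S" for x using mainS[OF that] by auto
    show "p (p x) = p x" if "x \<in> S" for x
    proof -
      have "p (x - p x) = 0" using mainS[OF that] ker by blast
      moreover have "p (x - p x) = p x - p (p x)" using lin[of "-1" "p x" x] by simp
      ultimately show ?thesis by simp
    qed
  qed
qed

text \<open>
  The direct sum of the \<open>V i\<close> over \<open>I\<close>; the value 0 outside \<open>I\<close> makes the functions unique.
\<close>

definition fam :: "'i set \<Rightarrow> ('i \<Rightarrow> 'v::cvector set) \<Rightarrow> ('i \<Rightarrow> 'v) set" where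
  "fam I V = {f. \<forall>i. (i \<in> I \<longrightarrow> f i \<in> V i) \<and> (i \<notin> I \<longrightarrow> f i = 0)}"

lemma subspace_fam: "(\<And>i. i \<in> I \<Longrightarrow> cv.subspace (V i)) \<Longrightarrow> cv.subspace (fam I V)"
  unfolding fam_def cv.subspace_def by (auto simp: cscale_apply)

lemma fam_fd_dim:
  assumes "finite I" "\<And>i. i \<in> I \<Longrightarrow> cv.subspace (V i)" "\<And>i. i \<in> I \<Longrightarrow> fd (V i)"
  shows "fd (fam I V) \<and> cv.dim (fam I V) = (\<Sum>i\<in>I. cv.dim (V i))"
  using assms
proof (induction I rule: finite_induct)
  case empty
  have "fam {} V = {0}" by (auto simp: fam_def zero_fun_def)
  moreover have "fd {0::'a \<Rightarrow> 'b}" by (auto simp: fd_def intro!: exI[of _ "{}"])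
  moreover have "cv.dim {0::'a \<Rightarrow> 'b} = 0"
    using dim_zero_iff[OF \<open>fd {0::'a \<Rightarrow> 'b}\<close>] cv.subspace_single_0 by blast
  ultimately show ?case by (metis sum.empty)
next
  case (insert a I)
  let ?F = "fam (insert a I) V" and ?G = "fam I V"
  have IH: "fd ?G" "cv.dim ?G = (\<Sum>i\<in>I. cv.dim (V i))" using insert by auto
  have sub: "cv.subspace ?F" "cv.subspace ?G" using insert by (auto intro!: subspace_fam)
  have lin: "lin_on ?F (\<lambda>f. f a)" by (auto simp: lin_on_def cscale_apply)
  have im: "(\<lambda>f. f a) ` ?F = V a"
  proof
    show "(\<lambda>f. f a) ` ?F \<subseteq> V a" by (auto simp: fam_def)
    show "V a \<subseteq> (\<lambda>f. f a) ` ?F"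
    proof
      fix v assume "v \<in> V a"
      then have "(\<lambda>i. if i = a then v else 0) \<in> ?F" using insert.prems(1) cv.subspace_0 by (auto simp: fam_def)
      then show "v \<in> (\<lambda>f. f a) ` ?F" by (rule image_eqI[rotated]) simp
    qed
  qed
  have ker: "{f\<in>?F. f a = 0} = ?G" using insert(2) cv.subspace_0[OF insert.prems(1)] by (auto simp: fam_def)
  obtain B where B: "finite B" "?G \<subseteq> cv.span B" using IH(1) by (auto simp: fd_def)
  obtain C where C: "finite C" "V a \<subseteq> cv.span C" using insert.prems(2)[of a] by (auto simp: fd_def)
  let ?e = "\<lambda>v. (\<lambda>i. if i = a then v else 0) :: 'a \<Rightarrow> 'b"
  have e: "?e v \<in> cv.span (?e ` C)" if "v \<in> cv.span C" for v
    using that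
  proof (induction rule: cv.span_induct_alt)
    case base
    have *: "?e 0 = 0" by (auto simp: fun_eq_iff)
    show ?case unfolding * by (rule cv.span_zero)
  next
    case (step c x y)
    have "?e (c *\<^sub>C x + y) = c *\<^sub>C ?e x + ?e y" by (auto simp: fun_eq_iff cscale_apply)
    then show ?case using step by (auto intro!: cv.span_add cv.span_scale intro: cv.span_base)
  qed
  have "?F \<subseteq> cv.span (B \<union> ?e ` C)"
  proof
    fix f assume f: "f \<in> ?F"
    then have "f a \<in> V a" by (auto simp: fam_def)
    then have e': "?e (f a) \<in> cv.span (B \<union> ?e ` C)" 
      using e[of "f a"] C(2) cv.span_mono[of "?e ` C" "B \<union> ?e ` C"] by blast
    have "f - ?e (f a) \<in> ?G" using f insert(2) by (auto simp: fam_def)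
    then have "f - ?e (f a) \<in> cv.span (B \<union> ?e ` C)" using B by (meson Un_upper1 cv.span_mono subset_iff)
    from cv.span_add[OF this e'] show "f \<in> cv.span (B \<union> ?e ` C)" by simp
  qed
  then have fdF: "fd ?F" unfolding fd_def using B C by (intro exI[of _ "B \<union> ?e ` C"]) auto
  show ?case using rank_nullity[OF fdF sub(1) lin] im ker IH(2) insert.hyps fdF by simp
qed

text \<open>
  The space Hom(\<open>S\<close>, \<open>T\<close>), with values fixed to 0 outside \<open>S\<close> so that it is finite-dimensional.
\<close>

definition hom_sp :: "'a::cvector set \<Rightarrow> 'b::cvector set \<Rightarrow> ('a \<Rightarrow> 'b) set" where
  "hom_sp S T = {f. lin_on S f \<and> (\<forall>x\<in>S. f x \<in> T) \<and> (\<forall>x. x \<notin> S \<longrightarrow> f x = 0)}"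

lemma subspace_hom_sp: "cv.subspace T \<Longrightarrow> cv.subspace (hom_sp S T)"
  unfolding hom_sp_def cv.subspace_def
  by (auto simp: lin_on_def cscale_add_right cscale_cscale mult.commute algebra_simps cscale_apply)

lemma fd_hom_sp:
  assumes "fd S" "cv.subspace S" "fd T" "cv.subspace T" shows "fd (hom_sp S T)"
proof -
  obtain B where B: "B \<subseteq> S" "finite B" "S \<subseteq> cv.span B" using fd_basis[OF assms(1)] by metis
  let ?r = "\<lambda>f b. if b \<in> B then f b else 0"
  have lin: "lin_on (hom_sp S T) ?r" by (auto simp: lin_on_def fun_eq_iff cscale_apply)
  have "fd (fam B (\<lambda>_. T))" using fam_fd_dim[of B "\<lambda>_. T"] assms B by auto
  moreover have "?r ` hom_sp S T \<subseteq> fam B (\<lambda>_. T)" using B(1) by (auto simp: fam_def hom_sp_def)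
  ultimately have fd: "fd (?r ` hom_sp S T)" using fd_subset by blast
  have inj: "inj_on ?r (hom_sp S T)"
    unfolding lin_on_inj_iff[OF lin subspace_hom_sp[OF assms(4)]]
  proof (intro ballI impI)
    fix f assume f: "f \<in> hom_sp S T" "?r f = 0"
    then have lf: "lin_on S f" by (auto simp: hom_sp_def)
    have fb: "f b = 0" if "b \<in> B" for b using fun_cong[OF f(2), of b] that by simp
    have "x \<in> S \<and> f x = 0" if "x \<in> cv.span B" for x
      using that
    proof (induction rule: cv.span_induct_alt)
      case base then show ?case using lin_on_zero[OF lf assms(2)] cv.subspace_0[OF assms(2)] by simp
    next
      case (step c x y)
      have x: "x \<in> S" using step B by auto
      then have "c *\<^sub>C x \<in> S" using assms(2) by (simp add: cv.subspace_scale)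
      then show ?case using x step fb lin_on_add[OF lf] lin_on_scale[OF lf] assms(2) by (auto simp: cv.subspace_add)
    qed
    then have "f x = 0" for x using B(3) f(1) by (cases "x \<in> S") (auto simp: hom_sp_def)
    then show "f = 0" by (simp add: fun_eq_iff)
  qed
  show ?thesis by (rule fd_inj_vimage[OF subspace_hom_sp[OF assms(4)] lin inj fd])
qed

lemma fd_seq_dependent:
  fixes z :: "nat \<Rightarrow> 'a::cvector"
  assumes "fd V" "\<And>n. z n \<in> V"
  obtains d c where "c d = 1" "(\<Sum>l\<le>d. c l *\<^sub>C z l) = 0"
proof -
  have "\<exists>d. z d \<in> cv.span (z ` {..<d})"
  proof (rule ccontr)
    assume "\<nexists>d. z d \<in> cv.span (z ` {..<d})"
    then have no: "z d \<notin> cv.span (z ` {..<d})" for d by blast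
    have ind: "cv.independent (z ` {..<d}) \<and> card (z ` {..<d}) = d" for d
    proof (induction d)
      case (Suc d)
      have "z ` {..<Suc d} = insert (z d) (z ` {..<d})" by (simp add: lessThan_Suc)
      then show ?case using Suc no[of d] cv.independent_insertI[OF no[of d]] cv.span_base
        by (metis card_insert_disjoint finite_imageI finite_lessThan)
    qed (auto simp: cv.independent_empty)
    obtain B where B: "finite B" "V \<subseteq> cv.span B" using assms(1) by (auto simp: fd_def)
    have "card (z ` {..<Suc (card B)}) \<le> card B"
      using cv.independent_span_bound[OF B(1)] ind assms(2) B(2) by (meson image_subsetI order_trans)
    then show False using ind[of "Suc (card B)"] by simp
  qed
  then obtain d where d: "z d \<in> cv.span (z ` {..<d})" by blast
  have comb: "\<exists>u. x = (\<Sum>l<d. u l *\<^sub>C z l)" if "x \<in> cv.span (z ` {..<d})" for x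
    using that
  proof (induction rule: cv.span_induct_alt)
    case base then show ?case by (intro exI[of _ "\<lambda>_. 0"]) simp
  next
    case (step c x y)
    then obtain u k where u: "y = (\<Sum>l<d. u l *\<^sub>C z l)" and k: "k < d" "x = z k" by auto
    have "(\<Sum>l<d. (if l = k then c else 0) *\<^sub>C z l) = (\<Sum>l<d. if l = k then c *\<^sub>C z l else 0)"
      by (rule sum.cong) auto
    also have "\<dots> = c *\<^sub>C x" using k by simp
    finally show ?case using u
      by (intro exI[of _ "\<lambda>l. (if l = k then c else 0) + u l"]) (simp add: cscale_add_left sum.distrib)
  qed
  obtain u where u: "z d = (\<Sum>l<d. u l *\<^sub>C z l)" using comb[OF d] by blast
  show ?thesis
  proof (rule that[of "\<lambda>l. if l = d then 1 else - u l" d])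
    have "(\<Sum>l\<le>d. (if l = d then 1 else - u l) *\<^sub>C z l) = z d + (\<Sum>l<d. (if l = d then 1 else - u l) *\<^sub>C z l)"
      by (simp add: lessThan_Suc_atMost[symmetric] add.commute cscale_one)
    also have "(\<Sum>l<d. (if l = d then 1 else - u l) *\<^sub>C z l) = - z d"
      unfolding u sum_negf[symmetric] by (rule sum.cong) auto
    finally show "(\<Sum>l\<le>d. (if l = d then 1 else - u l) *\<^sub>C z l) = 0" by simp
  qed simp
qed

text \<open>
  If \<open>x\<close> is killed by the operator with parameter t, then t is nonzero as \<open>F 0\<close> is the identity,
  and with s = 1/t the vector with blocks x, s x, ..., s^d x is an eigenvector with eigenvalue s
  of a block companion operator that does not depend on t. That operator is annihilated by a
  nonzero polynomial, since its powers lie in a finite-dimensional space, so it has finitely many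
  eigenvalues.
\<close>

lemma finite_singular_parameters:
  fixes F :: "nat \<Rightarrow> 'a::cvector \<Rightarrow> 'a"
  assumes S: "fd S" "cv.subspace S"
    and F: "\<And>m. lin_on S (F m)" "\<And>m x. x \<in> S \<Longrightarrow> F m x \<in> S" "\<And>x. x \<in> S \<Longrightarrow> F 0 x = x"
  shows "finite {t. \<exists>x\<in>S. x \<noteq> 0 \<and> (\<Sum>m\<le>d. t ^ m *\<^sub>C F m x) = 0}"
proof -
  define W where "W = fam {..d} (\<lambda>_. S)"
  have W: "fd W" "cv.subspace W"
    unfolding W_def using fam_fd_dim[of "{..d}" "\<lambda>_. S"] subspace_fam[of "{..d}" "\<lambda>_. S"] S by auto
  (* The sums below run to d + 1, where F is cut off. *)
  define H where "H = (\<lambda>m x. if m \<le> d then F m x else 0)"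
  have H: "lin_on S (H m)" for m
    by (cases "m \<le> d") (simp_all add: H_def F(1) lin_on_const0)
  have HS: "x \<in> S \<Longrightarrow> H m x \<in> S" for m x
    using F(2) cv.subspace_0[OF S(2)] by (simp add: H_def)
  (* Shift the blocks down, and let the last block be determined by the monic polynomial in s
     of degree d + 1 that arises from multiplying by s^(d+1). *)
  define C where "C = (\<lambda>(v :: nat \<Rightarrow> 'a) m. if m < d then v (Suc m)
      else if m = d then - (\<Sum>k\<le>d. H (Suc d - k) (v k)) else 0)"
  have CW: "C v \<in> W" if "v \<in> W" for v
  proof -
    have v: "v k \<in> S" if "k \<le> d" for k using \<open>v \<in> W\<close> that by (auto simp: W_def fam_def)
    have "(\<Sum>k\<le>d. H (Suc d - k) (v k)) \<in> S" using v HS S(2) by (auto intro!: cv.subspace_sum)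
    then show ?thesis using v S(2) by (auto simp: W_def fam_def C_def cv.subspace_neg)
  qed
  have Clin: "lin_on W C"
    unfolding lin_on_def
  proof (intro conjI ballI allI)
    fix x y assume "x \<in> W" "y \<in> W"
    then have "H m (x k + y k) = H m (x k) + H m (y k)" if "k \<le> d" for k m
      using that lin_on_add[OF H] by (auto simp: W_def fam_def)
    then show "C (x + y) = C x + C y" by (auto simp: C_def fun_eq_iff sum.distrib)
  next
    fix c x assume "x \<in> W"
    then have "H m (c *\<^sub>C x k) = c *\<^sub>C H m (x k)" if "k \<le> d" for k m
      using that lin_on_scale[OF H] by (auto simp: W_def fam_def)
    then show "C (c *\<^sub>C x) = c *\<^sub>C C x" by (auto simp: C_def fun_eq_iff cscale_apply cv.scale_sum_right)
  qed
  define G where "G = (\<lambda>l v. if v \<in> W then (C ^^ l) v else 0)"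
  have CWl: "(C ^^ l) v \<in> W" if "v \<in> W" for l v using that by (induction l) (auto simp: CW)
  have "lin_on W (C ^^ l)" for l
  proof (induction l)
    case (Suc l) then show ?case using lin_on_comp[OF Suc CWl Clin] by (simp add: comp_def)
  qed (auto simp: lin_on_def)
  then have "lin_on W (G l)" for l by (rule lin_on_cong) (auto simp: G_def W)
  then have G: "G l \<in> hom_sp W W" for l using CWl by (auto simp: hom_sp_def G_def)
  obtain D c where c: "c D = 1" "(\<Sum>l\<le>D. c l *\<^sub>C G l) = 0"
    using fd_seq_dependent[OF fd_hom_sp[OF W W], of G, OF G] .
  have fin: "finite {s. (\<Sum>l\<le>D. c l * s ^ l) = 0}"
    using polyfun_finite_roots[of c D] c(1) by (metis order_refl zero_neq_one)
  have "t \<in> inverse ` {s. (\<Sum>l\<le>D. c l * s ^ l) = 0}"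
    if x: "x \<in> S" "x \<noteq> 0" and t: "(\<Sum>m\<le>d. t ^ m *\<^sub>C F m x) = 0" for t x
  proof -
    have t0: "t \<noteq> 0"
    proof
      assume "t = 0"
      then have "(\<Sum>m\<le>d. t ^ m *\<^sub>C F m x) = (\<Sum>m\<le>d. if m = 0 then F 0 x else 0)"
        by (intro sum.cong) (auto simp: cscale_one)
      then show False using t x F(3) by simp
    qed
    define s where "s = inverse t"
    have s: "s \<noteq> 0" "t = inverse s" using t0 by (auto simp: s_def)
    define v where "v = (\<lambda>k. if k \<le> d then s ^ k *\<^sub>C x else 0)"
    have vW: "v \<in> W" using x S(2) by (auto simp: v_def W_def fam_def cv.subspace_scale)
    have "0 = s ^ Suc d *\<^sub>C (\<Sum>m\<le>d. t ^ m *\<^sub>C F m x)" using t by simp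
    also have "\<dots> = (\<Sum>m\<le>d. s ^ (Suc d - m) *\<^sub>C F m x)"
      unfolding cv.scale_sum_right cscale_cscale
    proof (rule sum.cong)
      fix m assume "m \<in> {..d}"
      then have "s ^ Suc d = s ^ (Suc d - m) * s ^ m" by (simp add: power_add[symmetric])
      then show "(s ^ Suc d * t ^ m) *\<^sub>C F m x = s ^ (Suc d - m) *\<^sub>C F m x"
        using s by (simp add: power_mult_distrib[symmetric])
    qed simp
    also have "\<dots> = (\<Sum>m\<le>Suc d. s ^ (Suc d - m) *\<^sub>C H m x)" by (simp add: H_def)
    also have "\<dots> = (\<Sum>k\<le>Suc d. s ^ k *\<^sub>C H (Suc d - k) x)"
      by (rule sum.reindex_bij_witness[of _ "\<lambda>k. Suc d - k" "\<lambda>k. Suc d - k"]) auto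
    also have "\<dots> = (\<Sum>k\<le>d. s ^ k *\<^sub>C H (Suc d - k) x) + s ^ Suc d *\<^sub>C x"
      using F(3) x by (simp add: H_def)
    also have "(\<Sum>k\<le>d. s ^ k *\<^sub>C H (Suc d - k) x) = (\<Sum>k\<le>d. H (Suc d - k) (v k))"
      using x lin_on_scale[OF H] by (intro sum.cong) (auto simp: v_def)
    finally have "C v d = s ^ Suc d *\<^sub>C x" by (simp add: C_def add_eq_0_iff2)
    then have ev: "C v = s *\<^sub>C v" by (auto simp: fun_eq_iff C_def v_def cscale_apply cscale_cscale)
    have "(C ^^ l) v = s ^ l *\<^sub>C v" for l
    proof (induction l)
      case (Suc l)
      then show ?case using lin_on_scale[OF Clin vW] ev by (simp add: cscale_cscale mult.commute)
    qed (simp add: cscale_one)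
    then have "(\<Sum>l\<le>D. c l *\<^sub>C G l) v = (\<Sum>l\<le>D. (c l * s ^ l) *\<^sub>C v)"
      using vW by (simp add: sum_fun_apply cscale_apply G_def cscale_cscale)
    also have "\<dots> = (\<Sum>l\<le>D. c l * s ^ l) *\<^sub>C v" by (simp add: cv.scale_sum_left)
    finally have "(\<Sum>l\<le>D. c l * s ^ l) *\<^sub>C v = 0" using c(2) by simp
    moreover have "v \<noteq> 0" using x by (auto simp: v_def fun_eq_iff cscale_one intro!: exI[of _ 0])
    ultimately have "(\<Sum>l\<le>D. c l * s ^ l) = 0" by simp
    then show ?thesis using s(2) by blast
  qed
  then show ?thesis by (intro finite_subset[OF _ finite_imageI[OF fin]]) blast
qed

section \<open>Positive definite diagrams and their roots\<close>

text \<open>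
  Positive definiteness is encoded by a witness: a positive vector \<open>h\<close> on which the Cartan matrix
  is positive. For a Cartan matrix of finite type such a vector is given by the coefficients of
  the sum of the positive roots, and the property passes to full subdiagrams with the same \<open>h\<close>.
\<close>

locale dynkin =
  fixes I :: "'i set" and E :: "('i \<times> 'i) set" and h :: "'i \<Rightarrow> int"
  assumes finI: "finite I" and EI: "E \<subseteq> I \<times> I"
    and symE: "(i, j) \<in> E \<Longrightarrow> (j, i) \<in> E" and irrE: "(i, i) \<notin> E"
    and h_pos: "i \<in> I \<Longrightarrow> 0 < h i"
    and Ch_pos: "i \<in> I \<Longrightarrow> 0 < (\<Sum>j\<in>I. cartan E i j * h j)"
begin

definition cmul :: "('i \<Rightarrow> int) \<Rightarrow> 'i \<Rightarrow> int" where
  "cmul x i = (\<Sum>j\<in>I. cartan E i j * x j)"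

definition bform :: "('i \<Rightarrow> int) \<Rightarrow> ('i \<Rightarrow> int) \<Rightarrow> int" where
  "bform x y = (\<Sum>i\<in>I. x i * cmul y i)"

lemma cartan_sym: "cartan E i j = cartan E j i"
  using symE by (auto simp: cartan_def)

lemma cartan_nonpos: "i \<noteq> j \<Longrightarrow> cartan E i j \<le> 0"
  by (simp add: cartan_def)

lemma bform_sym: "bform x y = bform y x"
proof -
  have "bform x y = (\<Sum>i\<in>I. \<Sum>j\<in>I. cartan E j i * y j * x i)"
    unfolding bform_def cmul_def sum_distrib_left
    by (intro sum.cong refl) (subst cartan_sym, simp add: algebra_simps)
  also have "\<dots> = (\<Sum>j\<in>I. \<Sum>i\<in>I. cartan E j i * y j * x i)" by (rule sum.swap)
  also have "\<dots> = bform y x"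
    unfolding bform_def cmul_def sum_distrib_left by (intro sum.cong refl) (simp add: algebra_simps)
  finally show ?thesis .
qed

text \<open>
  Substitute \<open>x i = h i * y i\<close>. Then the form is the sum of \<open>(C h) i * h i * (y i)^2\<close> over i plus
  the nonnegative sum of \<open>- C i j * h i * h j * (y i - y j)^2 / 2\<close> over all pairs, and \<open>(C h) i\<close>
  is a positive integer.
\<close>

lemma bform_lower_bound:
  "(\<Sum>i\<in>I. (real_of_int (x i))\<^sup>2 / h i) \<le> bform x x"
proof -
  let ?y = "\<lambda>i. real_of_int (x i) / h i"
  let ?c = "\<lambda>i j. real_of_int (cartan E i j)"
  have hy: "real_of_int (x i) = h i * ?y i" if "i \<in> I" for i using h_pos[OF that] by simp
  have "real_of_int (bform x x) = (\<Sum>i\<in>I. \<Sum>j\<in>I. ?c i j * h i * h j * (?y i * ?y j))"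
    unfolding bform_def cmul_def sum_distrib_left of_int_sum
  proof (intro sum.cong refl)
    fix i j assume "i \<in> I" "j \<in> I"
    then show "real_of_int (x i * (cartan E i j * x j)) = ?c i j * h i * h j * (?y i * ?y j)"
      using h_pos[of i] h_pos[of j] by simp
  qed
  also have "\<dots> = (\<Sum>i\<in>I. \<Sum>j\<in>I. ?c i j * h i * h j * ((?y i)\<^sup>2 / 2))
     + (\<Sum>i\<in>I. \<Sum>j\<in>I. ?c i j * h i * h j * ((?y j)\<^sup>2 / 2))
     + (\<Sum>i\<in>I. \<Sum>j\<in>I. - ?c i j * h i * h j * ((?y i - ?y j)\<^sup>2 / 2))"
    unfolding sum.distrib[symmetric]
    by (intro sum.cong refl) (simp add: power2_eq_square field_simps)
  also have "(\<Sum>i\<in>I. \<Sum>j\<in>I. ?c i j * h i * h j * ((?y j)\<^sup>2 / 2))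
      = (\<Sum>i\<in>I. \<Sum>j\<in>I. ?c i j * h i * h j * ((?y i)\<^sup>2 / 2))"
    by (subst sum.swap) (intro sum.cong refl, subst cartan_sym, simp add: algebra_simps)
  finally have eq: "real_of_int (bform x x) = 2 * (\<Sum>i\<in>I. \<Sum>j\<in>I. ?c i j * h i * h j * ((?y i)\<^sup>2 / 2))
     + (\<Sum>i\<in>I. \<Sum>j\<in>I. - ?c i j * h i * h j * ((?y i - ?y j)\<^sup>2 / 2))" by simp
  have "0 \<le> - ?c i j * h i * h j * ((?y i - ?y j)\<^sup>2 / 2)" if "i \<in> I" "j \<in> I" for i j
  proof (cases "i = j")
    case False
    then have "0 \<le> - ?c i j" using cartan_nonpos by simp
    then show ?thesis using h_pos that by (intro mult_nonneg_nonneg) (auto intro: less_imp_le)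
  qed simp
  then have "0 \<le> (\<Sum>i\<in>I. \<Sum>j\<in>I. - ?c i j * h i * h j * ((?y i - ?y j)\<^sup>2 / 2))"
    by (intro sum_nonneg) auto
  then have "2 * (\<Sum>i\<in>I. \<Sum>j\<in>I. ?c i j * h i * h j * ((?y i)\<^sup>2 / 2)) \<le> bform x x" using eq by linarith
  moreover have "(real_of_int (x i))\<^sup>2 / h i \<le> 2 * (\<Sum>j\<in>I. ?c i j * h i * h j * ((?y i)\<^sup>2 / 2))" if i: "i \<in> I" for i
  proof -
    have "2 * (\<Sum>j\<in>I. ?c i j * h i * h j * ((?y i)\<^sup>2 / 2)) = h i * (?y i)\<^sup>2 * real_of_int (\<Sum>j\<in>I. cartan E i j * h j)"
      unfolding sum_distrib_left of_int_sum by (intro sum.cong refl) (simp add: algebra_simps)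
    moreover have "1 \<le> real_of_int (\<Sum>j\<in>I. cartan E i j * h j)" using Ch_pos[OF i] by linarith
    then have "h i * (?y i)\<^sup>2 * 1 \<le> h i * (?y i)\<^sup>2 * real_of_int (\<Sum>j\<in>I. cartan E i j * h j)"
      using h_pos[OF i] by (intro mult_left_mono) auto
    moreover have "h i * (?y i)\<^sup>2 = (real_of_int (x i))\<^sup>2 / h i" using h_pos[OF i] by (simp add: power2_eq_square)
    ultimately show ?thesis by linarith
  qed
  then have "(\<Sum>i\<in>I. (real_of_int (x i))\<^sup>2 / h i) \<le> (\<Sum>i\<in>I. 2 * (\<Sum>j\<in>I. ?c i j * h i * h j * ((?y i)\<^sup>2 / 2)))"
    by (rule sum_mono)
  ultimately show ?thesis by (simp add: sum_distrib_left)
qed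

lemma bform_pos:
  assumes "i \<in> I" "x i \<noteq> 0" shows "0 < bform x x"
proof -
  have "0 < (\<Sum>i\<in>I. (real_of_int (x i))\<^sup>2 / h i)"
    using assms h_pos finI by (intro sum_pos2[of I i]) (auto simp: less_imp_le)
  then show ?thesis using bform_lower_bound[of x] by linarith
qed

lemma bform_self_even: "even (bform x x)"
proof -
  have *: "even ((\<Sum>i\<in>A. \<Sum>j\<in>A. f i j) - (\<Sum>i\<in>A. f i i))"
    if "finite A" "\<And>i j. f i j = f j i" for A :: "'i set" and f :: "'i \<Rightarrow> 'i \<Rightarrow> int"
    using that
  proof (induction A rule: finite_induct)
    case (insert a A)
    have "(\<Sum>i\<in>insert a A. \<Sum>j\<in>insert a A. f i j)
        = f a a + 2 * (\<Sum>j\<in>A. f a j) + (\<Sum>i\<in>A. \<Sum>j\<in>A. f i j)"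
      using insert by (simp add: sum.distrib)
    moreover have "(\<Sum>i\<in>insert a A. f i i) = f a a + (\<Sum>i\<in>A. f i i)" using insert by simp
    ultimately show ?case using insert by simp
  qed simp
  have "bform x x = (\<Sum>i\<in>I. \<Sum>j\<in>I. x i * cartan E i j * x j)"
    unfolding bform_def cmul_def sum_distrib_left by (simp add: mult.assoc)
  moreover have b: "even (\<Sum>i\<in>I. x i * cartan E i i * x i)" by (intro dvd_sum) (simp add: cartan_def)
  moreover have c: "even ((\<Sum>i\<in>I. \<Sum>j\<in>I. x i * cartan E i j * x j) - (\<Sum>i\<in>I. x i * cartan E i i * x i))"
    by (rule *[OF finI]) (subst cartan_sym, simp add: algebra_simps)
  ultimately show ?thesis using dvd_add[OF c b] by simp
qed

lemma cmul_add: "cmul (\<lambda>k. x k + c * y k) i = cmul x i + c * cmul y i"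
  unfolding cmul_def by (simp add: sum.distrib sum_distrib_left algebra_simps)

lemma cmul_simple: "j \<in> I \<Longrightarrow> cmul (simple_root j) i = cartan E i j"
  using finI by (simp add: cmul_def simple_root_def if_distrib cong: if_cong)

lemma bform_simple: "i \<in> I \<Longrightarrow> bform (simple_root i) x = cmul x i"
proof -
  assume "i \<in> I"
  then have "(\<Sum>k\<in>I. simple_root i k * cmul x k) = (\<Sum>k\<in>I. if k = i then cmul x i else 0)"
    by (intro sum.cong) (auto simp: simple_root_def)
  then show ?thesis using finI \<open>i \<in> I\<close> by (simp add: bform_def)
qed

lemma bform_add_simple:
  assumes "i \<in> I"
  shows "bform (\<lambda>k. x k + c * simple_root i k) (\<lambda>k. x k + c * simple_root i k) = bform x x + 2 * c * cmul x i + 2 * c\<^sup>2"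
proof -
  have *: "bform (\<lambda>k. x k + c * y k) z = bform x z + c * bform y z" for x y z c
    by (simp add: bform_def sum.distrib sum_distrib_left algebra_simps)
  let ?e = "simple_root i" and ?y = "\<lambda>k. x k + c * simple_root i k"
  have "bform ?y ?y = bform x ?y + c * bform ?e ?y" by (rule *)
  moreover have "bform x ?y = bform x x + c * bform ?e x" using bform_sym[of x ?y] *[of x c ?e x] by simp
  moreover have "bform ?e ?y = cmul x i + 2 * c"
    using assms by (simp add: bform_simple cmul_add cmul_simple cartan_def)
  moreover have "bform ?e x = cmul x i" using assms by (rule bform_simple)
  ultimately show ?thesis by (simp add: power2_eq_square algebra_simps)
qed

lemma simple_reflection_eq: "simple_reflection I E i x = (\<lambda>k. x k + (- cmul x i) * simple_root i k)"
  by (simp add: simple_reflection_def cmul_def)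

lemma root_props:
  assumes "x \<in> roots I E"
  shows "(\<forall>i. i \<notin> I \<longrightarrow> x i = 0) \<and> bform x x = 2"
  using assms
proof induction
  case (simple i)
  then have "bform (simple_root i) (simple_root i) = 2" by (simp add: bform_simple cmul_simple cartan_def)
  then show ?case using simple by (auto simp: simple_root_def)
next
  case (reflect x i)
  then show ?case unfolding simple_reflection_eq bform_add_simple[OF reflect(2)]
    by (auto simp: power2_eq_square algebra_simps simple_root_def)
qed

text \<open>
  Split a root into its positive part p and negative part n. Their product is at most 0, as the
  supports are disjoint and the off-diagonal entries of the Cartan matrix are not positive; so if
  neither vanishes the form takes a value of at least 2 + 2 by evenness, but it is 2 on roots.
\<close>

lemma root_sign:
  assumes "x \<in> roots I E"
  shows "(\<forall>i. 0 \<le> x i) \<or> (\<forall>i. x i \<le> 0)"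
proof (rule ccontr)
  assume "\<not> ?thesis"
  then obtain i j where ij: "x i < 0" "0 < x j" by (meson not_le)
  then have iI: "i \<in> I" "j \<in> I" using root_props[OF assms] by force+
  define p where "p = (\<lambda>k. max (x k) 0)"
  define n where "n = (\<lambda>k. max (- x k) 0)"
  have xpn: "x = (\<lambda>k. p k + (-1) * n k)" by (auto simp: p_def n_def)
  have *: "bform (\<lambda>k. x k + c * y k) z = bform x z + c * bform y z" for x y z c
    by (simp add: bform_def sum.distrib sum_distrib_left algebra_simps)
  have "bform x x = bform p x - bform n x" by (subst (1) xpn) (subst *, simp)
  also have "\<dots> = bform p p - 2 * bform p n + bform n n"
    using *[of p "-1" n p] *[of p "-1" n n] xpn bform_sym[of _ x] bform_sym[of p n] by (simp flip: xpn)
  finally have "bform x x = bform p p - 2 * bform p n + bform n n" .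
  moreover have "bform p n \<le> 0"
    unfolding bform_def cmul_def sum_distrib_left
  proof (intro sum_nonpos)
    fix k l
    show "p k * (cartan E k l * n l) \<le> 0"
    proof (cases "k = l")
      case True then show ?thesis by (auto simp: p_def n_def max_def)
    next
      case False
      have "0 \<le> p k * n l" by (simp add: p_def n_def)
      then show ?thesis using cartan_nonpos[OF False] by (metis mult.left_commute mult_nonpos_nonneg)
    qed
  qed
  moreover have "0 < bform p p" using ij iI by (intro bform_pos[of j]) (auto simp: p_def)
  moreover have "0 < bform n n" using ij iI by (intro bform_pos[of i]) (auto simp: n_def)
  moreover have "even (bform p p)" "even (bform n n)" by (rule bform_self_even)+
  ultimately have "bform x x \<ge> 4" by presburger
  then show False using root_props[OF assms] by simp
qed

text \<open>\<open>bform_lower_bound\<close> confines the coefficients of a root to a bounded range.\<close>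

lemma finite_positive_roots: "finite (positive_roots I E)"
proof -
  let ?F = "{x. \<forall>i. (i \<in> I \<longrightarrow> x i \<in> (\<Union>j\<in>I. {- (2 * h j)..2 * h j})) \<and> (i \<notin> I \<longrightarrow> x i = 0)}"
  have "x i \<in> {- (2 * h i)..2 * h i}" if x: "x \<in> roots I E" and i: "i \<in> I" for x i
  proof -
    have "(real_of_int (x i))\<^sup>2 / h i \<le> (\<Sum>i\<in>I. (real_of_int (x i))\<^sup>2 / h i)"
      using i finI h_pos by (intro member_le_sum) (auto simp: less_imp_le)
    also have "\<dots> \<le> 2" using bform_lower_bound[of x] root_props[OF x] by simp
    finally have "(real_of_int (x i))\<^sup>2 \<le> 2 * h i" using h_pos[OF i] by (simp add: field_simps)
    then have "(x i)\<^sup>2 \<le> 2 * h i" by (metis (mono_tags, lifting) of_int_le_iff of_int_mult of_int_numeral of_int_power)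
    also have "\<dots> \<le> (2 * h i)\<^sup>2" using h_pos[OF i] by (simp add: power2_eq_square)
    finally have "\<bar>x i\<bar> \<le> 2 * h i" using h_pos[OF i] abs_le_square_iff[of "x i" "2 * h i"] by simp
    then show ?thesis by auto
  qed
  then have "positive_roots I E \<subseteq> ?F" using root_props by (fastforce simp: positive_roots_def)
  moreover have "finite ?F" using finI by (intro finite_set_of_finite_funs) auto
  ultimately show ?thesis by (rule finite_subset)
qed

text \<open>
  A positive root other than the simple root at \<open>i\<close> has a positive coefficient elsewhere, which
  the reflection leaves alone.
\<close>

lemma reflection_positive:
  assumes x: "x \<in> positive_roots I E" "x \<noteq> simple_root i" and i: "i \<in> I"
  shows "simple_reflection I E i x \<in> positive_roots I E"
proof -
  have xr: "x \<in> roots I E" "\<And>k. 0 \<le> x k" using x by (auto simp: positive_roots_def)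
  have "\<exists>k. k \<noteq> i \<and> x k \<noteq> 0"
  proof (rule ccontr)
    assume "\<not> ?thesis"
    then have e: "x = (\<lambda>k. 0 + x i * simple_root i k)"
      unfolding fun_eq_iff by (auto simp: simple_root_def)
    have "bform (\<lambda>k. 0) (\<lambda>k. 0) = 0" "cmul (\<lambda>k. 0) i = 0" by (auto simp: bform_def cmul_def)
    then have "bform x x = 2 * (x i)\<^sup>2" using bform_add_simple[OF i, of "\<lambda>k. 0" "x i"] e by simp
    then have "(x i)\<^sup>2 = 1" using root_props[OF xr(1)] by simp
    then have "x i = 1" using xr(2)[of i] by (simp add: power2_eq_1_iff)
    then show False using e x(2) by (auto simp: fun_eq_iff)
  qed
  then obtain k where k: "k \<noteq> i" "x k \<noteq> 0" by blast
  have r: "simple_reflection I E i x \<in> roots I E" using xr(1) i by (rule roots.reflect)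
  moreover have "simple_reflection I E i x k > 0"
    using k xr(2)[of k] by (simp add: simple_reflection_eq simple_root_def)
  ultimately show ?thesis using root_sign[OF r] by (auto simp: positive_roots_def) (meson not_le)
qed

lemma reflection_involution:
  assumes "i \<in> I" shows "simple_reflection I E i (simple_reflection I E i x) = x"
  unfolding simple_reflection_eq cmul_add using assms
  by (simp add: cmul_simple cartan_def)

text \<open>The value of the weight \<open>l\<close>, given by its values on the simple roots, at \<open>x\<close>.\<close>

definition pair :: "('i \<Rightarrow> int) \<Rightarrow> ('i \<Rightarrow> int) \<Rightarrow> int" where
  "pair l x = (\<Sum>i\<in>I. l i * x i)"

definition npos :: "('i \<Rightarrow> int) \<Rightarrow> nat" where
  "npos l = card {x \<in> positive_roots I E. 0 < pair l x}"

end

section \<open>The numbers game and longest words\<close>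

text \<open>
  The reflection at \<open>i\<close> on weights. A position of the game is a weight; a move at a vertex with
  positive value is legal and reflects the weight there, so that every play spells a reduced word.
\<close>

definition wrefl :: "('i \<times> 'i) set \<Rightarrow> 'i \<Rightarrow> ('i \<Rightarrow> int) \<Rightarrow> ('i \<Rightarrow> int)" where
  "wrefl E i l = (\<lambda>j. l j - l i * cartan E i j)"

fun wplay :: "('i \<times> 'i) set \<Rightarrow> 'i list \<Rightarrow> ('i \<Rightarrow> int) \<Rightarrow> ('i \<Rightarrow> int)" where
  "wplay E [] l = l"
| "wplay E (i # w) l = wplay E w (wrefl E i l)"

fun legal :: "('i \<times> 'i) set \<Rightarrow> 'i set \<Rightarrow> 'i list \<Rightarrow> ('i \<Rightarrow> int) \<Rightarrow> bool" where
  "legal E A [] l = True"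
| "legal E A (i # w) l = (i \<in> A \<and> 0 < l i \<and> legal E A w (wrefl E i l))"

definition terminal :: "'i set \<Rightarrow> ('i \<Rightarrow> int) \<Rightarrow> bool" where
  "terminal A l \<longleftrightarrow> (\<forall>i\<in>A. l i \<le> 0)"

lemma wplay_append: "wplay E (u @ w) l = wplay E w (wplay E u l)"
  by (induction u arbitrary: l) auto

lemma legal_append: "legal E A (u @ w) l \<longleftrightarrow> legal E A u l \<and> legal E A w (wplay E u l)"
  by (induction u arbitrary: l) auto

lemma legal_set: "legal E A w l \<Longrightarrow> set w \<subseteq> A"
  by (induction w arbitrary: l) auto

lemma legal_mono: "legal E A w l \<Longrightarrow> A \<subseteq> B \<Longrightarrow> legal E B w l"
  by (induction w arbitrary: l) auto

lemma wrefl_involution: "wrefl E i (wrefl E i l) = l"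
  by (auto simp: wrefl_def cartan_def fun_eq_iff)

lemma wrefl_uminus: "wrefl E i (\<lambda>j. - l j) = (\<lambda>j. - wrefl E i l j)"
  by (auto simp: wrefl_def)

text \<open>
  Negating a position and playing backwards is legal, because a move turns the positive value at
  its vertex into its negative.
\<close>

lemma legal_reverse:
  "legal E A w l \<Longrightarrow> legal E A (rev w) (\<lambda>j. - wplay E w l j) \<and> wplay E (rev w) (\<lambda>j. - wplay E w l j) = (\<lambda>j. - l j)"
proof (induction w arbitrary: l)
  case (Cons i w)
  then have IH: "legal E A (rev w) (\<lambda>j. - wplay E (i # w) l j)"
    "wplay E (rev w) (\<lambda>j. - wplay E (i # w) l j) = (\<lambda>j. - wrefl E i l j)" by auto
  have "wrefl E i (\<lambda>j. - wrefl E i l j) = (\<lambda>j. - l j)"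
    by (simp add: wrefl_uminus wrefl_involution)
  moreover have "- wrefl E i l i = l i" by (simp add: wrefl_def cartan_def)
  ultimately show ?case using IH Cons.prems by (simp add: legal_append wplay_append)
qed simp

text \<open>The simply laced braid relations, without cancellation of repeated letters.\<close>

inductive braid_equiv :: "('i \<times> 'i) set \<Rightarrow> 'i list \<Rightarrow> 'i list \<Rightarrow> bool" for E :: "('i \<times> 'i) set" where
  braid_refl: "braid_equiv E w w"
| braid_trans: "braid_equiv E u v \<Longrightarrow> braid_equiv E v w \<Longrightarrow> braid_equiv E u w"
| braid_cons: "braid_equiv E v w \<Longrightarrow> braid_equiv E (i # v) (i # w)"
| braid_comm: "i \<noteq> j \<Longrightarrow> (i, j) \<notin> E \<Longrightarrow> braid_equiv E (i # j # w) (j # i # w)"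
| braid_braid: "(i, j) \<in> E \<Longrightarrow> braid_equiv E (i # j # i # w) (j # i # j # w)"

context dynkin
begin

lemma pair_wrefl:
  assumes "i \<in> I" "E' \<inter> I \<times> I = E"
  shows "pair (wrefl E' i l) x = pair l (simple_reflection I E i x)"
proof -
  have c: "cartan E' i j = cartan E i j" if "j \<in> I" for j
    using assms that by (auto simp: cartan_def)
  have "pair (wrefl E' i l) x = pair l x - l i * (\<Sum>j\<in>I. cartan E' i j * x j)"
    by (simp add: pair_def wrefl_def algebra_simps sum_subtractf sum_distrib_left)
  also have "(\<Sum>j\<in>I. cartan E' i j * x j) = cmul x i" using c by (simp add: cmul_def)
  also have "pair l x - l i * cmul x i = pair l (simple_reflection I E i x)"
  proof -
    have "(\<Sum>k\<in>I. l k * simple_root i k) = (\<Sum>k\<in>I. if k = i then l i else 0)"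
      by (intro sum.cong) (auto simp: simple_root_def)
    then have "(\<Sum>k\<in>I. l k * simple_root i k) = l i" using assms(1) finI by simp
    moreover have "pair l (simple_reflection I E i x) = pair l x - (\<Sum>k\<in>I. l k * simple_root i k) * cmul x i"
      unfolding sum_distrib_right by (simp add: pair_def simple_reflection_eq algebra_simps sum_subtractf)
    ultimately show ?thesis by simp
  qed
  finally show ?thesis .
qed

lemma pair_simple: "i \<in> I \<Longrightarrow> pair l (simple_root i) = l i"
proof -
  assume "i \<in> I"
  have "(\<Sum>k\<in>I. l k * simple_root i k) = (\<Sum>k\<in>I. if k = i then l i else 0)"
    by (intro sum.cong) (auto simp: simple_root_def)
  then show ?thesis using \<open>i \<in> I\<close> finI by (simp add: pair_def)
qed

text \<open>
  The reflection at \<open>i\<close> permutes the positive roots other than the simple root at \<open>i\<close>, and the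
  simple root changes from positive to negative value. The edges are those of a larger diagram
  \<open>E'\<close>, so that games on a subdiagram can be continued on the whole.
\<close>

lemma npos_wrefl:
  assumes i: "i \<in> I" "0 < l i" and E': "E' \<inter> I \<times> I = E"
  shows "npos l = Suc (npos (wrefl E' i l))"
proof -
  let ?s = "simple_reflection I E i"
  let ?A = "{x \<in> positive_roots I E. 0 < pair l x}" and ?B = "{x \<in> positive_roots I E. 0 < pair (wrefl E' i l) x}"
  have "\<forall>k. 0 \<le> simple_root i k" by (simp add: simple_root_def)
  then have ai: "simple_root i \<in> ?A" using i pair_simple roots.simple[OF i(1)] by (auto simp: positive_roots_def)
  have pl: "pair (wrefl E' i l) x = pair l (?s x)" for x by (rule pair_wrefl[OF i(1) E'])
  have s_simple: "?s (simple_root i) = (\<lambda>k. - simple_root i k)"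
    using i by (auto simp: simple_reflection_eq cmul_simple cartan_def)
  have neg: "pair l (\<lambda>k. - simple_root i k) = - l i"
    using pair_simple[OF i(1), of l] by (simp add: pair_def sum_negf)
  have not: "x \<noteq> simple_root i" if "x \<in> ?B" for x using that pl s_simple neg i by auto
  have "bij_betw ?s ?B (?A - {simple_root i})"
  proof (rule bij_betw_byWitness[where f' = ?s])
    show "\<forall>x\<in>?B. ?s (?s x) = x" "\<forall>x\<in>?A - {simple_root i}. ?s (?s x) = x"
      using reflection_involution[OF i(1)] by auto
    show "?s ` ?B \<subseteq> ?A - {simple_root i}"
    proof safe
      fix x assume x: "x \<in> positive_roots I E" "0 < pair (wrefl E' i l) x"
      then show "?s x \<in> positive_roots I E" using reflection_positive[OF _ _ i(1)] not by blast
      show "0 < pair l (?s x)" using x pl by simp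
      assume "?s x = simple_root i"
      then have "x = (\<lambda>k. - simple_root i k)" using reflection_involution[OF i(1), of x] s_simple by simp
      then have "x i < 0" by (simp add: simple_root_def)
      then show False using x by (auto simp: positive_roots_def) (meson not_le)
    qed
    show "?s ` (?A - {simple_root i}) \<subseteq> ?B"
    proof safe
      fix x assume "x \<in> positive_roots I E" "0 < pair l x" "x \<noteq> simple_root i"
      then show "?s x \<in> positive_roots I E" "0 < pair (wrefl E' i l) (?s x)"
        using reflection_positive[OF _ _ i(1)] pl reflection_involution[OF i(1)] by auto
    qed
  qed
  then have "card ?B = card (?A - {simple_root i})" by (rule bij_betw_same_card)
  moreover have "finite ?A" using finite_positive_roots by simp
  moreover have "card ?A = Suc (card (?A - {simple_root i}))" using \<open>finite ?A\<close> ai by (rule card.remove)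
  ultimately show ?thesis unfolding npos_def by simp
qed

text \<open>
  Every play from a position to a terminal one thus has the same length, the number of positive
  roots of positive value.
\<close>

lemma npos_play:
  assumes "E' \<inter> I \<times> I = E"
  shows "legal E' I w l \<Longrightarrow> npos l = length w + npos (wplay E' w l)"
  by (induction w arbitrary: l) (auto simp: npos_wrefl[OF _ _ assms])

lemma full_play_exists:
  assumes "E' \<inter> I \<times> I = E"
  shows "\<exists>w. legal E' I w l \<and> terminal I (wplay E' w l)"
proof (induction "npos l" arbitrary: l rule: less_induct)
  case less
  show ?case
  proof (cases "terminal I l")
    case True then show ?thesis by (intro exI[of _ "[]"]) simp
  next
    case False
    then obtain i where i: "i \<in> I" "0 < l i" by (auto simp: terminal_def not_le)
    then have "npos (wrefl E' i l) < npos l" using npos_wrefl[of i l E', OF i assms] by simp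
    then obtain w where "legal E' I w (wrefl E' i l)" "terminal I (wplay E' w (wrefl E' i l))" using less by blast
    then show ?thesis using i by (intro exI[of _ "i # w"]) simp
  qed
qed

lemma npos_terminal:
  assumes "terminal I l" shows "npos l = 0"
proof -
  have "pair l x \<le> 0" if "x \<in> positive_roots I E" for x
    unfolding pair_def using that assms
    by (intro sum_nonpos) (auto simp: terminal_def positive_roots_def mult_nonpos_nonneg)
  then have "{x \<in> positive_roots I E. 0 < pair l x} = {}" using not_le by blast
  then show ?thesis unfolding npos_def by (metis card.empty)
qed

lemma npos_dominant:
  assumes "\<And>i. i \<in> I \<Longrightarrow> 0 < l i" shows "npos l = num_positive_roots I E"
proof -
  have "0 < pair l x" if x: "x \<in> positive_roots I E" for x
  proof -
    have "bform x x = 2" using x root_props by (auto simp: positive_roots_def)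
    then have "\<exists>i\<in>I. x i \<noteq> 0" by (auto simp: bform_def intro: ccontr)
    then obtain i where "i \<in> I" "x i \<noteq> 0" by blast
    moreover have "0 \<le> x k" for k using x by (auto simp: positive_roots_def)
    ultimately show ?thesis unfolding pair_def using assms finI
      by (intro sum_pos2[of I i]) (auto intro!: mult_pos_pos mult_nonneg_nonneg simp: order_less_le dest: assms)
  qed
  then have "{x \<in> positive_roots I E. 0 < pair l x} = positive_roots I E" by blast
  then show ?thesis by (simp add: npos_def num_positive_roots_def)
qed

text \<open>
  The diamond argument. If the plays start at different vertices i and j, then both can be
  continued by j, i (if i and j are not adjacent) or by j, i, j and i, j, i (if they are) to a
  common position. From there any play to the end closes the diamond, and induction applies to the
  two positions after the first moves.
\<close>

lemma play_confluent:
  assumes "legal E I w l" "terminal I (wplay E w l)" "legal E I w' l" "terminal I (wplay E w' l)"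
  shows "wplay E w l = wplay E w' l \<and> braid_equiv E w w'"
  using assms
proof (induction "npos l" arbitrary: l w w' rule: less_induct)
  case less
  have EE: "E \<inter> I \<times> I = E" using EI by auto
  show ?case
  proof (cases w)
    case Nil
    then have "w' = []" using less.prems by (cases w') (auto simp: terminal_def not_le)
    then show ?thesis using Nil by (auto intro: braid_refl)
  next
    case (Cons i u)
    then have i: "i \<in> I" "0 < l i" "legal E I u (wrefl E i l)" "terminal I (wplay E u (wrefl E i l))" using less.prems by auto
    have "w' \<noteq> []" using i less.prems by (auto simp: terminal_def)
    then obtain j u' where w': "w' = j # u'" by (cases w') auto
    then have j: "j \<in> I" "0 < l j" "legal E I u' (wrefl E j l)" "terminal I (wplay E u' (wrefl E j l))" using less.prems by auto
    have ni: "npos (wrefl E i l) < npos l" and nj: "npos (wrefl E j l) < npos l"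
      using npos_wrefl[of i l E, OF i(1,2) EE] npos_wrefl[of j l E, OF j(1,2) EE] by auto
    show ?thesis
    proof (cases "i = j")
      case True
      then show ?thesis using less.hyps[OF ni i(3,4)] j w' Cons by (auto intro: braid_cons)
    next
      case ij: False
      show ?thesis
      proof (cases "(i, j) \<in> E")
        case False
        then have ji: "(j, i) \<notin> E" using symE by blast
        have comm: "wrefl E j (wrefl E i l) = wrefl E i (wrefl E j l)"
          using False ji ij by (auto simp: wrefl_def cartan_def fun_eq_iff)
        obtain z where z: "legal E I z (wrefl E j (wrefl E i l))" "terminal I (wplay E z (wrefl E j (wrefl E i l)))"
          using full_play_exists[OF EE] by blast
        have "0 < wrefl E i l j" "0 < wrefl E j l i"
          using ij False ji i j by (auto simp: wrefl_def cartan_def)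
        then have 1: "legal E I (j # z) (wrefl E i l)" "terminal I (wplay E (j # z) (wrefl E i l))"
          and 2: "legal E I (i # z) (wrefl E j l)" "terminal I (wplay E (i # z) (wrefl E j l))"
          using z i j comm by auto
        have "braid_equiv E (i # u) (i # j # z)" "wplay E u (wrefl E i l) = wplay E (j # z) (wrefl E i l)"
          using less.hyps[OF ni i(3,4) 1] by (auto intro: braid_cons)
        moreover have "braid_equiv E (j # i # z) (j # u')" "wplay E (i # z) (wrefl E j l) = wplay E u' (wrefl E j l)"
          using less.hyps[OF nj 2 j(3,4)] by (auto intro: braid_cons)
        moreover have "braid_equiv E (i # j # z) (j # i # z)" using ij False by (rule braid_comm)
        ultimately show ?thesis unfolding Cons w' using comm by (auto intro: braid_trans)
      next
        case True
        then have ji: "(j, i) \<in> E" using symE by blast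
        let ?m = "wrefl E i (wrefl E j (wrefl E i l))"
        have br: "?m = wrefl E j (wrefl E i (wrefl E j l))"
          using True ji ij by (auto simp: wrefl_def cartan_def fun_eq_iff algebra_simps)
        obtain z where z: "legal E I z ?m" "terminal I (wplay E z ?m)"
          using full_play_exists[OF EE] by blast
        have "0 < wrefl E i l j" "0 < wrefl E j l i" "0 < wrefl E j (wrefl E i l) i" "0 < wrefl E i (wrefl E j l) j"
          using ij True ji i j by (auto simp: wrefl_def cartan_def)
        then have 1: "legal E I (j # i # z) (wrefl E i l)" "terminal I (wplay E (j # i # z) (wrefl E i l))"
          and 2: "legal E I (i # j # z) (wrefl E j l)" "terminal I (wplay E (i # j # z) (wrefl E j l))"
          using z i j br by auto
        have "braid_equiv E (i # u) (i # j # i # z)" "wplay E u (wrefl E i l) = wplay E (j # i # z) (wrefl E i l)"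
          using less.hyps[OF ni i(3,4) 1] by (auto intro: braid_cons)
        moreover have "braid_equiv E (j # i # j # z) (j # u')" "wplay E (i # j # z) (wrefl E j l) = wplay E u' (wrefl E j l)"
          using less.hyps[OF nj 2 j(3,4)] by (auto intro: braid_cons)
        moreover have "braid_equiv E (i # j # i # z) (j # i # j # z)" using True by (rule braid_braid)
        ultimately show ?thesis unfolding Cons w' using br by (auto intro: braid_trans)
      qed
    qed
  qed
qed

lemma regular_play:
  assumes "\<And>x. x \<in> roots I E \<Longrightarrow> pair l x \<noteq> 0" "set w \<subseteq> I"
  shows "x \<in> roots I E \<Longrightarrow> pair (wplay E w l) x \<noteq> 0"
  using assms
proof (induction w arbitrary: l x)
  case (Cons i w)
  have "pair (wrefl E i l) x \<noteq> 0" if "x \<in> roots I E" for x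
    using Cons.prems that EI by (subst pair_wrefl) (auto intro: roots.reflect)
  then show ?case using Cons by simp
qed simp

text \<open>Deleting vertices removes nonpositive terms from the rows of the Cartan matrix.\<close>

lemma subdynkin:
  assumes "K \<subseteq> I" shows "dynkin K (full_subdiagram E K) h"
proof
  fix i assume i: "i \<in> K"
  have "(\<Sum>j\<in>I. cartan E i j * h j) = (\<Sum>j\<in>K. cartan E i j * h j) + (\<Sum>j\<in>I - K. cartan E i j * h j)"
    using assms finI by (metis add.commute sum.subset_diff)
  moreover have "(\<Sum>j\<in>I - K. cartan E i j * h j) \<le> 0"
  proof (intro sum_nonpos mult_nonpos_nonneg)
    fix j assume "j \<in> I - K"
    then show "cartan E i j \<le> 0" "0 \<le> h j" using i h_pos[of j] by (auto intro!: cartan_nonpos)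
  qed
  moreover have "(\<Sum>j\<in>K. cartan (full_subdiagram E K) i j * h j) = (\<Sum>j\<in>K. cartan E i j * h j)"
    using i by (intro sum.cong) (auto simp: cartan_def full_subdiagram_def)
  ultimately show "0 < (\<Sum>j\<in>K. cartan (full_subdiagram E K) i j * h j)" using Ch_pos[of i] i assms by auto
qed (use assms finI finite_subset symE irrE h_pos in \<open>auto simp: full_subdiagram_def\<close>)

text \<open>
  Play from the weight with all values 1, first in \<open>K\<close> until nothing can be played there, then in
  \<open>I\<close> to the end position m; the lengths are counted by \<open>npos_play\<close>. To end with a given letter
  \<open>k\<close>, note that m is negative at every vertex, so the reversed game from -m can be opened at \<open>k\<close>.
  By confluence it ends where the reverse of the first play ends, and read backwards it is a play
  from the weight 1 that closes with \<open>k\<close>; confluence makes it braid equivalent to the first.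
\<close>

theorem longest_word:
  assumes K: "K \<subseteq> I"
  obtains wK w where "set wK \<subseteq> K" "set w \<subseteq> I"
    "num_positive_roots I E = num_positive_roots K (full_subdiagram E K) + length w"
    "\<And>k. k \<in> I \<Longrightarrow> \<exists>u. set u \<subseteq> I \<and> braid_equiv E (wK @ w) (u @ [k])"
proof -
  interpret K: dynkin K "full_subdiagram E K" h by (rule subdynkin[OF K])
  have EE: "E \<inter> I \<times> I = E" using EI by auto
  have EK: "E \<inter> K \<times> K = full_subdiagram E K" by (simp add: full_subdiagram_def)
  let ?r = "\<lambda>i :: 'i. 1 :: int"
  obtain wK where wK: "legal E K wK ?r" "terminal K (wplay E wK ?r)" using K.full_play_exists[OF EK] by blast
  have lK: "length wK = num_positive_roots K (full_subdiagram E K)"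
    using K.npos_play[OF EK wK(1)] K.npos_terminal[OF wK(2)] K.npos_dominant[of ?r] by simp
  obtain w where w: "legal E I w (wplay E wK ?r)" "terminal I (wplay E w (wplay E wK ?r))" using full_play_exists[OF EE] by blast
  let ?W = "wK @ w"
  have W: "legal E I ?W ?r" "terminal I (wplay E ?W ?r)"
    using w legal_mono[OF wK(1) K] by (auto simp: legal_append wplay_append)
  have lW: "length ?W = num_positive_roots I E"
    using npos_play[OF EE W(1)] npos_terminal[OF W(2)] npos_dominant[of ?r] by simp
  define m where "m = wplay E ?W ?r"
  have "pair ?r x \<noteq> 0" if x: "x \<in> roots I E" for x
  proof
    assume 0: "pair ?r x = 0"
    have "\<forall>i\<in>I. x i = 0"
      using root_sign[OF x]
    proof
      assume "\<forall>i. 0 \<le> x i"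
      then show ?thesis using 0 sum_nonneg_eq_0_iff[OF finI, of x] by (simp add: pair_def)
    next
      assume "\<forall>i. x i \<le> 0"
      then show ?thesis using 0 sum_nonneg_eq_0_iff[OF finI, of "\<lambda>i. - x i"] by (simp add: pair_def sum_negf)
    qed
    then show False using root_props[OF x] by (simp add: bform_def)
  qed
  then have reg: "pair m x \<noteq> 0" if "x \<in> roots I E" for x
    unfolding m_def using regular_play[OF _ legal_set[OF W(1)]] that by blast
  have rev: "legal E I (rev ?W) (\<lambda>j. - m j)" "wplay E (rev ?W) (\<lambda>j. - m j) = (\<lambda>j. - 1)"
    using legal_reverse[OF W(1)] by (auto simp: m_def)
  show ?thesis
  proof (rule that[of wK w])
    show "set wK \<subseteq> K" using legal_set[OF wK(1)] .
    show "set w \<subseteq> I" using legal_set[OF w(1)] .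
    show "num_positive_roots I E = num_positive_roots K (full_subdiagram E K) + length w" using lK lW by simp
    fix k assume k: "k \<in> I"
    have "m k \<noteq> 0" using reg[OF roots.simple[OF k]] pair_simple[OF k] by simp
    moreover have "m k \<le> 0" using W(2) k by (auto simp: terminal_def m_def)
    ultimately have mk: "0 < - m k" by simp
    obtain z where z: "legal E I z (wrefl E k (\<lambda>j. - m j))" "terminal I (wplay E z (wrefl E k (\<lambda>j. - m j)))"
      using full_play_exists[OF EE] by blast
    have kz: "legal E I (k # z) (\<lambda>j. - m j)" "terminal I (wplay E (k # z) (\<lambda>j. - m j))" using z k mk by auto
    have t: "terminal I (wplay E (rev ?W) (\<lambda>j. - m j))" unfolding rev(2) by (simp add: terminal_def)
    have e: "wplay E (k # z) (\<lambda>j. - m j) = (\<lambda>j. - 1)"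
      using play_confluent[OF kz rev(1) t] rev(2) by simp
    have r2: "legal E I (rev (k # z)) ?r" "wplay E (rev (k # z)) ?r = m"
      using legal_reverse[OF kz(1)] unfolding e by simp_all
    have "terminal I (wplay E (rev (k # z)) ?r)" using W(2) r2(2) unfolding m_def by metis
    from play_confluent[OF W r2(1) this] have "braid_equiv E ?W (rev z @ [k])" by simp
    moreover have "set (rev z) \<subseteq> I" using legal_set[OF z(1)] by simp
    ultimately show "\<exists>u. set u \<subseteq> I \<and> braid_equiv E (wK @ w) (u @ [k])" by blast
  qed
qed

end

section \<open>The diagrams of type A, D and E\<close>

text \<open>
  The witnesses are the coefficients of the sum of the positive roots in terms of the simple ones,
  up to a factor in type D; the Cartan matrix is constant and positive on them.
\<close>

lemma dynkin_standard:
  assumes n: "(1 \<le> n \<and> F = A_edges n) \<or> (4 \<le> n \<and> F = D_edges n) \<or> (n \<in> {6, 7, 8} \<and> F = E_edges n)"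
  obtains h where "dynkin {1..n} (F \<union> F\<inverse>) h"
proof -
  note result = that
  have ax: "F \<union> F\<inverse> \<subseteq> {1..n} \<times> {1..n}" "(i, i) \<notin> F \<union> F\<inverse>" for i
    using n by (auto simp: A_edges_def D_edges_def E_edges_def)
  have sum: "(\<Sum>j\<in>{1..n}. cartan (F \<union> F\<inverse>) i j * h j) \<ge> 2 * h i - (\<Sum>j\<in>N. h j)"
    if i: "i \<in> {1..n}" and N: "finite N" "\<And>j. (i, j) \<in> F \<union> F\<inverse> \<Longrightarrow> j \<in> N"
      and h: "\<And>j. j \<in> N \<Longrightarrow> 0 \<le> h j" for i N and h :: "nat \<Rightarrow> int"
  proof -
    let ?M = "{j. (i, j) \<in> F \<union> F\<inverse>}"
    have M: "?M \<subseteq> {1..n} - {i}" using ax by blast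
    have "(\<Sum>j\<in>{1..n}. cartan (F \<union> F\<inverse>) i j * h j)
        = 2 * h i + (\<Sum>j\<in>{1..n} - {i}. cartan (F \<union> F\<inverse>) i j * h j)"
      using i by (subst sum.remove[of _ i]) (auto simp: cartan_def)
    also have "(\<Sum>j\<in>{1..n} - {i}. cartan (F \<union> F\<inverse>) i j * h j) = (\<Sum>j\<in>?M. - h j)"
      using M by (intro sum.mono_neutral_cong_right) (auto simp: cartan_def)
    finally have "(\<Sum>j\<in>{1..n}. cartan (F \<union> F\<inverse>) i j * h j) = 2 * h i - (\<Sum>j\<in>?M. h j)"
      by (simp add: sum_negf)
    moreover have "(\<Sum>j\<in>?M. h j) \<le> (\<Sum>j\<in>N. h j)"
      using N h by (intro sum_mono2) auto
    ultimately show ?thesis by linarith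
  qed
  have key: thesis if h: "\<And>i. i \<in> {1..n} \<Longrightarrow> 0 < h i"
    and N: "\<And>i. i \<in> {1..n} \<Longrightarrow> finite (N i)" "\<And>i j. i \<in> {1..n} \<Longrightarrow> (i, j) \<in> F \<union> F\<inverse> \<Longrightarrow> j \<in> N i"
      "\<And>i j. i \<in> {1..n} \<Longrightarrow> j \<in> N i \<Longrightarrow> 0 \<le> h j" "\<And>i. i \<in> {1..n} \<Longrightarrow> (\<Sum>j\<in>N i. h j) < 2 * h i"
    for h :: "nat \<Rightarrow> int" and N :: "nat \<Rightarrow> nat set"
  proof (rule result[of h], unfold_locales)
    fix i assume i: "i \<in> {1..n}"
    show "0 < (\<Sum>j\<in>{1..n}. cartan (F \<union> F\<inverse>) i j * h j)"
      using sum[where N = "N i" and h = h, OF i N(1)[OF i]] N(2,3,4)[OF i] by force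
  qed (use ax h in auto)
  consider (A) "1 \<le> n" "F = A_edges n" | (D) "4 \<le> n" "F = D_edges n" | (E) "n \<in> {6, 7, 8}" "F = E_edges n"
    using n by blast
  then show ?thesis
  proof cases
    case A
    (* The values at 0 and n + 1, which are not vertices, are 0. *)
    let ?h = "\<lambda>i. int i * (int n + 1 - int i)"
    show ?thesis
    proof (rule key[of ?h "\<lambda>i. {i - 1, i + 1}"])
      fix i assume i: "i \<in> {1..n}"
      show "0 < ?h i" using i by auto
      show "j \<in> {i - 1, i + 1}" if "(i, j) \<in> F \<union> F\<inverse>" for j using that A by (auto simp: A_edges_def)
      show "0 \<le> ?h j" if "j \<in> {i - 1, i + 1}" for j using that i by auto
      show "(\<Sum>j\<in>{i - 1, i + 1}. ?h j) < 2 * ?h i" using i by (simp add: of_nat_diff algebra_simps)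
    qed simp
  next
    case D
    (* Twice the coefficients, which avoids halves at the two ends of the fork. *)
    let ?h = "\<lambda>i. if i \<le> n - 2 then 2 * int i * (2 * int n - 1 - int i) else int n * (int n - 1)"
    show ?thesis
    proof (rule key[of ?h "\<lambda>i. if i < n - 2 then {i - 1, i + 1} else if i = n - 2 then {n - 3, n - 1, n} else {n - 2}"])
      fix i assume i: "i \<in> {1..n}"
      show "0 < ?h i" using i D by auto
      show "finite (if i < n - 2 then {i - 1, i + 1} else if i = n - 2 then {n - 3, n - 1, n} else {n - 2})" by simp
      show "j \<in> (if i < n - 2 then {i - 1, i + 1} else if i = n - 2 then {n - 3, n - 1, n} else {n - 2})"
        if "(i, j) \<in> F \<union> F\<inverse>" for j using that D by (auto simp: D_edges_def) arith
      show "0 \<le> ?h j" for j using D by auto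
      consider "i < n - 2" | "i = n - 2" | "i = n - 1 \<or> i = n" using i by force
      then show "(\<Sum>j\<in>(if i < n - 2 then {i - 1, i + 1} else if i = n - 2 then {n - 3, n - 1, n} else {n - 2}). ?h j) < 2 * ?h i"
      proof cases
        case 1
        then show ?thesis using i by (auto simp: of_nat_diff algebra_simps)
      next
        case 2
        obtain m where m: "n = m + 4" using D(1) by (metis add.commute le_Suc_ex)
        show ?thesis using 2 unfolding m by (simp add: of_nat_diff algebra_simps)
      next
        case 3
        obtain m where m: "n = m + 4" using D(1) by (metis add.commute le_Suc_ex)
        show ?thesis using 3 unfolding m by (auto simp: of_nat_diff algebra_simps)
      qed
    qed
  next
    case E
    let ?N = "\<lambda>i. if i = 1 then {3} else if i = 2 then {4} else if i = 3 then {1, 4} else if i = 4 then {2, 3, 5} else if i = n then {n - 1} else {i - 1, i + 1}"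
    (* Vertices start at 1, so position 0 of the lists is a filler. *)
    let ?h = "\<lambda>i. int ((if n = 6 then [0, 16, 22, 30, 42, 30, 16]
        else if n = 7 then [0, 34, 49, 66, 96, 75, 52, 27] else [0, 92, 136, 182, 270, 220, 168, 114, 58]) ! i)"
    have i8: "i \<in> {1..n} \<Longrightarrow> i \<in> {1, 2, 3, 4, 5, 6, 7, 8}" for i using E by auto
    show ?thesis
    proof (rule key[of ?h ?N])
      fix i assume i: "i \<in> {1..n}"
      show "0 < ?h i" using i i8[OF i] E(1) by auto
      show "finite (?N i)" by simp
      show "j \<in> ?N i" if "(i, j) \<in> F \<union> F\<inverse>" for j using that E by (auto simp: E_edges_def split: if_splits)
      show "0 \<le> ?h j" for j by simp
      from E(1) consider "n = 6" | "n = 7" | "n = 8" by auto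
      then show "(\<Sum>j\<in>?N i. ?h j) < 2 * ?h i"
      proof cases
        case 1
        then have "i \<in> {1, 2, 3, 4, 5, 6}" using i by auto
        then show ?thesis unfolding 1 by (elim insertE emptyE) simp_all
      next
        case 2
        then have "i \<in> {1, 2, 3, 4, 5, 6, 7}" using i by auto
        then show ?thesis unfolding 2 by (elim insertE emptyE) simp_all
      next
        case 3
        then have "i \<in> {1, 2, 3, 4, 5, 6, 7, 8}" using i by auto
        then show ?thesis unfolding 3 by (elim insertE emptyE) simp_all
      qed
    qed
  qed
qed

lemma dynkin_ADE:
  assumes "ADE_diagram I E"
  obtains h where "dynkin I E h"
proof -
  obtain n F \<phi> where EI: "E \<subseteq> I \<times> I"
    and n: "(1 \<le> n \<and> F = A_edges n) \<or> (4 \<le> n \<and> F = D_edges n) \<or> (n \<in> {6, 7, 8} \<and> F = E_edges n)"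
    and \<phi>: "bij_betw \<phi> I {1..n}" "\<forall>x\<in>I. \<forall>y\<in>I. (x, y) \<in> E \<longleftrightarrow> (\<phi> x, \<phi> y) \<in> F \<union> F\<inverse>"
    using assms unfolding ADE_diagram_def diagram_iso_def by blast
  obtain h where "dynkin {1..n} (F \<union> F\<inverse>) h" using dynkin_standard[OF n] .
  then interpret S: dynkin "{1..n}" "F \<union> F\<inverse>" h .
  have inj: "inj_on \<phi> I" and im: "\<phi> ` I = {1..n}" using \<phi>(1) by (auto simp: bij_betw_def)
  have "dynkin I E (h \<circ> \<phi>)"
  proof
    show "finite I" using \<phi>(1) bij_betw_finite by blast
    show "E \<subseteq> I \<times> I" by fact
    show "(j, i) \<in> E" if "(i, j) \<in> E" for i j using that \<phi>(2) EI by (auto 4 3)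
    show "(i, i) \<notin> E" for i using \<phi>(2) EI S.irrE by auto
    fix i assume i: "i \<in> I"
    have pi: "\<phi> i \<in> {1..n}" using im i by auto
    then show "0 < (h \<circ> \<phi>) i" using S.h_pos by simp
    have "(\<Sum>j\<in>I. cartan E i j * (h \<circ> \<phi>) j) = (\<Sum>j\<in>I. cartan (F \<union> F\<inverse>) (\<phi> i) (\<phi> j) * h (\<phi> j))"
      using i \<phi>(2) inj by (intro sum.cong) (auto simp: cartan_def inj_on_eq_iff)
    also have "\<dots> = (\<Sum>m\<in>\<phi> ` I. cartan (F \<union> F\<inverse>) (\<phi> i) m * h m)" using inj by (simp add: sum.reindex)
    finally show "0 < (\<Sum>j\<in>I. cartan E i j * (h \<circ> \<phi>) j)" using S.Ch_pos[OF pi] im by simp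
  qed
  then show ?thesis using that by blast
qed

section \<open>Representations of the double quiver and socle filtrations\<close>

text \<open>
  The signs of the preprojective relations enter only through nonzero coefficients \<open>eps\<close>.
\<close>

locale preproj = dynkin I E h for I :: "'i set" and E h +
  fixes eps :: "'i \<Rightarrow> 'i \<Rightarrow> complex"
  assumes eps_nz: "(i, j) \<in> E \<Longrightarrow> eps i j \<noteq> 0"
begin

definition nb :: "'i \<Rightarrow> 'i set" where
  "nb i = {j. (i, j) \<in> E}"

lemma finite_nb [simp]: "finite (nb i)"
  using EI finI by (auto simp: nb_def intro: finite_subset[of _ I])

lemma E_I: "(i, j) \<in> E \<Longrightarrow> i \<in> I \<and> j \<in> I"
  using EI by auto

text \<open>The defining relation of the preprojective algebra at the vertex \<open>i\<close>, as an operator.\<close>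

definition mesh :: "('i \<Rightarrow> 'i \<Rightarrow> 'v \<Rightarrow> 'v::cvector) \<Rightarrow> 'i \<Rightarrow> 'v \<Rightarrow> 'v" where
  "mesh A i x = (\<Sum>j\<in>nb i. eps i j *\<^sub>C A j i (A i j x))"

definition is_rep :: "('i \<Rightarrow> 'v::cvector set) \<Rightarrow> ('i \<Rightarrow> 'i \<Rightarrow> 'v \<Rightarrow> 'v) \<Rightarrow> bool" where
  "is_rep S A \<longleftrightarrow> (\<forall>i\<in>I. cv.subspace (S i) \<and> fd (S i)) \<and>
     (\<forall>i j. (i, j) \<in> E \<longrightarrow> lin_on (S i) (A i j) \<and> (\<forall>x\<in>S i. A i j x \<in> S j)) \<and>
     (\<forall>i\<in>I. \<forall>x\<in>S i. mesh A i x = 0)"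

lemma is_repD:
  assumes "is_rep S A"
  shows "i \<in> I \<Longrightarrow> cv.subspace (S i)" "i \<in> I \<Longrightarrow> fd (S i)"
    "(i, j) \<in> E \<Longrightarrow> lin_on (S i) (A i j)" "(i, j) \<in> E \<Longrightarrow> x \<in> S i \<Longrightarrow> A i j x \<in> S j"
    "i \<in> I \<Longrightarrow> x \<in> S i \<Longrightarrow> mesh A i x = 0"
    "i \<in> I \<Longrightarrow> 0 \<in> S i" "(i, j) \<in> E \<Longrightarrow> A i j 0 = 0"
proof -
  note r = assms[unfolded is_rep_def]
  show sub: "cv.subspace (S i)" if "i \<in> I" for i using r that by simp
  show "i \<in> I \<Longrightarrow> fd (S i)" using r by simp
  show lin: "(i, j) \<in> E \<Longrightarrow> lin_on (S i) (A i j)" using r by simp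
  show "(i, j) \<in> E \<Longrightarrow> x \<in> S i \<Longrightarrow> A i j x \<in> S j" using r by simp
  show "i \<in> I \<Longrightarrow> x \<in> S i \<Longrightarrow> mesh A i x = 0" using r by simp
  show "i \<in> I \<Longrightarrow> 0 \<in> S i" using sub cv.subspace_0 by metis
  show "(i, j) \<in> E \<Longrightarrow> A i j 0 = 0" using lin_on_zero[OF lin sub] E_I by metis
qed

definition subrep :: "('i \<Rightarrow> 'v::cvector set) \<Rightarrow> ('i \<Rightarrow> 'i \<Rightarrow> 'v \<Rightarrow> 'v) \<Rightarrow> ('i \<Rightarrow> 'v set) \<Rightarrow> bool" where
  "subrep S A V \<longleftrightarrow> (\<forall>i\<in>I. cv.subspace (V i) \<and> V i \<subseteq> S i) \<and>
     (\<forall>i j. (i, j) \<in> E \<longrightarrow> (\<forall>x\<in>V i. A i j x \<in> V j))"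

lemma subrepD:
  assumes "subrep S A V"
  shows "i \<in> I \<Longrightarrow> cv.subspace (V i)" "i \<in> I \<Longrightarrow> V i \<subseteq> S i"
    "i \<in> I \<Longrightarrow> x \<in> V i \<Longrightarrow> x \<in> S i"
    "(i, j) \<in> E \<Longrightarrow> x \<in> V i \<Longrightarrow> A i j x \<in> V j"
  using assms unfolding subrep_def by blast+

lemma subrep_is_rep: "is_rep S A \<Longrightarrow> subrep S A V \<Longrightarrow> is_rep V A"
  unfolding is_rep_def subrep_def using fd_subset lin_on_subset E_I by (metis subset_iff)

text \<open>
  If \<open>V\<close> is a subrepresentation, \<open>step S A i V\<close> is the preimage of the part of the socle of
  \<open>S / V\<close> that is supported at \<open>i\<close>.
\<close>

definition step :: "('i \<Rightarrow> 'v::cvector set) \<Rightarrow> ('i \<Rightarrow> 'i \<Rightarrow> 'v \<Rightarrow> 'v) \<Rightarrow> 'i \<Rightarrow> ('i \<Rightarrow> 'v set) \<Rightarrow> ('i \<Rightarrow> 'v set)" where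
  "step S A i V = V(i := {x \<in> S i. \<forall>j\<in>nb i. A i j x \<in> V j})"

lemma step_same: "step S A i V i = {x \<in> S i. \<forall>j\<in>nb i. A i j x \<in> V j}"
  and step_other: "k \<noteq> i \<Longrightarrow> step S A i V k = V k"
  by (auto simp: step_def)

text \<open>
  The socle filtration along a word, read from left to right and started at a given
  subrepresentation.
\<close>

abbreviation socw where "socw S A \<equiv> fold (step S A)"

lemma step_subrep:
  assumes "is_rep S A" "subrep S A V" "i \<in> I"
  shows "subrep S A (step S A i V)" "k \<in> I \<Longrightarrow> V k \<subseteq> step S A i V k"
proof -
  have le: "V k \<subseteq> step S A i V k" if "k \<in> I" for k
    using subrepD[OF assms(2)] that by (cases "k = i") (auto simp: step_same step_other nb_def)
  show "V k \<subseteq> step S A i V k" if "k \<in> I" by (rule le[OF that])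
  have sub: "cv.subspace {x \<in> S i. \<forall>j\<in>nb i. A i j x \<in> V j}"
    unfolding cv.subspace_def
  proof (intro conjI ballI allI)
    show "0 \<in> {x \<in> S i. \<forall>j\<in>nb i. A i j x \<in> V j}"
      using is_repD(6,7)[OF assms(1)] assms(3) subrepD(1)[OF assms(2)] E_I by (auto simp: nb_def cv.subspace_0)
  next
    fix x y assume "x \<in> {x \<in> S i. \<forall>j\<in>nb i. A i j x \<in> V j}" "y \<in> {x \<in> S i. \<forall>j\<in>nb i. A i j x \<in> V j}"
    then show "x + y \<in> {x \<in> S i. \<forall>j\<in>nb i. A i j x \<in> V j}"
      using is_repD(1)[OF assms(1)] assms(3) subrepD(1)[OF assms(2)] E_I
      by (auto simp: nb_def cv.subspace_add lin_on_add[OF is_repD(3)[OF assms(1)]])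
  next
    fix x c assume "x \<in> {x \<in> S i. \<forall>j\<in>nb i. A i j x \<in> V j}"
    then show "c *\<^sub>C x \<in> {x \<in> S i. \<forall>j\<in>nb i. A i j x \<in> V j}"
      using is_repD(1)[OF assms(1)] assms(3) subrepD(1)[OF assms(2)] E_I
      by (auto simp: nb_def cv.subspace_scale lin_on_scale[OF is_repD(3)[OF assms(1)]])
  qed
  show "subrep S A (step S A i V)"
    unfolding subrep_def
  proof (intro conjI ballI allI impI)
    fix k assume k: "k \<in> I"
    show "cv.subspace (step S A i V k)" using sub subrepD(1)[OF assms(2) k] by (auto simp: step_def)
    show "step S A i V k \<subseteq> S k" using subrepD(2)[OF assms(2) k] by (auto simp: step_def)
  next
    fix k l x assume kl: "(k, l) \<in> E" and x: "x \<in> step S A i V k"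
    show "A k l x \<in> step S A i V l"
    proof (cases "k = i")
      case True
      then have "l \<noteq> i" using kl irrE by auto
      then show ?thesis using True x kl by (auto simp: step_same step_other nb_def)
    next
      case False
      then have "A k l x \<in> V l" using x kl subrepD(4)[OF assms(2)] by (auto simp: step_other)
      then show ?thesis using le E_I kl by blast
    qed
  qed
qed

lemma socw_subrep:
  assumes "is_rep S A"
  shows "subrep S A V \<Longrightarrow> set w \<subseteq> I \<Longrightarrow> subrep S A (socw S A w V)"
  by (induction w arbitrary: V) (auto simp: step_subrep[OF assms])

lemma step_idem: "step S A i (step S A i V) = step S A i V"
proof -
  have "j \<noteq> i" if "j \<in> nb i" for j using that irrE by (auto simp: nb_def)
  then show ?thesis by (auto simp: step_def fun_eq_iff)
qed

lemma step_comm: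
  assumes "i \<noteq> j" "(i, j) \<notin> E" shows "step S A i (step S A j V) = step S A j (step S A i V)"
proof -
  have "(j, i) \<notin> E" using assms symE by blast
  then show ?thesis using assms by (auto simp: step_def fun_eq_iff nb_def)
qed

text \<open>
  If all arrows out of \<open>j\<close> except the one to \<open>i\<close> send \<open>y\<close> into \<open>V\<close>, then the relation at \<open>j\<close>
  leaves a single term modulo \<open>V\<close>.
\<close>

lemma mesh_other:
  assumes r: "is_rep S A" and V: "subrep S A V" and E: "(j, i) \<in> E" and y: "y \<in> S j"
    and k: "\<And>k. k \<in> nb j \<Longrightarrow> k \<noteq> i \<Longrightarrow> A j k y \<in> V k"
  shows "A i j (A j i y) \<in> V j"
proof -
  have j: "j \<in> I" and Vj: "cv.subspace (V j)" using E E_I subrepD(1)[OF V] by auto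
  have i: "i \<in> nb j" using E by (simp add: nb_def)
  have "mesh A j y = eps j i *\<^sub>C A i j (A j i y) + (\<Sum>k\<in>nb j - {i}. eps j k *\<^sub>C A k j (A j k y))"
    unfolding mesh_def using i by (simp add: sum.remove)
  then have e: "eps j i *\<^sub>C A i j (A j i y) = - (\<Sum>k\<in>nb j - {i}. eps j k *\<^sub>C A k j (A j k y))"
    using is_repD(5)[OF r j y] by (simp add: add_eq_0_iff2)
  have "(\<Sum>k\<in>nb j - {i}. eps j k *\<^sub>C A k j (A j k y)) \<in> V j"
  proof (intro cv.subspace_sum Vj cv.subspace_scale)
    fix k assume kk: "k \<in> nb j - {i}"
    then have "(k, j) \<in> E" using symE by (auto simp: nb_def)
    then show "A k j (A j k y) \<in> V j" using k kk subrepD(4)[OF V] by auto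
  qed
  then have "eps j i *\<^sub>C A i j (A j i y) \<in> V j" unfolding e using Vj cv.subspace_neg by blast
  then have "inverse (eps j i) *\<^sub>C eps j i *\<^sub>C A i j (A j i y) \<in> V j" using Vj cv.subspace_scale by blast
  then show ?thesis using eps_nz[OF E] by (simp add: cscale_cscale cscale_one)
qed

text \<open>
  Both sides consist of the vectors at \<open>i\<close> that go to \<open>V\<close> along the arrows other than the one to
  \<open>j\<close>, and whose image at \<open>j\<close> goes to \<open>V\<close> along the arrows other than the one back to \<open>i\<close>. The
  remaining conditions, on paths that return to \<open>i\<close>, follow from the relations.
\<close>

lemma step_braid_aux:
  assumes r: "is_rep S A" and V: "subrep S A V" and E: "(i, j) \<in> E"
  shows "step S A i (step S A j (step S A i V)) i = step S A j (step S A i (step S A j V)) i"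
proof -
  have ne: "i \<noteq> j" and ji: "(j, i) \<in> E" using E irrE symE by auto
  have inb: "j \<in> nb i" "i \<in> nb j" "i \<notin> nb i" "j \<notin> nb j" using E ji irrE by (auto simp: nb_def)
  let ?P = "\<lambda>x. x \<in> S i \<and> (\<forall>k\<in>nb i - {j}. A i k x \<in> V k)"
  have "step S A i (step S A j (step S A i V)) i
      = {x. ?P x \<and> (\<forall>k\<in>nb j - {i}. A j k (A i j x) \<in> V k) \<and> A j i (A i j x) \<in> step S A i V i}"
    using ne inb is_repD(4)[OF r E] by (auto simp: step_def)
  also have "\<dots> = {x. ?P x \<and> (\<forall>k\<in>nb j - {i}. A j k (A i j x) \<in> V k)}"
  proof -
    have "A j i (A i j x) \<in> step S A i V i" if "?P x" for x
    proof -
      have "A j i (A i j x) \<in> V i" by (rule mesh_other[OF r V E]) (use that in auto)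
      then show ?thesis using step_subrep(2)[OF r V, of i i] E_I E by blast
    qed
    then show ?thesis by auto
  qed
  also have "\<dots> = {x. ?P x \<and> A i j x \<in> step S A j V j}"
  proof -
    have "A j i (A i j x) \<in> V i" if "?P x" for x
      by (rule mesh_other[OF r V E]) (use that in auto)
    then show ?thesis using ne inb is_repD(4)[OF r E] by (auto simp: step_def)
  qed
  also have "\<dots> = step S A j (step S A i (step S A j V)) i"
    using ne inb by (auto simp: step_def)
  finally show ?thesis .
qed

lemma step_braid:
  assumes r: "is_rep S A" and V: "subrep S A V" and E: "(i, j) \<in> E"
  shows "step S A i (step S A j (step S A i V)) = step S A j (step S A i (step S A j V))"
proof
  fix k
  have ji: "(j, i) \<in> E" using E symE by auto
  consider "k = i" | "k = j" | "k \<noteq> i" "k \<noteq> j" by blast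
  then show "step S A i (step S A j (step S A i V)) k = step S A j (step S A i (step S A j V)) k"
  proof cases
    case 1 then show ?thesis using step_braid_aux[OF r V E] by simp
  next
    case 2 then show ?thesis using step_braid_aux[OF r V ji] by simp
  next
    case 3 then show ?thesis by (simp add: step_other)
  qed
qed

lemma braid_equiv_set: "braid_equiv E u w \<Longrightarrow> set u = set w"
  by (induction rule: braid_equiv.induct) auto

lemma socw_braid_equiv:
  assumes r: "is_rep S A"
  shows "braid_equiv E u w \<Longrightarrow> set u \<subseteq> I \<Longrightarrow> subrep S A V \<Longrightarrow> socw S A u V = socw S A w V"
proof (induction arbitrary: V rule: braid_equiv.induct)
  case (braid_trans u v w)
  then show ?case using braid_equiv_set by metis
next
  case (braid_cons v w i)
  then show ?case using step_subrep(1)[OF r] by simp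
next
  case (braid_comm i j w)
  then have "step S A j (step S A i V) = step S A i (step S A j V)"
    using step_comm[of j i] symE by blast
  then show ?case by simp
next
  case (braid_braid i j w)
  then show ?case using step_braid[OF r _ braid_braid(1)] by simp
qed simp

text \<open>
  The quotient by \<open>V\<close> is modelled by the image of a projection \<open>p i\<close> along \<open>V i\<close>, with the arrows
  composed with the projections.
\<close>

definition is_quot :: "('i \<Rightarrow> 'v::cvector set) \<Rightarrow> ('i \<Rightarrow> 'v set) \<Rightarrow> ('i \<Rightarrow> 'v \<Rightarrow> 'v) \<Rightarrow> bool" where
  "is_quot S V p \<longleftrightarrow> (\<forall>i\<in>I. lin_on (S i) (p i) \<and> (\<forall>x\<in>S i. p i x \<in> S i \<and> (p i x = 0 \<longleftrightarrow> x \<in> V i) \<and>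
      x - p i x \<in> V i \<and> p i (p i x) = p i x))"

lemma is_quotD:
  assumes "is_quot S V p" "i \<in> I"
  shows "lin_on (S i) (p i)" "x \<in> S i \<Longrightarrow> p i x \<in> S i" "x \<in> S i \<Longrightarrow> p i x = 0 \<longleftrightarrow> x \<in> V i"
    "x \<in> S i \<Longrightarrow> x - p i x \<in> V i" "x \<in> S i \<Longrightarrow> p i (p i x) = p i x"
  using assms unfolding is_quot_def by blast+

lemma quot_exists:
  assumes "is_rep S A" "subrep S A V"
  obtains p where "is_quot S V p"
proof -
  have "\<forall>i\<in>I. \<exists>q. lin_on (S i) q \<and> (\<forall>x\<in>S i. q x \<in> S i \<and> (q x = 0 \<longleftrightarrow> x \<in> V i) \<and>
      x - q x \<in> V i \<and> q (q x) = q x)"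
  proof
    fix i assume i: "i \<in> I"
    obtain q where "lin_on (S i) q" "q ` S i \<subseteq> S i" "\<And>x. x \<in> S i \<Longrightarrow> q x = 0 \<longleftrightarrow> x \<in> V i"
      "\<And>x. x \<in> S i \<Longrightarrow> x - q x \<in> V i" "\<And>x. x \<in> S i \<Longrightarrow> q (q x) = q x"
      using complement_projection[OF is_repD(1)[OF assms(1) i] subrepD(1,2)[OF assms(2) i]] by metis
    then show "\<exists>q. lin_on (S i) q \<and> (\<forall>x\<in>S i. q x \<in> S i \<and> (q x = 0 \<longleftrightarrow> x \<in> V i) \<and>
      x - q x \<in> V i \<and> q (q x) = q x)" by blast
  qed
  then obtain p where "\<forall>i\<in>I. lin_on (S i) (p i) \<and> (\<forall>x\<in>S i. p i x \<in> S i \<and> (p i x = 0 \<longleftrightarrow> x \<in> V i) \<and>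
      x - p i x \<in> V i \<and> p i (p i x) = p i x)" by metis
  then show ?thesis using that by (auto simp: is_quot_def)
qed

abbreviation "qspace S p \<equiv> (\<lambda>i. p i ` S i)"
abbreviation "qmap A p \<equiv> (\<lambda>i j x. p j (A i j x))"

lemma quot_comm:
  assumes r: "is_rep S A" and V: "subrep S A V" and p: "is_quot S V p" and E: "(i, j) \<in> E" and x: "x \<in> S i"
  shows "p j (A i j (p i x)) = p j (A i j x)"
proof -
  have ij: "i \<in> I" "j \<in> I" using E E_I by auto
  note pi = is_quotD[OF p ij(1)] and pj = is_quotD[OF p ij(2)]
  have "A i j (x - p i x) \<in> V j" using subrepD(4)[OF V E] pi(4) x by blast
  moreover have "A i j (x - p i x) = A i j x - A i j (p i x)"
    using lin_on_diff[OF is_repD(3)[OF r E] is_repD(1)[OF r ij(1)]] x pi(2) by blast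
  moreover have m: "A i j x \<in> S j" "A i j (p i x) \<in> S j" using is_repD(4)[OF r E] x pi(2) by auto
  ultimately have "p j (A i j x - A i j (p i x)) = 0" using pj(3) subrepD(3)[OF V ij(2)] by metis
  then show ?thesis using lin_on_diff[OF pj(1) is_repD(1)[OF r ij(2)]] m by simp
qed

lemma quot_is_rep:
  assumes r: "is_rep S A" and V: "subrep S A V" and p: "is_quot S V p"
  shows "is_rep (qspace S p) (qmap A p)"
  unfolding is_rep_def
proof (intro conjI ballI allI impI)
  fix i assume i: "i \<in> I"
  show "cv.subspace (p i ` S i)" using subspace_lin_image[OF is_quotD(1)[OF p i] is_repD(1)[OF r i]] .
  show "fd (p i ` S i)" using is_quotD(2)[OF p i] fd_subset[OF is_repD(2)[OF r i]] by blast
  fix x assume x: "x \<in> p i ` S i"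
  then have xS: "x \<in> S i" using is_quotD(2)[OF p i] by blast
  have "mesh (qmap A p) i x = (\<Sum>j\<in>nb i. p i (eps i j *\<^sub>C A j i (A i j x)))"
    unfolding mesh_def
  proof (rule sum.cong)
    fix j assume "j \<in> nb i"
    then have E: "(i, j) \<in> E" "(j, i) \<in> E" using symE by (auto simp: nb_def)
    have "p i (A j i (p j (A i j x))) = p i (A j i (A i j x))"
      using quot_comm[OF r V p E(2)] is_repD(4)[OF r E(1) xS] by simp
    then show "eps i j *\<^sub>C p i (A j i (p j (A i j x))) = p i (eps i j *\<^sub>C A j i (A i j x))"
      using lin_on_scale[OF is_quotD(1)[OF p i]] is_repD(4)[OF r E(2)] is_repD(4)[OF r E(1) xS] by simp
  qed simp
  also have "\<dots> = p i (mesh A i x)" unfolding mesh_def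
  proof (rule lin_on_sum[OF is_quotD(1)[OF p i] is_repD(1)[OF r i], symmetric])
    fix j assume "j \<in> nb i"
    then have E: "(i, j) \<in> E" "(j, i) \<in> E" using symE by (auto simp: nb_def)
    show "eps i j *\<^sub>C A j i (A i j x) \<in> S i"
      using is_repD(4)[OF r E(2)] is_repD(4)[OF r E(1) xS] cv.subspace_scale[OF is_repD(1)[OF r i]] by blast
  qed
  also have "\<dots> = 0" using is_repD(5)[OF r i xS] lin_on_zero[OF is_quotD(1)[OF p i] is_repD(1)[OF r i]] by simp
  finally show "mesh (qmap A p) i x = 0" .
next
  fix i j assume E: "(i, j) \<in> E"
  then have ij: "i \<in> I" "j \<in> I" using E_I by auto
  have sub: "p i ` S i \<subseteq> S i" using is_quotD(2)[OF p ij(1)] by blast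
  show "lin_on (p i ` S i) (\<lambda>x. p j (A i j x))"
    using lin_on_comp[OF is_repD(3)[OF r E] _ is_quotD(1)[OF p ij(2)]] is_repD(4)[OF r E] lin_on_subset[OF _ sub] by blast
  fix x assume "x \<in> p i ` S i"
  then show "p j (A i j x) \<in> p j ` S j" using sub is_repD(4)[OF r E] by blast
qed

lemma bform_pos_vertex:
  assumes "k \<in> I" "x k \<noteq> 0"
  obtains i where "i \<in> I" "0 < x i * cmul x i"
proof -
  have "0 < (\<Sum>i\<in>I. x i * cmul x i)" using bform_pos[of k x] assms by (simp add: bform_def)
  then show ?thesis using that by (meson not_le sum_nonpos)
qed

lemma cmul_nb:
  assumes "i \<in> I" shows "cmul x i = 2 * x i - (\<Sum>j\<in>nb i. x j)"
proof -
  have "cmul x i = 2 * x i + (\<Sum>j\<in>I - {i}. cartan E i j * x j)"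
    unfolding cmul_def using assms finI by (subst sum.remove[of _ i]) (auto simp: cartan_def)
  also have "(\<Sum>j\<in>I - {i}. cartan E i j * x j) = (\<Sum>j\<in>nb i. - x j)"
    using finI EI irrE by (intro sum.mono_neutral_cong_right) (auto simp: cartan_def nb_def)
  finally show ?thesis by (simp add: sum_negf)
qed

text \<open>
  By definiteness, a nonzero dimension vector d has a vertex i with \<open>d i > 0\<close> at which the sum of
  d over the neighbours is less than \<open>2 * d i\<close>. If the socle is zero then the joint map out of
  \<open>S i\<close> is injective; composed with the joint map into \<open>S i\<close> it vanishes, so the image of the
  latter has dimension below \<open>d i\<close>. Replacing \<open>S i\<close> by this image gives a proper
  subrepresentation, which is zero by induction. Then the neighbours of i carry nothing, so \<open>S i\<close>
  lies in the socle.
\<close>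

lemma socle_zero_imp_zero:
  assumes "is_rep S A" "\<And>i x. i \<in> I \<Longrightarrow> x \<in> S i \<Longrightarrow> (\<And>j. j \<in> nb i \<Longrightarrow> A i j x = 0) \<Longrightarrow> x = 0"
  shows "i \<in> I \<Longrightarrow> S i = {0}"
  using assms
proof (induction "\<Sum>i\<in>I. cv.dim (S i)" arbitrary: S i rule: less_induct)
  case (less S i0)
  note r = less.prems(2) and soc = less.prems(3)
  show ?case
  proof (rule ccontr)
    assume "S i0 \<noteq> {0}"
    then have "int (cv.dim (S i0)) \<noteq> 0"
      using dim_zero_iff[OF is_repD(2)[OF r less.prems(1)] is_repD(1)[OF r less.prems(1)]] by simp
    from bform_pos_vertex[of i0 "\<lambda>i. int (cv.dim (S i))", OF less.prems(1) this]
    obtain i where i: "i \<in> I" "0 < int (cv.dim (S i)) * cmul (\<lambda>i. int (cv.dim (S i))) i" .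
    let ?F = "fam (nb i) S"
    let ?out = "\<lambda>x j. if j \<in> nb i then A i j x else 0"
    (* The signs are put into the incoming map, so that its composite with the outgoing one is
       the mesh relation. *)
    let ?in = "\<lambda>v. \<Sum>j\<in>nb i. eps i j *\<^sub>C A j i (v j)"
    have nbI: "j \<in> I" "(i, j) \<in> E" "(j, i) \<in> E" if "j \<in> nb i" for j using that E_I symE by (auto simp: nb_def)
    have Si: "cv.subspace (S i)" "fd (S i)" using is_repD(1,2)[OF r i(1)] by auto
    have F: "cv.subspace ?F" "fd ?F" "cv.dim ?F = (\<Sum>j\<in>nb i. cv.dim (S j))"
      using subspace_fam[of "nb i" S] fam_fd_dim[of "nb i" S] is_repD(1,2)[OF r] nbI by auto
    have Fv: "v j \<in> S j" if "v \<in> ?F" "j \<in> nb i" for v j using that by (auto simp: fam_def)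
    have in_mem: "eps i j *\<^sub>C A j i (v j) \<in> S i" if "v \<in> ?F" "j \<in> nb i" for v j
      using is_repD(4)[OF r nbI(3)] Fv that Si(1) cv.subspace_scale by metis
    have lin_in: "lin_on ?F ?in"
    proof (rule lin_on_sum_fun, rule lin_on_cmult)
      fix j assume j: "j \<in> nb i"
      show "lin_on ?F (\<lambda>v. A j i (v j))"
        by (rule lin_on_comp[where T = "S j"])
          (use j Fv is_repD(3)[OF r nbI(3)[OF j]] in \<open>auto simp: lin_on_def cscale_apply\<close>)
    qed
    have lin_out: "lin_on (S i) ?out"
      using is_repD(3)[OF r] nbI(2) by (auto simp: lin_on_def fun_eq_iff cscale_apply)
    have inj_out: "inj_on ?out (S i)"
      unfolding lin_on_inj_iff[OF lin_out Si(1)]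
    proof (intro ballI impI)
      fix x assume x: "x \<in> S i" "?out x = 0"
      then have "A i j x = 0" if "j \<in> nb i" for j using that fun_cong[OF x(2), of j] by simp
      then show "x = 0" using soc[OF i(1) x(1)] by blast
    qed
    have "?out ` S i \<subseteq> {v\<in>?F. ?in v = 0}"
    proof (rule image_subsetI)
      fix x assume x: "x \<in> S i"
      have "?in (?out x) = mesh A i x" unfolding mesh_def by (rule sum.cong) auto
      then show "?out x \<in> {v\<in>?F. ?in v = 0}" using x is_repD(4)[OF r nbI(2)] is_repD(5)[OF r i(1) x] by (simp add: fam_def)
    qed
    then have "cv.dim (S i) \<le> cv.dim {v\<in>?F. ?in v = 0}"
      using dim_mono_fd[OF fd_subset[OF F(2)]] dim_inj_image[OF Si(2,1) lin_out inj_out]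
      by (metis (no_types, lifting) mem_Collect_eq subsetI)
    moreover have "(\<Sum>j\<in>nb i. cv.dim (S j)) = cv.dim (?in ` ?F) + cv.dim {v\<in>?F. ?in v = 0}"
      using rank_nullity[OF F(2,1) lin_in] F(3) by simp
    moreover have "(\<Sum>j\<in>nb i. cv.dim (S j)) < 2 * cv.dim (S i)"
    proof -
      have "0 < cmul (\<lambda>i. int (cv.dim (S i))) i" using i(2) by (auto simp: zero_less_mult_iff)
      then have "(\<Sum>j\<in>nb i. int (cv.dim (S j))) < 2 * int (cv.dim (S i))" using cmul_nb[OF i(1)] by simp
      then show ?thesis by (metis of_nat_less_iff of_nat_mult of_nat_numeral of_nat_sum)
    qed
    ultimately have small: "cv.dim (?in ` ?F) < cv.dim (S i)" by linarith
    define S' where "S' = S(i := ?in ` ?F)"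
    have inS: "?in ` ?F \<subseteq> S i" using in_mem Si(1) by (auto intro!: cv.subspace_sum)
    have arrow: "A j i y \<in> ?in ` ?F" if j: "j \<in> nb i" and y: "y \<in> S j" for j y
    proof -
      have e: "eps i j \<noteq> 0" using eps_nz nbI(2)[OF j] by simp
      let ?v = "\<lambda>k. if k = j then inverse (eps i j) *\<^sub>C y else 0"
      have v: "?v \<in> ?F"
        using j y is_repD(1,6)[OF r] nbI(1) by (auto simp: fam_def cv.subspace_scale)
      have "?in ?v = (\<Sum>k\<in>nb i. if k = j then A j i y else 0)"
      proof (rule sum.cong)
        fix k assume "k \<in> nb i"
        then show "eps i k *\<^sub>C A k i (?v k) = (if k = j then A j i y else 0)"
          using e y is_repD(7)[OF r nbI(3)] lin_on_scale[OF is_repD(3)[OF r nbI(3)[OF j]] y]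
          by (simp add: cscale_cscale cscale_one)
      qed simp
      also have "\<dots> = A j i y" using j by simp
      finally have "?in ?v = A j i y" .
      then have "A j i y = ?in ?v" by (rule sym)
      then show ?thesis using v by (rule image_eqI[of _ ?in ?v])
    qed
    have "subrep S A S'"
      unfolding subrep_def
    proof (intro conjI ballI allI impI)
      fix k assume "k \<in> I"
      then show "cv.subspace (S' k)" "S' k \<subseteq> S k"
        using subspace_lin_image[OF lin_in F(1)] is_repD(1)[OF r] inS by (auto simp: S'_def)
    next
      fix k l x assume kl: "(k, l) \<in> E" and x: "x \<in> S' k"
      have xS: "x \<in> S k" using x inS by (auto simp: S'_def split: if_splits)
      show "A k l x \<in> S' l"
      proof (cases "l = i")
        case True
        then have "k \<in> nb i" using kl symE by (auto simp: nb_def)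
        then show ?thesis using arrow[OF _ xS] True by (simp add: S'_def)
      next
        case False then show ?thesis using is_repD(4)[OF r kl xS] by (simp add: S'_def)
      qed
    qed
    then have r': "is_rep S' A" using subrep_is_rep[OF r] by blast
    have "(\<Sum>k\<in>I. cv.dim (S' k)) < (\<Sum>k\<in>I. cv.dim (S k))"
      using small i(1) finI by (intro sum_strict_mono_ex1) (auto simp: S'_def)
    moreover have soc': "x = 0" if "k \<in> I" "x \<in> S' k" "\<And>j. j \<in> nb k \<Longrightarrow> A k j x = 0" for k x
      using soc[OF that(1) _ that(3)] that(2) inS by (auto simp: S'_def split: if_splits)
    ultimately have zero: "S' k = {0}" if "k \<in> I" for k using less.hyps[OF _ that r'] by blast
    have "x = 0" if x: "x \<in> S i" for x
    proof (rule soc[OF i(1) x])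
      fix j assume j: "j \<in> nb i"
      then have "j \<noteq> i" using irrE by (auto simp: nb_def)
      then have "S j = {0}" using zero[OF nbI(1)[OF j]] by (simp add: S'_def)
      then show "A i j x = 0" using is_repD(4)[OF r nbI(2)[OF j] x] by simp
    qed
    then have "S i = {0}" using is_repD(6)[OF r i(1)] by auto
    then show False using i(2) dim_zero_iff[OF Si(2,1)] by simp
  qed
qed

lemma no_step_imp_full:
  assumes r: "is_rep S A" and V: "subrep S A V" and no: "\<And>k. k \<in> I \<Longrightarrow> step S A k V k \<subseteq> V k"
  shows "i \<in> I \<Longrightarrow> V i = S i"
proof -
  assume i: "i \<in> I"
  obtain p where p: "is_quot S V p" using quot_exists[OF r V] .
  have "p i ` S i = {0}"
  proof (rule socle_zero_imp_zero[OF quot_is_rep[OF r V p] _ i])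
    fix k x assume k: "k \<in> I" and x: "x \<in> p k ` S k" and out: "\<And>j. j \<in> nb k \<Longrightarrow> p j (A k j x) = 0"
    have xS: "x \<in> S k" and px: "p k x = x" using x is_quotD(2,5)[OF p k] by auto
    have "A k j x \<in> V j" if j: "j \<in> nb k" for j
    proof -
      have "(k, j) \<in> E" "j \<in> I" using j E_I by (auto simp: nb_def)
      then show ?thesis using out[OF j] is_quotD(3)[OF p] is_repD(4)[OF r _ xS] by blast
    qed
    then have "x \<in> V k" using no[OF k] xS by (auto simp: step_same)
    then show "x = 0" using is_quotD(3)[OF p k xS] px by simp
  qed
  then have "S i \<subseteq> V i" using is_quotD(3)[OF p i] by blast
  then show "V i = S i" using subrepD(2)[OF V i] by blast
qed

abbreviation zspace :: "'i \<Rightarrow> 'v::cvector set" where "zspace \<equiv> (\<lambda>_. {0})"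

lemma zspace_subrep: "is_rep S A \<Longrightarrow> subrep S A zspace"
  using is_repD(6,7) by (fastforce simp: subrep_def)

text \<open>
  A word of the longest element can be rewritten to end with any vertex, so no further step
  enlarges the result.
\<close>

lemma socw_full:
  assumes r: "is_rep S A" and W: "set W \<subseteq> I" "\<And>k. k \<in> I \<Longrightarrow> \<exists>u. set u \<subseteq> I \<and> braid_equiv E W (u @ [k])"
    and i: "i \<in> I"
  shows "socw S A W zspace i = S i"
proof (rule no_step_imp_full[OF r socw_subrep[OF r zspace_subrep[OF r] W(1)] _ i])
  fix k assume "k \<in> I"
  then obtain u where "braid_equiv E W (u @ [k])" using W(2) by blast
  then have "socw S A W zspace = step S A k (socw S A u zspace)"
    using socw_braid_equiv[OF r _ W(1) zspace_subrep[OF r]] by fastforce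
  then show "step S A k (socw S A W zspace) k \<subseteq> socw S A W zspace k" by (simp add: step_idem)
qed

lemma socw_trivial_socle:
  assumes r: "is_rep S A" and K: "K \<subseteq> I"
    and soc: "\<And>k x. k \<in> K \<Longrightarrow> x \<in> S k \<Longrightarrow> (\<And>j. j \<in> nb k \<Longrightarrow> A k j x = 0) \<Longrightarrow> x = 0"
  shows "set w \<subseteq> K \<Longrightarrow> socw S A w zspace = zspace"
proof (induction w)
  case (Cons k w)
  then have k: "k \<in> K" "k \<in> I" using K by auto
  have "A k j 0 = 0" if "j \<in> nb k" for j using is_repD(7)[OF r] that by (simp add: nb_def)
  then have "{x \<in> S k. \<forall>j\<in>nb k. A k j x \<in> {0}} = {0}" using soc[OF k(1)] is_repD(6)[OF r k(2)] by auto
  then have "step S A k zspace = zspace" by (auto simp: step_def)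
  then show ?case using Cons by simp
qed simp

text \<open>
  The part of the longest word that is spelled in \<open>K\<close> finds only zero socles and can be dropped.
\<close>

theorem socle_word:
  assumes K: "K \<subseteq> I"
  obtains w where "set w \<subseteq> I"
    "num_positive_roots I E = num_positive_roots K (full_subdiagram E K) + length w"
    "\<And>(S :: 'i \<Rightarrow> 'v::cvector set) A i. is_rep S A \<Longrightarrow>
      (\<And>k x. k \<in> K \<Longrightarrow> x \<in> S k \<Longrightarrow> (\<And>j. j \<in> nb k \<Longrightarrow> A k j x = 0) \<Longrightarrow> x = 0) \<Longrightarrow>
      i \<in> I \<Longrightarrow> socw S A w zspace i = S i"
proof -
  obtain wK w where w: "set wK \<subseteq> K" "set w \<subseteq> I"
    "num_positive_roots I E = num_positive_roots K (full_subdiagram E K) + length w"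
    "\<And>k. k \<in> I \<Longrightarrow> \<exists>u. set u \<subseteq> I \<and> braid_equiv E (wK @ w) (u @ [k])"
    by (rule longest_word[OF K]) blast
  show ?thesis
  proof (rule that[OF w(2,3)])
    fix S :: "'i \<Rightarrow> 'v set" and A i
    assume r: "is_rep S A" and soc: "\<And>k x. k \<in> K \<Longrightarrow> x \<in> S k \<Longrightarrow> (\<And>j. j \<in> nb k \<Longrightarrow> A k j x = 0) \<Longrightarrow> x = 0" and i: "i \<in> I"
    have "socw S A (wK @ w) zspace i = S i" using socw_full[OF r _ w(4) i] w(1,2) K by auto
    then show "socw S A w zspace i = S i" using socw_trivial_socle[OF r K soc w(1)] by simp
  qed
qed

section \<open>Cocycles and coboundaries\<close>

definition maps :: "('i \<Rightarrow> 'v::cvector set) \<Rightarrow> ('i \<Rightarrow> 'w::cvector set) \<Rightarrow> ('i \<Rightarrow> 'v \<Rightarrow> 'w) \<Rightarrow> bool" where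
  "maps S T f \<longleftrightarrow> (\<forall>i\<in>I. lin_on (S i) (f i) \<and> (\<forall>x\<in>S i. f i x \<in> T i))"

lemma mapsD:
  assumes "maps S T f" "i \<in> I"
  shows "lin_on (S i) (f i)" "x \<in> S i \<Longrightarrow> f i x \<in> T i"
  using assms unfolding maps_def by auto

definition rep_hom where
  "rep_hom S A T B f \<longleftrightarrow> maps S T f \<and> (\<forall>i j. (i, j) \<in> E \<longrightarrow> (\<forall>x\<in>S i. f j (A i j x) = B i j (f i x)))"

lemma rep_homD:
  assumes "rep_hom S A T B f"
  shows "maps S T f" "(i, j) \<in> E \<Longrightarrow> x \<in> S i \<Longrightarrow> f j (A i j x) = B i j (f i x)"
  using assms unfolding rep_hom_def by auto

definition rep_iso where
  "rep_iso S A T B f \<longleftrightarrow> rep_hom S A T B f \<and> (\<forall>i\<in>I. bij_betw (f i) (S i) (T i))"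

definition isomorphic where
  "isomorphic S A T B \<longleftrightarrow> (\<exists>f. rep_iso S A T B f)"

text \<open>
  The linearized mesh relations: exactly the \<open>g\<close> for which the maps of \<open>S\<close> and \<open>T\<close>, with \<open>g\<close> as
  the off-diagonal block, form a representation on the direct sum. It is an extension of \<open>S\<close> by
  \<open>T\<close>, and it splits precisely for coboundaries.
\<close>

definition cocycle where
  "cocycle S A T B g \<longleftrightarrow> (\<forall>i j. (i, j) \<in> E \<longrightarrow> lin_on (S i) (g i j) \<and> (\<forall>x\<in>S i. g i j x \<in> T j)) \<and>
     (\<forall>i\<in>I. \<forall>x\<in>S i. (\<Sum>j\<in>nb i. eps i j *\<^sub>C (B j i (g i j x) + g j i (A i j x))) = 0)"

lemma cocycleD:
  assumes "cocycle S A T B g"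
  shows "(i, j) \<in> E \<Longrightarrow> lin_on (S i) (g i j)" "(i, j) \<in> E \<Longrightarrow> x \<in> S i \<Longrightarrow> g i j x \<in> T j"
    "i \<in> I \<Longrightarrow> x \<in> S i \<Longrightarrow> (\<Sum>j\<in>nb i. eps i j *\<^sub>C (B j i (g i j x) + g j i (A i j x))) = 0"
  using assms unfolding cocycle_def by auto

definition coboundary where
  "coboundary S A T B g \<longleftrightarrow> (\<exists>f. maps S T f \<and>
     (\<forall>i j. (i, j) \<in> E \<longrightarrow> (\<forall>x\<in>S i. g i j x = f j (A i j x) - B i j (f i x))))"

lemma coboundaryE:
  assumes "coboundary S A T B g"
  obtains f where "maps S T f" "\<And>i j x. (i, j) \<in> E \<Longrightarrow> x \<in> S i \<Longrightarrow> g i j x = f j (A i j x) - B i j (f i x)"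
  using assms unfolding coboundary_def by blast

text \<open>The vanishing of \<open>Ext1(S, T)\<close>.\<close>

definition ext_orth where
  "ext_orth S A T B \<longleftrightarrow> (\<forall>g. cocycle S A T B g \<longrightarrow> coboundary S A T B g)"

lemma maps_comp: "maps S T f \<Longrightarrow> maps T U g \<Longrightarrow> maps S U (\<lambda>i x. g i (f i x))"
  unfolding maps_def using lin_on_comp by metis

lemma rep_hom_comp: "rep_hom S A T B f \<Longrightarrow> rep_hom T B U C g \<Longrightarrow> rep_hom S A U C (\<lambda>i x. g i (f i x))"
  using maps_comp[of S T f U g] E_I unfolding rep_hom_def by (auto simp: mapsD)

lemma nbD: assumes "j \<in> nb i" shows "(i, j) \<in> E" "(j, i) \<in> E" "i \<in> I" "j \<in> I" "j \<noteq> i"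
  using assms symE E_I irrE by (auto simp: nb_def)

lemma rep_iso_inv:
  assumes r: "is_rep S A" and f: "rep_iso S A T B f"
  shows "rep_iso T B S A (\<lambda>i. inv_into (S i) (f i))"
proof -
  have bij: "bij_betw (f i) (S i) (T i)" and lin: "lin_on (S i) (f i)" if "i \<in> I" for i
    using f that by (auto simp: rep_iso_def rep_hom_def maps_def)
  let ?g = "\<lambda>i. inv_into (S i) (f i)"
  have bg: "bij_betw (?g i) (T i) (S i)" if "i \<in> I" for i using bij_betw_inv_into[OF bij[OF that]] .
  have fg: "f i (?g i y) = y" if "i \<in> I" "y \<in> T i" for i y
    using bij_betw_inv_into_right[OF bij[OF that(1)] that(2)] .
  have gf: "?g i (f i x) = x" if "i \<in> I" "x \<in> S i" for i x
    using bij_betw_inv_into_left[OF bij[OF that(1)] that(2)] .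
  have gS: "?g i y \<in> S i" if "i \<in> I" "y \<in> T i" for i y using bg[OF that(1)] that(2) by (auto simp: bij_betw_def)
  have "maps T S ?g"
    unfolding maps_def
  proof (intro ballI conjI)
    fix i assume i: "i \<in> I"
    then have "f i ` S i = T i" "inj_on (f i) (S i)" using bij by (auto simp: bij_betw_def)
    then show "lin_on (T i) (?g i)" using lin_on_inv_into[OF lin[OF i] is_repD(1)[OF r i]] by simp
    show "?g i x \<in> S i" if "x \<in> T i" for x using gS[OF i that] .
  qed
  moreover have "?g j (B i j y) = A i j (?g i y)" if E: "(i, j) \<in> E" and y: "y \<in> T i" for i j y
  proof -
    have ij: "i \<in> I" "j \<in> I" using E E_I by auto
    have "f j (A i j (?g i y)) = B i j y"
      using f E gS[OF ij(1) y] fg[OF ij(1) y] by (simp add: rep_iso_def rep_hom_def)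
    then show ?thesis using gf[OF ij(2)] is_repD(4)[OF r E gS[OF ij(1) y]] by metis
  qed
  ultimately show ?thesis using bg by (auto simp: rep_iso_def rep_hom_def)
qed

lemma rep_iso_comp: "rep_iso S A T B f \<Longrightarrow> rep_iso T B U C g \<Longrightarrow> rep_iso S A U C (\<lambda>i x. g i (f i x))"
proof -
  assume a: "rep_iso S A T B f" and b: "rep_iso T B U C g"
  have "bij_betw (\<lambda>x. g i (f i x)) (S i) (U i)" if "i \<in> I" for i
    using bij_betw_trans[of "f i" "S i" "T i" "g i" "U i"] a b that by (simp add: rep_iso_def comp_def)
  then show ?thesis using a b rep_hom_comp[of S A T B f U C g] by (simp add: rep_iso_def)
qed

lemma isomorphic_sym: "is_rep S A \<Longrightarrow> isomorphic S A T B \<Longrightarrow> isomorphic T B S A"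
  unfolding isomorphic_def using rep_iso_inv by blast

lemma isomorphic_trans: "isomorphic S A T B \<Longrightarrow> isomorphic T B U C \<Longrightarrow> isomorphic S A U C"
  unfolding isomorphic_def using rep_iso_comp by blast

lemma ext_orth_iso:
  assumes rS: "is_rep S A" and rT: "is_rep T B" and f: "rep_iso S A T B f" and o: "ext_orth T B T B"
  shows "ext_orth S A S A"
  unfolding ext_orth_def
proof (intro allI impI)
  fix g assume g: "cocycle S A S A g"
  let ?h = "\<lambda>i. inv_into (S i) (f i)"
  have hom: "rep_hom S A T B f" and fm: "maps S T f" using f by (auto simp: rep_iso_def rep_hom_def)
  have h: "rep_iso T B S A ?h" using rep_iso_inv[OF rS f] .
  then have hhom: "rep_hom T B S A ?h" and hm: "maps T S ?h" by (auto simp: rep_iso_def rep_hom_def)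
  have hf: "?h i (f i x) = x" if "i \<in> I" "x \<in> S i" for i x
    using f that bij_betw_inv_into_left by (fastforce simp: rep_iso_def)
  let ?g = "\<lambda>i j y. f j (g i j (?h i y))"
  have "cocycle T B T B ?g"
    unfolding cocycle_def
  proof (intro conjI allI impI ballI)
    fix i j assume E: "(i, j) \<in> E"
    then have ij: "i \<in> I" "j \<in> I" using E_I by auto
    show "lin_on (T i) (?g i j)"
      by (rule lin_on_comp[where T = "S j"], rule lin_on_comp[where T = "S i"])
        (use mapsD[OF hm ij(1)] mapsD[OF fm ij(2)] cocycleD[OF g] E in auto)
    show "?g i j y \<in> T j" if "y \<in> T i" for y
      using mapsD(2)[OF hm ij(1) that] mapsD(2)[OF fm ij(2)] cocycleD(2)[OF g E] by blast
  next
    fix i y assume i: "i \<in> I" and y: "y \<in> T i"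
    let ?x = "?h i y"
    have x: "?x \<in> S i" using mapsD(2)[OF hm i y] .
    have mem: "eps i j *\<^sub>C (A j i (g i j ?x) + g j i (A i j ?x)) \<in> S i" if "j \<in> nb i" for j
      using is_repD(4)[OF rS nbD(2)[OF that]] cocycleD(2)[OF g] is_repD(4)[OF rS nbD(1)[OF that] x] nbD[OF that] x
        is_repD(1)[OF rS i] by (meson cv.subspace_add cv.subspace_scale)
    have "(\<Sum>j\<in>nb i. eps i j *\<^sub>C (B j i (?g i j y) + ?g j i (B i j y)))
        = (\<Sum>j\<in>nb i. f i (eps i j *\<^sub>C (A j i (g i j ?x) + g j i (A i j ?x))))"
    proof (rule sum.cong)
      fix j assume j: "j \<in> nb i"
      note n = nbD[OF j]
      have m: "g i j ?x \<in> S j" "A j i (g i j ?x) \<in> S i" "A i j ?x \<in> S j" "g j i (A i j ?x) \<in> S i"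
        using cocycleD(2)[OF g n(1) x] is_repD(4)[OF rS n(2)] is_repD(4)[OF rS n(1) x] cocycleD(2)[OF g n(2)] by auto
      have "B j i (f j (g i j ?x)) = f i (A j i (g i j ?x))" using rep_homD(2)[OF hom n(2) m(1)] by simp
      moreover have "?h j (B i j y) = A i j ?x" using rep_homD(2)[OF hhom n(1) y] .
      ultimately show "eps i j *\<^sub>C (B j i (?g i j y) + ?g j i (B i j y)) = f i (eps i j *\<^sub>C (A j i (g i j ?x) + g j i (A i j ?x)))"
        using m lin_on_add[OF mapsD(1)[OF fm i]] lin_on_scale[OF mapsD(1)[OF fm i]] is_repD(1)[OF rS i]
        by (simp add: cv.subspace_add)
    qed simp
    also have "\<dots> = f i (\<Sum>j\<in>nb i. eps i j *\<^sub>C (A j i (g i j ?x) + g j i (A i j ?x)))"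
      by (rule lin_on_sum[OF mapsD(1)[OF fm i] is_repD(1)[OF rS i] mem, symmetric])
    also have "\<dots> = 0" using cocycleD(3)[OF g i x] lin_on_zero[OF mapsD(1)[OF fm i] is_repD(1)[OF rS i]] by simp
    finally show "(\<Sum>j\<in>nb i. eps i j *\<^sub>C (B j i (?g i j y) + ?g j i (B i j y))) = 0" .
  qed
  then have "coboundary T B T B ?g" using o unfolding ext_orth_def by blast
  then obtain u where u: "maps T T u" "\<And>i j y. (i, j) \<in> E \<Longrightarrow> y \<in> T i \<Longrightarrow> ?g i j y = u j (B i j y) - B i j (u i y)"
    by (rule coboundaryE) blast
  let ?v = "\<lambda>i x. ?h i (u i (f i x))"
  have "maps S S ?v" using maps_comp[OF maps_comp[OF fm u(1)] hm] .
  moreover have "g i j x = ?v j (A i j x) - A i j (?v i x)" if E: "(i, j) \<in> E" and x: "x \<in> S i" for i j x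
  proof -
    have ij: "i \<in> I" "j \<in> I" using E E_I by auto
    have fx: "f i x \<in> T i" and ux: "u i (f i x) \<in> T i" using mapsD(2)[OF fm ij(1) x] mapsD(2)[OF u(1) ij(1)] by auto
    have "g i j x = ?h j (?g i j (f i x))" using hf ij x cocycleD(2)[OF g E x] by simp
    also have "\<dots> = ?h j (u j (B i j (f i x)) - B i j (u i (f i x)))" using u(2)[OF E fx] by simp
    also have "\<dots> = ?h j (u j (B i j (f i x))) - ?h j (B i j (u i (f i x)))"
      using lin_on_diff[OF mapsD(1)[OF hm ij(2)] is_repD(1)[OF rT ij(2)]] mapsD(2)[OF u(1) ij(2)] is_repD(4)[OF rT E] fx ux by simp
    also have "?h j (B i j (u i (f i x))) = A i j (?v i x)" using rep_homD(2)[OF hhom E ux] .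
    also have "B i j (f i x) = f j (A i j x)" using rep_homD(2)[OF hom E x] by simp
    finally show ?thesis .
  qed
  ultimately show "coboundary S A S A g" unfolding coboundary_def by blast
qed

text \<open>
  Structure is carried over along linear isomorphisms of the spaces, so that two representations
  can be compared on the same spaces.
\<close>

lemma transport:
  assumes rT: "is_rep T B" and S: "\<And>i. i \<in> I \<Longrightarrow> cv.subspace (S i)" "\<And>i. i \<in> I \<Longrightarrow> fd (S i)"
    and f: "maps S T f" "\<And>i. i \<in> I \<Longrightarrow> bij_betw (f i) (S i) (T i)"
  defines "A \<equiv> \<lambda>i j x. inv_into (S j) (f j) (B i j (f i x))"
  shows "is_rep S A" "rep_iso S A T B f"
proof -
  let ?h = "\<lambda>i. inv_into (S i) (f i)"
  have fh: "f i (?h i y) = y" and hS: "?h i y \<in> S i" if "i \<in> I" "y \<in> T i" for i y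
    using bij_betw_inv_into_right[OF f(2)[OF that(1)] that(2)] f(2)[OF that(1)] that(2)
    by (auto simp: bij_betw_def intro: inv_into_into)
  have inj: "inj_on (f i) (S i)" "f i ` S i = T i" if "i \<in> I" for i using f(2)[OF that] by (auto simp: bij_betw_def)
  have hl: "lin_on (T i) (?h i)" if "i \<in> I" for i
    using lin_on_inv_into[OF mapsD(1)[OF f(1) that] S(1)[OF that] inj(1)[OF that]] inj(2)[OF that] by simp
  have BT: "B i j (f i x) \<in> T j" if "(i, j) \<in> E" "x \<in> S i" for i j x
    using is_repD(4)[OF rT that(1)] mapsD(2)[OF f(1) _ that(2)] E_I[OF that(1)] by blast
  have com: "f j (A i j x) = B i j (f i x)" if "(i, j) \<in> E" "x \<in> S i" for i j x
    using fh[OF _ BT[OF that]] E_I[OF that(1)] by (simp add: A_def)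
  have AS: "A i j x \<in> S j" if "(i, j) \<in> E" "x \<in> S i" for i j x
    using hS[OF _ BT[OF that]] E_I[OF that(1)] by (simp add: A_def)
  have Al: "lin_on (S i) (A i j)" if E: "(i, j) \<in> E" for i j
    unfolding A_def
    by (rule lin_on_comp[where T = "T j" and g = "?h j"], rule lin_on_comp[where T = "T i"])
      (use E E_I[OF E] mapsD[OF f(1)] is_repD(3)[OF rT E] BT hl in auto)
  have "mesh A i x = 0" if i: "i \<in> I" and x: "x \<in> S i" for i x
  proof -
    have mem: "A j i (A i j x) \<in> S i" if "j \<in> nb i" for j using AS nbD[OF that] x by blast
    then have memsum: "mesh A i x \<in> S i" unfolding mesh_def using S(1)[OF i] by (auto intro!: cv.subspace_sum cv.subspace_scale)
    have "f i (mesh A i x) = (\<Sum>j\<in>nb i. f i (eps i j *\<^sub>C A j i (A i j x)))"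
      unfolding mesh_def using mem S(1)[OF i]
      by (intro lin_on_sum[OF mapsD(1)[OF f(1) i] S(1)[OF i]]) (auto intro: cv.subspace_scale)
    also have "\<dots> = mesh B i (f i x)" unfolding mesh_def
    proof (rule sum.cong)
      fix j assume j: "j \<in> nb i"
      have "f i (A j i (A i j x)) = B j i (B i j (f i x))"
        using com[OF nbD(2)[OF j] AS[OF nbD(1)[OF j] x]] com[OF nbD(1)[OF j] x] by simp
      then show "f i (eps i j *\<^sub>C A j i (A i j x)) = eps i j *\<^sub>C B j i (B i j (f i x))"
        using lin_on_scale[OF mapsD(1)[OF f(1) i] mem[OF j]] by simp
    qed simp
    also have "\<dots> = 0" using is_repD(5)[OF rT i] mapsD(2)[OF f(1) i x] by blast
    finally show ?thesis using lin_on_inj_iff[OF mapsD(1)[OF f(1) i] S(1)[OF i]] inj(1)[OF i] memsum by blast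
  qed
  then show "is_rep S A" unfolding is_rep_def using S Al AS by blast
  show "rep_iso S A T B f" unfolding rep_iso_def rep_hom_def using f com by blast
qed

section \<open>Rigidity of the quotient by a socle\<close>

lemma soc_quot_id:
  assumes r: "is_rep S A" and i: "i \<in> I" and p: "is_quot S (step S A i zspace) p" and k: "k \<in> I" "k \<noteq> i" and x: "x \<in> S k"
  shows "p k x = x"
  using is_quotD(4)[OF p k(1) x] k(2) by (simp add: step_other)

lemma soc_mem: "x \<in> step S A i zspace i \<longleftrightarrow> x \<in> S i \<and> (\<forall>j\<in>nb i. A i j x = 0)"
  by (auto simp: step_same)

text \<open>
  The map \<open>t\<close> is defined on the image of the injection \<open>out\<close> into a direct sum; a linear extension
  to the whole sum is determined by its components \<open>q j\<close>, and a projection brings the values back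
  into \<open>Z\<close>.
\<close>

lemma extend_from_fam:
  fixes S :: "'i \<Rightarrow> 'v::cvector set" and out :: "'v \<Rightarrow> 'i \<Rightarrow> 'v" and t :: "'v \<Rightarrow> 'v"
  assumes M: "cv.subspace M" and Z: "cv.subspace Z"
    and out: "lin_on M out" "inj_on out M" "\<And>m. m \<in> M \<Longrightarrow> out m \<in> fam N S" and N: "finite N"
    and S: "\<And>j. j \<in> N \<Longrightarrow> cv.subspace (S j)"
    and t: "lin_on M t" "\<And>m. m \<in> M \<Longrightarrow> t m \<in> Z"
  obtains q where "\<And>j. lin_on (S j) (q j)" "\<And>j x. q j x \<in> Z"
    "\<And>m. m \<in> M \<Longrightarrow> (\<Sum>j\<in>N. q j (out m j)) = t m"
proof -
  let ?inv = "inv_into M out"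
  have inv: "lin_on (out ` M) ?inv" using lin_on_inv_into[OF out(1) M out(2)] .
  have "lin_on (out ` M) (\<lambda>v. t (?inv v))"
    by (rule lin_on_comp[OF inv _ t(1)]) (auto intro: inv_into_into)
  then obtain g where g: "Vector_Spaces.linear cscale cscale g" "\<And>v. v \<in> out ` M \<Longrightarrow> g v = t (?inv v)"
    using lin_extend[OF subspace_lin_image[OF out(1) M]] by metis
  obtain P where P: "lin_on UNIV P" "\<And>x. P x = 0 \<longleftrightarrow> x \<in> Z" "\<And>x. x - P x \<in> Z"
    using complement_projection[OF cv.subspace_UNIV Z] by (metis UNIV_I subset_UNIV)
  define Q where "Q = (\<lambda>v. g v - P (g v))"
  have gl: "lin_on UNIV g" using linear_lin_on[OF g(1)] .
  have Ql: "lin_on UNIV Q" unfolding Q_def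
    by (intro lin_on_minus_fun gl lin_on_comp[OF gl _ P(1)]) auto
  have QZ: "Q v \<in> Z" for v using P(3) by (simp add: Q_def)
  have Qout: "Q (out m) = t m" if "m \<in> M" for m
  proof -
    have "g (out m) = t m" using g(2)[of "out m"] that out(2) by (simp add: inv_into_f_f)
    then show ?thesis using P(2)[of "t m"] t(2)[OF that] by (simp add: Q_def)
  qed
  define e where "e = (\<lambda>(j :: 'i) (x :: 'v) k. if k = j then x else 0)"
  have el: "lin_on A (e j)" for A j by (auto simp: e_def lin_on_def fun_eq_iff cscale_apply)
  show ?thesis
  proof (rule that[of "\<lambda>j x. Q (e j x)"])
    show "lin_on (S j) (\<lambda>x. Q (e j x))" for j by (rule lin_on_comp[OF el _ Ql]) auto
    show "Q (e j x) \<in> Z" for j x by (rule QZ)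
    fix m assume m: "m \<in> M"
    have "(\<Sum>j\<in>N. e j (out m j)) = out m"
    proof
      fix k
      have "(\<Sum>j\<in>N. e j (out m j)) k = (\<Sum>j\<in>N. if j = k then out m k else 0)"
        unfolding sum_fun_apply by (rule sum.cong) (auto simp: e_def)
      also have "\<dots> = out m k" using N out(3)[OF m] by (auto simp: fam_def)
      finally show "(\<Sum>j\<in>N. e j (out m j)) k = out m k" .
    qed
    then show "(\<Sum>j\<in>N. Q (e j (out m j))) = t m"
      using lin_on_sum[OF Ql cv.subspace_UNIV, of N "\<lambda>j. e j (out m j)"] Qout[OF m] by simp
  qed
qed

text \<open>
  A cocycle g' on the quotient by the i-socle is lifted to one on \<open>S\<close>. Composition with the
  projection satisfies all relations except the one at i, which holds only modulo the socle. The
  defect is repaired by maps into the socle on the arrows into i; they exist because the maps out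
  of i are jointly injective on a complement of the socle, and they do not disturb the other
  relations because arrows out of i kill the socle. A map that bounds the lift preserves the socle
  and so descends.
\<close>

lemma ext_orth_soc_quot:
  assumes r: "is_rep S A" and o: "ext_orth S A S A" and i: "i \<in> I"
    and p: "is_quot S (step S A i zspace) p"
  shows "ext_orth (qspace S p) (qmap A p) (qspace S p) (qmap A p)"
  unfolding ext_orth_def
proof (intro allI impI)
  fix g' assume g': "cocycle (qspace S p) (qmap A p) (qspace S p) (qmap A p) g'"
  let ?V = "step S A i zspace"
  define Z where "Z = ?V i"
  have V: "subrep S A ?V" using step_subrep(1)[OF r zspace_subrep[OF r] i] .
  have Z: "cv.subspace Z" "Z \<subseteq> S i" using subrepD(1,2)[OF V i] by (auto simp: Z_def)
  have Zk: "A i j z = 0" if "z \<in> Z" "j \<in> nb i" for z j using that unfolding Z_def soc_mem by blast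
  have pid: "p k x = x" if "k \<in> I" "k \<noteq> i" "x \<in> S k" for k x using soc_quot_id[OF r i p that] .
  have pS: "p k x \<in> S k" and ppx: "p k (p k x) = p k x" if "k \<in> I" "x \<in> S k" for k x
    using is_quotD(2,5)[OF p that] .
  have pl: "lin_on (S k) (p k)" if "k \<in> I" for k using is_quotD(1)[OF p that] .
  define M where "M = p i ` S i"
  have M: "cv.subspace M" "M \<subseteq> S i" "\<And>m. m \<in> M \<Longrightarrow> p i m = m"
    using subspace_lin_image[OF pl[OF i] is_repD(1)[OF r i]] pS[OF i] ppx[OF i] by (auto simp: M_def)
  have Aip: "A i j (p i x) = A i j x" if x: "x \<in> S i" and j: "j \<in> nb i" for x j
  proof -
    have "A i j (x - p i x) = 0" using is_quotD(4)[OF p i x] Zk[OF _ j] by (simp add: Z_def)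
    then show ?thesis using lin_on_diff[OF is_repD(3)[OF r nbD(1)[OF j]] is_repD(1)[OF r i] x pS[OF i x]] by simp
  qed
  define out where "out = (\<lambda>m j. if j \<in> nb i then A i j m else 0)"
  have outl: "lin_on M out"
    using lin_on_subset[OF is_repD(3)[OF r nbD(1)] M(2)] by (auto simp: out_def lin_on_def fun_eq_iff cscale_apply)
  have outi: "inj_on out M"
    unfolding lin_on_inj_iff[OF outl M(1)]
  proof (intro ballI impI)
    fix m assume m: "m \<in> M" "out m = 0"
    have "A i j m = 0" if "j \<in> nb i" for j using fun_cong[OF m(2), of j] that by (simp add: out_def)
    then have "m \<in> ?V i" using m(1) M(2) soc_mem by blast
    then show "m = 0" using is_quotD(3)[OF p i] m(1) M(2,3) by force
  qed
  have outS: "out m \<in> fam (nb i) S" if "m \<in> M" for m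
    using that M(2) is_repD(4)[OF r nbD(1)] by (auto simp: out_def fam_def)
  (* The component in the socle of the arrow from j to i. *)
  define z where "z = (\<lambda>j y. A j i y - p i (A j i y))"
  have zZ: "z j y \<in> Z" if "j \<in> nb i" "y \<in> S j" for j y
    using is_quotD(4)[OF p i is_repD(4)[OF r nbD(2)[OF that(1)] that(2)]] by (simp add: z_def Z_def)
  have zl: "lin_on (S j) (z j)" if j: "j \<in> nb i" for j
    unfolding z_def by (intro lin_on_minus_fun is_repD(3)[OF r nbD(2)[OF j]]
      lin_on_comp[OF is_repD(3)[OF r nbD(2)[OF j]] is_repD(4)[OF r nbD(2)[OF j]] pl[OF i]])
  have g'M: "lin_on M (g' i j)" if j: "j \<in> nb i" for j
    using cocycleD(1)[OF g' nbD(1)[OF j]] by (simp add: M_def)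
  have g'MS: "g' i j m \<in> S j" if j: "j \<in> nb i" and m: "m \<in> M" for j m
  proof -
    have "g' i j m \<in> p j ` S j" using cocycleD(2)[OF g' nbD(1)[OF j]] m by (simp add: M_def)
    then show ?thesis using pS[OF nbD(4)[OF j]] by auto
  qed
  (* The defect of the relation at i, to be cancelled by q. *)
  define t where "t = (\<lambda>m. - (\<Sum>j\<in>nb i. eps i j *\<^sub>C z j (g' i j m)))"
  have "lin_on M (\<lambda>m. - 1 *\<^sub>C (\<Sum>j\<in>nb i. eps i j *\<^sub>C z j (g' i j m)))"
    by (intro lin_on_cmult lin_on_sum_fun) (use lin_on_comp[OF g'M g'MS zl] in blast)
  then have tl: "lin_on M t" by (simp add: t_def)
  have tZ: "t m \<in> Z" if "m \<in> M" for m
    unfolding t_def using zZ g'MS that Z(1) by (auto intro!: cv.subspace_neg cv.subspace_sum cv.subspace_scale)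
  obtain q0 where q0: "\<And>j. lin_on (S j) (q0 j)" "\<And>j x. q0 j x \<in> Z"
    "\<And>m. m \<in> M \<Longrightarrow> (\<Sum>j\<in>nb i. q0 j (out m j)) = t m"
  proof (rule extend_from_fam[OF M(1) Z(1) outl outi _ finite_nb _ tl])
    show "out m \<in> fam (nb i) S" if "m \<in> M" for m using outS that .
    show "cv.subspace (S j)" if "j \<in> nb i" for j using is_repD(1)[OF r nbD(4)[OF that]] .
    show "t m \<in> Z" if "m \<in> M" for m using tZ that .
  qed blast
  define q where "q = (\<lambda>j x. inverse (eps i j) *\<^sub>C q0 j x)"
  have ql: "lin_on (S j) (q j)" for j unfolding q_def by (intro lin_on_cmult q0)
  have qZ: "q j x \<in> Z" for j x
    unfolding q_def by (rule cv.subspace_scale[OF Z(1) q0(2)])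
  have qsum: "(\<Sum>j\<in>nb i. eps i j *\<^sub>C (z j (g' i j m) + q j (A i j m))) = 0" if "m \<in> M" for m
  proof -
    have "(\<Sum>j\<in>nb i. eps i j *\<^sub>C q j (A i j m)) = (\<Sum>j\<in>nb i. q0 j (out m j))"
      using eps_nz nbD(1) by (intro sum.cong) (auto simp: q_def out_def cscale_cscale cscale_one)
    then show ?thesis using q0(3)[OF that] by (simp add: cscale_add_right sum.distrib t_def)
  qed
  define g where "g = (\<lambda>k l x. g' k l (p k x) + (if l = i then q k x else 0))"
  have g'S: "g' k l (p k x) \<in> S l" and g'p: "p l (g' k l (p k x)) = g' k l (p k x)"
    if E: "(k, l) \<in> E" and x: "x \<in> S k" for k l x
    using cocycleD(2)[OF g' E, of "p k x"] x pS ppx E_I[OF E] by auto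
  have gS: "g k l x \<in> S l" if E: "(k, l) \<in> E" and x: "x \<in> S k" for k l x
    using g'S[OF E x] qZ Z(2) is_repD(1)[OF r] E_I[OF E] by (auto simp: g_def cv.subspace_add subset_iff)
  have Pi: "p k ` S k \<subseteq> S k" if "k \<in> I" for k using pS that by blast
  have "cocycle S A S A g"
    unfolding cocycle_def
  proof (intro conjI allI impI ballI)
    fix k l assume E: "(k, l) \<in> E"
    have "lin_on (S k) (\<lambda>x. g' k l (p k x))"
      by (rule lin_on_comp[OF pl _ cocycleD(1)[OF g' E]]) (use E_I[OF E] in auto)
    then show "lin_on (S k) (g k l)"
      unfolding g_def using lin_on_plus[OF _ ql] by (cases "l = i") simp_all
    show "g k l x \<in> S l" if "x \<in> S k" for x using gS[OF E that] .
  next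
    fix k x assume k: "k \<in> I" and x: "x \<in> S k"
    have px: "p k x \<in> p k ` S k" using x by blast
    have c0: "(\<Sum>j\<in>nb k. eps k j *\<^sub>C (p k (A j k (g' k j (p k x))) + g' j k (p j (A k j (p k x))))) = 0"
      using cocycleD(3)[OF g' k px] .
    show "(\<Sum>j\<in>nb k. eps k j *\<^sub>C (A j k (g k j x) + g j k (A k j x))) = 0"
    proof (cases "k = i")
      case True
      let ?m = "p i x"
      have m: "?m \<in> M" using x True by (auto simp: M_def)
      have "(\<Sum>j\<in>nb i. eps i j *\<^sub>C (A j i (g i j x) + g j i (A i j x)))
         = (\<Sum>j\<in>nb i. eps i j *\<^sub>C (p i (A j i (g' i j ?m)) + g' j i (p j (A i j ?m))) + eps i j *\<^sub>C (z j (g' i j ?m) + q j (A i j ?m)))"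
      proof (rule sum.cong)
        fix j assume j: "j \<in> nb i"
        have "A i j x = A i j ?m" using Aip[OF _ j] x True by simp
        moreover have "p j (A i j ?m) = A i j ?m" using pid nbD[OF j] is_repD(4)[OF r nbD(1)[OF j]] M(2) m by blast
        ultimately show "eps i j *\<^sub>C (A j i (g i j x) + g j i (A i j x)) = eps i j *\<^sub>C (p i (A j i (g' i j ?m)) + g' j i (p j (A i j ?m))) + eps i j *\<^sub>C (z j (g' i j ?m) + q j (A i j ?m))"
          using nbD(5)[OF j] by (simp add: g_def z_def cscale_add_right[symmetric])
      qed simp
      then show ?thesis using c0 qsum[OF m] True by (simp add: sum.distrib)
    next
      case False
      have pk: "p k x = x" using pid[OF k False x] .
      have "(\<Sum>j\<in>nb k. eps k j *\<^sub>C (A j k (g k j x) + g j k (A k j x))) = (\<Sum>j\<in>nb k. eps k j *\<^sub>C (p k (A j k (g' k j (p k x))) + g' j k (p j (A k j (p k x)))))"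
      proof (rule sum.cong)
        fix j assume j: "j \<in> nb k"
        note n = nbD[OF j]
        have m: "g' k j x \<in> S j" using g'S[OF n(1) x] pk by simp
        have "A j k (g k j x) = A j k (g' k j x)"
        proof (cases "j = i")
          case True
          then have ki: "k \<in> nb i" using n by (simp add: nb_def)
          have "A i k (g' k i x + q k x) = A i k (g' k i x) + A i k (q k x)"
            using lin_on_add[OF is_repD(3)[OF r nbD(1)[OF ki]]] m qZ Z(2) True by blast
          then show ?thesis using Zk[OF qZ ki] True pk by (simp add: g_def)
        qed (simp add: g_def pk)
        moreover have "p k (A j k (g' k j x)) = A j k (g' k j x)"
          using pid[OF k False] is_repD(4)[OF r n(2) m] by simp
        moreover have "g j k (A k j x) = g' j k (p j (A k j x))" using False by (simp add: g_def)
        ultimately show "eps k j *\<^sub>C (A j k (g k j x) + g j k (A k j x)) = eps k j *\<^sub>C (p k (A j k (g' k j (p k x))) + g' j k (p j (A k j (p k x))))"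
          by (simp add: pk)
      qed simp
      then show ?thesis using c0 by simp
    qed
  qed
  then have "coboundary S A S A g" using o unfolding ext_orth_def by blast
  then obtain f where f: "maps S S f" "\<And>k l x. (k, l) \<in> E \<Longrightarrow> x \<in> S k \<Longrightarrow> g k l x = f l (A k l x) - A k l (f k x)"
    by (rule coboundaryE) blast
  have f0: "f k 0 = 0" if "k \<in> I" for k using lin_on_zero[OF mapsD(1)[OF f(1) that] is_repD(1)[OF r that]] .
  have fZ: "f i y \<in> ?V i" if y: "y \<in> ?V i" for y
  proof -
    have yS: "y \<in> S i" and yZ: "\<And>j. j \<in> nb i \<Longrightarrow> A i j y = 0" using y unfolding soc_mem by auto
    have "A i j (f i y) = 0" if j: "j \<in> nb i" for j
    proof -
      have "p i y = 0" using is_quotD(3)[OF p i yS] y by simp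
      moreover have "g' i j 0 = 0" using lin_on_zero[OF g'M[OF j] M(1)] .
      ultimately have "g i j y = 0" using nbD(5)[OF j] by (simp add: g_def)
      then show ?thesis using f(2)[OF nbD(1)[OF j] yS] yZ[OF j] f0[OF nbD(4)[OF j]] by simp
    qed
    then show ?thesis using mapsD(2)[OF f(1) i yS] soc_mem by blast
  qed
  have fV: "f k y \<in> ?V k" if "k \<in> I" "y \<in> ?V k" for k y
    using that fZ f0 by (cases "k = i") (auto simp: step_other)
  let ?f' = "\<lambda>k x. p k (f k x)"
  have "maps (qspace S p) (qspace S p) ?f'"
    unfolding maps_def
  proof (intro ballI conjI)
    fix k assume k: "k \<in> I"
    show "lin_on (p k ` S k) (?f' k)"
      by (rule lin_on_comp[OF lin_on_subset[OF mapsD(1)[OF f(1) k] Pi[OF k]] _ pl[OF k]])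
        (use mapsD(2)[OF f(1) k] Pi[OF k] in blast)
    show "?f' k x \<in> p k ` S k" if "x \<in> p k ` S k" for x using mapsD(2)[OF f(1) k] Pi[OF k] that by blast
  qed
  moreover have "g' k l x = ?f' l (p l (A k l x)) - p l (A k l (?f' k x))" if E: "(k, l) \<in> E" and x: "x \<in> p k ` S k" for k l x
  proof -
    have kl: "k \<in> I" "l \<in> I" using E E_I by auto
    have xS: "x \<in> S k" and px: "p k x = x" using x Pi[OF kl(1)] ppx[OF kl(1)] by auto
    have fx: "f k x \<in> S k" and Ax: "A k l x \<in> S l" using mapsD(2)[OF f(1) kl(1) xS] is_repD(4)[OF r E xS] by auto
    have fAx: "f l (A k l x) \<in> S l" and Afx: "A k l (f k x) \<in> S l"
      using mapsD(2)[OF f(1) kl(2) Ax] is_repD(4)[OF r E fx] by auto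
    have pAx: "p l (A k l x) \<in> S l" "f l (p l (A k l x)) \<in> S l" using pS[OF kl(2) Ax] mapsD(2)[OF f(1) kl(2)] by auto
    have "f l (A k l x - p l (A k l x)) \<in> ?V l" using fV[OF kl(2) is_quotD(4)[OF p kl(2) Ax]] .
    moreover have "f l (A k l x - p l (A k l x)) = f l (A k l x) - f l (p l (A k l x))"
      using lin_on_diff[OF mapsD(1)[OF f(1) kl(2)] is_repD(1)[OF r kl(2)] Ax pAx(1)] .
    ultimately have "p l (f l (A k l x) - f l (p l (A k l x))) = 0"
      using is_quotD(3)[OF p kl(2)] subrepD(3)[OF V kl(2)] by metis
    then have 1: "p l (f l (p l (A k l x))) = p l (f l (A k l x))"
      using lin_on_diff[OF pl[OF kl(2)] is_repD(1)[OF r kl(2)] fAx pAx(2)] by simp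
    have 2: "p l (A k l (p k (f k x))) = p l (A k l (f k x))" using quot_comm[OF r V p E fx] .
    have "p l (g k l x) = p l (f l (A k l x)) - p l (A k l (f k x))"
      using f(2)[OF E xS] lin_on_diff[OF pl[OF kl(2)] is_repD(1)[OF r kl(2)] fAx Afx] by simp
    moreover have "p l (g k l x) = g' k l x"
    proof (cases "l = i")
      case True
      have "p i (g' k i x + q k x) = p i (g' k i x) + p i (q k x)"
        using lin_on_add[OF pl[OF i]] g'S[OF E xS] px True qZ[of k x] Z(2) by auto
      also have "p i (q k x) = 0" using is_quotD(3)[OF p i] qZ[of k x] Z(2) by (auto simp: Z_def)
      finally show ?thesis using True px g'p[OF E xS] by (simp add: g_def)
    next
      case False then show ?thesis using px g'p[OF E xS] by (simp add: g_def)
    qed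
    ultimately show ?thesis using 1 2 by simp
  qed
  ultimately show "coboundary (qspace S p) (qmap A p) (qspace S p) (qmap A p) g'"
    unfolding coboundary_def by blast
qed

section \<open>Rigid representations are determined by their strings\<close>

lemma isomorphic_cong:
  assumes "isomorphic S A T B" "is_rep S A"
    "\<And>i j x. (i, j) \<in> E \<Longrightarrow> x \<in> T i \<Longrightarrow> B i j x = C i j x"
  shows "isomorphic S A T C"
proof -
  obtain f where f: "rep_iso S A T B f" using assms(1) by (auto simp: isomorphic_def)
  have "f i x \<in> T i" if "(i, j) \<in> E" "x \<in> S i" for i j x
    using f that E_I[OF that(1)] by (auto simp: rep_iso_def rep_hom_def maps_def)
  then have "rep_iso S A T C f" using f assms(3) by (auto simp: rep_iso_def rep_hom_def)
  then show ?thesis by (auto simp: isomorphic_def)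
qed

lemma maps_id: "maps S S (\<lambda>i x. x)"
  by (auto simp: maps_def lin_on_id)

lemma maps_cscale: "is_rep S A \<Longrightarrow> maps S S f \<Longrightarrow> maps S S (\<lambda>i x. c *\<^sub>C f i x)"
  unfolding maps_def using lin_on_cmult is_repD(1) cv.subspace_scale by metis

lemma maps_sum:
  assumes "is_rep S A" "\<And>a. a \<in> N \<Longrightarrow> maps S S (f a)"
  shows "maps S S (\<lambda>i x. \<Sum>a\<in>N. f a i x)"
  unfolding maps_def
proof (intro ballI conjI)
  fix i assume i: "i \<in> I"
  show "lin_on (S i) (\<lambda>x. \<Sum>a\<in>N. f a i x)" using assms(2) i by (intro lin_on_sum_fun) (auto simp: maps_def)
  show "(\<Sum>a\<in>N. f a i x) \<in> S i" if "x \<in> S i" for x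
    using assms(2) i that is_repD(1)[OF assms(1) i] by (intro cv.subspace_sum) (auto simp: maps_def)
qed

text \<open>
  The affine line through two representations that differ only on the arrows into \<open>i\<close>; \<open>t = 0\<close>
  gives \<open>A\<close> and \<open>t = 1\<close> gives \<open>B\<close>.
\<close>

definition line where
  "line A B i t = (\<lambda>j k x. if k = i then A j i x + t *\<^sub>C (B j i x - A j i x) else A j k x)"

text \<open>
  Let D be the difference on the arrows into \<open>i\<close>; it has values in the i-socle. An isomorphism
  from \<open>A\<close> to the point of parameter t is sought as a power series in t with coefficients \<open>F m\<close>
  and \<open>F 0\<close> the identity: the coefficient \<open>F (Suc m)\<close> has to bound the cocycle \<open>D (F m)\<close>, which is
  possible by rigidity. A polynomial is needed. The cocycles of a first solution f lie in a
  finite-dimensional space and so satisfy a linear relation; multiplying the series by the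
  polynomial with the coefficients of that relation (in reverse order) makes the cocycle of one
  coefficient zero, and the series can be stopped there. A polynomial family of endomorphisms that
  is the identity at t = 0 is invertible for all but finitely many t.
\<close>

lemma line_isomorphic:
  fixes S :: "'i \<Rightarrow> 'v::cvector set"
  assumes rA: "is_rep S A" and rB: "is_rep S B" and i: "i \<in> I" and rigid: "ext_orth S A S A"
    and same: "\<And>k l x. (k, l) \<in> E \<Longrightarrow> l \<noteq> i \<Longrightarrow> x \<in> S k \<Longrightarrow> A k l x = B k l x"
    and soc: "\<And>j l x. j \<in> nb i \<Longrightarrow> l \<in> nb i \<Longrightarrow> x \<in> S j \<Longrightarrow> A i l (B j i x - A j i x) = 0"
  shows "finite {t. \<not> isomorphic S A S (line A B i t)}"
proof -
  define D where "D = (\<lambda>j x. B j i x - A j i x)"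
  have DS: "D j x \<in> S i" if "j \<in> nb i" "x \<in> S j" for j x
    unfolding D_def by (rule cv.subspace_diff[OF is_repD(1)[OF rA i] is_repD(4)[OF rB nbD(2)[OF that(1)] that(2)]
      is_repD(4)[OF rA nbD(2)[OF that(1)] that(2)]])
  have Dl: "lin_on (S j) (D j)" if "j \<in> nb i" for j
    unfolding D_def by (rule lin_on_minus_fun[OF is_repD(3)[OF rB nbD(2)[OF that]] is_repD(3)[OF rA nbD(2)[OF that]]])
  have Dsoc: "A i l (D j x) = 0" if "j \<in> nb i" "l \<in> nb i" "x \<in> S j" for j l x
    unfolding D_def by (rule soc[OF that])
  define good where "good = (\<lambda>f. maps S S f \<and>
    (\<forall>k l x. (k, l) \<in> E \<longrightarrow> l \<noteq> i \<longrightarrow> x \<in> S k \<longrightarrow> f l (A k l x) = A k l (f k x)))"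
  have goodD: "maps S S f" "(k, l) \<in> E \<Longrightarrow> l \<noteq> i \<Longrightarrow> x \<in> S k \<Longrightarrow> f l (A k l x) = A k l (f k x)" if "good f" for f k l x
    using that unfolding good_def by blast+
  (* The recursion for the coefficients: f' bounds the cocycle of f. *)
  define nxt where "nxt = (\<lambda>f f'. \<forall>j\<in>nb i. \<forall>x\<in>S j. f' i (A j i x) - A j i (f' j x) = D j (f j x))"
  have ex_nxt: "\<exists>f'. good f' \<and> nxt f f'" if f: "good f" for f
  proof -
    have fm: "maps S S f" using goodD(1)[OF f] .
    define g where "g = (\<lambda>k l x. if l = i then D k (f k x) else 0)"
    have "cocycle S A S A g"
      unfolding cocycle_def
    proof (intro conjI allI impI ballI)
      fix k l assume E: "(k, l) \<in> E"
      have kl: "k \<in> I" "l \<in> I" using E E_I by auto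
      show "lin_on (S k) (g k l)"
      proof (cases "l = i")
        case True
        then have k: "k \<in> nb i" using E symE by (auto simp: nb_def)
        have "lin_on (S k) (\<lambda>x. D k (f k x))"
          by (rule lin_on_comp[OF mapsD(1)[OF fm kl(1)] mapsD(2)[OF fm kl(1)] Dl[OF k]])
        then show ?thesis using True by (simp add: g_def)
      qed (simp add: g_def lin_on_const0)
      show "g k l x \<in> S l" if "x \<in> S k" for x
      proof (cases "l = i")
        case True
        then have k: "k \<in> nb i" using E symE by (auto simp: nb_def)
        then show ?thesis using True DS[OF k mapsD(2)[OF fm kl(1) that]] by (simp add: g_def)
      qed (simp add: g_def is_repD(6)[OF rA kl(2)])
    next
      fix k x assume k: "k \<in> I" and x: "x \<in> S k"
      show "(\<Sum>j\<in>nb k. eps k j *\<^sub>C (A j k (g k j x) + g j k (A k j x))) = 0"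
      proof (cases "k = i")
        case True
        let ?y = "f i x"
        have y: "?y \<in> S i" using mapsD(2)[OF fm i] x True by simp
        have "(\<Sum>j\<in>nb k. eps k j *\<^sub>C (A j k (g k j x) + g j k (A k j x)))
            = (\<Sum>j\<in>nb i. eps i j *\<^sub>C B j i (B i j ?y) - eps i j *\<^sub>C A j i (A i j ?y))"
          unfolding True
        proof (rule sum.cong)
          fix j assume j: "j \<in> nb i"
          note n = nbD[OF j]
          have "f j (A i j x) = A i j ?y" using goodD(2)[OF f n(1) n(5)] x True by simp
          moreover have "A i j ?y = B i j ?y" using same[OF n(1,5) y] .
          ultimately show "eps i j *\<^sub>C (A j i (g i j x) + g j i (A i j x)) = eps i j *\<^sub>C B j i (B i j ?y) - eps i j *\<^sub>C A j i (A i j ?y)"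
            using n(5) is_repD(7)[OF rA n(2)] by (simp add: g_def D_def cv.scale_right_diff_distrib)
        qed simp
        also have "\<dots> = mesh B i ?y - mesh A i ?y" by (simp add: mesh_def sum_subtractf)
        finally show ?thesis using is_repD(5)[OF rA i y] is_repD(5)[OF rB i y] by simp
      next
        case False
        show ?thesis
        proof (rule sum.neutral, rule ballI)
          fix j assume j: "j \<in> nb k"
          have "A j k (g k j x) = 0"
          proof (cases "j = i")
            case True
            then have "k \<in> nb i" using nbD(2)[OF j] by (simp add: nb_def)
            then show ?thesis using True Dsoc[of k k "f k x"] mapsD(2)[OF fm k x] by (simp add: g_def)
          qed (simp add: g_def is_repD(7)[OF rA nbD(2)[OF j]])
          then show "eps k j *\<^sub>C (A j k (g k j x) + g j k (A k j x)) = 0" using False by (simp add: g_def)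
        qed
      qed
    qed
    then have "coboundary S A S A g" using rigid unfolding ext_orth_def by blast
    then obtain u where u: "maps S S u" "\<And>k l x. (k, l) \<in> E \<Longrightarrow> x \<in> S k \<Longrightarrow> g k l x = u l (A k l x) - A k l (u k x)"
      by (rule coboundaryE) blast
    have "u l (A k l x) = A k l (u k x)" if "(k, l) \<in> E" "l \<noteq> i" "x \<in> S k" for k l x
    proof -
      have "u l (A k l x) - A k l (u k x) = 0" using u(2)[OF that(1,3)] that(2) by (simp add: g_def)
      then show ?thesis by simp
    qed
    then have "good u" unfolding good_def using u(1) by blast
    moreover have "nxt f u" unfolding nxt_def
    proof (intro ballI)
      fix j x assume "j \<in> nb i" "x \<in> S j"
      then show "u i (A j i x) - A j i (u j x) = D j (f j x)" using u(2)[of j i x] nbD(2)[of j i] by (simp add: g_def)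
    qed
    ultimately show ?thesis by blast
  qed
  have id: "good (\<lambda>k x. x)" unfolding good_def using maps_id by auto
  obtain f where f: "\<And>n. good (f n)" "f 0 = (\<lambda>k x. x)" "\<And>n. nxt (f n) (f (Suc n))"
  proof -
    let ?P = "\<lambda>(n :: nat) f. good f \<and> (n = 0 \<longrightarrow> f = (\<lambda>k x. x))"
    have 0: "\<exists>f. ?P 0 f" using id by blast
    have Suc: "\<exists>f'. ?P (Suc n) f' \<and> nxt f f'" if "?P n f" for n f using ex_nxt that by blast
    have "\<exists>f. \<forall>n. ?P n (f n) \<and> nxt (f n) (f (Suc n))"
      by (rule dependent_nat_choice[of ?P "\<lambda>_. nxt", OF 0 Suc])
    then show ?thesis using that by blast
  qed
  define z where "z = (\<lambda>n j x. if j \<in> nb i \<and> x \<in> S j then D j (f n j x) else 0)"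
  let ?H = "fam (nb i) (\<lambda>j. hom_sp (S j) (S i))"
  have "fd ?H"
  proof (rule fam_fd_dim[THEN conjunct1])
    fix j assume "j \<in> nb i"
    then have j: "j \<in> I" by (rule nbD(4))
    show "cv.subspace (hom_sp (S j) (S i))" by (rule subspace_hom_sp[OF is_repD(1)[OF rA i]])
    show "fd (hom_sp (S j) (S i))"
      by (rule fd_hom_sp[OF is_repD(2)[OF rA j] is_repD(1)[OF rA j] is_repD(2)[OF rA i] is_repD(1)[OF rA i]])
  qed simp
  moreover have "z n \<in> ?H" for n
  proof -
    have "(\<lambda>x. if x \<in> S j then D j (f n j x) else 0) \<in> hom_sp (S j) (S i)" if j: "j \<in> nb i" for j
    proof -
      have fm: "maps S S (f n)" using goodD(1)[OF f(1)] .
      note jI = nbD(4)[OF j]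
      have "lin_on (S j) (\<lambda>x. D j (f n j x))"
        by (rule lin_on_comp[OF mapsD(1)[OF fm jI] mapsD(2)[OF fm jI] Dl[OF j]])
      then have "lin_on (S j) (\<lambda>x. if x \<in> S j then D j (f n j x) else 0)"
        by (rule lin_on_cong[OF _ is_repD(1)[OF rA jI]]) simp
      then show ?thesis using DS[OF j] mapsD(2)[OF fm jI] by (simp add: hom_sp_def)
    qed
    then have "(\<lambda>j x. if j \<in> nb i \<and> x \<in> S j then D j (f n j x) else 0) \<in> ?H"
      by (auto simp: fam_def zero_fun_def fun_eq_iff)
    then show ?thesis by (simp add: z_def)
  qed
  ultimately obtain d c where c: "c d = 1" "(\<Sum>l\<le>d. c l *\<^sub>C z l) = 0" using fd_seq_dependent by metis
  (* The product of the power series f with the polynomial whose coefficients are those of the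
     relation in reverse order. *)
  define F where "F = (\<lambda>m k x. \<Sum>l\<le>m. (if l \<le> d then c (d - l) else 0) *\<^sub>C f (m - l) k x)"
  have Fm: "maps S S (F m)" for m unfolding F_def
    by (intro maps_sum[OF rA] maps_cscale[OF rA] goodD(1) f(1))
  have F0: "F 0 k x = x" for k x using f(2) c(1) by (simp add: F_def cscale_one)
  have Fgood: "F m l (A k l x) = A k l (F m k x)" if E: "(k, l) \<in> E" and l: "l \<noteq> i" and x: "x \<in> S k" for m k l x
  proof -
    have k: "k \<in> I" using E E_I by auto
    have fx: "f n k x \<in> S k" for n using mapsD(2)[OF goodD(1)[OF f(1)] k x] .
    have "A k l (F m k x) = (\<Sum>a\<le>m. A k l ((if a \<le> d then c (d - a) else 0) *\<^sub>C f (m - a) k x))"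
      unfolding F_def using fx is_repD(1)[OF rA k]
      by (intro lin_on_sum[OF is_repD(3)[OF rA E] is_repD(1)[OF rA k]]) (simp add: cv.subspace_scale)
    also have "\<dots> = F m l (A k l x)"
      unfolding F_def lin_on_scale[OF is_repD(3)[OF rA E] fx] goodD(2)[OF f(1) E l x] ..
    finally show ?thesis by simp
  qed
  have dF: "F m i (A j i x) - A j i (F m j x) = (case m of 0 \<Rightarrow> 0 | Suc n \<Rightarrow> D j (F n j x))"
    if j: "j \<in> nb i" and x: "x \<in> S j" for m j x
  proof -
    note n = nbD[OF j]
    let ?q = "\<lambda>a. if a \<le> d then c (d - a) else 0"
    have fx: "f a j x \<in> S j" for a using mapsD(2)[OF goodD(1)[OF f(1)] n(4) x] .
    have "A j i (F m j x) = (\<Sum>a\<le>m. A j i (?q a *\<^sub>C f (m - a) j x))"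
      unfolding F_def using fx is_repD(1)[OF rA n(4)]
      by (intro lin_on_sum[OF is_repD(3)[OF rA n(2)] is_repD(1)[OF rA n(4)]]) (simp add: cv.subspace_scale)
    also have "\<dots> = (\<Sum>a\<le>m. ?q a *\<^sub>C A j i (f (m - a) j x))"
      unfolding lin_on_scale[OF is_repD(3)[OF rA n(2)] fx] ..
    finally have "F m i (A j i x) - A j i (F m j x) = (\<Sum>a\<le>m. ?q a *\<^sub>C (f (m - a) i (A j i x) - A j i (f (m - a) j x)))"
      unfolding F_def by (simp add: sum_subtractf cv.scale_right_diff_distrib)
    also have "\<dots> = (case m of 0 \<Rightarrow> 0 | Suc n \<Rightarrow> D j (F n j x))"
    proof (cases m)
      case 0 then show ?thesis by (simp add: f(2))
    next
      case (Suc b)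
      have "(\<Sum>a\<le>m. ?q a *\<^sub>C (f (m - a) i (A j i x) - A j i (f (m - a) j x)))
          = (\<Sum>a\<le>b. ?q a *\<^sub>C (f (m - a) i (A j i x) - A j i (f (m - a) j x)))"
        unfolding Suc by (simp add: f(2))
      also have "\<dots> = (\<Sum>a\<le>b. ?q a *\<^sub>C D j (f (b - a) j x))"
      proof (rule sum.cong)
        fix a assume "a \<in> {..b}"
        then have "m - a = Suc (b - a)" using Suc by auto
        then show "?q a *\<^sub>C (f (m - a) i (A j i x) - A j i (f (m - a) j x)) = ?q a *\<^sub>C D j (f (b - a) j x)"
          using f(3)[of "b - a"] j x by (simp add: nxt_def)
      qed simp
      also have "\<dots> = (\<Sum>a\<le>b. D j (?q a *\<^sub>C f (b - a) j x))"
        unfolding lin_on_scale[OF Dl[OF j] fx] ..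
      also have "\<dots> = D j (F b j x)"
        unfolding F_def using fx is_repD(1)[OF rA n(4)]
        by (intro lin_on_sum[OF Dl[OF j] is_repD(1)[OF rA n(4)], symmetric]) (simp add: cv.subspace_scale)
      finally show ?thesis using Suc by simp
    qed
    finally show ?thesis .
  qed
  (* The coefficient of degree d reproduces the linear relation. *)
  have DF: "D j (F d j x) = 0" if j: "j \<in> nb i" and x: "x \<in> S j" for j x
  proof -
    note n = nbD[OF j]
    have fx: "f a j x \<in> S j" for a using mapsD(2)[OF goodD(1)[OF f(1)] n(4) x] .
    have "D j (F d j x) = (\<Sum>a\<le>d. D j ((if a \<le> d then c (d - a) else 0) *\<^sub>C f (d - a) j x))"
      unfolding F_def using fx is_repD(1)[OF rA n(4)]
      by (intro lin_on_sum[OF Dl[OF j] is_repD(1)[OF rA n(4)]]) (simp add: cv.subspace_scale)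
    also have "\<dots> = (\<Sum>a\<le>d. c (d - a) *\<^sub>C D j (f (d - a) j x))"
      unfolding lin_on_scale[OF Dl[OF j] fx] by (rule sum.cong) auto
    also have "\<dots> = (\<Sum>a\<le>d. c a *\<^sub>C D j (f a j x))"
      by (rule sum.reindex_bij_witness[of _ "\<lambda>a. d - a" "\<lambda>a. d - a"]) auto
    also have "\<dots> = (\<Sum>l\<le>d. c l *\<^sub>C z l) j x"
      unfolding sum_fun_apply using j x by (simp add: z_def cscale_apply)
    finally show ?thesis using c(2) by simp
  qed
  define \<phi> where "\<phi> = (\<lambda>t k x. \<Sum>m\<le>d. t ^ m *\<^sub>C F m k x)"
  have \<phi>m: "maps S S (\<phi> t)" for t unfolding \<phi>_def
    by (intro maps_sum[OF rA] maps_cscale[OF rA] Fm)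
  have hom: "rep_hom S A S (line A B i t) (\<phi> t)" for t
    unfolding rep_hom_def
  proof (intro conjI \<phi>m allI impI ballI)
    fix k l x assume E: "(k, l) \<in> E" and x: "x \<in> S k"
    have k: "k \<in> I" using E E_I by auto
    have Fx: "F m k x \<in> S k" for m using mapsD(2)[OF Fm k x] .
    have Ak: "A k l (\<phi> t k x) = (\<Sum>m\<le>d. t ^ m *\<^sub>C A k l (F m k x))"
    proof -
      have "A k l (\<phi> t k x) = (\<Sum>m\<le>d. A k l (t ^ m *\<^sub>C F m k x))"
        unfolding \<phi>_def using Fx is_repD(1)[OF rA k]
        by (intro lin_on_sum[OF is_repD(3)[OF rA E] is_repD(1)[OF rA k]]) (simp add: cv.subspace_scale)
      then show ?thesis unfolding lin_on_scale[OF is_repD(3)[OF rA E] Fx] .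
    qed
    show "\<phi> t l (A k l x) = line A B i t k l (\<phi> t k x)"
    proof (cases "l = i")
      case False
      then show ?thesis using Ak Fgood[OF E False x] by (simp add: line_def \<phi>_def)
    next
      case True
      have kn: "k \<in> nb i" using E True symE by (auto simp: nb_def)
      have "D k (\<phi> t k x) = (\<Sum>m\<le>d. D k (t ^ m *\<^sub>C F m k x))"
        unfolding \<phi>_def using Fx is_repD(1)[OF rA k]
        by (intro lin_on_sum[OF Dl[OF kn] is_repD(1)[OF rA k]]) (simp add: cv.subspace_scale)
      also have "\<dots> = (\<Sum>m\<le>d. t ^ m *\<^sub>C D k (F m k x))"
        unfolding lin_on_scale[OF Dl[OF kn] Fx] ..
      finally have Dk: "D k (\<phi> t k x) = (\<Sum>m\<le>d. t ^ m *\<^sub>C D k (F m k x))" .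
      have "\<phi> t i (A k i x) - A k i (\<phi> t k x) = (\<Sum>m\<le>d. t ^ m *\<^sub>C (F m i (A k i x) - A k i (F m k x)))"
        using Ak True by (simp add: \<phi>_def sum_subtractf cv.scale_right_diff_distrib)
      also have "\<dots> = (\<Sum>m\<le>d. t ^ m *\<^sub>C (case m of 0 \<Rightarrow> 0 | Suc n \<Rightarrow> D k (F n k x)))"
        using dF[OF kn x] by simp
      also have "\<dots> = (\<Sum>m\<le>Suc d. t ^ m *\<^sub>C (case m of 0 \<Rightarrow> 0 | Suc n \<Rightarrow> D k (F n k x)))"
        using DF[OF kn x] by simp
      also have "\<dots> = (\<Sum>m\<le>d. t ^ Suc m *\<^sub>C D k (F m k x))"
        by (subst sum.atMost_Suc_shift) simp
      also have "\<dots> = t *\<^sub>C D k (\<phi> t k x)" unfolding Dk by (simp add: cv.scale_sum_right cscale_cscale)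
      finally show ?thesis using True by (simp add: line_def D_def algebra_simps)
    qed
  qed
  define bad where "bad = (\<lambda>k. {t. \<exists>x\<in>S k. x \<noteq> 0 \<and> \<phi> t k x = 0})"
  have finbad: "finite (bad k)" if k: "k \<in> I" for k
    unfolding bad_def \<phi>_def
    by (rule finite_singular_parameters[OF is_repD(2)[OF rA k] is_repD(1)[OF rA k]])
      (use mapsD[OF Fm k] F0 in auto)
  have "isomorphic S A S (line A B i t)" if t: "t \<notin> (\<Union>k\<in>I. bad k)" for t
  proof -
    have "bij_betw (\<phi> t k) (S k) (S k)" if k: "k \<in> I" for k
    proof -
      have "inj_on (\<phi> t k) (S k)"
        unfolding lin_on_inj_iff[OF mapsD(1)[OF \<phi>m k] is_repD(1)[OF rA k]] using t k by (auto simp: bad_def)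
      moreover have "\<phi> t k ` S k = S k"
        by (rule inj_endo_surj[OF is_repD(2)[OF rA k] is_repD(1)[OF rA k] mapsD(1)[OF \<phi>m k] _ calculation])
          (use mapsD(2)[OF \<phi>m k] in auto)
      ultimately show ?thesis by (simp add: bij_betw_def)
    qed
    then show ?thesis using hom unfolding isomorphic_def rep_iso_def by blast
  qed
  then have "{t. \<not> isomorphic S A S (line A B i t)} \<subseteq> (\<Union>k\<in>I. bad k)" by blast
  then show ?thesis using finbad finI by (meson finite_UN_I finite_subset)
qed

text \<open>
  The line is the same seen from both ends, and the infinite field has a parameter that is good
  for both.
\<close>

lemma rigid_lift_unique:
  fixes S :: "'i \<Rightarrow> 'v::cvector set"
  assumes rA: "is_rep S A" and rB: "is_rep S B" and i: "i \<in> I"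
    and rigid: "ext_orth S A S A" "ext_orth S B S B"
    and same: "\<And>k l x. (k, l) \<in> E \<Longrightarrow> l \<noteq> i \<Longrightarrow> x \<in> S k \<Longrightarrow> A k l x = B k l x"
    and soc: "\<And>j l x. j \<in> nb i \<Longrightarrow> l \<in> nb i \<Longrightarrow> x \<in> S j \<Longrightarrow> A i l (B j i x - A j i x) = 0"
  shows "isomorphic S A S B"
proof -
  have fin1: "finite {t. \<not> isomorphic S A S (line A B i t)}"
    by (rule line_isomorphic[OF rA rB i rigid(1) same soc])
  have "finite {t. \<not> isomorphic S B S (line B A i t)}"
  proof (rule line_isomorphic[OF rB rA i rigid(2)])
    show "B k l x = A k l x" if "(k, l) \<in> E" "l \<noteq> i" "x \<in> S k" for k l x using same[OF that] by simp
    fix j l x assume j: "j \<in> nb i" and l: "l \<in> nb i" and x: "x \<in> S j"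
    have m: "A j i x \<in> S i" "B j i x \<in> S i" using is_repD(4)[OF rA nbD(2)[OF j] x] is_repD(4)[OF rB nbD(2)[OF j] x] by auto
    then have d: "A j i x - B j i x \<in> S i" "B j i x - A j i x \<in> S i"
      using is_repD(1)[OF rA i] cv.subspace_diff by blast+
    have "B i l (A j i x - B j i x) = A i l (A j i x - B j i x)" using same[OF nbD(1)[OF l] nbD(5)[OF l] d(1)] by simp
    also have "\<dots> = - A i l (B j i x - A j i x)" using lin_on_minus[OF is_repD(3)[OF rA nbD(1)[OF l]] d(2)] by simp
    finally show "B i l (A j i x - B j i x) = 0" using soc[OF j l x] by simp
  qed
  then have "finite ((\<lambda>t. 1 - t) ` {t. \<not> isomorphic S B S (line B A i t)})" by (rule finite_imageI)
  with fin1 have "finite ({t. \<not> isomorphic S A S (line A B i t)} \<union> (\<lambda>t. 1 - t) ` {t. \<not> isomorphic S B S (line B A i t)})" by simp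
  then obtain t where t: "t \<notin> {t. \<not> isomorphic S A S (line A B i t)} \<union> (\<lambda>t. 1 - t) ` {t. \<not> isomorphic S B S (line B A i t)}"
    using ex_new_if_finite[OF infinite_UNIV_char_0] by blast
  then have 1: "isomorphic S A S (line A B i t)" by blast
  have "isomorphic S B S (line B A i (1 - t))"
  proof (rule ccontr)
    assume "\<not> isomorphic S B S (line B A i (1 - t))"
    then have "1 - (1 - t) \<in> (\<lambda>t. 1 - t) ` {t. \<not> isomorphic S B S (line B A i t)}" by blast
    then show False using t by simp
  qed
  moreover have "line B A i (1 - t) k l x = line A B i t k l x" if "(k, l) \<in> E" "x \<in> S k" for k l x
    using same[OF that(1) _ that(2)]
    by (auto simp: line_def cv.scale_left_diff_distrib cv.scale_right_diff_distrib cscale_one)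
  ultimately have "isomorphic S B S (line A B i t)" using isomorphic_cong[OF _ rB] by blast
  then show ?thesis using isomorphic_trans[OF 1 isomorphic_sym[OF rB]] by blast
qed

text \<open>
  The multiplicities along the socle filtration. Natural subtraction is exact here, since a step
  only enlarges the subrepresentation.
\<close>

fun socle_string where
  "socle_string S A [] V = []"
| "socle_string S A (i # w) V = (cv.dim (step S A i V i) - cv.dim (V i)) # socle_string S A w (step S A i V)"

lemma step_quot:
  assumes r: "is_rep S A" and V: "subrep S A V" and p: "is_quot S V p"
    and U: "subrep S A U" "\<And>k. k \<in> I \<Longrightarrow> V k \<subseteq> U k" and U': "\<And>k. k \<in> I \<Longrightarrow> U' k = p k ` U k"
    and i: "i \<in> I" and k: "k \<in> I"
  shows "step (qspace S p) (qmap A p) i U' k = p k ` step S A i U k"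
proof (cases "k = i")
  case False then show ?thesis using U'[OF k] by (simp add: step_other)
next
  case True
  have key: "p j (A i j (p i y)) \<in> U' j \<longleftrightarrow> A i j y \<in> U j" if j: "j \<in> nb i" and y: "y \<in> S i" for j y
  proof -
    note n = nbD[OF j]
    have Ay: "A i j y \<in> S j" using is_repD(4)[OF r n(1) y] .
    have "p j (A i j y) \<in> p j ` U j \<longleftrightarrow> A i j y \<in> U j"
    proof
      assume "p j (A i j y) \<in> p j ` U j"
      then obtain u where u: "u \<in> U j" "p j (A i j y) = p j u" by auto
      have uS: "u \<in> S j" using subrepD(3)[OF U(1) n(4) u(1)] .
      have "p j (A i j y - u) = 0" using lin_on_diff[OF is_quotD(1)[OF p n(4)] is_repD(1)[OF r n(4)] Ay uS] u(2) by simp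
      then have "A i j y - u \<in> U j"
        using is_quotD(3)[OF p n(4) cv.subspace_diff[OF is_repD(1)[OF r n(4)] Ay uS]] U(2)[OF n(4)] by blast
      then show "A i j y \<in> U j" using u(1) cv.subspace_add[OF subrepD(1)[OF U(1) n(4)], of "A i j y - u" u] by simp
    qed blast
    then show ?thesis using quot_comm[OF r V p n(1) y] U'[OF n(4)] by simp
  qed
  show ?thesis unfolding True step_same using key is_quotD(2,5)[OF p i] by auto
qed

lemma dim_quot:
  assumes r: "is_rep S A" and V: "subrep S A V" and p: "is_quot S V p"
    and U: "subrep S A U" "\<And>k. k \<in> I \<Longrightarrow> V k \<subseteq> U k" and k: "k \<in> I"
  shows "cv.dim (U k) = cv.dim (p k ` U k) + cv.dim (V k)"
proof -
  have "{x\<in>U k. p k x = 0} = V k" using is_quotD(3)[OF p k] subrepD(3)[OF U(1) k] U(2)[OF k] by auto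
  then show ?thesis
    using rank_nullity[OF fd_subset[OF is_repD(2)[OF r k] subrepD(2)[OF U(1) k]] subrepD(1)[OF U(1) k]
      lin_on_subset[OF is_quotD(1)[OF p k] subrepD(2)[OF U(1) k]]] by simp
qed

text \<open>The filtration of a quotient by \<open>V\<close> is the filtration of the whole, started at \<open>V\<close>.\<close>

lemma quot_shift:
  assumes r: "is_rep S A" and V: "subrep S A V" and p: "is_quot S V p"
    and U: "subrep S A U" "\<And>k. k \<in> I \<Longrightarrow> V k \<subseteq> U k" "\<And>k. k \<in> I \<Longrightarrow> U' k = p k ` U k"
    and w: "set w \<subseteq> I"
  shows "socle_string (qspace S p) (qmap A p) w U' = socle_string S A w U \<and>
    (\<forall>k\<in>I. socw (qspace S p) (qmap A p) w U' k = p k ` socw S A w U k)"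
  using U w
proof (induction w arbitrary: U U')
  case (Cons i w)
  have i: "i \<in> I" using Cons.prems by simp
  let ?U = "step S A i U" and ?U' = "step (qspace S p) (qmap A p) i U'"
  have s: "subrep S A ?U" using step_subrep(1)[OF r Cons.prems(1) i] .
  have VU: "V k \<subseteq> ?U k" if "k \<in> I" for k
    using step_subrep(2)[OF r Cons.prems(1) i that] Cons.prems(2)[OF that] by blast
  have U': "?U' k = p k ` ?U k" if "k \<in> I" for k
    by (rule step_quot[OF r V p Cons.prems(1-3) i that])
  have "cv.dim (?U' i) - cv.dim (U' i) = cv.dim (?U i) - cv.dim (U i)"
    using dim_quot[OF r V p Cons.prems(1,2) i] dim_quot[OF r V p s VU i] U'[OF i] Cons.prems(3)[OF i] by simp
  moreover have "set w \<subseteq> I" using Cons.prems(4) by simp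
  ultimately show ?case using Cons.IH[OF s VU U'] by simp
qed simp

text \<open>
  Induction on the word. The quotients by the first socle are rigid with equal strings, hence
  isomorphic by some h; the socles have equal dimension. Together these give a linear isomorphism
  from \<open>S\<close> to \<open>T\<close>. The structure of \<open>T\<close> pulled back along it differs from that of \<open>S\<close> only on the
  arrows into i and only by values in the i-socle, so that \<open>rigid_lift_unique\<close> applies.
\<close>

theorem rigid_determined_by_string:
  fixes S :: "'i \<Rightarrow> 'v::cvector set" and T :: "'i \<Rightarrow> 'w::cvector set"
  assumes "is_rep S A" "is_rep T B" "ext_orth S A S A" "ext_orth T B T B" "set w \<subseteq> I"
    "\<And>i. i \<in> I \<Longrightarrow> socw S A w zspace i = S i" "\<And>i. i \<in> I \<Longrightarrow> socw T B w zspace i = T i"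
    "socle_string S A w zspace = socle_string T B w zspace"
  shows "isomorphic S A T B"
  using assms
proof (induction w arbitrary: S A T B)
  case Nil
  have "S k = {0}" "T k = {0}" if "k \<in> I" for k using Nil.prems(6,7)[OF that] by auto
  then have "rep_iso S A T B (\<lambda>_ _. 0)"
    using is_repD(7)[OF Nil.prems(2)]
    by (auto simp: rep_iso_def rep_hom_def maps_def lin_on_const0 bij_betw_def)
  then show ?case by (auto simp: isomorphic_def)
next
  case (Cons i w)
  note rS = Cons.prems(1) and rT = Cons.prems(2)
  have i: "i \<in> I" and w: "set w \<subseteq> I" using Cons.prems(5) by auto
  let ?V = "step S A i zspace" and ?W = "step T B i zspace"
  have V: "subrep S A ?V" and W: "subrep T B ?W"
    using step_subrep(1)[OF rS zspace_subrep[OF rS] i] step_subrep(1)[OF rT zspace_subrep[OF rT] i] by auto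
  obtain p where p: "is_quot S ?V p" using quot_exists[OF rS V] .
  obtain q where q: "is_quot T ?W q" using quot_exists[OF rT W] .
  have rS': "is_rep (qspace S p) (qmap A p)" and rT': "is_rep (qspace T q) (qmap B q)"
    using quot_is_rep[OF rS V p] quot_is_rep[OF rT W q] .
  have pV: "{0} = p k ` ?V k" if k: "k \<in> I" for k
    using is_quotD(3)[OF p k] subrepD(3)[OF V k] cv.subspace_0[OF subrepD(1)[OF V k]] by (auto intro!: image_eqI[of _ _ 0] simp: set_eq_iff)
  have qW: "{0} = q k ` ?W k" if k: "k \<in> I" for k
    using is_quotD(3)[OF q k] subrepD(3)[OF W k] cv.subspace_0[OF subrepD(1)[OF W k]] by (auto intro!: image_eqI[of _ _ 0] simp: set_eq_iff)
  have shS: "socle_string (qspace S p) (qmap A p) w zspace = socle_string S A w ?V"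
    "\<And>k. k \<in> I \<Longrightarrow> socw (qspace S p) (qmap A p) w zspace k = p k ` socw S A w ?V k"
    using quot_shift[OF rS V p V order_refl pV w] by auto
  have shT: "socle_string (qspace T q) (qmap B q) w zspace = socle_string T B w ?W"
    "\<And>k. k \<in> I \<Longrightarrow> socw (qspace T q) (qmap B q) w zspace k = q k ` socw T B w ?W k"
    using quot_shift[OF rT W q W order_refl qW w] by auto
  have "isomorphic (qspace S p) (qmap A p) (qspace T q) (qmap B q)"
  proof (rule Cons.IH[OF rS' rT' ext_orth_soc_quot[OF rS Cons.prems(3) i p] ext_orth_soc_quot[OF rT Cons.prems(4) i q] w])
    show "socw (qspace S p) (qmap A p) w zspace k = p k ` S k" if "k \<in> I" for k
      using shS(2)[OF that] Cons.prems(6)[OF that] by simp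
    show "socw (qspace T q) (qmap B q) w zspace k = q k ` T k" if "k \<in> I" for k
      using shT(2)[OF that] Cons.prems(7)[OF that] by simp
    show "socle_string (qspace S p) (qmap A p) w zspace = socle_string (qspace T q) (qmap B q) w zspace"
      using shS(1) shT(1) Cons.prems(8) by simp
  qed
  then obtain h where h: "rep_iso (qspace S p) (qmap A p) (qspace T q) (qmap B q) h" by (auto simp: isomorphic_def)
  then have hh: "rep_hom (qspace S p) (qmap A p) (qspace T q) (qmap B q) h"
    and hm: "maps (qspace S p) (qspace T q) h" and hb: "\<And>k. k \<in> I \<Longrightarrow> bij_betw (h k) (p k ` S k) (q k ` T k)"
    by (auto simp: rep_iso_def rep_hom_def)
  define Z where "Z = ?V i"
  define Y where "Y = ?W i"
  have Z: "cv.subspace Z" "Z \<subseteq> S i" "fd Z" and Y: "cv.subspace Y" "Y \<subseteq> T i" "fd Y"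
    using subrepD(1,2)[OF V i] subrepD(1,2)[OF W i] fd_subset[OF is_repD(2)[OF rS i]] fd_subset[OF is_repD(2)[OF rT i]]
    by (auto simp: Z_def Y_def)
  have "cv.dim Z = cv.dim Y"
  proof -
    have "cv.dim {0 :: 'v} = 0" "cv.dim {0 :: 'w} = 0"
      by (subst dim_zero_iff; auto simp: fd_def intro!: exI[of _ "{}"])+
    then show ?thesis using Cons.prems(8) by (simp add: Z_def Y_def)
  qed
  then obtain s where s: "lin_on Z s" "bij_betw s Z Y" using dim_eq_iso[OF Z(3,1) Y(3,1)] by metis
  have sY: "s z \<in> Y" if "z \<in> Z" for z using s(2) that by (auto simp: bij_betw_def)
  have pid: "p k x = x" if "k \<in> I" "k \<noteq> i" "x \<in> S k" for k x using soc_quot_id[OF rS i p that] .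
  have qid: "q k x = x" if "k \<in> I" "k \<noteq> i" "x \<in> T k" for k x using soc_quot_id[OF rT i q that] .
  have pS: "p k x \<in> S k" and ppx: "p k (p k x) = p k x" and pl: "lin_on (S k) (p k)" if "k \<in> I" "x \<in> S k" for k x
    using is_quotD(1,2,5)[OF p] that by auto
  have qT: "q k x \<in> T k" and qqx: "q k (q k x) = q k x" and ql: "lin_on (T k) (q k)" if "k \<in> I" "x \<in> T k" for k x
    using is_quotD(1,2,5)[OF q] that by auto
  have zmem: "x - p i x \<in> Z" if "x \<in> S i" for x using is_quotD(4)[OF p i that] by (simp add: Z_def)
  have hq: "h k (p k x) \<in> q k ` T k" if "k \<in> I" "x \<in> S k" for k x using mapsD(2)[OF hm] that by blast
  have hT: "h k (p k x) \<in> T k" and qh: "q k (h k (p k x)) = h k (p k x)" if "k \<in> I" "x \<in> S k" for k x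
    using hq[OF that] qT[OF that(1)] qqx[OF that(1)] by auto
  (* The socle and its complement at i are mapped by s and h separately. *)
  define \<theta> where "\<theta> = (\<lambda>k x. (if k = i then s (x - p k x) else 0) + h k (p k x))"
  have \<theta>T: "\<theta> k x \<in> T k" if k: "k \<in> I" "x \<in> S k" for k x
    using hT[OF k] sY[OF zmem] Y(2) is_repD(1)[OF rT k(1)] k by (auto simp: \<theta>_def intro!: cv.subspace_add)
  have \<theta>l: "lin_on (S k) (\<theta> k)" if k: "k \<in> I" for k
  proof -
    have pl: "lin_on (S k) (p k)" using is_quotD(1)[OF p k] .
    have 1: "lin_on (S k) (\<lambda>x. h k (p k x))" by (rule lin_on_comp[OF pl _ mapsD(1)[OF hm k]]) auto
    show ?thesis
    proof (cases "k = i")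
      case True
      have "lin_on (S k) (\<lambda>x. s (x - p k x))"
        by (rule lin_on_comp[OF lin_on_minus_fun[OF lin_on_id pl] _ s(1)]) (use zmem True in auto)
      from lin_on_plus[OF this 1] show ?thesis using True by (simp add: \<theta>_def)
    qed (use 1 in \<open>simp add: \<theta>_def\<close>)
  qed
  have \<theta>m: "maps S T \<theta>" unfolding maps_def using \<theta>l \<theta>T by blast
  have q\<theta>: "q k (\<theta> k x) = h k (p k x)" if k: "k \<in> I" "x \<in> S k" for k x
  proof (cases "k = i")
    case True
    have sT: "s (x - p k x) \<in> T k" using sY[OF zmem] True k Y(2) by auto
    have "q k (\<theta> k x) = q k (s (x - p k x)) + q k (h k (p k x))"
      using lin_on_add[OF is_quotD(1)[OF q k(1)] sT hT[OF k]] True by (simp add: \<theta>_def)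
    moreover have "q k (s (x - p k x)) = 0" using is_quotD(3)[OF q k(1) sT] sY[OF zmem] True k by (simp add: Y_def)
    ultimately show ?thesis using qh[OF k] by simp
  qed (use qh[OF k] in \<open>simp add: \<theta>_def\<close>)
  have hinj: "x = 0" if "k \<in> I" "x \<in> p k ` S k" "h k x = 0" for k x
    using lin_on_inj_iff[OF mapsD(1)[OF hm that(1)] is_repD(1)[OF rS' that(1)]] hb[OF that(1)] that(2,3)
    by (auto simp: bij_betw_def)
  have \<theta>b: "bij_betw (\<theta> k) (S k) (T k)" if k: "k \<in> I" for k
    unfolding bij_betw_def
  proof
    show "inj_on (\<theta> k) (S k)"
      unfolding lin_on_inj_iff[OF \<theta>l[OF k] is_repD(1)[OF rS k]]
    proof (intro ballI impI)
      fix x assume x: "x \<in> S k" "\<theta> k x = 0"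
      have "h k (p k x) = 0" using q\<theta>[OF k x(1)] x(2) lin_on_zero[OF is_quotD(1)[OF q k] is_repD(1)[OF rT k]] by simp
      then have px: "p k x = 0" using hinj[OF k] x(1) by blast
      have h0: "h k 0 = 0" using lin_on_zero[OF mapsD(1)[OF hm k] is_repD(1)[OF rS' k]] .
      show "x = 0"
      proof (cases "k = i")
        case True
        have "s x = 0" using x(2) px h0 True by (simp add: \<theta>_def)
        moreover have "x \<in> Z" using zmem[of x] x(1) px True by simp
        ultimately show ?thesis using lin_on_inj_iff[OF s(1) Z(1)] s(2) by (auto simp: bij_betw_def)
      next
        case False then show ?thesis using pid[OF k False x(1)] px by simp
      qed
    qed
    show "\<theta> k ` S k = T k"
    proof
      show "\<theta> k ` S k \<subseteq> T k" using \<theta>T[OF k] by blast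
      show "T k \<subseteq> \<theta> k ` S k"
      proof
        fix y assume y: "y \<in> T k"
        then have "q k y \<in> h k ` p k ` S k" using hb[OF k] by (auto simp: bij_betw_def)
        then obtain a where a: "a \<in> S k" "q k y = h k (p k a)" by auto
        show "y \<in> \<theta> k ` S k"
        proof (cases "k = i")
          case False
          have "\<theta> k a = y" using a qid[OF k False y] False by (simp add: \<theta>_def)
          then show ?thesis using a by blast
        next
          case True
          have "y - q k y \<in> Y" using is_quotD(4)[OF q k y] True by (simp add: Y_def)
          then have "y - q k y \<in> s ` Z" using s(2) by (simp add: bij_betw_def)
          then obtain z where z: "z \<in> Z" "s z = y - q k y" by auto
          have zS: "z \<in> S k" "p k z = 0" using z(1) Z(2) is_quotD(3)[OF p i] True by (auto simp: Z_def)
          have pa: "p k a \<in> S k" using pS[OF k a(1)] .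
          have pz: "p k (z + p k a) = p k a"
            using lin_on_add[OF is_quotD(1)[OF p k] zS(1) pa] zS(2) ppx[OF k a(1)] by simp
          have "\<theta> k (z + p k a) = y" using z(2) a(2) True pz by (simp add: \<theta>_def)
          moreover have "z + p k a \<in> S k" using zS pa is_repD(1)[OF rS k] cv.subspace_add by blast
          ultimately show ?thesis by blast
        qed
      qed
    qed
  qed
  define C where "C = (\<lambda>k l x. inv_into (S l) (\<theta> l) (B k l (\<theta> k x)))"
  have rC: "is_rep S C" and isoC: "rep_iso S C T B \<theta>"
    using transport[OF rT is_repD(1)[OF rS] is_repD(2)[OF rS] \<theta>m \<theta>b] by (auto simp: C_def)
  have oC: "ext_orth S C S C" using ext_orth_iso[OF rC rT isoC Cons.prems(4)] .
  have \<theta>C: "\<theta> l (C k l x) = B k l (\<theta> k x)" if "(k, l) \<in> E" "x \<in> S k" for k l x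
    using isoC that by (auto simp: rep_iso_def rep_hom_def)
  have hA: "h l (p l (A k l x)) = q l (B k l (h k (p k x)))" if E: "(k, l) \<in> E" and x: "x \<in> S k" for k l x
    using rep_homD(2)[OF hh E, of "p k x"] quot_comm[OF rS V p E x] x by auto
  have "isomorphic S A S C"
  proof (rule rigid_lift_unique[OF rS rC i Cons.prems(3) oC])
    fix k l x assume E: "(k, l) \<in> E" and l: "l \<noteq> i" and x: "x \<in> S k"
    have kl: "k \<in> I" "l \<in> I" using E E_I by auto
    have Ax: "A k l x \<in> S l" using is_repD(4)[OF rS E x] .
    have "B k l (\<theta> k x) = B k l (h k (p k x))"
    proof (cases "k = i")
      case True
      have "B i l (s (x - p i x)) = 0"
        using sY[OF zmem] x True E soc_mem[of _ T B i] by (auto simp: Y_def nb_def)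
      moreover have "B k l (s (x - p i x) + h k (p k x)) = B k l (s (x - p i x)) + B k l (h k (p k x))"
        using lin_on_add[OF is_repD(3)[OF rT E]] sY[OF zmem] Y(2) x True hT[OF kl(1) x] by blast
      ultimately show ?thesis using True by (simp add: \<theta>_def)
    qed (simp add: \<theta>_def)
    moreover have "B k l (h k (p k x)) = \<theta> l (A k l x)"
      using hA[OF E x] qid[OF kl(2) l is_repD(4)[OF rT E hT[OF kl(1) x]]] l by (simp add: \<theta>_def)
    ultimately have "\<theta> l (A k l x) = \<theta> l (C k l x)" using \<theta>C[OF E x] by simp
    then show "A k l x = C k l x"
      using \<theta>b[OF kl(2)] Ax is_repD(4)[OF rC E x] by (auto simp: bij_betw_def dest: inj_onD)
  next
    fix j l x assume j: "j \<in> nb i" and l: "l \<in> nb i" and x: "x \<in> S j"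
    note n = nbD[OF j]
    have Ax: "A j i x \<in> S i" and Cx: "C j i x \<in> S i" using is_repD(4)[OF rS n(2) x] is_repD(4)[OF rC n(2) x] by auto
    have "h i (p i (C j i x)) = q i (B j i (\<theta> j x))" using q\<theta>[OF i Cx] \<theta>C[OF n(2) x] by simp
    also have "\<theta> j x = h j (p j x)" using n(5) by (simp add: \<theta>_def)
    also have "q i (B j i (h j (p j x))) = h i (p i (A j i x))" using hA[OF n(2) x] by simp
    finally have "h i (p i (C j i x)) = h i (p i (A j i x))" .
    then have "p i (C j i x) = p i (A j i x)" using hb[OF i] Ax Cx by (auto simp: bij_betw_def dest: inj_onD)
    then have "p i (C j i x - A j i x) = 0"
      using lin_on_diff[OF is_quotD(1)[OF p i] is_repD(1)[OF rS i] Cx Ax] by simp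
    then have "C j i x - A j i x \<in> ?V i"
      using is_quotD(3)[OF p i] cv.subspace_diff[OF is_repD(1)[OF rS i] Cx Ax] by blast
    then show "A i l (C j i x - A j i x) = 0" using soc_mem l by blast
  qed
  moreover have "isomorphic S C T B" using isoC by (auto simp: isomorphic_def)
  ultimately show ?case by (rule isomorphic_trans)
qed

section \<open>Direct sums\<close>

text \<open>
  All summands live in one type and share the maps \<open>A\<close> of the arrows, as submodules of one module
  do.
\<close>

definition dspace where
  "dspace L S = (\<lambda>i. fam L (\<lambda>l. S l i))"

definition dmap where
  "dmap L A = (\<lambda>i j v l. if l \<in> L then A i j (v l) else 0)"

definition single :: "'l \<Rightarrow> 'v::cvector \<Rightarrow> 'l \<Rightarrow> 'v" where
  "single l x = (\<lambda>k. if k = l then x else 0)"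

lemma single_same [simp]: "single l x l = x"
  by (simp add: single_def)

lemma lin_on_single: "lin_on V (single l)"
  by (auto simp: single_def lin_on_def fun_eq_iff cscale_apply)

lemma single_mem: "l \<in> L \<Longrightarrow> x \<in> S l i \<Longrightarrow> (\<And>l. l \<in> L \<Longrightarrow> 0 \<in> S l i) \<Longrightarrow> single l x \<in> dspace L S i"
  by (auto simp: single_def dspace_def fam_def)

lemma dspaceD: "v \<in> dspace L S i \<Longrightarrow> l \<in> L \<Longrightarrow> v l \<in> S l i" "v \<in> dspace L S i \<Longrightarrow> l \<notin> L \<Longrightarrow> v l = 0"
  by (auto simp: dspace_def fam_def)

lemma sum_single:
  assumes "finite L" "v \<in> dspace L S i"
  shows "(\<Sum>l\<in>L. single l (v l)) = v"
proof
  fix k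
  have "(\<Sum>l\<in>L. single l (v l)) k = (\<Sum>l\<in>L. if l = k then v k else 0)"
    unfolding sum_fun_apply by (rule sum.cong) (auto simp: single_def)
  also have "\<dots> = v k" using assms dspaceD(2)[OF assms(2)] by auto
  finally show "(\<Sum>l\<in>L. single l (v l)) k = v k" .
qed

lemma lin_on_coord: "lin_on V (\<lambda>v. v l)"
  by (auto simp: lin_on_def cscale_apply)

lemma lin_on_at: "l \<in> L \<Longrightarrow> lin_on (S l i) g \<Longrightarrow> lin_on (dspace L S i) (\<lambda>v. g (v l))"
  by (auto simp: lin_on_def dspace_def fam_def cscale_apply)

lemma lin_on_fun: "(\<And>l. lin_on V (\<lambda>v. f v l)) \<Longrightarrow> lin_on V f"
  by (auto simp: lin_on_def fun_eq_iff cscale_apply)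

context
  fixes L :: "'l set" and S :: "'l \<Rightarrow> 'i \<Rightarrow> 'v::cvector set" and A :: "'i \<Rightarrow> 'i \<Rightarrow> 'v \<Rightarrow> 'v"
  assumes finL: "finite L" and rep: "\<And>l. l \<in> L \<Longrightarrow> is_rep (S l) A"
begin

lemma dmap_lin:
  assumes "\<And>l. l \<in> L \<Longrightarrow> lin_on (S l i) (A i j)"
  shows "lin_on (dspace L S i) (dmap L A i j)"
proof (rule lin_on_fun)
  fix l show "lin_on (dspace L S i) (\<lambda>v. dmap L A i j v l)"
  proof (cases "l \<in> L")
    case True
    have "lin_on (dspace L S i) (\<lambda>v. A i j (v l))"
      by (rule lin_on_at[where S = S, OF True assms[OF True]])
    then show ?thesis using True by (simp add: dmap_def)
  qed (simp add: dmap_def lin_on_const0)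
qed

lemma dsum_is_rep: "is_rep (dspace L S) (dmap L A)"
  unfolding is_rep_def
proof (intro conjI ballI allI impI)
  fix i assume i: "i \<in> I"
  show "cv.subspace (dspace L S i)" unfolding dspace_def by (rule subspace_fam) (rule is_repD(1)[OF rep i])
  show "fd (dspace L S i)" unfolding dspace_def
    by (rule fam_fd_dim[THEN conjunct1, OF finL is_repD(1)[OF rep i] is_repD(2)[OF rep i]])
  fix v assume v: "v \<in> dspace L S i"
  show "mesh (dmap L A) i v = 0"
  proof
    fix l
    show "mesh (dmap L A) i v l = 0 l"
    proof (cases "l \<in> L")
      case True
      then have "mesh (dmap L A) i v l = mesh A i (v l)" by (simp add: mesh_def sum_fun_apply cscale_apply dmap_def)
      then show ?thesis using is_repD(5)[OF rep[OF True] i dspaceD(1)[OF v True]] by simp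
    qed (simp add: mesh_def sum_fun_apply cscale_apply dmap_def)
  qed
next
  fix i j assume E: "(i, j) \<in> E"
  show "lin_on (dspace L S i) (dmap L A i j)" by (rule dmap_lin) (rule is_repD(3)[OF rep E])
  show "dmap L A i j v \<in> dspace L S j" if "v \<in> dspace L S i" for v
    using is_repD(4)[OF rep E] dspaceD(1)[OF that] by (auto simp: dspace_def fam_def dmap_def)
qed

lemma zero_mem: "i \<in> I \<Longrightarrow> l \<in> L \<Longrightarrow> 0 \<in> S l i"
  using is_repD(6)[OF rep] .

lemma single_dspace: "i \<in> I \<Longrightarrow> l \<in> L \<Longrightarrow> x \<in> S l i \<Longrightarrow> single l x \<in> dspace L S i"
  using single_mem zero_mem by metis

lemma dmap_single:
  assumes "(i, j) \<in> E" "l \<in> L" shows "dmap L A i j (single l x) = single l (A i j x)"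
  using is_repD(7)[OF rep[OF assms(2)] assms(1)] assms(2) by (auto simp: dmap_def single_def fun_eq_iff)

text \<open>
  A cocycle on the sum is a matrix of cocycles, and the maps that bound its entries form a matrix
  that bounds it.
\<close>

lemma dsum_ext_orth:
  assumes o: "\<And>l m. l \<in> L \<Longrightarrow> m \<in> L \<Longrightarrow> ext_orth (S l) A (S m) A"
  shows "ext_orth (dspace L S) (dmap L A) (dspace L S) (dmap L A)"
  unfolding ext_orth_def
proof (intro allI impI)
  let ?S = "dspace L S" and ?A = "dmap L A"
  fix g assume g: "cocycle ?S ?A ?S ?A g"
  define c where "c = (\<lambda>l m i j x. g i j (single l x) m)"
  have "coboundary (S l) A (S m) A (c l m)" if l: "l \<in> L" and m: "m \<in> L" for l m
  proof -
    have "cocycle (S l) A (S m) A (c l m)"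
      unfolding cocycle_def
    proof (intro conjI allI impI ballI)
      fix i j assume E: "(i, j) \<in> E"
      then have i: "i \<in> I" using E_I by blast
      have "lin_on (S l i) (\<lambda>x. g i j (single l x))"
        by (rule lin_on_comp[OF lin_on_single single_dspace[OF i l] cocycleD(1)[OF g E]])
      from lin_on_comp[OF this _ lin_on_coord[of UNIV]]
      show "lin_on (S l i) (c l m i j)" unfolding c_def by blast
      show "c l m i j x \<in> S m j" if "x \<in> S l i" for x
        using dspaceD(1)[OF cocycleD(2)[OF g E single_dspace[OF i l that]] m] by (simp add: c_def)
    next
      fix i x assume i: "i \<in> I" and x: "x \<in> S l i"
      have "(\<Sum>j\<in>nb i. eps i j *\<^sub>C (A j i (c l m i j x) + c l m j i (A i j x)))
          = (\<Sum>j\<in>nb i. eps i j *\<^sub>C (?A j i (g i j (single l x)) + g j i (?A i j (single l x)))) m"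
        unfolding sum_fun_apply
      proof (rule sum.cong)
        fix j assume "j \<in> nb i"
        then have e: "?A i j (single l x) = single l (A i j x)" using dmap_single[OF nbD(1) l] by blast
        show "eps i j *\<^sub>C (A j i (c l m i j x) + c l m j i (A i j x)) = (eps i j *\<^sub>C (?A j i (g i j (single l x)) + g j i (?A i j (single l x)))) m"
          unfolding c_def e using m by (simp add: cscale_apply dmap_def)
      qed simp
      then show "(\<Sum>j\<in>nb i. eps i j *\<^sub>C (A j i (c l m i j x) + c l m j i (A i j x))) = 0"
        using cocycleD(3)[OF g i single_dspace[OF i l x]] by simp
    qed
    then show ?thesis using o[OF l m] unfolding ext_orth_def by blast
  qed
  then have "\<forall>l m. \<exists>f. l \<in> L \<longrightarrow> m \<in> L \<longrightarrow> maps (S l) (S m) f \<and>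
     (\<forall>i j. (i, j) \<in> E \<longrightarrow> (\<forall>x\<in>S l i. c l m i j x = f j (A i j x) - A i j (f i x)))"
    unfolding coboundary_def by blast
  then obtain f where f: "\<And>l m. l \<in> L \<Longrightarrow> m \<in> L \<Longrightarrow> maps (S l) (S m) (f l m)"
    "\<And>l m i j x. l \<in> L \<Longrightarrow> m \<in> L \<Longrightarrow> (i, j) \<in> E \<Longrightarrow> x \<in> S l i \<Longrightarrow> c l m i j x = f l m j (A i j x) - A i j (f l m i x)"
    by metis
  define F where "F = (\<lambda>i v m. if m \<in> L then (\<Sum>l\<in>L. f l m i (v l)) else 0)"
  have "maps ?S ?S F"
    unfolding maps_def
  proof (intro ballI conjI)
    fix i assume i: "i \<in> I"
    show "lin_on (?S i) (F i)"
    proof (rule lin_on_fun)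
      fix m show "lin_on (?S i) (\<lambda>v. F i v m)"
      proof (cases "m \<in> L")
        case True
        have "lin_on (?S i) (\<lambda>v. \<Sum>l\<in>L. f l m i (v l))"
        proof (rule lin_on_sum_fun)
          fix l assume l: "l \<in> L"
          show "lin_on (?S i) (\<lambda>v. f l m i (v l))"
            by (rule lin_on_at[where S = S, OF l mapsD(1)[OF f(1)[OF l True] i]])
        qed
        then show ?thesis using True by (simp add: F_def)
      qed (simp add: F_def lin_on_const0)
    qed
    show "F i v \<in> ?S i" if v: "v \<in> ?S i" for v
    proof -
      have "(\<Sum>l\<in>L. f l m i (v l)) \<in> S m i" if m: "m \<in> L" for m
        using is_repD(1)[OF rep[OF m] i] mapsD(2)[OF f(1)[OF _ m] i dspaceD(1)[OF v]] by (intro cv.subspace_sum)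
      then show ?thesis by (auto simp: F_def dspace_def fam_def)
    qed
  qed
  moreover have "g i j v = F j (?A i j v) - ?A i j (F i v)" if E: "(i, j) \<in> E" and v: "v \<in> ?S i" for i j v
  proof
    fix m
    have ij: "i \<in> I" "j \<in> I" using E E_I by auto
    have gS: "g i j v \<in> ?S j" using cocycleD(2)[OF g E v] .
    show "g i j v m = (F j (?A i j v) - ?A i j (F i v)) m"
    proof (cases "m \<in> L")
      case False then show ?thesis using dspaceD(2)[OF gS False] by (simp add: F_def dmap_def)
    next
      case m: True
      have "g i j v = g i j (\<Sum>l\<in>L. single l (v l))" using sum_single[OF finL v] by simp
      also have "\<dots> = (\<Sum>l\<in>L. g i j (single l (v l)))"
        by (rule lin_on_sum[OF cocycleD(1)[OF g E] is_repD(1)[OF dsum_is_rep ij(1)]])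
          (rule single_dspace[OF ij(1) _ dspaceD(1)[OF v]])
      finally have "g i j v m = (\<Sum>l\<in>L. c l m i j (v l))" by (simp add: sum_fun_apply c_def)
      also have "\<dots> = (\<Sum>l\<in>L. f l m j (A i j (v l)) - A i j (f l m i (v l)))"
        by (rule sum.cong) (use f(2)[OF _ m E dspaceD(1)[OF v]] in auto)
      also have "\<dots> = (\<Sum>l\<in>L. f l m j (A i j (v l))) - (\<Sum>l\<in>L. A i j (f l m i (v l)))" by (rule sum_subtractf)
      also have "(\<Sum>l\<in>L. A i j (f l m i (v l))) = A i j (\<Sum>l\<in>L. f l m i (v l))"
        by (rule lin_on_sum[OF is_repD(3)[OF rep[OF m] E] is_repD(1)[OF rep[OF m] ij(1)], symmetric])
          (rule mapsD(2)[OF f(1)[OF _ m] ij(1) dspaceD(1)[OF v]])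
      finally show ?thesis using m by (simp add: F_def dmap_def)
    qed
  qed
  ultimately show "coboundary ?S ?A ?S ?A g" unfolding coboundary_def by blast
qed

lemma dsum_step:
  assumes V: "\<And>k. k \<in> I \<Longrightarrow> V k = dspace L W k" and i: "i \<in> I" and k: "k \<in> I"
  shows "step (dspace L S) (dmap L A) i V k = dspace L (\<lambda>l. step (S l) A i (W l)) k"
proof (cases "k = i")
  case False then show ?thesis using V[OF k] by (simp add: step_other dspace_def)
next
  case True
  have "dmap L A i j v \<in> V j \<longleftrightarrow> (\<forall>l\<in>L. A i j (v l) \<in> W l j)" if "j \<in> nb i" for j v
    using V[OF nbD(4)[OF that]] by (auto simp: dspace_def fam_def dmap_def)
  then show ?thesis unfolding True by (auto simp: step_same dspace_def fam_def)
qed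

lemma dsum_socw:
  assumes "set w \<subseteq> I" "\<And>k. k \<in> I \<Longrightarrow> V k = dspace L W k" "\<And>l. l \<in> L \<Longrightarrow> subrep (S l) A (W l)"
  shows "(\<forall>k\<in>I. socw (dspace L S) (dmap L A) w V k = dspace L (\<lambda>l. socw (S l) A w (W l)) k) \<and>
    length (socle_string (dspace L S) (dmap L A) w V) = length w \<and>
    (\<forall>n<length w. socle_string (dspace L S) (dmap L A) w V ! n = (\<Sum>l\<in>L. socle_string (S l) A w (W l) ! n))"
  using assms
proof (induction w arbitrary: V W)
  case (Cons i w)
  have i: "i \<in> I" "set w \<subseteq> I" using Cons.prems by auto
  let ?V = "step (dspace L S) (dmap L A) i V" and ?W = "\<lambda>l. step (S l) A i (W l)"
  have V: "?V k = dspace L ?W k" if "k \<in> I" for k using dsum_step[OF Cons.prems(2) i(1) that] .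
  have W: "subrep (S l) A (?W l)" if "l \<in> L" for l using step_subrep(1)[OF rep[OF that] Cons.prems(3)[OF that] i(1)] .
  have dimd: "cv.dim (dspace L X i) = (\<Sum>l\<in>L. cv.dim (X l i))" if "\<And>l. l \<in> L \<Longrightarrow> subrep (S l) A (X l)" for X
    unfolding dspace_def
  proof (rule fam_fd_dim[THEN conjunct2, OF finL])
    fix l assume l: "l \<in> L"
    show "cv.subspace (X l i)" by (rule subrepD(1)[OF that[OF l] i(1)])
    show "fd (X l i)" by (rule fd_subset[OF is_repD(2)[OF rep[OF l] i(1)] subrepD(2)[OF that[OF l] i(1)]])
  qed
  have "cv.dim (?V i) - cv.dim (V i) = (\<Sum>l\<in>L. cv.dim (?W l i) - cv.dim (W l i))"
  proof -
    have "cv.dim (W l i) \<le> cv.dim (?W l i)" if l: "l \<in> L" for l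
      by (rule dim_mono_fd[OF fd_subset[OF is_repD(2)[OF rep[OF l] i(1)] subrepD(2)[OF W[OF l] i(1)]]
            step_subrep(2)[OF rep[OF l] Cons.prems(3)[OF l] i(1) i(1)]])
    then show ?thesis using V[OF i(1)] Cons.prems(2)[OF i(1)] dimd[OF W] dimd[OF Cons.prems(3)]
      by (simp add: sum_subtractf_nat)
  qed
  then have d: "socle_string (dspace L S) (dmap L A) (i # w) V ! 0 = (\<Sum>l\<in>L. socle_string (S l) A (i # w) (W l) ! 0)" by simp
  note IH = Cons.IH[OF i(2) V W]
  show ?case
  proof (intro conjI allI impI)
    show "\<forall>k\<in>I. socw (dspace L S) (dmap L A) (i # w) V k = dspace L (\<lambda>l. socw (S l) A (i # w) (W l)) k"
      using IH by simp
    show "length (socle_string (dspace L S) (dmap L A) (i # w) V) = length (i # w)" using IH by simp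
    fix n assume n: "n < length (i # w)"
    show "socle_string (dspace L S) (dmap L A) (i # w) V ! n = (\<Sum>l\<in>L. socle_string (S l) A (i # w) (W l) ! n)"
    proof (cases n)
      case 0 then show ?thesis using d by simp
    next
      case (Suc m) then show ?thesis using IH n by simp
    qed
  qed
qed simp

end

section \<open>Endomorphisms of indecomposable representations\<close>

definition rep_indec where
  "rep_indec S A \<longleftrightarrow> (\<exists>i\<in>I. S i \<noteq> {0}) \<and>
     (\<forall>V W. subrep S A V \<longrightarrow> subrep S A W \<longrightarrow> (\<forall>i\<in>I. V i \<inter> W i = {0} \<and> (\<forall>x\<in>S i. \<exists>v\<in>V i. \<exists>w\<in>W i. x = v + w)) \<longrightarrow>
        (\<forall>i\<in>I. V i = {0}) \<or> (\<forall>i\<in>I. W i = {0}))"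

definition bij_fam where
  "bij_fam S f \<longleftrightarrow> (\<forall>i\<in>I. bij_betw (f i) (S i) (S i))"

lemma hom_ker_subrep:
  assumes r: "is_rep S A" and f: "rep_hom S A T B f" and rT: "is_rep T B"
  shows "subrep S A (\<lambda>i. {x \<in> S i. f i x = 0})"
  unfolding subrep_def
proof (intro conjI ballI allI impI)
  fix i assume i: "i \<in> I"
  show "cv.subspace {x \<in> S i. f i x = 0}"
    by (rule subspace_lin_ker[OF mapsD(1)[OF rep_homD(1)[OF f] i] is_repD(1)[OF r i]])
next
  fix i j x assume "(i, j) \<in> E" "x \<in> {x \<in> S i. f i x = 0}"
  then show "A i j x \<in> {x \<in> S j. f j x = 0}"
    using rep_homD(2)[OF f] is_repD(4)[OF r] is_repD(7)[OF rT] by auto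
qed auto

lemma hom_im_subrep:
  assumes r: "is_rep S A" and f: "rep_hom S A T B f"
  shows "subrep T B (\<lambda>i. f i ` S i)"
  unfolding subrep_def
proof (intro conjI ballI allI impI)
  fix i assume i: "i \<in> I"
  show "cv.subspace (f i ` S i)"
    by (rule subspace_lin_image[OF mapsD(1)[OF rep_homD(1)[OF f] i] is_repD(1)[OF r i]])
  show "f i ` S i \<subseteq> T i" using mapsD(2)[OF rep_homD(1)[OF f] i] by auto
next
  fix i j y assume E: "(i, j) \<in> E" and "y \<in> f i ` S i"
  then obtain x where x: "x \<in> S i" "y = f i x" by auto
  then show "B i j y \<in> f j ` S j" using rep_homD(2)[OF f E x(1)] is_repD(4)[OF r E x(1)] by (metis image_eqI)
qed

lemma hom_funpow: "rep_hom S A S A f \<Longrightarrow> rep_hom S A S A (\<lambda>i. f i ^^ n)"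
proof (induction n)
  case 0 then show ?case by (simp add: rep_hom_def maps_def lin_on_def)
next
  case (Suc n)
  from rep_hom_comp[OF Suc.IH[OF Suc.prems] Suc.prems] show ?case by (simp add: comp_def)
qed

lemma inj_fam_bij:
  assumes r: "is_rep S A" and f: "maps S S f" and inj: "\<And>i x. i \<in> I \<Longrightarrow> x \<in> S i \<Longrightarrow> f i x = 0 \<Longrightarrow> x = 0"
  shows "bij_fam S f"
  unfolding bij_fam_def
proof
  fix i assume i: "i \<in> I"
  have "inj_on (f i) (S i)"
    unfolding lin_on_inj_iff[OF mapsD(1)[OF f i] is_repD(1)[OF r i]] using inj[OF i] by blast
  moreover have "f i ` S i = S i"
    by (rule inj_endo_surj[OF is_repD(2)[OF r i] is_repD(1)[OF r i] mapsD(1)[OF f i] _ calculation])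
      (use mapsD(2)[OF f i] in auto)
  ultimately show "bij_betw (f i) (S i) (S i)" by (simp add: bij_betw_def)
qed

text \<open>
  The ranks of the powers of \<open>f\<close> become stationary at some n; then the kernel and the image of the
  n-th power are complementary subrepresentations.
\<close>

lemma fitting:
  assumes r: "is_rep S A" and ind: "rep_indec S A" and f: "rep_hom S A S A f"
  obtains "bij_fam S f" | n where "\<And>i x. i \<in> I \<Longrightarrow> x \<in> S i \<Longrightarrow> (f i ^^ n) x = 0"
proof -
  have hp: "rep_hom S A S A (\<lambda>i. f i ^^ n)" for n by (rule hom_funpow[OF f])
  note fm = mapsD[OF rep_homD(1)[OF f]]
  note pm = mapsD[OF rep_homD(1)[OF hp]]
  define D where "D = (\<lambda>n. \<Sum>i\<in>I. cv.dim ((f i ^^ n) ` S i))"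
  have subset: "(f i ^^ Suc n) ` S i \<subseteq> (f i ^^ n) ` S i" if i: "i \<in> I" for i n
  proof
    fix y assume "y \<in> (f i ^^ Suc n) ` S i"
    then obtain x where "x \<in> S i" "y = (f i ^^ n) (f i x)" by (auto simp: funpow_swap1)
    then show "y \<in> (f i ^^ n) ` S i" using fm(2)[OF i] by blast
  qed
  have fdim: "fd ((f i ^^ n) ` S i)" if i: "i \<in> I" for i n
    using pm(2)[OF i] fd_subset[OF is_repD(2)[OF r i]] by blast
  have dle: "cv.dim ((f i ^^ Suc n) ` S i) \<le> cv.dim ((f i ^^ n) ` S i)" if "i \<in> I" for i n
    by (rule dim_mono_fd[OF fdim subset]) (use that in auto)
  have "\<exists>n. D (Suc n) = D n"
  proof (rule ccontr)
    assume no: "\<nexists>n. D (Suc n) = D n"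
    have "D (Suc n) \<le> D n" for n unfolding D_def by (rule sum_mono) (rule dle)
    then have "D (Suc n) < D n" for n using no by (metis le_neq_implies_less)
    then have "D n + n \<le> D 0" for n
    proof (induction n)
      case (Suc n)
      have "D (Suc n) < D n" by (rule Suc.prems)
      moreover have "D n + n \<le> D 0" by (rule Suc.IH[OF Suc.prems])
      ultimately show ?case by simp
    qed simp
    from this[of "Suc (D 0)"] show False by simp
  qed
  then obtain n where n: "D (Suc n) = D n" by blast
  have "\<forall>i\<in>I. cv.dim ((f i ^^ Suc n) ` S i) = cv.dim ((f i ^^ n) ` S i)"
  proof (rule ccontr)
    assume "\<not> ?thesis"
    then obtain i where "i \<in> I" "cv.dim ((f i ^^ Suc n) ` S i) < cv.dim ((f i ^^ n) ` S i)"
      using dle by (metis le_neq_implies_less)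
    then have "D (Suc n) < D n" unfolding D_def using finI dle by (intro sum_strict_mono_ex1) auto
    then show False using n by simp
  qed
  then have eq: "(f i ^^ Suc n) ` S i = (f i ^^ n) ` S i" if i: "i \<in> I" for i
    using subspace_dim_eq[OF fdim[OF i] subspace_lin_image[OF pm(1)[OF i] is_repD(1)[OF r i]] subset[OF i]] i by blast
  (* The restriction of f to the stable image is surjective, hence bijective. *)
  define W where "W = (\<lambda>i. (f i ^^ n) ` S i)"
  define V where "V = (\<lambda>i. {x \<in> S i. (f i ^^ n) x = 0})"
  have W: "subrep S A W" unfolding W_def by (rule hom_im_subrep[OF r hp])
  have V: "subrep S A V" unfolding V_def by (rule hom_ker_subrep[OF r hp r])
  have fW: "f i ` W i = W i" if i: "i \<in> I" for i
    using eq[OF i] by (simp add: W_def image_comp)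
  have inj: "inj_on (f i) (W i)" if i: "i \<in> I" for i
    by (rule surj_endo_inj[OF _ subrepD(1)[OF W i] lin_on_subset[OF fm(1)[OF i] subrepD(2)[OF W i]] fW[OF i]])
      (use fdim[OF i] in \<open>simp add: W_def\<close>)
  have pW: "(f i ^^ m) ` W i = W i \<and> inj_on (f i ^^ m) (W i)" if i: "i \<in> I" for i m
  proof (induction m)
    case (Suc m)
    then have m1: "(f i ^^ m) ` W i = W i" and m2: "inj_on (f i ^^ m) (W i)" by auto
    have "(f i ^^ Suc m) ` W i = f i ` ((f i ^^ m) ` W i)" by (simp add: image_comp)
    moreover have "inj_on (f i \<circ> f i ^^ m) (W i)" by (rule comp_inj_on[OF m2]) (simp add: m1 inj[OF i])
    ultimately show ?case using m1 fW[OF i] by (simp add: comp_def)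
  qed simp
  have "\<forall>i\<in>I. V i \<inter> W i = {0} \<and> (\<forall>x\<in>S i. \<exists>v\<in>V i. \<exists>w\<in>W i. x = v + w)"
  proof (intro ballI conjI)
    fix i assume i: "i \<in> I"
    have linW: "lin_on (W i) (f i ^^ n)" by (rule lin_on_subset[OF pm(1)[OF i] subrepD(2)[OF W i]])
    show "V i \<inter> W i = {0}"
    proof
      show "V i \<inter> W i \<subseteq> {0}"
        using pW[OF i, of n] lin_on_inj_iff[OF linW subrepD(1)[OF W i]] by (auto simp: V_def)
      show "{0} \<subseteq> V i \<inter> W i" using cv.subspace_0 subrepD(1)[OF W i] subrepD(1)[OF V i] by blast
    qed
    fix x assume x: "x \<in> S i"
    then have "(f i ^^ n) x \<in> (f i ^^ n) ` W i" using pW[OF i, of n] by (auto simp: W_def)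
    then obtain w where w: "w \<in> W i" "(f i ^^ n) x = (f i ^^ n) w" by auto
    have wS: "w \<in> S i" using subrepD(3)[OF W i w(1)] .
    have "x - w \<in> V i"
      using lin_on_diff[OF pm(1)[OF i] is_repD(1)[OF r i] x wS] w(2) cv.subspace_diff[OF is_repD(1)[OF r i] x wS]
      by (simp add: V_def)
    then show "\<exists>v\<in>V i. \<exists>w\<in>W i. x = v + w" using w(1) by (intro bexI[of _ "x - w"] bexI[of _ w]) auto
  qed
  then consider "\<forall>i\<in>I. V i = {0}" | "\<forall>i\<in>I. W i = {0}" using ind V W unfolding rep_indec_def by blast
  then show ?thesis
  proof cases
    case 1
    have "bij_fam S f"
    proof (rule inj_fam_bij[OF r rep_homD(1)[OF f]])
      fix i x assume i: "i \<in> I" and x: "x \<in> S i" "f i x = 0"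
      have p0: "(f i ^^ m) 0 = 0" for m using lin_on_zero[OF pm(1)[OF i] is_repD(1)[OF r i]] .
      show "x = 0"
      proof (cases n)
        case 0
        then have "W i = S i" by (simp add: W_def)
        then show ?thesis using inj[OF i] lin_on_inj_iff[OF fm(1)[OF i] is_repD(1)[OF r i]] x by auto
      next
        case (Suc m)
        then have "(f i ^^ n) x = 0" using x p0 by (simp add: funpow_swap1)
        then show ?thesis using 1 i x by (auto simp: V_def)
      qed
    qed
    then show ?thesis by (rule that(1))
  next
    case 2
    then have "(f i ^^ n) x = 0" if "i \<in> I" "x \<in> S i" for i x using that by (auto simp: W_def)
    then show ?thesis by (rule that(2))
  qed
qed

lemma bij_fam_inj: "bij_fam S f \<Longrightarrow> maps S S f \<Longrightarrow> is_rep S A \<Longrightarrow> i \<in> I \<Longrightarrow> x \<in> S i \<Longrightarrow> f i x = 0 \<Longrightarrow> x = 0"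
  using lin_on_inj_iff[of "S i" "f i"] by (auto simp: bij_fam_def bij_betw_def mapsD is_repD(1))

text \<open>
  The endomorphism ring of an indecomposable representation is local: if an automorphism is a sum
  and one summand is not invertible, then that summand is nilpotent relative to the automorphism,
  and the sum of the others is invertible.
\<close>

lemma sum_bij_imp_bij:
  assumes r: "is_rep S A" and ind: "rep_indec S A" and "finite L"
    and f: "\<And>l. l \<in> L \<Longrightarrow> rep_hom S A S A (f l)" and g: "rep_hom S A S A g" "bij_fam S g"
    and sum: "\<And>i x. i \<in> I \<Longrightarrow> x \<in> S i \<Longrightarrow> (\<Sum>l\<in>L. f l i x) = g i x"
  shows "\<exists>l\<in>L. bij_fam S (f l)"
  using assms(3-)
proof (induction L arbitrary: g rule: finite_induct)
  case empty
  then have "g i x = 0" if "i \<in> I" "x \<in> S i" for i x using that by simp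
  then have "S i = {0}" if "i \<in> I" for i
    using bij_fam_inj[OF empty(3) rep_homD(1)[OF empty(2)] r that] is_repD(6)[OF r that] that by blast
  then show ?case using ind by (auto simp: rep_indec_def)
next
  case (insert a L)
  note g = insert.prems(2,3)
  have gi: "rep_iso S A S A g" using g by (simp add: rep_iso_def bij_fam_def)
  let ?g' = "\<lambda>i. inv_into (S i) (g i)"
  have gi': "rep_iso S A S A ?g'" by (rule rep_iso_inv[OF r gi])
  then have g': "rep_hom S A S A ?g'" and bg': "bij_fam S ?g'" by (auto simp: rep_iso_def bij_fam_def)
  have gg': "g i (?g' i y) = y" if "i \<in> I" "y \<in> S i" for i y
    using g(2) that bij_betw_inv_into_right by (fastforce simp: bij_fam_def)
  have ha: "rep_hom S A S A (f a)" using insert.prems(1) by simp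
  have k: "rep_hom S A S A (\<lambda>i x. ?g' i (f a i x))" by (rule rep_hom_comp[OF ha g'])
  note haS = mapsD(2)[OF rep_homD(1)[OF ha]] and kS = mapsD(2)[OF rep_homD(1)[OF k]]
  from k show ?case
  proof (rule fitting[OF r ind])
    assume b: "bij_fam S (\<lambda>i x. ?g' i (f a i x))"
    have "bij_fam S (f a)"
    proof (rule inj_fam_bij[OF r rep_homD(1)[OF ha]])
      fix i x assume i: "i \<in> I" and x: "x \<in> S i" "f a i x = 0"
      have "?g' i (f a i x) = 0" using x(2) lin_on_zero[OF mapsD(1)[OF rep_homD(1)[OF g'] i] is_repD(1)[OF r i]] by simp
      then show "x = 0" using bij_fam_inj[OF b rep_homD(1)[OF k] r i x(1)] by simp
    qed
    then show ?thesis by blast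
  next
    fix n assume nil: "\<And>i x. i \<in> I \<Longrightarrow> x \<in> S i \<Longrightarrow> ((\<lambda>x. ?g' i (f a i x)) ^^ n) x = 0"
    let ?u = "\<lambda>i x. g i x - f a i x"
    have um: "rep_hom S A S A ?u"
      unfolding rep_hom_def maps_def
    proof (intro conjI ballI allI impI)
      fix i assume i: "i \<in> I"
      show "lin_on (S i) (?u i)" by (intro lin_on_minus_fun mapsD(1)[OF rep_homD(1)[OF g(1)] i] mapsD(1)[OF rep_homD(1)[OF ha] i])
      show "?u i x \<in> S i" if "x \<in> S i" for x
        by (rule cv.subspace_diff[OF is_repD(1)[OF r i] mapsD(2)[OF rep_homD(1)[OF g(1)] i that] haS[OF i that]])
    next
      fix i j x assume E: "(i, j) \<in> E" and x: "x \<in> S i"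
      then have i: "i \<in> I" using E_I by blast
      show "?u j (A i j x) = A i j (?u i x)"
        using rep_homD(2)[OF g(1) E x] rep_homD(2)[OF ha E x]
          lin_on_diff[OF is_repD(3)[OF r E] is_repD(1)[OF r i] mapsD(2)[OF rep_homD(1)[OF g(1)] i x] haS[OF i x]] by simp
    qed
    have "bij_fam S ?u"
    proof (rule inj_fam_bij[OF r rep_homD(1)[OF um]])
      fix i x assume i: "i \<in> I" and x: "x \<in> S i" "?u i x = 0"
      have "?g' i (f a i x) = ?g' i (g i x)" using x(2) by simp
      also have "\<dots> = x" using g(2) i x(1) bij_betw_inv_into_left by (fastforce simp: bij_fam_def)
      finally have fx: "?g' i (f a i x) = x" .
      have "((\<lambda>x. ?g' i (f a i x)) ^^ m) x = x" for m by (induction m) (simp_all add: fx)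
      then show "x = 0" using nil[OF i x(1)] by simp
    qed
    moreover have "(\<Sum>l\<in>L. f l i x) = ?u i x" if "i \<in> I" "x \<in> S i" for i x
      using insert.prems(4)[OF that] insert.hyps by (simp add: algebra_simps)
    ultimately have "\<exists>l\<in>L. bij_fam S (f l)" using insert.IH[OF _ um] insert.prems(1) by blast
    then show ?thesis by blast
  qed
qed

text \<open>The image of \<open>a\<close> and the kernel of \<open>b\<close> are complementary.\<close>

lemma split_mono_indec_iso:
  assumes rS: "is_rep S A" and rT: "is_rep T B" and neS: "\<exists>i\<in>I. S i \<noteq> {0}" and ind: "rep_indec T B"
    and a: "rep_hom S A T B a" and b: "rep_hom T B S A b" and ba: "bij_fam S (\<lambda>i x. b i (a i x))"
  shows "rep_iso S A T B a"
proof -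
  let ?V = "\<lambda>i. a i ` S i" and ?W = "\<lambda>i. {y \<in> T i. b i y = 0}"
  note am = mapsD[OF rep_homD(1)[OF a]] and bm = mapsD[OF rep_homD(1)[OF b]]
  have bam: "maps S S (\<lambda>i x. b i (a i x))" by (rule maps_comp[OF rep_homD(1)[OF a] rep_homD(1)[OF b]])
  have inj: "x = 0" if "i \<in> I" "x \<in> S i" "b i (a i x) = 0" for i x by (rule bij_fam_inj[OF ba bam rS that])
  have a0: "a i 0 = 0" and b0: "b i 0 = 0" if "i \<in> I" for i
    using lin_on_zero[OF am(1)[OF that] is_repD(1)[OF rS that]] lin_on_zero[OF bm(1)[OF that] is_repD(1)[OF rT that]] .
  have V: "subrep T B ?V" by (rule hom_im_subrep[OF rS a])
  have W: "subrep T B ?W" by (rule hom_ker_subrep[OF rT b rS])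
  have dec: "?V i \<inter> ?W i = {0} \<and> (\<forall>y\<in>T i. \<exists>v\<in>?V i. \<exists>w\<in>?W i. y = v + w)" if i: "i \<in> I" for i
  proof (intro conjI ballI)
    show "?V i \<inter> ?W i = {0}"
    proof
      show "?V i \<inter> ?W i \<subseteq> {0}" using inj[OF i] a0[OF i] by auto
      show "{0} \<subseteq> ?V i \<inter> ?W i" using cv.subspace_0 subrepD(1)[OF V i] subrepD(1)[OF W i] by blast
    qed
    fix y assume y: "y \<in> T i"
    then have "b i y \<in> (\<lambda>x. b i (a i x)) ` S i" using ba i bm(2)[OF i y] by (simp add: bij_fam_def bij_betw_def)
    then obtain x where x: "x \<in> S i" "b i y = b i (a i x)" by auto
    have ax: "a i x \<in> T i" using am(2)[OF i x(1)] .
    have "y - a i x \<in> ?W i"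
      using lin_on_diff[OF bm(1)[OF i] is_repD(1)[OF rT i] y ax] x(2) cv.subspace_diff[OF is_repD(1)[OF rT i] y ax] by simp
    then show "\<exists>v\<in>?V i. \<exists>w\<in>?W i. y = v + w" using x(1) by (intro bexI[of _ "a i x"] bexI[of _ "y - a i x"]) auto
  qed
  have "\<not> (\<forall>i\<in>I. ?V i = {0})"
  proof
    assume z: "\<forall>i\<in>I. ?V i = {0}"
    have "S i = {0}" if i: "i \<in> I" for i
    proof -
      have "x = 0" if x: "x \<in> S i" for x
      proof -
        have "a i x = 0" using z i x by blast
        then show ?thesis using inj[OF i x] b0[OF i] by simp
      qed
      then show ?thesis using is_repD(6)[OF rS i] by auto
    qed
    then show False using neS by blast
  qed
  then have W0: "\<forall>i\<in>I. ?W i = {0}" using ind V W dec unfolding rep_indec_def by blast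
  have "bij_betw (a i) (S i) (T i)" if i: "i \<in> I" for i
    unfolding bij_betw_def
  proof
    show "inj_on (a i) (S i)"
      unfolding lin_on_inj_iff[OF am(1)[OF i] is_repD(1)[OF rS i]] using inj[OF i] b0[OF i] by auto
    show "a i ` S i = T i"
    proof
      show "a i ` S i \<subseteq> T i" using am(2)[OF i] by blast
      show "T i \<subseteq> a i ` S i"
      proof
        fix y assume y: "y \<in> T i"
        then obtain v w where vw: "v \<in> ?V i" "w \<in> ?W i" "y = v + w" using dec[OF i] by blast
        then have "w = 0" using W0 i by blast
        then show "y \<in> a i ` S i" using vw by simp
      qed
    qed
  qed
  then show ?thesis using a by (simp add: rep_iso_def)
qed

end

section \<open>The number of indecomposable summands of a rigid representation\<close>

text \<open>
  There are more vectors x with entries up to B than possible values of the m sums; two with the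
  same values are made disjoint by subtracting their minimum.
\<close>

lemma nat_dependence:
  fixes a :: "'c \<Rightarrow> nat \<Rightarrow> nat"
  assumes C: "finite C" "m < card C"
  obtains x y :: "'c \<Rightarrow> nat" where "\<And>k. k < m \<Longrightarrow> (\<Sum>c\<in>C. x c * a c k) = (\<Sum>c\<in>C. y c * a c k)"
    "\<And>c. c \<in> C \<Longrightarrow> x c = 0 \<or> y c = 0" "\<exists>c\<in>C. 0 < x c"
proof -
  define K where "K = (\<Sum>c\<in>C. \<Sum>k<m. a c k)"
  (* With this B, (K B + 1)^m \<le> (K + 1)^m (B + 1)^m = B (B + 1)^m < (B + 1)^(m + 1). *)
  define B where "B = (K + 1) ^ m"
  let ?X = "C \<rightarrow>\<^sub>E {..B}"
  let ?Y = "{..<m} \<rightarrow>\<^sub>E {..K * B}"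
  define F where "F = (\<lambda>x. \<lambda>k\<in>{..<m}. \<Sum>c\<in>C. x c * a c k)"
  have FY: "F ` ?X \<subseteq> ?Y"
  proof (rule image_subsetI)
    fix x assume x: "x \<in> ?X"
    have "(\<Sum>c\<in>C. x c * a c k) \<le> K * B" if k: "k < m" for k
    proof -
      have "(\<Sum>c\<in>C. x c * a c k) \<le> (\<Sum>c\<in>C. B * (\<Sum>k<m. a c k))"
      proof (rule sum_mono)
        fix c assume c: "c \<in> C"
        have "a c k \<le> (\<Sum>k<m. a c k)" using k by (intro member_le_sum) auto
        moreover have "x c \<le> B" using x c by (auto simp: PiE_iff)
        ultimately show "x c * a c k \<le> B * (\<Sum>k<m. a c k)" by (rule mult_le_mono[rotated])
      qed
      then show ?thesis by (simp add: K_def sum_distrib_left[symmetric] mult.commute)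
    qed
    then show "F x \<in> ?Y" by (auto simp: F_def PiE_iff)
  qed
  have "card ?Y = (K * B + 1) ^ m" by (simp add: card_PiE)
  also have "\<dots> \<le> ((K + 1) * (B + 1)) ^ m" by (intro power_mono) auto
  also have "\<dots> = B * (B + 1) ^ m" by (simp only: power_mult_distrib B_def)
  also have "\<dots> < (B + 1) ^ Suc m" by simp
  also have "\<dots> \<le> (B + 1) ^ card C" using C(2) by (intro power_increasing) auto
  also have "\<dots> = card ?X" using C(1) by (simp add: card_PiE)
  finally have "card ?Y < card ?X" .
  moreover have "finite ?Y" by (intro finite_PiE) auto
  ultimately have "\<not> inj_on F ?X" using FY card_inj_on_le by (metis not_le)
  then obtain x y where xy: "x \<in> ?X" "y \<in> ?X" "x \<noteq> y" "F x = F y" by (auto simp: inj_on_def)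
  obtain c0 where c0: "c0 \<in> C" "x c0 \<noteq> y c0" using xy by (metis PiE_ext)
  have eq: "(\<Sum>c\<in>C. x c * a c k) = (\<Sum>c\<in>C. y c * a c k)" if "k < m" for k
    using fun_cong[OF xy(4), of k] that by (simp add: F_def)
  have eq': "(\<Sum>c\<in>C. (x c - y c) * a c k) = (\<Sum>c\<in>C. (y c - x c) * a c k)" if k: "k < m" for k
  proof -
    have "int (\<Sum>c\<in>C. (x c - y c) * a c k) - int (\<Sum>c\<in>C. (y c - x c) * a c k)
        = (\<Sum>c\<in>C. int ((x c - y c) * a c k) - int ((y c - x c) * a c k))"
      by (simp add: sum_subtractf)
    also have "\<dots> = (\<Sum>c\<in>C. int (x c * a c k) - int (y c * a c k))"
    proof (rule sum.cong)
      fix c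
      show "int ((x c - y c) * a c k) - int ((y c - x c) * a c k) = int (x c * a c k) - int (y c * a c k)"
        by (cases "x c \<le> y c") (simp_all add: of_nat_diff left_diff_distrib)
    qed simp
    also have "\<dots> = int (\<Sum>c\<in>C. x c * a c k) - int (\<Sum>c\<in>C. y c * a c k)" by (simp add: sum_subtractf)
    also have "\<dots> = 0" unfolding eq[OF k] by (rule diff_self)
    finally show ?thesis by (simp only: right_minus_eq of_nat_eq_iff)
  qed
  show ?thesis
  proof (cases "x c0 < y c0")
    case True
    show ?thesis
      by (rule that[of "\<lambda>c. y c - x c" "\<lambda>c. x c - y c"]) (use eq' c0 True in auto)
  next
    case False
    show ?thesis
      by (rule that[of "\<lambda>c. x c - y c" "\<lambda>c. y c - x c"]) (use eq' c0 False in \<open>auto intro!: bexI[of _ c0]\<close>)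
  qed
qed

context preproj
begin

text \<open>
  More members than letters would give two direct sums without common summand and with equal
  strings. Both are rigid, hence isomorphic. Passing from a member c through the other direct sum
  and back is the identity of c, and it is the sum of the maps through the individual summands;
  since the endomorphism ring of c is local, one of these is invertible, and so c is isomorphic to
  a summand on the other side.
\<close>

theorem card_rigid_family:
  fixes U :: "'c \<Rightarrow> 'i \<Rightarrow> 'v::cvector set"
  assumes C: "finite C" and w: "set w \<subseteq> I"
    and r: "\<And>c. c \<in> C \<Longrightarrow> is_rep (U c) A" and ind: "\<And>c. c \<in> C \<Longrightarrow> rep_indec (U c) A"
    and o: "\<And>c d. c \<in> C \<Longrightarrow> d \<in> C \<Longrightarrow> ext_orth (U c) A (U d) A"
    and non: "\<And>c d. c \<in> C \<Longrightarrow> d \<in> C \<Longrightarrow> c \<noteq> d \<Longrightarrow> \<not> isomorphic (U c) A (U d) A"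
    and full: "\<And>c i. c \<in> C \<Longrightarrow> i \<in> I \<Longrightarrow> socw (U c) A w zspace i = U c i"
  shows "card C \<le> length w"
proof (rule ccontr)
  assume "\<not> card C \<le> length w"
  then have "length w < card C" by simp
  then obtain x y where xy: "\<And>k. k < length w \<Longrightarrow>
      (\<Sum>c\<in>C. x c * socle_string (U c) A w zspace ! k) = (\<Sum>c\<in>C. y c * socle_string (U c) A w zspace ! k)"
    "\<And>c. c \<in> C \<Longrightarrow> x c = 0 \<or> y c = 0" "\<exists>c\<in>C. 0 < x c"
    by (rule nat_dependence[OF C, of "length w" "\<lambda>c k. socle_string (U c) A w zspace ! k"]) blast
  (* Index sets of the direct sums in which the member c occurs x c times. *)
  define L where "L = (\<lambda>x :: 'c \<Rightarrow> nat. SIGMA c:C. {..<x c})"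
  define S where "S = (\<lambda>l :: 'c \<times> nat. U (fst l))"
  have L: "finite (L x)" for x using C by (auto simp: L_def)
  have LC: "fst l \<in> C" if "l \<in> L x" for l x using that by (auto simp: L_def)
  have rS: "is_rep (S l) A" if "l \<in> L x" for l x using r[OF LC[OF that]] by (simp add: S_def)
  have zd: "zspace k = dspace (L x) (\<lambda>_. zspace) k" for x k by (auto simp: dspace_def fam_def zero_fun_def fun_eq_iff)
  have sds: "single l u \<in> dspace (L x) S i" if "i \<in> I" "l \<in> L x" "u \<in> S l i" for x i l u
    by (rule single_dspace[where S = S and A = A, OF L rS[of _ x] that])
  have rD: "is_rep (dspace (L x) S) (dmap (L x) A)" for x by (rule dsum_is_rep[OF L rS])
  have oD: "ext_orth (dspace (L x) S) (dmap (L x) A) (dspace (L x) S) (dmap (L x) A)" for x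
    by (rule dsum_ext_orth[OF L rS]) (use o LC in \<open>auto simp: S_def\<close>)
  have soc: "(\<forall>k\<in>I. socw (dspace (L x) S) (dmap (L x) A) w zspace k = dspace (L x) (\<lambda>l. socw (S l) A w zspace) k) \<and>
    length (socle_string (dspace (L x) S) (dmap (L x) A) w zspace) = length w \<and>
    (\<forall>n<length w. socle_string (dspace (L x) S) (dmap (L x) A) w zspace ! n = (\<Sum>l\<in>L x. socle_string (S l) A w zspace ! n))" for x
    by (rule dsum_socw[OF L rS w zd zspace_subrep[OF rS]])
  have fullD: "socw (dspace (L x) S) (dmap (L x) A) w zspace k = dspace (L x) S k" if k: "k \<in> I" for x k
  proof -
    have "dspace (L x) (\<lambda>l. socw (S l) A w zspace) k = dspace (L x) S k"
      using full[OF LC k] by (auto simp: dspace_def fam_def S_def)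
    then show ?thesis using soc[of x] k by simp
  qed
  have strD: "(\<Sum>l\<in>L x. socle_string (S l) A w zspace ! n) = (\<Sum>c\<in>C. x c * socle_string (U c) A w zspace ! n)" for x n
    using sum.Sigma[of C "\<lambda>c. {..<x c}" "\<lambda>c _. socle_string (U c) A w zspace ! n"] C
    by (simp add: L_def S_def split_def)
  have "socle_string (dspace (L x) S) (dmap (L x) A) w zspace = socle_string (dspace (L y) S) (dmap (L y) A) w zspace"
    using soc[of x] soc[of y] strD xy(1) by (intro nth_equalityI) auto
  then have "isomorphic (dspace (L x) S) (dmap (L x) A) (dspace (L y) S) (dmap (L y) A)"
    using rigid_determined_by_string[OF rD rD oD oD w fullD fullD] by blast
  then obtain f where f: "rep_iso (dspace (L x) S) (dmap (L x) A) (dspace (L y) S) (dmap (L y) A) f"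
    by (auto simp: isomorphic_def)
  let ?g = "\<lambda>i. inv_into (dspace (L x) S i) (f i)"
  have g: "rep_iso (dspace (L y) S) (dmap (L y) A) (dspace (L x) S) (dmap (L x) A) ?g" by (rule rep_iso_inv[OF rD f])
  have fh: "rep_hom (dspace (L x) S) (dmap (L x) A) (dspace (L y) S) (dmap (L y) A) f"
    and gh: "rep_hom (dspace (L y) S) (dmap (L y) A) (dspace (L x) S) (dmap (L x) A) ?g"
    using f g by (auto simp: rep_iso_def)
  have gf: "?g i (f i v) = v" if "i \<in> I" "v \<in> dspace (L x) S i" for i v
    using f that bij_betw_inv_into_left by (fastforce simp: rep_iso_def)
  have comp: "rep_hom (S l) A (S m) A (\<lambda>i u. q i (single l u) m)"
    if q: "rep_hom (dspace (L x) S) (dmap (L x) A) (dspace (L y) S) (dmap (L y) A) q" and l: "l \<in> L x" and m: "m \<in> L y"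
    for x y q l m
    unfolding rep_hom_def maps_def
  proof (intro conjI ballI allI impI)
    fix i assume i: "i \<in> I"
    note qm = mapsD[OF rep_homD(1)[OF q] i]
    have sd: "single l u \<in> dspace (L x) S i" if "u \<in> S l i" for u using sds[OF i l that] .
    have "lin_on (S l i) (\<lambda>u. q i (single l u))" by (rule lin_on_comp[OF lin_on_single sd qm(1)])
    from lin_on_comp[OF this _ lin_on_coord[of UNIV]] show "lin_on (S l i) (\<lambda>u. q i (single l u) m)" by blast
    show "q i (single l u) m \<in> S m i" if "u \<in> S l i" for u using dspaceD(1)[OF qm(2)[OF sd[OF that]] m] .
  next
    fix i j u assume E: "(i, j) \<in> E" and u: "u \<in> S l i"
    then have i: "i \<in> I" using E_I by blast
    have "q j (single l (A i j u)) = q j (dmap (L x) A i j (single l u))" using dmap_single[OF L rS E l] by simp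
    also have "\<dots> = dmap (L y) A i j (q i (single l u))" using rep_homD(2)[OF q E sds[OF i l u]] .
    finally show "q j (single l (A i j u)) m = A i j (q i (single l u) m)" using m by (simp add: dmap_def)
  qed
  obtain c where c: "c \<in> C" "0 < x c" using xy(3) by blast
  let ?c = "(c, 0 :: nat)"
  have cL: "?c \<in> L x" using c by (auto simp: L_def)
  have Sc: "S ?c = U c" by (simp add: S_def)
  let ?a = "\<lambda>l i u. f i (single ?c u) l" and ?b = "\<lambda>l i u. ?g i (single l u) ?c"
  have a: "rep_hom (U c) A (S l) A (?a l)" and b: "rep_hom (S l) A (U c) A (?b l)" if "l \<in> L y" for l
    using comp[OF fh cL that] comp[OF gh that cL] Sc by auto
  have "\<exists>l\<in>L y. bij_fam (U c) (\<lambda>i u. ?b l i (?a l i u))"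
  proof (rule sum_bij_imp_bij[OF r[OF c(1)] ind[OF c(1)] L])
    show "rep_hom (U c) A (U c) A (\<lambda>i u. ?b l i (?a l i u))" if "l \<in> L y" for l
      by (rule rep_hom_comp[OF a[OF that] b[OF that]])
    show "rep_hom (U c) A (U c) A (\<lambda>i u. u)" by (simp add: rep_hom_def maps_id)
    show "bij_fam (U c) (\<lambda>i u. u)" by (simp add: bij_fam_def bij_betw_def)
    fix i u assume i: "i \<in> I" and u: "u \<in> U c i"
    have su: "single ?c u \<in> dspace (L x) S i" using sds[OF i cL] u Sc by simp
    let ?v = "f i (single ?c u)"
    have v: "?v \<in> dspace (L y) S i" using mapsD(2)[OF rep_homD(1)[OF fh] i su] .
    have "(\<Sum>l\<in>L y. ?g i (single l (?v l))) = ?g i (\<Sum>l\<in>L y. single l (?v l))"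
      by (rule lin_on_sum[OF mapsD(1)[OF rep_homD(1)[OF gh] i] is_repD(1)[OF rD i], symmetric])
        (rule sds[OF i _ dspaceD(1)[OF v]])
    also have "\<dots> = single ?c u" using sum_single[OF L v] gf[OF i su] by simp
    finally have "(\<Sum>l\<in>L y. ?g i (single l (?v l))) ?c = u" by simp
    then show "(\<Sum>l\<in>L y. ?b l i (?a l i u)) = u" by (simp add: sum_fun_apply)
  qed
  then obtain l where l: "l \<in> L y" "bij_fam (U c) (\<lambda>i u. ?b l i (?a l i u))" by blast
  obtain d where d: "d \<in> C" "0 < y d" "S l = U d" using l(1) by (auto simp: L_def S_def)
  have "rep_iso (U c) A (U d) A (?a l)"
  proof (rule split_mono_indec_iso[where a = "?a l" and b = "?b l", OF r[OF c(1)] r[OF d(1)] _ ind[OF d(1)] _ _ l(2)])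
    show "\<exists>i\<in>I. U c i \<noteq> {0}" using ind[OF c(1)] by (auto simp: rep_indec_def)
    show "rep_hom (U c) A (U d) A (?a l)" "rep_hom (U d) A (U c) A (?b l)" using a[OF l(1)] b[OF l(1)] d(3) by auto
  qed
  moreover have "c \<noteq> d" using xy(2)[OF c(1)] c(2) d(2) by auto
  ultimately show False using non[OF c(1) d(1)] by (auto simp: isomorphic_def)
qed

end

section \<open>The path algebra\<close>

lemma double_paths_join:
  assumes "u \<in> double_paths V \<Omega>" "v \<in> double_paths V \<Omega>" "last u = hd v"
  shows "u @ tl v \<in> double_paths V \<Omega>"
proof -
  obtain x y where v: "v = x # y" using assms(2) by (cases v) (auto simp: double_paths_def)
  show ?thesis using assms unfolding v
    by (cases y) (auto simp: double_paths_def successively_append_iff)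
qed

lemma cut_join: "k < length w \<Longrightarrow> take (k + 1) w @ tl (drop k w) = w"
  by (metis Suc_eq_plus1 append_take_drop_id drop_Suc tl_drop)

lemma cut_last: "k < length w \<Longrightarrow> last (take (k + 1) w) = hd (drop k w)"
  by (simp add: take_Suc_conv_app_nth hd_drop_conv_nth)

abbreviation pcarrier where "pcarrier V \<Omega> \<equiv> carrier (path_algebra V \<Omega>)"

lemma path_algebra_simps:
  "f \<in> pcarrier V \<Omega> \<longleftrightarrow> finite {w. f w \<noteq> 0} \<and> {w. f w \<noteq> 0} \<subseteq> double_paths V \<Omega>"
  "f \<otimes>\<^bsub>path_algebra V \<Omega>\<^esub> g = (\<lambda>w. \<Sum>k<length w. f (drop k w) * g (take (k + 1) w))"
  "\<one>\<^bsub>path_algebra V \<Omega>\<^esub> = (\<lambda>w. if \<exists>i\<in>V. w = [i] then 1 else 0)"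
  "\<zero>\<^bsub>path_algebra V \<Omega>\<^esub> = (\<lambda>w. 0)"
  "f \<oplus>\<^bsub>path_algebra V \<Omega>\<^esub> g = (\<lambda>w. f w + g w)"
  by (simp_all add: path_algebra_def)

lemma path_algebra_mult_closed:
  assumes "f \<in> pcarrier V \<Omega>" "g \<in> pcarrier V \<Omega>"
  shows "f \<otimes>\<^bsub>path_algebra V \<Omega>\<^esub> g \<in> pcarrier V \<Omega>"
proof -
  let ?A = "{w. f w \<noteq> 0}" and ?B = "{w. g w \<noteq> 0}" and ?C = "{w. (f \<otimes>\<^bsub>path_algebra V \<Omega>\<^esub> g) w \<noteq> 0}"
  have *: "\<exists>k<length w. drop k w \<in> ?A \<and> take (k + 1) w \<in> ?B" if "w \<in> ?C" for w
  proof (rule ccontr)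
    assume "\<not> ?thesis"
    then have "(\<Sum>k<length w. f (drop k w) * g (take (k + 1) w)) = 0" by (intro sum.neutral) auto
    then show False using that by (simp add: path_algebra_simps)
  qed
  have "?C \<subseteq> (\<lambda>(u, v). u @ tl v) ` (?B \<times> ?A)"
  proof
    fix w assume "w \<in> ?C"
    then obtain k where k: "k < length w" "drop k w \<in> ?A" "take (k + 1) w \<in> ?B" using * by blast
    then show "w \<in> (\<lambda>(u, v). u @ tl v) ` (?B \<times> ?A)"
      by (intro image_eqI[of _ _ "(take (k + 1) w, drop k w)"]) (use cut_join[OF k(1)] in auto)
  qed
  moreover have "finite (?B \<times> ?A)" using assms by (simp add: path_algebra_simps)
  ultimately have "finite ?C" using finite_subset by blast
  moreover have "?C \<subseteq> double_paths V \<Omega>"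
  proof
    fix w assume "w \<in> ?C"
    then obtain k where k: "k < length w" "drop k w \<in> ?A" "take (k + 1) w \<in> ?B" using * by blast
    then have "drop k w \<in> double_paths V \<Omega>" "take (k + 1) w \<in> double_paths V \<Omega>"
      using assms by (auto simp only: path_algebra_simps)
    from double_paths_join[OF this(2,1) cut_last[OF k(1)]] show "w \<in> double_paths V \<Omega>" by (simp only: cut_join[OF k(1)])
  qed
  ultimately show ?thesis unfolding path_algebra_simps(1) by blast
qed

text \<open>
  Both sides sum over the ways to cut the path at two vertices with positions k and m, k \<le> m.
\<close>

lemma path_algebra_assoc:
  "(f \<otimes>\<^bsub>path_algebra V \<Omega>\<^esub> g) \<otimes>\<^bsub>path_algebra V \<Omega>\<^esub> h = f \<otimes>\<^bsub>path_algebra V \<Omega>\<^esub> (g \<otimes>\<^bsub>path_algebra V \<Omega>\<^esub> h)"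
proof
  fix w :: "'a list"
  let ?n = "length w"
  have "((f \<otimes>\<^bsub>path_algebra V \<Omega>\<^esub> g) \<otimes>\<^bsub>path_algebra V \<Omega>\<^esub> h) w
      = (\<Sum>k<?n. \<Sum>l<?n - k. f (drop (k + l) w) * g (take (l + 1) (drop k w)) * h (take (k + 1) w))"
    by (simp add: path_algebra_simps sum_distrib_right add.commute)
  also have "\<dots> = (\<Sum>(k, l)\<in>(SIGMA k:{..<?n}. {..<?n - k}). f (drop (k + l) w) * g (take (l + 1) (drop k w)) * h (take (k + 1) w))"
    by (rule sum.Sigma) auto
  also have "\<dots> = (\<Sum>(m, k)\<in>(SIGMA m:{..<?n}. {..<m + 1}). f (drop m w) * (g (drop k (take (m + 1) w)) * h (take (k + 1) (take (m + 1) w))))"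
  proof (rule sum.reindex_bij_witness[of _ "\<lambda>(m, k). (k, m - k)" "\<lambda>(k, l). (k + l, k)"])
    fix x assume x: "x \<in> (SIGMA k:{..<?n}. {..<?n - k})"
    obtain k l where kl: "x = (k, l)" by (cases x)
    have "drop k (take (k + l + 1) w) = take (l + 1) (drop k w)" by (simp add: drop_take)
    moreover have "take (k + 1) (take (k + l + 1) w) = take (k + 1) w" by (simp add: min_def)
    ultimately show "(case (case x of (k, l) \<Rightarrow> (k + l, k)) of (m, k) \<Rightarrow> f (drop m w) * (g (drop k (take (m + 1) w)) * h (take (k + 1) (take (m + 1) w))))
        = (case x of (k, l) \<Rightarrow> f (drop (k + l) w) * g (take (l + 1) (drop k w)) * h (take (k + 1) w))"
      unfolding kl prod.case by (simp only: mult.assoc)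
  qed auto
  also have "\<dots> = (\<Sum>m<?n. \<Sum>k<m + 1. f (drop m w) * (g (drop k (take (m + 1) w)) * h (take (k + 1) (take (m + 1) w))))"
    by (rule sum.Sigma[symmetric]) auto
  also have "\<dots> = (f \<otimes>\<^bsub>path_algebra V \<Omega>\<^esub> (g \<otimes>\<^bsub>path_algebra V \<Omega>\<^esub> h)) w"
    unfolding path_algebra_simps sum_distrib_left
  proof (rule sum.cong)
    fix m assume "m \<in> {..<?n}"
    then have "length (take (m + 1) w) = m + 1" by auto
    then show "(\<Sum>k<m + 1. f (drop m w) * (g (drop k (take (m + 1) w)) * h (take (k + 1) (take (m + 1) w))))
      = (\<Sum>k<length (take (m + 1) w). f (drop m w) * (g (drop k (take (m + 1) w)) * h (take (k + 1) (take (m + 1) w))))" by (simp only:)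
  qed simp
  finally show "((f \<otimes>\<^bsub>path_algebra V \<Omega>\<^esub> g) \<otimes>\<^bsub>path_algebra V \<Omega>\<^esub> h) w = (f \<otimes>\<^bsub>path_algebra V \<Omega>\<^esub> (g \<otimes>\<^bsub>path_algebra V \<Omega>\<^esub> h)) w" .
qed

lemma path_algebra_one:
  assumes "f \<in> pcarrier V \<Omega>"
  shows "\<one>\<^bsub>path_algebra V \<Omega>\<^esub> \<otimes>\<^bsub>path_algebra V \<Omega>\<^esub> f = f" "f \<otimes>\<^bsub>path_algebra V \<Omega>\<^esub> \<one>\<^bsub>path_algebra V \<Omega>\<^esub> = f"
proof -
  let ?one = "\<lambda>w :: 'a list. if \<exists>i\<in>V. w = [i] then 1 else 0 :: complex"
  have f0: "f w = 0" if "w = [] \<or> last w \<notin> V \<or> hd w \<notin> V" for w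
  proof (rule ccontr)
    assume "f w \<noteq> 0"
    then have "w \<in> double_paths V \<Omega>" using assms by (auto simp: path_algebra_simps)
    then have "w \<noteq> []" "set w \<subseteq> V" by (auto simp: double_paths_def)
    then show False using that last_in_set[of w] hd_in_set[of w] by blast
  qed
  show "\<one>\<^bsub>path_algebra V \<Omega>\<^esub> \<otimes>\<^bsub>path_algebra V \<Omega>\<^esub> f = f"
    unfolding path_algebra_simps
  proof
    fix w :: "'a list"
    show "(\<Sum>k<length w. ?one (drop k w) * f (take (k + 1) w)) = f w"
    proof (cases "w = [] \<or> last w \<notin> V")
      case True
      have "?one (drop k w) = 0" if "k < length w" for k
      proof -
        have "last (drop k w) \<notin> V" using True that by (auto simp: last_drop)
        then have "\<nexists>i. i \<in> V \<and> drop k w = [i]" by force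
        then show ?thesis by auto
      qed
      then have "(\<Sum>k<length w. ?one (drop k w) * f (take (k + 1) w)) = 0" by (intro sum.neutral) auto
      moreover have "f w = 0" using f0 True by blast
      ultimately show ?thesis by simp
    next
      case False
      then have w: "w \<noteq> []" "last w \<in> V" by auto
      have "(\<Sum>k<length w. ?one (drop k w) * f (take (k + 1) w)) = (\<Sum>k<length w. if k = length w - 1 then f w else 0)"
      proof (rule sum.cong)
        fix k assume k: "k \<in> {..<length w}"
        show "?one (drop k w) * f (take (k + 1) w) = (if k = length w - 1 then f w else 0)"
        proof (cases "k = length w - 1")
          case True
          have "drop k w = [last w]" using True w by (metis append_butlast_last_id append_eq_conv_conj length_butlast)
          then show ?thesis using True w by simp
        next
          case False
          then have "length (drop k w) \<noteq> 1" using k by auto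
          then have "drop k w \<noteq> [i]" for i by fastforce
          then have "?one (drop k w) = 0" by simp
          then show ?thesis using False by simp
        qed
      qed simp
      also have "\<dots> = f w" using w by simp
      finally show ?thesis .
    qed
  qed
  show "f \<otimes>\<^bsub>path_algebra V \<Omega>\<^esub> \<one>\<^bsub>path_algebra V \<Omega>\<^esub> = f"
    unfolding path_algebra_simps
  proof
    fix w :: "'a list"
    show "(\<Sum>k<length w. f (drop k w) * ?one (take (k + 1) w)) = f w"
    proof (cases "w = [] \<or> hd w \<notin> V")
      case True
      have "?one (take (k + 1) w) = 0" if "k < length w" for k
        using True that by (cases w) auto
      then have "(\<Sum>k<length w. f (drop k w) * ?one (take (k + 1) w)) = 0" by (intro sum.neutral) auto
      moreover have "f w = 0" using f0 True by blast
      ultimately show ?thesis by simp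
    next
      case False
      then have w: "w \<noteq> []" "hd w \<in> V" by auto
      have "(\<Sum>k<length w. f (drop k w) * ?one (take (k + 1) w)) = (\<Sum>k<length w. if k = 0 then f w else 0)"
      proof (rule sum.cong)
        fix k assume k: "k \<in> {..<length w}"
        show "f (drop k w) * ?one (take (k + 1) w) = (if k = 0 then f w else 0)"
        proof (cases "k = 0")
          case True then show ?thesis using w by (cases w) auto
        next
          case False
          then have "length (take (k + 1) w) \<noteq> 1" using k by auto
          then have "take (k + 1) w \<noteq> [i]" for i by (metis One_nat_def length_Cons list.size(3))
          then have "?one (take (k + 1) w) = 0" by simp
          then show ?thesis using False by simp
        qed
      qed simp
      also have "\<dots> = f w" using w by simp
      finally show ?thesis .
    qed
  qed
qed

lemma path_algebra_add_closed: "f \<in> pcarrier V \<Omega> \<Longrightarrow> g \<in> pcarrier V \<Omega> \<Longrightarrow> (\<lambda>w. f w + g w) \<in> pcarrier V \<Omega>"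
proof -
  assume fg: "f \<in> pcarrier V \<Omega>" "g \<in> pcarrier V \<Omega>"
  have "{w. f w + g w \<noteq> 0} \<subseteq> {w. f w \<noteq> 0} \<union> {w. g w \<noteq> 0}" by auto
  then show ?thesis using fg unfolding path_algebra_simps by (meson Un_least finite_Un finite_subset subset_trans)
qed

lemma ring_path_algebra:
  assumes "finite V" shows "ring (path_algebra V \<Omega>)"
proof (rule ringI)
  show "abelian_group (path_algebra V \<Omega>)"
  proof (rule abelian_groupI)
    fix f assume f: "f \<in> pcarrier V \<Omega>"
    then have "(\<lambda>w. - f w) \<in> pcarrier V \<Omega>" by (simp add: path_algebra_simps)
    moreover have "(\<lambda>w. - f w) \<oplus>\<^bsub>path_algebra V \<Omega>\<^esub> f = \<zero>\<^bsub>path_algebra V \<Omega>\<^esub>" by (simp add: path_algebra_simps)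
    ultimately show "\<exists>g\<in>pcarrier V \<Omega>. g \<oplus>\<^bsub>path_algebra V \<Omega>\<^esub> f = \<zero>\<^bsub>path_algebra V \<Omega>\<^esub>" by blast
  qed (use path_algebra_add_closed in \<open>auto simp: path_algebra_simps(2-) simp: path_algebra_simps(1)[of "\<lambda>w. 0"] algebra_simps\<close>)
  show "Group.monoid (path_algebra V \<Omega>)"
  proof (rule monoidI)
    have "{w. \<one>\<^bsub>path_algebra V \<Omega>\<^esub> w \<noteq> 0} \<subseteq> (\<lambda>i. [i]) ` V" by (auto simp: path_algebra_simps)
    then have "finite {w. \<one>\<^bsub>path_algebra V \<Omega>\<^esub> w \<noteq> 0}" using assms finite_subset by blast
    moreover have "{w. \<one>\<^bsub>path_algebra V \<Omega>\<^esub> w \<noteq> 0} \<subseteq> double_paths V \<Omega>"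
      by (auto simp: path_algebra_simps double_paths_def split: if_splits)
    ultimately show "\<one>\<^bsub>path_algebra V \<Omega>\<^esub> \<in> pcarrier V \<Omega>" unfolding path_algebra_simps(1) by blast
  qed (simp_all add: path_algebra_mult_closed path_algebra_assoc path_algebra_one)
qed (simp_all add: path_algebra_simps sum.distrib algebra_simps)

definition spath :: "'i list \<Rightarrow> complex \<Rightarrow> 'i list \<Rightarrow> complex" where
  "spath w c = (\<lambda>u. if u = w then c else 0)"

lemma spath_carrier: "w \<in> double_paths V \<Omega> \<Longrightarrow> spath w c \<in> pcarrier V \<Omega>"
  unfolding path_algebra_simps by (auto simp: spath_def intro: finite_subset[of _ "{w}"])

lemma arrow_spath: "arrow (i, j) = spath [i, j] 1"
  by (simp add: arrow_def spath_def)

text \<open>Every element is a finite sum of multiples of paths.\<close>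

lemma path_algebra_induct [consumes 1, case_names zero add]:
  assumes "f \<in> pcarrier V \<Omega>"
    and "Q (\<lambda>w. 0)"
    and "\<And>w c f. w \<in> double_paths V \<Omega> \<Longrightarrow> f \<in> pcarrier V \<Omega> \<Longrightarrow> Q f \<Longrightarrow> Q (\<lambda>u. spath w c u + f u)"
  shows "Q f"
proof -
  have "Q f" if "finite S" "S \<subseteq> double_paths V \<Omega>" "\<And>w. w \<notin> S \<Longrightarrow> f w = 0" for S f
    using that
  proof (induction S arbitrary: f rule: finite_induct)
    case empty
    then have "f = (\<lambda>w. 0)" by auto
    then show ?case using assms(2) by simp
  next
    case (insert w S)
    let ?g = "f(w := 0)"
    have g: "?g u = 0" if "u \<notin> S" for u using insert.prems(2)[of u] that by auto
    then have "{u. ?g u \<noteq> 0} \<subseteq> S" by blast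
    then have "?g \<in> pcarrier V \<Omega>" unfolding path_algebra_simps(1) using insert.hyps(1) insert.prems(1) finite_subset by blast
    moreover have "Q ?g" using insert.IH[of ?g] insert.prems(1) g by blast
    ultimately have "Q (\<lambda>u. spath w (f w) u + ?g u)" using assms(3) insert.prems(1) by blast
    moreover have "(\<lambda>u. spath w (f w) u + ?g u) = f" by (auto simp: spath_def)
    ultimately show ?case by simp
  qed
  from this[of "{w. f w \<noteq> 0}" f] show ?thesis using assms(1) unfolding path_algebra_simps(1) by blast
qed

lemma spath_mult:
  assumes "v \<noteq> []" "u \<noteq> []"
  shows "spath v c \<otimes>\<^bsub>path_algebra V \<Omega>\<^esub> spath u d = (if last u = hd v then spath (u @ tl v) (c * d) else (\<lambda>w. 0))"
proof
  fix w
  let ?k = "length u - 1"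
  have eq: "(drop k w = v \<and> take (k + 1) w = u) \<longleftrightarrow> (k = ?k \<and> last u = hd v \<and> w = u @ tl v)" if k: "k < length w" for k
  proof
    assume a: "drop k w = v \<and> take (k + 1) w = u"
    then have "length u = k + 1" using k by (metis Suc_eq_plus1 Suc_leI length_take min.absorb2)
    then show "k = ?k \<and> last u = hd v \<and> w = u @ tl v" using a cut_join[OF k] cut_last[OF k] by simp
  next
    assume a: "k = ?k \<and> last u = hd v \<and> w = u @ tl v"
    have t: "take (k + 1) w = u" using a assms(2) by simp
    have "u = butlast u @ [hd v]" using a assms(2) by (metis append_butlast_last_id)
    then have "w = butlast u @ v" using a assms(1) by (metis append.assoc append_Cons append_Nil list.collapse)
    then have "drop k w = v" using a by simp
    then show "drop k w = v \<and> take (k + 1) w = u" using t by simp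
  qed
  have "(spath v c \<otimes>\<^bsub>path_algebra V \<Omega>\<^esub> spath u d) w
     = (\<Sum>k<length w. if k = ?k then (if last u = hd v \<and> w = u @ tl v then c * d else 0) else 0)"
    unfolding path_algebra_simps
  proof (rule sum.cong)
    fix k assume "k \<in> {..<length w}"
    then have eq': "(drop k w = v \<and> take (k + 1) w = u) = (k = ?k \<and> last u = hd v \<and> w = u @ tl v)" using eq by blast
    have "spath v c (drop k w) * spath u d (take (k + 1) w) = (if drop k w = v \<and> take (k + 1) w = u then c * d else 0)"
      by (simp add: spath_def)
    also have "\<dots> = (if k = ?k \<and> last u = hd v \<and> w = u @ tl v then c * d else 0)" by (simp only: eq')
    also have "\<dots> = (if k = ?k then (if last u = hd v \<and> w = u @ tl v then c * d else 0) else 0)" by (rule if_if_eq_conj[symmetric])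
    finally show "spath v c (drop k w) * spath u d (take (k + 1) w)
        = (if k = ?k then (if last u = hd v \<and> w = u @ tl v then c * d else 0) else 0)" .
  qed simp
  also have "\<dots> = (if last u = hd v \<and> w = u @ tl v then c * d else 0)"
  proof -
    have "0 < length u" "0 < length v" using assms by auto
    then have "?k < length u + (length v - 1)" by linarith
    then show ?thesis by (auto simp: sum.delta)
  qed
  finally show "(spath v c \<otimes>\<^bsub>path_algebra V \<Omega>\<^esub> spath u d) w = (if last u = hd v then spath (u @ tl v) (c * d) else (\<lambda>w. 0)) w"
    by (simp add: spath_def)
qed

section \<open>Actions of the path algebra\<close>

definition sgn_eps :: "('i \<times> 'i) set \<Rightarrow> 'i \<Rightarrow> 'i \<Rightarrow> complex" where
  "sgn_eps \<Omega> i j = (if (i, j) \<in> \<Omega> then 1 else -1)"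

locale ppalg = preproj I E h "sgn_eps \<Omega>" for I :: "'i set" and E h and \<Omega> :: "('i \<times> 'i) set" +
  assumes orient: "orientation E \<Omega>"
begin

lemma E_eq: "E = \<Omega> \<union> \<Omega>\<inverse>" and Omega_disj: "\<Omega> \<inter> \<Omega>\<inverse> = {}"
  using orient by (auto simp: orientation_def)

lemma finOmega: "finite \<Omega>"
  using E_eq EI finI by (metis finite_SigmaI finite_subset le_sup_iff)

abbreviation "P \<equiv> path_algebra I \<Omega>"
abbreviation "DP \<equiv> double_paths I \<Omega>"

lemma DP_Cons: "i # w \<in> DP \<longleftrightarrow> i \<in> I \<and> (case w of [] \<Rightarrow> True | j # r \<Rightarrow> (i, j) \<in> E \<and> w \<in> DP)"
  by (auto simp: double_paths_def E_eq split: list.splits)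

lemma DP_nonempty: "[] \<notin> DP"
  by (simp add: double_paths_def)

lemma ringP: "ring P"
  by (rule ring_path_algebra[OF finI])

lemma arrow_carrier: "(i, j) \<in> E \<Longrightarrow> arrow (i, j) \<in> carrier P"
  unfolding arrow_spath using E_I by (intro spath_carrier) (auto simp: DP_Cons)

abbreviation "rho \<equiv> \<Oplus>\<^bsub>P\<^esub>b\<in>\<Omega>. (arrow (prod.swap b) \<otimes>\<^bsub>P\<^esub> arrow b) \<ominus>\<^bsub>P\<^esub> (arrow b \<otimes>\<^bsub>P\<^esub> arrow (prod.swap b))"

lemma rho_term_carrier:
  assumes "b \<in> \<Omega>"
  shows "(arrow (prod.swap b) \<otimes>\<^bsub>P\<^esub> arrow b) \<ominus>\<^bsub>P\<^esub> (arrow b \<otimes>\<^bsub>P\<^esub> arrow (prod.swap b)) \<in> carrier P"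
proof -
  interpret R: ring P by (rule ringP)
  obtain i j where "b = (i, j)" by (cases b)
  then show ?thesis using arrow_carrier[of i j] arrow_carrier[of j i] assms E_eq by auto
qed

lemma ideal_eq: "preprojective_ideal I \<Omega> = Idl\<^bsub>P\<^esub> {rho}"
  by (simp add: preprojective_ideal_def Let_def)

lemma rho_carrier: "rho \<in> carrier P"
proof -
  interpret R: ring P by (rule ringP)
  show ?thesis using rho_term_carrier by (intro R.finsum_closed) auto
qed

lemma ideal_J: "ideal (preprojective_ideal I \<Omega>) P"
proof -
  interpret R: ring P by (rule ringP)
  show ?thesis unfolding ideal_eq using rho_carrier by (intro R.genideal_ideal) auto
qed

end

text \<open>
  The operators of the trivial paths and of the arrows on a vector space, with the relations of
  the path algebra but not the mesh relations.
\<close>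

locale opspace = ppalg I E h \<Omega> for I :: "'i set" and E h and \<Omega> :: "('i \<times> 'i) set" +
  fixes W :: "'u::cvector set" and e :: "'i \<Rightarrow> 'u \<Rightarrow> 'u" and a :: "'i \<Rightarrow> 'i \<Rightarrow> 'u \<Rightarrow> 'u"
  assumes W: "cv.subspace W"
    and e_lin: "i \<in> I \<Longrightarrow> lin_on W (e i)" and e_W: "i \<in> I \<Longrightarrow> x \<in> W \<Longrightarrow> e i x \<in> W"
    and e_e: "i \<in> I \<Longrightarrow> j \<in> I \<Longrightarrow> x \<in> W \<Longrightarrow> e i (e j x) = (if i = j then e j x else 0)"
    and e_sum: "x \<in> W \<Longrightarrow> (\<Sum>i\<in>I. e i x) = x"
    and a_lin: "(i, j) \<in> E \<Longrightarrow> lin_on W (a i j)" and a_W: "(i, j) \<in> E \<Longrightarrow> x \<in> W \<Longrightarrow> a i j x \<in> W"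
    and e_a: "(i, j) \<in> E \<Longrightarrow> x \<in> W \<Longrightarrow> e j (a i j x) = a i j x"
    and a_e: "(i, j) \<in> E \<Longrightarrow> x \<in> W \<Longrightarrow> a i j (e i x) = a i j x"
begin

text \<open>The operator of a path. The empty list is not a path and gets the value 0.\<close>

fun pact :: "'i list \<Rightarrow> 'u \<Rightarrow> 'u" where
  "pact [] x = 0"
| "pact [i] x = e i x"
| "pact (i # j # r) x = pact (j # r) (a i j x)"

lemma pact_W: "w \<in> DP \<Longrightarrow> x \<in> W \<Longrightarrow> pact w x \<in> W"
  by (induction w x rule: pact.induct) (auto simp: DP_Cons DP_nonempty e_W a_W)

lemma pact_lin: "w \<in> DP \<Longrightarrow> lin_on W (pact w)"
proof (induction w rule: induct_list012)
  case (2 i) then show ?case using e_lin by (simp add: DP_Cons)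
next
  case (3 i j r)
  then have E: "(i, j) \<in> E" and D: "j # r \<in> DP" by (auto simp: DP_Cons)
  show ?case using lin_on_comp[OF a_lin[OF E] a_W[OF E] 3(2)[OF D]] by simp
qed (simp add: DP_nonempty)

lemma pact_start: "i # w \<in> DP \<Longrightarrow> x \<in> W \<Longrightarrow> pact (i # w) (e i x) = pact (i # w) x"
  by (cases w) (auto simp: DP_Cons e_e a_e)

lemma pact_end: "w \<in> DP \<Longrightarrow> x \<in> W \<Longrightarrow> e (last w) (pact w x) = pact w x"
  by (induction w x rule: pact.induct) (auto simp: DP_Cons DP_nonempty e_e a_W)

lemma pact_join: "u \<in> DP \<Longrightarrow> v \<in> DP \<Longrightarrow> last u = hd v \<Longrightarrow> x \<in> W \<Longrightarrow> pact v (pact u x) = pact (u @ tl v) x"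
proof (induction u x rule: pact.induct)
  case (2 i x)
  then obtain r where "v = i # r" using DP_nonempty by (cases v) auto
  then show ?case using 2 pact_start by simp
next
  case (3 i j r x)
  then show ?case by (auto simp: DP_Cons a_W)
qed (simp add: DP_nonempty)

lemma pact_apart: 
  assumes "u \<in> DP" "v \<in> DP" "last u \<noteq> hd v" "x \<in> W"
  shows "pact v (pact u x) = 0"
proof -
  obtain i r where v: "v = i # r" using assms(2) DP_nonempty by (cases v) auto
  have "last u \<in> I" using assms(1) by (auto simp: double_paths_def)
  moreover have "i \<in> I" using assms(2) v by (simp add: DP_Cons)
  ultimately have "e i (e (last u) (pact u x)) = 0" using e_e pact_W[OF assms(1,4)] assms(3) v by simp
  then have "e i (pact u x) = 0" using pact_end[OF assms(1,4)] by simp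
  then have "pact v (pact u x) = pact v 0" using pact_start[of i r "pact u x"] assms(2) v pact_W[OF assms(1,4)] by simp
  then show ?thesis using lin_on_zero[OF pact_lin[OF assms(2)] W] by simp
qed

definition act :: "('i list \<Rightarrow> complex) \<Rightarrow> 'u \<Rightarrow> 'u" where
  "act p x = (\<Sum>w\<in>{w. p w \<noteq> 0}. p w *\<^sub>C pact w x)"

lemma act_superset: "finite F \<Longrightarrow> {w. p w \<noteq> 0} \<subseteq> F \<Longrightarrow> act p x = (\<Sum>w\<in>F. p w *\<^sub>C pact w x)"
  unfolding act_def by (rule sum.mono_neutral_left) auto

lemma act_add:
  assumes "p \<in> carrier P" "q \<in> carrier P"
  shows "act (\<lambda>w. p w + q w) x = act p x + act q x"
proof -
  let ?F = "{w. p w \<noteq> 0} \<union> {w. q w \<noteq> 0}"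
  have F: "finite ?F" using assms by (simp add: path_algebra_simps)
  have "act (\<lambda>w. p w + q w) x = (\<Sum>w\<in>?F. (p w + q w) *\<^sub>C pact w x)" by (rule act_superset[OF F]) auto
  also have "\<dots> = act p x + act q x"
    using act_superset[OF F, of p x] act_superset[OF F, of q x] by (simp add: cscale_add_left sum.distrib)
  finally show ?thesis .
qed

lemma act_zero: "act (\<lambda>w. 0) x = 0"
  by (simp add: act_def)

lemma act_spath: "act (spath w c) x = c *\<^sub>C pact w x"
  by (subst act_superset[of "{w}"]) (auto simp: spath_def split: if_splits)

lemma act_W: "p \<in> carrier P \<Longrightarrow> x \<in> W \<Longrightarrow> act p x \<in> W"
  unfolding act_def using pact_W W by (intro cv.subspace_sum cv.subspace_scale) (auto simp: path_algebra_simps)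

lemma act_lin: "p \<in> carrier P \<Longrightarrow> lin_on W (act p)"
  unfolding act_def by (intro lin_on_sum_fun lin_on_cmult pact_lin) (auto simp: path_algebra_simps)

lemma act_mult:
  assumes "p \<in> carrier P" "q \<in> carrier P" "x \<in> W"
  shows "act (p \<otimes>\<^bsub>P\<^esub> q) x = act p (act q x)"
proof -
  interpret R: ring P by (rule ringP)
  have addP: "f \<oplus>\<^bsub>P\<^esub> g = (\<lambda>w. f w + g w)" for f g by (simp add: path_algebra_simps)
  have zeroP: "\<zero>\<^bsub>P\<^esub> = (\<lambda>w. 0)" by (simp add: path_algebra_simps)
  have z0: "act f 0 = 0" if "f \<in> carrier P" for f using lin_on_zero[OF act_lin[OF that] W] .
  have single: "act (spath v c \<otimes>\<^bsub>P\<^esub> spath u d) x = act (spath v c) (act (spath u d) x)" if u: "u \<in> DP" and v: "v \<in> DP" for u v c d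
  proof -
    have ne: "v \<noteq> []" "u \<noteq> []" using u v DP_nonempty by auto
    have "act (spath v c) (act (spath u d) x) = (c * d) *\<^sub>C pact v (pact u x)"
      using lin_on_scale[OF pact_lin[OF v] pact_W[OF u assms(3)]] by (simp add: act_spath cscale_cscale)
    then show ?thesis using pact_join[OF u v _ assms(3)] pact_apart[OF u v _ assms(3)]
      by (cases "last u = hd v") (simp_all add: spath_mult[OF ne] act_spath act_zero)
  qed
  have right: "act (spath v c \<otimes>\<^bsub>P\<^esub> q) x = act (spath v c) (act q x)" if v: "v \<in> DP" for v c
    using assms(2)
  proof (induction rule: path_algebra_induct)
    case zero
    have "spath v c \<otimes>\<^bsub>P\<^esub> (\<lambda>w. 0) = (\<lambda>w. 0)" using R.r_null[OF spath_carrier[OF v, of c]] by (simp only: zeroP)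
    then show ?case using z0[OF spath_carrier[OF v]] by (simp add: act_zero)
  next
    case (add u d f)
    note s = spath_carrier[OF v, of c] spath_carrier[OF add(1), of d]
    have "spath v c \<otimes>\<^bsub>P\<^esub> (\<lambda>w. spath u d w + f w) = (\<lambda>w. (spath v c \<otimes>\<^bsub>P\<^esub> spath u d) w + (spath v c \<otimes>\<^bsub>P\<^esub> f) w)"
      using R.r_distr[OF s(2) add(2) s(1)] by (simp only: addP)
    then show ?case
      using single[OF add(1) v] add(3) lin_on_add[OF act_lin[OF s(1)] act_W[OF s(2) assms(3)] act_W[OF add(2) assms(3)]]
        act_add[OF R.m_closed[OF s] R.m_closed[OF s(1) add(2)]] act_add[OF s(2) add(2)] by simp
  qed
  show ?thesis using assms(1)
  proof (induction rule: path_algebra_induct)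
    case zero
    have "(\<lambda>w. 0) \<otimes>\<^bsub>P\<^esub> q = (\<lambda>w. 0)" using R.l_null[OF assms(2)] by (simp only: zeroP)
    then show ?case by (simp add: act_zero)
  next
    case (add v c f)
    note s = spath_carrier[OF add(1), of c]
    have "(\<lambda>w. spath v c w + f w) \<otimes>\<^bsub>P\<^esub> q = (\<lambda>w. (spath v c \<otimes>\<^bsub>P\<^esub> q) w + (f \<otimes>\<^bsub>P\<^esub> q) w)"
      using R.l_distr[OF s add(2) assms(2)] by (simp only: addP)
    then show ?case using right[OF add(1)] add(3) act_add[OF R.m_closed[OF s assms(2)] R.m_closed[OF add(2) assms(2)]]
        act_add[OF s add(2)] by simp
  qed
qed

lemma act_scalar: 
  assumes "x \<in> W" shows "act (\<lambda>w. c * \<one>\<^bsub>P\<^esub> w) x = c *\<^sub>C x"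
proof -
  have "act (\<lambda>w. c * \<one>\<^bsub>P\<^esub> w) x = (\<Sum>w\<in>(\<lambda>i. [i]) ` I. (c * \<one>\<^bsub>P\<^esub> w) *\<^sub>C pact w x)"
    by (rule act_superset) (auto simp: finI path_algebra_simps split: if_splits)
  also have "\<dots> = (\<Sum>i\<in>I. c *\<^sub>C e i x)"
    by (subst sum.reindex) (auto simp: inj_on_def path_algebra_simps intro!: sum.cong)
  also have "\<dots> = c *\<^sub>C x" using e_sum[OF assms] by (simp add: cv.scale_sum_right[symmetric])
  finally show ?thesis .
qed

lemma act_one: "x \<in> W \<Longrightarrow> act \<one>\<^bsub>P\<^esub> x = x"
  using act_scalar[of x 1] by (simp add: cscale_one)

lemma act_arrow: "(i, j) \<in> E \<Longrightarrow> x \<in> W \<Longrightarrow> act (arrow (i, j)) x = a i j x"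
  by (simp add: arrow_spath act_spath cscale_one e_a)

lemma act_neg:
  assumes "q \<in> carrier P" shows "act (\<ominus>\<^bsub>P\<^esub> q) x = - act q x"
proof -
  interpret R: ring P by (rule ringP)
  have m: "\<ominus>\<^bsub>P\<^esub> q \<in> carrier P" using assms by simp
  have "act (\<lambda>w. (\<ominus>\<^bsub>P\<^esub> q) w + q w) x = 0"
    using R.l_neg[OF assms] by (simp add: path_algebra_simps act_zero)
  then show ?thesis using act_add[OF m assms] by (simp add: eq_neg_iff_add_eq_0)
qed

lemma act_minus:
  assumes "p \<in> carrier P" "q \<in> carrier P"
  shows "act (p \<ominus>\<^bsub>P\<^esub> q) x = act p x - act q x"
proof -
  interpret R: ring P by (rule ringP)
  have m: "\<ominus>\<^bsub>P\<^esub> q \<in> carrier P" using assms by simp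
  show ?thesis using act_neg[OF assms(2)] act_add[OF assms(1) m] by (simp add: a_minus_def path_algebra_simps)
qed

text \<open>
  The arrows of the double quiver, grouped by their starting vertex, give the mesh relations;
  those of \<Omega> occur with sign 1, their reverses with sign -1.
\<close>

lemma act_rho:
  assumes x: "x \<in> W" shows "act rho x = (\<Sum>k\<in>I. mesh a k x)"
proof -
  interpret R: ring P by (rule ringP)
  let ?t = "\<lambda>b. (arrow (prod.swap b) \<otimes>\<^bsub>P\<^esub> arrow b) \<ominus>\<^bsub>P\<^esub> (arrow b \<otimes>\<^bsub>P\<^esub> arrow (prod.swap b))"
  have "act (\<Oplus>\<^bsub>P\<^esub>b\<in>F. ?t b) x = (\<Sum>b\<in>F. act (?t b) x)" if "finite F" "F \<subseteq> \<Omega>" for F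
    using that
  proof (induction F rule: finite_induct)
    case empty then show ?case by (simp add: path_algebra_simps act_zero)
  next
    case (insert b F)
    have c: "?t \<in> F \<rightarrow> carrier P" "?t b \<in> carrier P" using insert rho_term_carrier by auto
    have "(\<Oplus>\<^bsub>P\<^esub>b\<in>insert b F. ?t b) = ?t b \<oplus>\<^bsub>P\<^esub> (\<Oplus>\<^bsub>P\<^esub>b\<in>F. ?t b)"
      by (rule R.finsum_insert[OF insert.hyps c])
    then have "act (\<Oplus>\<^bsub>P\<^esub>b\<in>insert b F. ?t b) x = act (?t b) x + act (\<Oplus>\<^bsub>P\<^esub>b\<in>F. ?t b) x"
      using act_add[OF c(2) R.finsum_closed[OF c(1)]] by (simp add: path_algebra_simps(5))
    then show ?case using insert by simp
  qed
  then have "act rho x = (\<Sum>b\<in>\<Omega>. act (?t b) x)" using finOmega by blast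
  also have "\<dots> = (\<Sum>(i, j)\<in>\<Omega>. a j i (a i j x) - a i j (a j i x))"
  proof (rule sum.cong)
    fix b assume b: "b \<in> \<Omega>"
    obtain i j where ij: "b = (i, j)" by (cases b)
    have E: "(i, j) \<in> E" "(j, i) \<in> E" using b ij E_eq by auto
    note c = arrow_carrier[OF E(1)] arrow_carrier[OF E(2)]
    show "act (?t b) x = (case b of (i, j) \<Rightarrow> a j i (a i j x) - a i j (a j i x))"
      using act_minus[OF R.m_closed[OF c(2,1)] R.m_closed[OF c]] act_mult[OF c(2,1) x] act_mult[OF c x] x
      by (simp add: ij act_arrow[OF E(1)] act_arrow[OF E(2)] a_W[OF E(1)] a_W[OF E(2)])
  qed simp
  also have "\<dots> = (\<Sum>(i, j)\<in>\<Omega>. a j i (a i j x)) - (\<Sum>(i, j)\<in>\<Omega>. a i j (a j i x))"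
    by (simp add: split_def sum_subtractf)
  also have "(\<Sum>(i, j)\<in>\<Omega>. a i j (a j i x)) = (\<Sum>(i, j)\<in>\<Omega>\<inverse>. a j i (a i j x))"
    by (rule sum.reindex_bij_witness[of _ prod.swap prod.swap]) auto
  finally have l: "act rho x = (\<Sum>(i, j)\<in>\<Omega>. a j i (a i j x)) - (\<Sum>(i, j)\<in>\<Omega>\<inverse>. a j i (a i j x))" .
  have pairs: "(SIGMA k:I. nb k) = \<Omega> \<union> \<Omega>\<inverse>"
  proof -
    have "(SIGMA k:I. nb k) = E" using E_I by (auto simp: nb_def)
    then show ?thesis using E_eq by (rule trans)
  qed
  have "(\<Sum>k\<in>I. mesh a k x) = (\<Sum>(i, j)\<in>(SIGMA k:I. nb k). sgn_eps \<Omega> i j *\<^sub>C a j i (a i j x))"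
    unfolding mesh_def by (rule sum.Sigma) (auto simp: finI)
  also note pairs
  also have "(\<Sum>(i, j)\<in>\<Omega> \<union> \<Omega>\<inverse>. sgn_eps \<Omega> i j *\<^sub>C a j i (a i j x))
     = (\<Sum>(i, j)\<in>\<Omega>. sgn_eps \<Omega> i j *\<^sub>C a j i (a i j x)) + (\<Sum>(i, j)\<in>\<Omega>\<inverse>. sgn_eps \<Omega> i j *\<^sub>C a j i (a i j x))"
    by (rule sum.union_disjoint) (use finOmega Omega_disj in auto)
  also have "(\<Sum>(i, j)\<in>\<Omega>. sgn_eps \<Omega> i j *\<^sub>C a j i (a i j x)) = (\<Sum>(i, j)\<in>\<Omega>. a j i (a i j x))"
    by (rule sum.cong) (auto simp: sgn_eps_def cscale_one)
  also have "(\<Sum>(i, j)\<in>\<Omega>\<inverse>. sgn_eps \<Omega> i j *\<^sub>C a j i (a i j x)) = - (\<Sum>(i, j)\<in>\<Omega>\<inverse>. a j i (a i j x))"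
    unfolding sum_negf[symmetric] using Omega_disj by (intro sum.cong) (auto simp: sgn_eps_def cscale_one)
  finally show ?thesis using l by simp
qed

text \<open>The elements that act as zero form an ideal, which contains the generator.\<close>

lemma act_ideal:
  assumes mesh: "\<And>k x. k \<in> I \<Longrightarrow> x \<in> W \<Longrightarrow> mesh a k x = 0"
    and p: "p \<in> preprojective_ideal I \<Omega>" and x: "x \<in> W"
  shows "act p x = 0"
proof -
  interpret R: ring P by (rule ringP)
  let ?N = "{p \<in> carrier P. \<forall>x\<in>W. act p x = 0}"
  have "ideal ?N P"
  proof (rule idealI[OF ringP])
    show "subgroup ?N (add_monoid P)"
    proof (rule group.subgroupI[OF R.a_group])
      show "?N \<noteq> {}" using act_zero R.zero_closed by (auto simp: path_algebra_simps(4))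
      fix q assume q: "q \<in> ?N"
      have "act (\<ominus>\<^bsub>P\<^esub> q) x = 0" if "x \<in> W" for x
        using act_neg[of q x] q that by simp
      moreover have "inv\<^bsub>add_monoid P\<^esub> q = \<ominus>\<^bsub>P\<^esub> q" by (simp only: a_inv_def)
      ultimately show "inv\<^bsub>add_monoid P\<^esub> q \<in> ?N" using q by simp
    next
      fix q s assume "q \<in> ?N" "s \<in> ?N"
      then show "q \<otimes>\<^bsub>add_monoid P\<^esub> s \<in> ?N" using act_add[of q s] R.add.m_closed[of q s] by (auto simp: path_algebra_simps(5))
    qed auto
  next
    fix q s assume "q \<in> ?N" "s \<in> carrier P"
    then show "s \<otimes>\<^bsub>P\<^esub> q \<in> ?N" "q \<otimes>\<^bsub>P\<^esub> s \<in> ?N"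
      using act_mult act_W lin_on_zero[OF act_lin W] by auto
  qed
  moreover have "{rho} \<subseteq> ?N" using rho_carrier act_rho mesh by auto
  ultimately have "Idl\<^bsub>P\<^esub> {rho} \<subseteq> ?N" by (rule R.genideal_minimal)
  then show ?thesis using p x by (auto simp: ideal_eq)
qed

end

section \<open>Left modules over the preprojective algebra\<close>

context ppalg
begin

abbreviation "Jd \<equiv> preprojective_ideal I \<Omega>"
abbreviation "Lam \<equiv> preprojective_algebra I \<Omega>"

definition cls :: "('i list \<Rightarrow> complex) \<Rightarrow> ('i list \<Rightarrow> complex) set" where
  "cls p = Jd +>\<^bsub>P\<^esub> p"

definition path_scalar :: "complex \<Rightarrow> 'i list \<Rightarrow> complex" where
  "path_scalar c = (\<lambda>w. c * \<one>\<^bsub>P\<^esub> w)"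

lemma scalar_cls: "preprojective_scalar I \<Omega> c = cls (path_scalar c)"
  by (simp add: preprojective_scalar_def cls_def path_scalar_def)

lemma Lam_eq: "Lam = P Quot Jd"
  by (simp add: preprojective_algebra_def)

lemma cls_hom: "cls \<in> ring_hom P Lam"
proof -
  have "(+>\<^bsub>P\<^esub>) Jd \<in> ring_hom P (P Quot Jd)" by (rule ideal.rcos_ring_hom[OF ideal_J])
  moreover have "(+>\<^bsub>P\<^esub>) Jd = cls" by (simp add: cls_def fun_eq_iff)
  ultimately show ?thesis by (simp add: Lam_eq)
qed

lemma cls_carrier: "p \<in> carrier P \<Longrightarrow> cls p \<in> carrier Lam"
  using cls_hom by (auto simp: ring_hom_def)

lemma cls_add: "p \<in> carrier P \<Longrightarrow> q \<in> carrier P \<Longrightarrow> cls (\<lambda>w. p w + q w) = cls p \<oplus>\<^bsub>Lam\<^esub> cls q"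
  using ring_hom_add[OF cls_hom] by (simp add: path_algebra_simps(5))

lemma cls_mult: "p \<in> carrier P \<Longrightarrow> q \<in> carrier P \<Longrightarrow> cls (p \<otimes>\<^bsub>P\<^esub> q) = cls p \<otimes>\<^bsub>Lam\<^esub> cls q"
  using ring_hom_mult[OF cls_hom] .

lemma cls_one: "cls \<one>\<^bsub>P\<^esub> = \<one>\<^bsub>Lam\<^esub>"
  using ring_hom_one[OF cls_hom] .

lemma cls_surj: "r \<in> carrier Lam \<Longrightarrow> \<exists>p\<in>carrier P. r = cls p"
  unfolding Lam_eq FactRing_def A_RCOSETS_def' by (auto simp: cls_def)

lemma cls_eq_iff: "p \<in> carrier P \<Longrightarrow> q \<in> carrier P \<Longrightarrow> cls p = cls q \<longleftrightarrow> p \<ominus>\<^bsub>P\<^esub> q \<in> Jd"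
  unfolding cls_def using ring.quotient_eq_iff_same_a_r_cos[OF ringP ideal_J] by metis

lemma path_scalar_carrier: "path_scalar c \<in> carrier P"
proof -
  interpret R: ring P by (rule ringP)
  have "{w. path_scalar c w \<noteq> 0} \<subseteq> {w. \<one>\<^bsub>P\<^esub> w \<noteq> 0}" by (auto simp: path_scalar_def)
  then show ?thesis using R.one_closed unfolding path_algebra_simps(1) by (meson finite_subset subset_trans)
qed

lemma path_scalar_one: "path_scalar 1 = \<one>\<^bsub>P\<^esub>"
  by (simp add: path_scalar_def)

lemma path_scalar_zero: "path_scalar 0 = (\<lambda>w. 0)"
  by (simp add: path_scalar_def)

lemma path_scalar_mult:
  assumes "p \<in> carrier P"
  shows "path_scalar c \<otimes>\<^bsub>P\<^esub> p = (\<lambda>w. c * p w)" "p \<otimes>\<^bsub>P\<^esub> path_scalar c = (\<lambda>w. c * p w)"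
proof -
  have "(path_scalar c \<otimes>\<^bsub>P\<^esub> p) w = c * (\<one>\<^bsub>P\<^esub> \<otimes>\<^bsub>P\<^esub> p) w" for w
    by (simp add: path_algebra_simps(2) path_scalar_def sum_distrib_left mult.assoc)
  then show "path_scalar c \<otimes>\<^bsub>P\<^esub> p = (\<lambda>w. c * p w)" using path_algebra_one(1)[OF assms] by (simp add: fun_eq_iff)
  have "(p \<otimes>\<^bsub>P\<^esub> path_scalar c) w = c * (p \<otimes>\<^bsub>P\<^esub> \<one>\<^bsub>P\<^esub>) w" for w
    by (simp add: path_algebra_simps(2) path_scalar_def sum_distrib_left mult.left_commute)
  then show "p \<otimes>\<^bsub>P\<^esub> path_scalar c = (\<lambda>w. c * p w)" using path_algebra_one(2)[OF assms] by (simp add: fun_eq_iff)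
qed

lemma path_scalar_add: "path_scalar (c + d) = (\<lambda>w. path_scalar c w + path_scalar d w)"
  by (simp add: path_scalar_def algebra_simps)

lemma path_scalar_times: "path_scalar (c * d) = path_scalar c \<otimes>\<^bsub>P\<^esub> path_scalar d"
  using path_scalar_mult(1)[OF path_scalar_carrier, of c d] by (simp add: path_scalar_def mult.assoc)

abbreviation path_smult where "path_smult M p x \<equiv> cls p \<odot>\<^bsub>M\<^esub> x"

context
  fixes M :: "(('i list \<Rightarrow> complex) set, 'm) module"
  assumes lm: "left_module Lam M"
begin

interpretation M: left_module Lam M by (rule lm)

lemma path_smult_closed: "p \<in> carrier P \<Longrightarrow> x \<in> carrier M \<Longrightarrow> path_smult M p x \<in> carrier M"
  by (rule M.smult_closed[OF cls_carrier])

lemma path_smult_add: "p \<in> carrier P \<Longrightarrow> q \<in> carrier P \<Longrightarrow> x \<in> carrier M \<Longrightarrow> path_smult M (\<lambda>w. p w + q w) x = path_smult M p x \<oplus>\<^bsub>M\<^esub> path_smult M q x"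
  using M.smult_l_distr[OF cls_carrier cls_carrier] cls_add by simp

lemma path_smult_mult: "p \<in> carrier P \<Longrightarrow> q \<in> carrier P \<Longrightarrow> x \<in> carrier M \<Longrightarrow> path_smult M (p \<otimes>\<^bsub>P\<^esub> q) x = path_smult M p (path_smult M q x)"
  using M.smult_assoc[OF cls_carrier cls_carrier] cls_mult by simp

lemma path_smult_one: "x \<in> carrier M \<Longrightarrow> path_smult M (path_scalar 1) x = x"
  using M.smult_one cls_one by (simp add: path_scalar_one)

lemma path_smult_r: "p \<in> carrier P \<Longrightarrow> x \<in> carrier M \<Longrightarrow> y \<in> carrier M \<Longrightarrow> path_smult M p (x \<oplus>\<^bsub>M\<^esub> y) = path_smult M p x \<oplus>\<^bsub>M\<^esub> path_smult M p y"
  by (rule M.smult_r_distr[OF cls_carrier])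

lemma path_smult_zero_r: assumes "p \<in> carrier P" shows "path_smult M p \<zero>\<^bsub>M\<^esub> = \<zero>\<^bsub>M\<^esub>"
proof -
  have z: "\<zero>\<^bsub>M\<^esub> \<in> carrier M" by simp
  have "path_smult M p \<zero>\<^bsub>M\<^esub> \<oplus>\<^bsub>M\<^esub> path_smult M p \<zero>\<^bsub>M\<^esub> = path_smult M p \<zero>\<^bsub>M\<^esub>" using path_smult_r[OF assms z z] by simp
  then show ?thesis using path_smult_closed[OF assms z] M.add.l_cancel_one by blast
qed

lemma path_smult_zero: assumes "x \<in> carrier M" shows "path_smult M (\<lambda>w. 0) x = \<zero>\<^bsub>M\<^esub>"
proof -
  interpret R: ring P by (rule ringP)
  have z: "(\<lambda>w. 0) \<in> carrier P" using R.zero_closed by (simp add: path_algebra_simps(4))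
  have "path_smult M (\<lambda>w. 0) x \<oplus>\<^bsub>M\<^esub> path_smult M (\<lambda>w. 0) x = path_smult M (\<lambda>w. 0) x" using path_smult_add[OF z z assms] by simp
  then show ?thesis using path_smult_closed[OF z assms] M.add.l_cancel_one by blast
qed

lemma path_smult_ideal:
  assumes "p \<in> Jd" "x \<in> carrier M" shows "path_smult M p x = \<zero>\<^bsub>M\<^esub>"
proof -
  interpret R: ring P by (rule ringP)
  have z: "(\<lambda>w. 0) = \<zero>\<^bsub>P\<^esub>" by (simp add: path_algebra_simps(4))
  have p: "p \<in> carrier P" using ideal.Icarr[OF ideal_J assms(1)] .
  have "p \<ominus>\<^bsub>P\<^esub> \<zero>\<^bsub>P\<^esub> = p" using p by (simp add: R.minus_eq)
  then have "cls p = cls \<zero>\<^bsub>P\<^esub>" using cls_eq_iff[OF p R.zero_closed] assms(1) by simp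
  then show ?thesis using path_smult_zero[OF assms(2)] by (simp add: z)
qed

lemma submodule_intro:
  assumes "H \<subseteq> carrier M" "\<zero>\<^bsub>M\<^esub> \<in> H" "\<And>x y. x \<in> H \<Longrightarrow> y \<in> H \<Longrightarrow> x \<oplus>\<^bsub>M\<^esub> y \<in> H"
    "\<And>p x. p \<in> carrier P \<Longrightarrow> x \<in> H \<Longrightarrow> path_smult M p x \<in> H"
  shows "submodule H Lam M"
proof (intro submodule.intro)
  show "subgroup H (add_monoid M)"
  proof (rule group.subgroupI[OF M.a_group])
    fix x assume x: "x \<in> H"
    then have xM: "x \<in> carrier M" using assms(1) by blast
    have "path_smult M (path_scalar (-1)) x \<oplus>\<^bsub>M\<^esub> x = path_smult M (\<lambda>w. 0) x"
      using path_smult_add[OF path_scalar_carrier path_scalar_carrier xM, of "-1" 1] path_smult_one[OF xM] path_scalar_add[of "-1" 1] path_scalar_zero by simp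
    also have "\<dots> = \<zero>\<^bsub>M\<^esub>" by (rule path_smult_zero[OF xM])
    finally have "\<ominus>\<^bsub>M\<^esub> x = path_smult M (path_scalar (-1)) x" using M.minus_equality[OF _ xM path_smult_closed[OF path_scalar_carrier xM]] by simp
    moreover have "inv\<^bsub>add_monoid M\<^esub> x = \<ominus>\<^bsub>M\<^esub> x" by (simp only: a_inv_def)
    ultimately show "inv\<^bsub>add_monoid M\<^esub> x \<in> H" using assms(4)[OF path_scalar_carrier x] by simp
  qed (use assms in auto)
  show "submodule_axioms H Lam M"
    unfolding submodule_axioms_def using assms(4) cls_surj by metis
qed

lemma submodule_facts:
  assumes "submodule H Lam M"
  shows "H \<subseteq> carrier M" "\<zero>\<^bsub>M\<^esub> \<in> H" "x \<in> H \<Longrightarrow> y \<in> H \<Longrightarrow> x \<oplus>\<^bsub>M\<^esub> y \<in> H"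
    "p \<in> carrier P \<Longrightarrow> x \<in> H \<Longrightarrow> path_smult M p x \<in> H"
proof -
  interpret H: submodule H Lam M by (rule assms)
  show "H \<subseteq> carrier M" using H.subset by simp
  show "\<zero>\<^bsub>M\<^esub> \<in> H" using H.one_closed by simp
  show "x \<in> H \<Longrightarrow> y \<in> H \<Longrightarrow> x \<oplus>\<^bsub>M\<^esub> y \<in> H" using H.m_closed by simp
  show "p \<in> carrier P \<Longrightarrow> x \<in> H \<Longrightarrow> path_smult M p x \<in> H" using H.smult_closed[OF cls_carrier] .
qed

lemma submodule_restrict:
  assumes "submodule H Lam M" "submodule U Lam M" "H \<subseteq> U"
  shows "submodule H Lam (restrict_module M U)"
proof (intro submodule.intro)
  have "subgroup H (add_monoid M)" "subgroup U (add_monoid M)" using assms by (auto dest: submodule.axioms)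
  then have "subgroup H (add_monoid M\<lparr>carrier := U\<rparr>)" by (rule group.subgroup_incl[OF M.a_group _ _ assms(3)])
  then show "subgroup H (add_monoid (restrict_module M U))" by simp
  show "submodule_axioms H Lam (restrict_module M U)"
    using submodule.axioms(2)[OF assms(1)] by (simp add: submodule_axioms_def)
qed

end

text \<open>
  Take the coefficient vectors on a finite spanning set, and a complement of those that represent
  zero. The carrier type of a module has no vector space structure of its own, so everything is
  computed on this copy.
\<close>

lemma fd_module_coordinates:
  fixes T :: "(('i list \<Rightarrow> complex) set, 'm) module"
  assumes T: "fd_module I \<Omega> T"
  obtains W :: "('m \<Rightarrow> complex) set" and \<Phi> where "cv.subspace W" "fd W" "bij_betw \<Phi> W (carrier T)"
    "\<And>x y. x \<in> W \<Longrightarrow> y \<in> W \<Longrightarrow> \<Phi> (x + y) = \<Phi> x \<oplus>\<^bsub>T\<^esub> \<Phi> y"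
    "\<And>c x. x \<in> W \<Longrightarrow> \<Phi> (c *\<^sub>C x) = path_smult T (path_scalar c) (\<Phi> x)"
proof -
  have lm: "left_module Lam T" using T by (simp add: fd_module_def)
  interpret T: left_module Lam T by (rule lm)
  obtain B where B: "finite B" "B \<subseteq> carrier T"
    and span: "\<And>x. x \<in> carrier T \<Longrightarrow> \<exists>c. x = (\<Oplus>\<^bsub>T\<^esub>b\<in>B. path_smult T (path_scalar (c b)) b)"
    using T unfolding fd_module_def scalar_cls by blast
  define \<Psi> where "\<Psi> = (\<lambda>c. \<Oplus>\<^bsub>T\<^esub>b\<in>B. path_smult T (path_scalar (c b)) b)"
  have fs: "(\<lambda>b. path_smult T (path_scalar (c b)) b) \<in> B \<rightarrow> carrier T" for c
    using B(2) path_smult_closed[OF lm path_scalar_carrier] by auto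
  have \<Psi>T: "\<Psi> c \<in> carrier T" for c unfolding \<Psi>_def using fs by (rule T.finsum_closed)
  have \<Psi>_add: "\<Psi> (c + d) = \<Psi> c \<oplus>\<^bsub>T\<^esub> \<Psi> d" for c d
  proof -
    have "\<Psi> (c + d) = (\<Oplus>\<^bsub>T\<^esub>b\<in>B. path_smult T (path_scalar (c b)) b \<oplus>\<^bsub>T\<^esub> path_smult T (path_scalar (d b)) b)"
      unfolding \<Psi>_def
    proof (rule T.finsum_cong')
      fix b assume "b \<in> B"
      then show "path_smult T (path_scalar ((c + d) b)) b = path_smult T (path_scalar (c b)) b \<oplus>\<^bsub>T\<^esub> path_smult T (path_scalar (d b)) b"
        using path_smult_add[OF lm path_scalar_carrier path_scalar_carrier, of b "c b" "d b"] B(2) by (auto simp: path_scalar_add)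
    qed (use fs in auto)
    then show ?thesis unfolding \<Psi>_def using T.finsum_addf[OF fs fs] by simp
  qed
  have \<Psi>_scale: "\<Psi> (s *\<^sub>C c) = path_smult T (path_scalar s) (\<Psi> c)" for s c
  proof -
    have *: "path_smult T (path_scalar s) (\<Oplus>\<^bsub>T\<^esub>b\<in>A. path_smult T (path_scalar (c b)) b) = (\<Oplus>\<^bsub>T\<^esub>b\<in>A. path_smult T (path_scalar (s * c b)) b)" if "finite A" "A \<subseteq> B" for A
      using that
    proof (induction A rule: finite_induct)
      case empty then show ?case using path_smult_zero_r[OF lm path_scalar_carrier] by simp
    next
      case (insert b A)
      have f: "(\<lambda>b. path_smult T (path_scalar (c b)) b) \<in> A \<rightarrow> carrier T" "(\<lambda>b. path_smult T (path_scalar (s * c b)) b) \<in> A \<rightarrow> carrier T" and b: "b \<in> carrier T"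
        using insert.prems B(2) path_smult_closed[OF lm path_scalar_carrier] by auto
      note pb = path_smult_closed[OF lm path_scalar_carrier b]
      have "path_smult T (path_scalar s) (\<Oplus>\<^bsub>T\<^esub>b\<in>insert b A. path_smult T (path_scalar (c b)) b)
          = path_smult T (path_scalar s) (path_smult T (path_scalar (c b)) b \<oplus>\<^bsub>T\<^esub> (\<Oplus>\<^bsub>T\<^esub>b\<in>A. path_smult T (path_scalar (c b)) b))"
        using T.finsum_insert[OF insert.hyps f(1) pb] by simp
      also have "\<dots> = path_smult T (path_scalar s) (path_smult T (path_scalar (c b)) b) \<oplus>\<^bsub>T\<^esub> path_smult T (path_scalar s) (\<Oplus>\<^bsub>T\<^esub>b\<in>A. path_smult T (path_scalar (c b)) b)"
        by (rule path_smult_r[OF lm path_scalar_carrier pb T.finsum_closed[OF f(1)]])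
      also have "path_smult T (path_scalar s) (path_smult T (path_scalar (c b)) b) = path_smult T (path_scalar (s * c b)) b"
        using path_smult_mult[OF lm path_scalar_carrier path_scalar_carrier b] by (simp add: path_scalar_times)
      also have "path_smult T (path_scalar s) (\<Oplus>\<^bsub>T\<^esub>b\<in>A. path_smult T (path_scalar (c b)) b) = (\<Oplus>\<^bsub>T\<^esub>b\<in>A. path_smult T (path_scalar (s * c b)) b)"
        using insert by simp
      finally show ?case using T.finsum_insert[OF insert.hyps f(2) pb] by simp
    qed
    show ?thesis unfolding \<Psi>_def using *[OF B(1) order_refl] by (simp add: cscale_apply)
  qed
  define F where "F = fam B (\<lambda>_. UNIV :: complex set)"
  have fdU: "fd (UNIV :: complex set)"
    unfolding fd_def
  proof (intro exI[of _ "{1}"] conjI subsetI)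
    fix z :: complex
    have "z *\<^sub>C 1 \<in> cv.span {1 :: complex}" by (intro cv.span_scale cv.span_base) simp
    then show "z \<in> cv.span {1}" by simp
  qed simp
  have F: "cv.subspace F" "fd F"
    unfolding F_def using subspace_fam[of B "\<lambda>_. UNIV :: complex set"] fam_fd_dim[OF B(1), of "\<lambda>_. UNIV :: complex set"] fdU
    by (auto simp: cv.subspace_UNIV)
  define N where "N = {c \<in> F. \<Psi> c = \<zero>\<^bsub>T\<^esub>}"
  have z0: "\<Psi> 0 = \<zero>\<^bsub>T\<^esub>" using \<Psi>_scale[of 0 0] path_smult_zero[OF lm \<Psi>T] by (simp add: path_scalar_zero)
  have N: "cv.subspace N" "N \<subseteq> F"
    using F(1) z0 \<Psi>_add \<Psi>_scale path_smult_zero_r[OF lm path_scalar_carrier] by (auto simp: N_def cv.subspace_def)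
  obtain p where p: "lin_on F p" "p ` F \<subseteq> F" "\<And>x. x \<in> F \<Longrightarrow> p x = 0 \<longleftrightarrow> x \<in> N"
    "\<And>x. x \<in> F \<Longrightarrow> x - p x \<in> N" "\<And>x. x \<in> F \<Longrightarrow> p (p x) = p x"
    using complement_projection[OF F(1) N] by metis
  show ?thesis
  proof (rule that[of "p ` F" \<Psi>])
    show "cv.subspace (p ` F)" by (rule subspace_lin_image[OF p(1) F(1)])
    show "fd (p ` F)" by (rule fd_subset[OF F(2) p(2)])
    show "bij_betw \<Psi> (p ` F) (carrier T)"
      unfolding bij_betw_def
    proof
      show "inj_on \<Psi> (p ` F)"
      proof (rule inj_onI)
        fix x y assume x: "x \<in> p ` F" and y: "y \<in> p ` F" and e: "\<Psi> x = \<Psi> y"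
        then have xF: "x \<in> F" "y \<in> F" "p x = x" "p y = y" using p(2,5) by auto
        have d: "x - y \<in> F" using xF F(1) cv.subspace_diff by blast
        have "\<Psi> (x - y) \<oplus>\<^bsub>T\<^esub> \<Psi> y = \<Psi> y" using \<Psi>_add[of "x - y" y] e by simp
        then have "\<Psi> (x - y) = \<zero>\<^bsub>T\<^esub>" using \<Psi>T T.add.r_cancel_one by blast
        then have "p (x - y) = 0" using p(3)[OF d] d by (simp add: N_def)
        then show "x = y" using lin_on_diff[OF p(1) F(1) xF(1,2)] xF by simp
      qed
      show "\<Psi> ` p ` F = carrier T"
      proof
        show "\<Psi> ` p ` F \<subseteq> carrier T" using \<Psi>T by auto
        show "carrier T \<subseteq> \<Psi> ` p ` F"
        proof
          fix t assume "t \<in> carrier T"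
          then obtain c where c: "t = \<Psi> c" using span unfolding \<Psi>_def by blast
          define c' where "c' = (\<lambda>b. if b \<in> B then c b else 0)"
          have c'F: "c' \<in> F" by (simp add: c'_def F_def fam_def)
          have "\<Psi> c' = \<Psi> c" unfolding \<Psi>_def
            by (rule T.finsum_cong') (use fs in \<open>auto simp: c'_def\<close>)
          moreover have "\<Psi> c' = \<Psi> (c' - p c') \<oplus>\<^bsub>T\<^esub> \<Psi> (p c')" using \<Psi>_add[of "c' - p c'" "p c'"] by simp
          moreover have "\<Psi> (c' - p c') = \<zero>\<^bsub>T\<^esub>" using p(4)[OF c'F] by (simp add: N_def)
          ultimately have "t = \<Psi> (p c')" using c \<Psi>T by simp
          then show "t \<in> \<Psi> ` p ` F" using c'F by blast
        qed
      qed
    qed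
  qed (use \<Psi>_add \<Psi>_scale in auto)
qed

end

section \<open>Modules as representations\<close>

locale coord = ppalg I E h \<Omega> for I :: "'i set" and E h and \<Omega> :: "('i \<times> 'i) set" +
  fixes T :: "(('i list \<Rightarrow> complex) set, 'm) module" and W :: "'u::cvector set" and \<Phi> :: "'u \<Rightarrow> 'm"
  assumes lmT: "left_module Lam T" and Wsub: "cv.subspace W" and Wfd: "fd W" and bijPhi: "bij_betw \<Phi> W (carrier T)"
    and Phi_add: "x \<in> W \<Longrightarrow> y \<in> W \<Longrightarrow> \<Phi> (x + y) = \<Phi> x \<oplus>\<^bsub>T\<^esub> \<Phi> y"
    and Phi_scale: "x \<in> W \<Longrightarrow> \<Phi> (c *\<^sub>C x) = path_smult T (path_scalar c) (\<Phi> x)"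
begin

definition "\<psi> = inv_into W \<Phi>"
definition "op p x = \<psi> (path_smult T p (\<Phi> x))"
definition "e i = op (spath [i] 1)"
definition "a i j = op (arrow (i, j))"

lemma Phi_T: "x \<in> W \<Longrightarrow> \<Phi> x \<in> carrier T"
  using bijPhi by (auto simp: bij_betw_def)

lemma psi_W: "t \<in> carrier T \<Longrightarrow> \<psi> t \<in> W"
  using bijPhi by (auto simp: bij_betw_def \<psi>_def intro: inv_into_into)

lemma psi_Phi: "x \<in> W \<Longrightarrow> \<psi> (\<Phi> x) = x"
  using bij_betw_inv_into_left[OF bijPhi] by (simp add: \<psi>_def)

lemma Phi_psi: "t \<in> carrier T \<Longrightarrow> \<Phi> (\<psi> t) = t"
  using bij_betw_inv_into_right[OF bijPhi] by (simp add: \<psi>_def)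

lemma Phi_zero: "\<Phi> 0 = \<zero>\<^bsub>T\<^esub>"
  using Phi_scale[of 0 0] cv.subspace_0[OF Wsub] path_smult_zero[OF lmT Phi_T] by (simp add: path_scalar_zero)

lemma psi_add: "s \<in> carrier T \<Longrightarrow> t \<in> carrier T \<Longrightarrow> \<psi> (s \<oplus>\<^bsub>T\<^esub> t) = \<psi> s + \<psi> t"
  using Phi_add[OF psi_W psi_W] psi_Phi[OF cv.subspace_add[OF Wsub psi_W psi_W]] by (simp add: Phi_psi)

lemma psi_scale: "t \<in> carrier T \<Longrightarrow> \<psi> (path_smult T (path_scalar c) t) = c *\<^sub>C \<psi> t"
  using Phi_scale[OF psi_W] psi_Phi[OF cv.subspace_scale[OF Wsub psi_W]] by (simp add: Phi_psi)

lemma op_W: "p \<in> carrier P \<Longrightarrow> x \<in> W \<Longrightarrow> op p x \<in> W"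
  unfolding op_def by (intro psi_W path_smult_closed[OF lmT] Phi_T)

lemma Phi_op: "p \<in> carrier P \<Longrightarrow> x \<in> W \<Longrightarrow> \<Phi> (op p x) = path_smult T p (\<Phi> x)"
  unfolding op_def by (intro Phi_psi path_smult_closed[OF lmT] Phi_T)

lemma op_mult: "p \<in> carrier P \<Longrightarrow> q \<in> carrier P \<Longrightarrow> x \<in> W \<Longrightarrow> op (p \<otimes>\<^bsub>P\<^esub> q) x = op p (op q x)"
  using path_smult_mult[OF lmT _ _ Phi_T] Phi_op by (simp add: op_def)

lemma op_Kc: "x \<in> W \<Longrightarrow> op (path_scalar c) x = c *\<^sub>C x"
  using psi_scale[OF Phi_T] psi_Phi by (simp add: op_def)

lemma op_lin: assumes p: "p \<in> carrier P" shows "lin_on W (op p)"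
  unfolding lin_on_def
proof (intro conjI ballI allI)
  fix x y assume "x \<in> W" "y \<in> W"
  then show "op p (x + y) = op p x + op p y"
    using Phi_add path_smult_r[OF lmT p Phi_T Phi_T] psi_add[OF path_smult_closed[OF lmT p Phi_T] path_smult_closed[OF lmT p Phi_T]]
    by (simp add: op_def)
next
  fix c x assume x: "x \<in> W"
  have "op p (c *\<^sub>C x) = op (p \<otimes>\<^bsub>P\<^esub> path_scalar c) x" using op_mult[OF p path_scalar_carrier x] op_Kc[OF x] by simp
  also have "p \<otimes>\<^bsub>P\<^esub> path_scalar c = path_scalar c \<otimes>\<^bsub>P\<^esub> p" using path_scalar_mult[OF p] by simp
  also have "op (path_scalar c \<otimes>\<^bsub>P\<^esub> p) x = c *\<^sub>C op p x" using op_mult[OF path_scalar_carrier p x] op_Kc[OF op_W[OF p x]] by simp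
  finally show "op p (c *\<^sub>C x) = c *\<^sub>C op p x" .
qed

lemma op_add: "p \<in> carrier P \<Longrightarrow> q \<in> carrier P \<Longrightarrow> x \<in> W \<Longrightarrow> op (\<lambda>w. p w + q w) x = op p x + op q x"
  using path_smult_add[OF lmT _ _ Phi_T] psi_add[OF path_smult_closed[OF lmT _ Phi_T] path_smult_closed[OF lmT _ Phi_T]] by (simp add: op_def)

lemma op_zero: "x \<in> W \<Longrightarrow> op (\<lambda>w. 0) x = 0"
  using path_smult_zero[OF lmT Phi_T] psi_Phi[OF cv.subspace_0[OF Wsub]] Phi_zero by (simp add: op_def)

lemma vertex_DP: "i \<in> I \<Longrightarrow> [i] \<in> DP"
  by (simp add: DP_Cons)

lemma opspace: "opspace I E h \<Omega> W e a"
proof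
  show "cv.subspace W" by (rule Wsub)
  note sp = spath_carrier[of _ I \<Omega>]
  show "lin_on W (e i)" if "i \<in> I" for i unfolding e_def by (rule op_lin[OF sp[OF vertex_DP[OF that]]])
  show "e i x \<in> W" if "i \<in> I" "x \<in> W" for i x unfolding e_def by (rule op_W[OF sp[OF vertex_DP[OF that(1)]] that(2)])
  show "e i (e j x) = (if i = j then e j x else 0)" if "i \<in> I" "j \<in> I" "x \<in> W" for i j x
    using op_mult[OF sp[OF vertex_DP[OF that(1)]] sp[OF vertex_DP[OF that(2)]] that(3), of 1 1] op_zero[OF that(3)]
    by (auto simp: e_def spath_mult)
  show "(\<Sum>i\<in>I. e i x) = x" if x: "x \<in> W" for x
  proof -
    have "(\<lambda>w. \<Sum>i\<in>F. spath [i] 1 w) \<in> carrier P \<and> (\<Sum>i\<in>F. e i x) = op (\<lambda>w. \<Sum>i\<in>F. spath [i] 1 w) x" if "finite F" "F \<subseteq> I" for F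
      using that
    proof (induction F rule: finite_induct)
      case empty
      then show ?case using op_zero[OF x] ring.ring_simprules(2)[OF ringP] by (simp add: path_algebra_simps(4))
    next
      case (insert i F)
      then have i: "spath [i] 1 \<in> carrier P" by (intro sp vertex_DP) simp
      have F: "(\<lambda>w. \<Sum>i\<in>F. spath [i] 1 w) \<in> carrier P" using insert by simp
      show ?case using insert path_algebra_add_closed[OF i F] op_add[OF i F x] by (simp add: e_def)
    qed
    then have "(\<Sum>i\<in>I. e i x) = op (\<lambda>w. \<Sum>i\<in>I. spath [i] 1 w) x" using finI by blast
    also have "(\<lambda>w. \<Sum>i\<in>I. spath [i] 1 w) = path_scalar 1"
    proof
      fix w
      show "(\<Sum>i\<in>I. spath [i] 1 w) = path_scalar 1 w"
      proof (cases "\<exists>k\<in>I. w = [k]")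
        case True
        then obtain k where k: "k \<in> I" "w = [k]" by blast
        have "(\<Sum>i\<in>I. spath [i] 1 w) = (\<Sum>i\<in>I. if i = k then 1 else 0)" using k by (intro sum.cong) (auto simp: spath_def)
        then show ?thesis using k finI by (simp add: path_scalar_def path_algebra_simps(3))
      next
        case False
        then show ?thesis by (auto simp: path_scalar_def path_algebra_simps(3) spath_def intro!: sum.neutral)
      qed
    qed
    finally show ?thesis using op_Kc[OF x, of 1] by (simp add: cscale_one)
  qed
  show "lin_on W (a i j)" if "(i, j) \<in> E" for i j unfolding a_def by (rule op_lin[OF arrow_carrier[OF that]])
  show "a i j x \<in> W" if "(i, j) \<in> E" "x \<in> W" for i j x unfolding a_def by (rule op_W[OF arrow_carrier[OF that(1)] that(2)])
  show "e j (a i j x) = a i j x" if "(i, j) \<in> E" "x \<in> W" for i j x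
  proof -
    have j: "j \<in> I" using that E_I by blast
    have "spath [j] 1 \<otimes>\<^bsub>P\<^esub> arrow (i, j) = arrow (i, j)" by (simp add: arrow_spath spath_mult)
    then show ?thesis using op_mult[OF sp[OF vertex_DP[OF j]] arrow_carrier[OF that(1)] that(2), of 1] by (simp add: e_def a_def)
  qed
  show "a i j (e i x) = a i j x" if "(i, j) \<in> E" "x \<in> W" for i j x
  proof -
    have i: "i \<in> I" using that E_I by blast
    have "arrow (i, j) \<otimes>\<^bsub>P\<^esub> spath [i] 1 = arrow (i, j)" by (simp add: arrow_spath spath_mult)
    then show ?thesis using op_mult[OF arrow_carrier[OF that(1)] sp[OF vertex_DP[OF i]] that(2), of 1] by (simp add: e_def a_def)
  qed
qed

end

sublocale coord \<subseteq> opspace I E h \<Omega> W e a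
  by (rule opspace)

context opspace
begin

text \<open>The representation formed by the parts of an invariant subspace at the vertices.\<close>

definition "sp X = (\<lambda>i. e i ` X)"

definition stable :: "'u set \<Rightarrow> bool" where
  "stable X \<longleftrightarrow> cv.subspace X \<and> X \<subseteq> W \<and> (\<forall>i\<in>I. \<forall>x\<in>X. e i x \<in> X) \<and> (\<forall>i j. (i, j) \<in> E \<longrightarrow> (\<forall>x\<in>X. a i j x \<in> X))"

lemma stableD:
  assumes "stable X"
  shows "cv.subspace X" "X \<subseteq> W" "x \<in> X \<Longrightarrow> x \<in> W" "i \<in> I \<Longrightarrow> x \<in> X \<Longrightarrow> e i x \<in> X"
    "(i, j) \<in> E \<Longrightarrow> x \<in> X \<Longrightarrow> a i j x \<in> X"
  using assms unfolding stable_def by auto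

lemma stable_W: "stable W"
  unfolding stable_def using W e_W a_W by blast

lemma sp_iff: "stable X \<Longrightarrow> i \<in> I \<Longrightarrow> x \<in> sp X i \<longleftrightarrow> x \<in> X \<and> e i x = x"
  unfolding sp_def using stableD(3,4)[of X] e_e[of i i] by (auto simp: image_iff) metis+

lemma sp_mono: "X \<subseteq> Y \<Longrightarrow> sp X i \<subseteq> sp Y i"
  by (auto simp: sp_def)

lemma e_mem_sp: "x \<in> X \<Longrightarrow> e i x \<in> sp X i"
  by (simp add: sp_def)

lemma sp_eq: "stable X \<Longrightarrow> i \<in> I \<Longrightarrow> x \<in> sp X i \<Longrightarrow> e i x = x" "stable X \<Longrightarrow> i \<in> I \<Longrightarrow> x \<in> sp X i \<Longrightarrow> x \<in> X"
  using sp_iff by auto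

lemma e_other: "i \<in> I \<Longrightarrow> k \<in> I \<Longrightarrow> x \<in> sp W i \<Longrightarrow> k \<noteq> i \<Longrightarrow> e k x = 0"
  using sp_eq[OF stable_W] e_e by metis

lemma mesh_e: "i \<in> I \<Longrightarrow> x \<in> W \<Longrightarrow> mesh a i (e i x) = mesh a i x"
  unfolding mesh_def using a_e[OF nbD(1)] by (intro sum.cong) auto

lemma a_other: "i \<in> I \<Longrightarrow> k \<in> I \<Longrightarrow> x \<in> sp W i \<Longrightarrow> k \<noteq> i \<Longrightarrow> (k, l) \<in> E \<Longrightarrow> a k l x = 0"
  using a_e[of k l x] e_other[of i k x] lin_on_zero[OF a_lin W] sp_eq(2)[OF stable_W] by metis

lemma stable_rep:
  assumes X: "stable X" and fdW: "fd W" and mesh: "\<And>i x. i \<in> I \<Longrightarrow> x \<in> W \<Longrightarrow> mesh a i x = 0"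
  shows "is_rep (sp X) a"
  unfolding is_rep_def
proof (intro conjI ballI allI impI)
  fix i assume i: "i \<in> I"
  have sub: "sp X i \<subseteq> W" using sp_eq(2)[OF X i] stableD(2)[OF X] by blast
  show "cv.subspace (sp X i)" unfolding sp_def
    by (rule subspace_lin_image[OF lin_on_subset[OF e_lin[OF i] stableD(2)[OF X]] stableD(1)[OF X]])
  show "fd (sp X i)" by (rule fd_subset[OF fdW sub])
  show "mesh a i x = 0" if "x \<in> sp X i" for x using mesh[OF i] sub that by blast
next
  fix i j assume E: "(i, j) \<in> E"
  then have ij: "i \<in> I" "j \<in> I" using E_I by auto
  have sub: "sp X i \<subseteq> W" using sp_eq(2)[OF X ij(1)] stableD(2)[OF X] by blast
  show "lin_on (sp X i) (a i j)" by (rule lin_on_subset[OF a_lin[OF E] sub])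
  show "a i j x \<in> sp X j" if "x \<in> sp X i" for x
    unfolding sp_iff[OF X ij(2)] using stableD(5)[OF X E] sp_eq(2)[OF X ij(1) that] e_a[OF E] sub that by blast
qed

text \<open>The invariant subspace assembled from a subrepresentation; the inverse of \<open>sp\<close>.\<close>

definition "assembled V = {x \<in> W. \<forall>i\<in>I. e i x \<in> V i}"

lemma assembled_stable:
  assumes X: "stable X" and V: "subrep (sp X) a V"
  shows "stable (assembled V)" "assembled V \<subseteq> X" "i \<in> I \<Longrightarrow> sp (assembled V) i = V i" "i \<in> I \<Longrightarrow> V i \<subseteq> assembled V"
proof -
  have V0: "0 \<in> V i" if "i \<in> I" for i using cv.subspace_0[OF subrepD(1)[OF V that]] .
  have VX: "x \<in> X" "x \<in> W" "e i x = x" "x \<in> sp W i" if "i \<in> I" "x \<in> V i" for i x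
  proof -
    have s: "x \<in> sp X i" using subrepD(2)[OF V that(1)] that(2) by blast
    show "x \<in> X" "e i x = x" using sp_eq[OF X that(1) s] by auto
    then show "x \<in> W" using stableD(3)[OF X] by blast
    show "x \<in> sp W i" using s sp_mono[OF stableD(2)[OF X]] by blast
  qed
  show Vtot: "V i \<subseteq> assembled V" if i: "i \<in> I" for i
  proof
    fix x assume x: "x \<in> V i"
    have "e k x \<in> V k" if k: "k \<in> I" for k
      using VX[OF i x] e_other[OF i k, of x] V0[OF k] x by (cases "k = i") auto
    then show "x \<in> assembled V" using VX(2)[OF i x] by (simp add: assembled_def)
  qed
  show sub: "assembled V \<subseteq> X"
  proof
    fix x assume x: "x \<in> assembled V"
    then have "(\<Sum>i\<in>I. e i x) \<in> X" using VX(1) by (intro cv.subspace_sum[OF stableD(1)[OF X]]) (auto simp: assembled_def)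
    then show "x \<in> X" using e_sum x by (simp add: assembled_def)
  qed
  show st: "stable (assembled V)"
    unfolding stable_def
  proof (intro conjI ballI allI impI)
    show "cv.subspace (assembled V)"
      unfolding cv.subspace_def
    proof (intro conjI ballI allI)
      show "0 \<in> assembled V" using V0 lin_on_zero[OF e_lin W] cv.subspace_0[OF W] by (simp add: assembled_def)
      fix x y assume "x \<in> assembled V" "y \<in> assembled V"
      then show "x + y \<in> assembled V"
        using lin_on_add[OF e_lin] subrepD(1)[OF V] by (auto simp: assembled_def cv.subspace_add cv.subspace_add[OF W])
    next
      fix c x assume "x \<in> assembled V"
      then show "c *\<^sub>C x \<in> assembled V"
        using lin_on_scale[OF e_lin] subrepD(1)[OF V] by (auto simp: assembled_def cv.subspace_scale cv.subspace_scale[OF W])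
    qed
    show "assembled V \<subseteq> W" by (auto simp: assembled_def)
    show "e i x \<in> assembled V" if "i \<in> I" "x \<in> assembled V" for i x using Vtot[OF that(1)] that by (auto simp: assembled_def)
    fix i j x assume E: "(i, j) \<in> E" and x: "x \<in> assembled V"
    have ij: "i \<in> I" "j \<in> I" using E E_I by auto
    have "a i j (e i x) \<in> V j" using subrepD(4)[OF V E] x ij(1) by (auto simp: assembled_def)
    then have "a i j x \<in> V j" using a_e[OF E] x by (simp add: assembled_def)
    then show "a i j x \<in> assembled V" using Vtot[OF ij(2)] by blast
  qed
  show "sp (assembled V) i = V i" if i: "i \<in> I" for i
  proof
    show "sp (assembled V) i \<subseteq> V i" using i by (auto simp: sp_def assembled_def)
    show "V i \<subseteq> sp (assembled V) i" using Vtot[OF i] VX(3)[OF i] sp_iff[OF st i] by blast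
  qed
qed

lemma pact_stable: "stable X \<Longrightarrow> w \<in> DP \<Longrightarrow> x \<in> X \<Longrightarrow> pact w x \<in> X"
  by (induction w x rule: pact.induct) (auto simp: DP_Cons DP_nonempty stableD)

lemma act_stable: "stable X \<Longrightarrow> p \<in> carrier P \<Longrightarrow> x \<in> X \<Longrightarrow> act p x \<in> X"
  unfolding act_def using pact_stable stableD(1)
  by (intro cv.subspace_sum cv.subspace_scale) (auto simp: path_algebra_simps)

end

context coord
begin

lemma op_act: "p \<in> carrier P \<Longrightarrow> x \<in> W \<Longrightarrow> op p x = act p x"
proof (induction rule: path_algebra_induct)
  case zero then show ?case by (simp add: op_zero act_zero)
next
  case (add w c f)
  have "op (spath w c) x = c *\<^sub>C pact w x" if "w \<in> DP" "x \<in> W" for w x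
    using that
  proof (induction w x rule: pact.induct)
    case (2 i x)
    have s: "spath [i] 1 \<in> carrier P" using 2 by (intro spath_carrier)
    have "spath [i] c = path_scalar c \<otimes>\<^bsub>P\<^esub> spath [i] 1" using path_scalar_mult(1)[OF s] by (auto simp: spath_def fun_eq_iff)
    then have "op (spath [i] c) x = c *\<^sub>C e i x"
      using op_mult[OF path_scalar_carrier s 2(2)] op_Kc[OF op_W[OF s 2(2)]] unfolding e_def by simp
    then show ?case by simp
  next
    case (3 i j r x)
    then have E: "(i, j) \<in> E" and D: "j # r \<in> DP" by (auto simp: DP_Cons)
    have "spath (i # j # r) c = spath (j # r) c \<otimes>\<^bsub>P\<^esub> arrow (i, j)" by (simp add: arrow_spath spath_mult)
    then have "op (spath (i # j # r) c) x = op (spath (j # r) c) (a i j x)"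
      using op_mult[OF spath_carrier[OF D] arrow_carrier[OF E] 3(3)] by (simp add: a_def)
    also have "\<dots> = c *\<^sub>C pact (j # r) (a i j x)" using 3(1)[OF D a_W[OF E 3(3)]] .
    finally show ?case by simp
  qed (simp add: DP_nonempty)
  then show ?case using add op_add[OF spath_carrier[OF add(1)] add(2) add.prems] act_add[OF spath_carrier[OF add(1)] add(2)]
    by (simp add: act_spath)
qed

text \<open>
  The generator of the ideal acts as zero, and on the part at \<open>i\<close> only the mesh relation at \<open>i\<close>
  contributes to it.
\<close>

lemma mesh_zero: assumes i: "i \<in> I" and x: "x \<in> W" shows "mesh a i x = 0"
proof -
  have ex: "e i x \<in> W" "e i x \<in> sp W i" using e_W[OF i x] e_mem_sp[OF x] by auto
  have rho: "rho \<in> Jd" unfolding ideal_eq using ring.genideal_self'[OF ringP rho_carrier] .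
  have "act rho (e i x) = 0"
    using op_act[OF rho_carrier ex(1)] path_smult_ideal[OF lmT rho Phi_T[OF ex(1)]] psi_Phi[OF cv.subspace_0[OF W]] Phi_zero
    by (simp add: op_def)
  moreover have "(\<Sum>k\<in>I. mesh a k (e i x)) = (\<Sum>k\<in>I. if k = i then mesh a i (e i x) else 0)"
  proof (rule sum.cong)
    fix k assume k: "k \<in> I"
    show "mesh a k (e i x) = (if k = i then mesh a i (e i x) else 0)"
    proof (cases "k = i")
      case False
      have "a l k (a k l (e i x)) = 0" if "l \<in> nb k" for l
        using a_other[OF i k ex(2) False nbD(1)[OF that]] lin_on_zero[OF a_lin[OF nbD(2)[OF that]] W] by simp
      then show ?thesis using False by (simp add: mesh_def)
    qed simp
  qed simp
  ultimately have "mesh a i (e i x) = 0" using act_rho[OF ex(1)] finI i by simp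
  then show ?thesis using mesh_e[OF i x] by simp
qed

lemma stable_is_rep: "stable X \<Longrightarrow> is_rep (sp X) a"
  using stable_rep[OF _ Wfd mesh_zero] .

lemma submodule_of_stable:
  assumes X: "stable X" shows "submodule (\<Phi> ` X) Lam T"
proof (rule submodule_intro[OF lmT])
  show "\<Phi> ` X \<subseteq> carrier T" using stableD(2)[OF X] Phi_T by blast
  show "\<zero>\<^bsub>T\<^esub> \<in> \<Phi> ` X" using cv.subspace_0[OF stableD(1)[OF X]] Phi_zero by (metis image_eqI)
  show "x \<oplus>\<^bsub>T\<^esub> y \<in> \<Phi> ` X" if "x \<in> \<Phi> ` X" "y \<in> \<Phi> ` X" for x y
    using that Phi_add[symmetric] stableD(3)[OF X] cv.subspace_add[OF stableD(1)[OF X]] by auto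
  show "path_smult T p x \<in> \<Phi> ` X" if p: "p \<in> carrier P" and x: "x \<in> \<Phi> ` X" for p x
  proof -
    obtain u where u: "u \<in> X" "x = \<Phi> u" using x by blast
    then show ?thesis using Phi_op[OF p] op_act[OF p] stableD(3)[OF X u(1)] act_stable[OF X p u(1)] by (metis image_eqI)
  qed
qed

definition "pre U = {x \<in> W. \<Phi> x \<in> U}"

lemma stable_of_submodule:
  assumes U: "submodule U Lam T" shows "stable (pre U)" "\<Phi> ` pre U = U"
proof -
  note s = submodule_facts[OF lmT U]
  have op: "op p x \<in> pre U" if "p \<in> carrier P" "x \<in> pre U" for p x
    using that s(4) op_W Phi_op by (auto simp: pre_def)
  show "stable (pre U)"
    unfolding stable_def
  proof (intro conjI ballI allI impI)
    show "cv.subspace (pre U)"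
      unfolding cv.subspace_def
      using s cv.subspace_0[OF W] Phi_zero Phi_add Phi_scale cv.subspace_add[OF W] cv.subspace_scale[OF W] path_scalar_carrier
      by (auto simp: pre_def)
    show "pre U \<subseteq> W" by (auto simp: pre_def)
    show "e i x \<in> pre U" if "i \<in> I" "x \<in> pre U" for i x
      unfolding e_def by (rule op[OF spath_carrier[OF vertex_DP[OF that(1)]] that(2)])
    show "a i j x \<in> pre U" if "(i, j) \<in> E" "x \<in> pre U" for i j x
      unfolding a_def by (rule op[OF arrow_carrier[OF that(1)] that(2)])
  qed
  show "\<Phi> ` pre U = U" using s(1) psi_W Phi_psi by (force simp: pre_def)
qed

end

section \<open>Direct summands\<close>

context opspace
begin

definition "is_decomp X Y \<longleftrightarrow> stable X \<and> stable Y \<and> X \<inter> Y = {0} \<and> (\<forall>x\<in>W. \<exists>u\<in>X. \<exists>v\<in>Y. x = u + v)"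

lemma decomp_projection:
  assumes d: "is_decomp X Y"
  obtains q where "lin_on W q" "\<And>x. x \<in> W \<Longrightarrow> q x \<in> X" "\<And>x. x \<in> X \<Longrightarrow> q x = x"
    "\<And>i x. i \<in> I \<Longrightarrow> x \<in> W \<Longrightarrow> q (e i x) = e i (q x)" "\<And>i j x. (i, j) \<in> E \<Longrightarrow> x \<in> W \<Longrightarrow> q (a i j x) = a i j (q x)"
proof -
  have X: "stable X" and Y: "stable Y" and XY: "X \<inter> Y = {0}" and sum: "\<forall>x\<in>W. \<exists>u\<in>X. \<exists>v\<in>Y. x = u + v"
    using d by (auto simp: is_decomp_def)
  note sX = stableD(1)[OF X] and sY = stableD(1)[OF Y]
  have "\<forall>x\<in>W. \<exists>u. u \<in> X \<and> x - u \<in> Y"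
  proof
    fix x assume "x \<in> W"
    then obtain u v where "u \<in> X" "v \<in> Y" "x = u + v" using sum by blast
    then show "\<exists>u. u \<in> X \<and> x - u \<in> Y" by (intro exI[of _ u]) simp
  qed
  then obtain q where q: "\<And>x. x \<in> W \<Longrightarrow> q x \<in> X" "\<And>x. x \<in> W \<Longrightarrow> x - q x \<in> Y" by metis
  have uniq: "q x = u" if x: "x \<in> W" and u: "u \<in> X" "x - u \<in> Y" for x u
  proof -
    have "q x - u \<in> X" using cv.subspace_diff[OF sX q(1)[OF x] u(1)] .
    moreover have "(x - u) - (x - q x) \<in> Y" using cv.subspace_diff[OF sY u(2) q(2)[OF x]] .
    then have "q x - u \<in> Y" by simp
    ultimately have "q x - u \<in> X \<inter> Y" by blast
    then show ?thesis using XY by simp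
  qed
  show ?thesis
  proof (rule that[of q])
    show "lin_on W q"
      unfolding lin_on_def
    proof (intro conjI ballI allI)
      fix x y assume x: "x \<in> W" and y: "y \<in> W"
      have "(x - q x) + (y - q y) \<in> Y" using cv.subspace_add[OF sY q(2)[OF x] q(2)[OF y]] .
      then show "q (x + y) = q x + q y"
        by (intro uniq cv.subspace_add[OF W x y] cv.subspace_add[OF sX q(1)[OF x] q(1)[OF y]]) (simp add: algebra_simps)
    next
      fix c x assume x: "x \<in> W"
      have "c *\<^sub>C (x - q x) \<in> Y" using cv.subspace_scale[OF sY q(2)[OF x]] .
      then show "q (c *\<^sub>C x) = c *\<^sub>C q x"
        by (intro uniq cv.subspace_scale[OF W x] cv.subspace_scale[OF sX q(1)[OF x]]) (simp add: cv.scale_right_diff_distrib)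
    qed
    show "q x \<in> X" if "x \<in> W" for x using q(1)[OF that] .
    show "q x = x" if "x \<in> X" for x by (rule uniq) (use that stableD(3)[OF X] cv.subspace_0[OF sY] in auto)
    show "q (e i x) = e i (q x)" if i: "i \<in> I" and x: "x \<in> W" for i x
    proof (rule uniq[OF e_W[OF i x] stableD(4)[OF X i q(1)[OF x]]])
      have "e i (x - q x) = e i x - e i (q x)" by (rule lin_on_diff[OF e_lin[OF i] W x stableD(3)[OF X q(1)[OF x]]])
      then show "e i x - e i (q x) \<in> Y" using stableD(4)[OF Y i q(2)[OF x]] by simp
    qed
    show "q (a i j x) = a i j (q x)" if E: "(i, j) \<in> E" and x: "x \<in> W" for i j x
    proof (rule uniq[OF a_W[OF E x] stableD(5)[OF X E q(1)[OF x]]])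
      have "a i j (x - q x) = a i j x - a i j (q x)" by (rule lin_on_diff[OF a_lin[OF E] W x stableD(3)[OF X q(1)[OF x]]])
      then show "a i j x - a i j (q x) \<in> Y" using stableD(5)[OF Y E q(2)[OF x]] by simp
    qed
  qed
qed

text \<open>
  Extend a cocycle by the projections to the whole space, bound it there and project back.
\<close>

lemma summands_ext_orth:
  assumes o: "ext_orth (sp W) a (sp W) a" and X: "is_decomp X Y" and X': "is_decomp X' Y'"
  shows "ext_orth (sp X) a (sp X') a"
  unfolding ext_orth_def
proof (intro allI impI)
  fix g assume g: "cocycle (sp X) a (sp X') a g"
  obtain q where q: "lin_on W q" "\<And>x. x \<in> W \<Longrightarrow> q x \<in> X" "\<And>x. x \<in> X \<Longrightarrow> q x = x"
    "\<And>i x. i \<in> I \<Longrightarrow> x \<in> W \<Longrightarrow> q (e i x) = e i (q x)" "\<And>i j x. (i, j) \<in> E \<Longrightarrow> x \<in> W \<Longrightarrow> q (a i j x) = a i j (q x)"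
    using decomp_projection[OF X] by blast
  obtain r where r: "lin_on W r" "\<And>x. x \<in> W \<Longrightarrow> r x \<in> X'" "\<And>x. x \<in> X' \<Longrightarrow> r x = x"
    "\<And>i x. i \<in> I \<Longrightarrow> x \<in> W \<Longrightarrow> r (e i x) = e i (r x)" "\<And>i j x. (i, j) \<in> E \<Longrightarrow> x \<in> W \<Longrightarrow> r (a i j x) = a i j (r x)"
    using decomp_projection[OF X'] by blast
  have stX: "stable X" and stX': "stable X'" using X X' by (auto simp: is_decomp_def)
  have WW: "x \<in> W" if "i \<in> I" "x \<in> sp W i" for i x using sp_eq(2)[OF stable_W that] .
  have qsp: "q x \<in> sp X i" if i: "i \<in> I" and x: "x \<in> sp W i" for i x
    using q(2,4)[OF _] sp_eq[OF stable_W i x] i unfolding sp_iff[OF stX i] by metis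
  have rsp: "r x \<in> sp X' i" if i: "i \<in> I" and x: "x \<in> sp W i" for i x
    using r(2,4)[OF _] sp_eq[OF stable_W i x] i unfolding sp_iff[OF stX' i] by metis
  let ?g = "\<lambda>i j x. g i j (q x)"
  have spX: "sp X i \<subseteq> sp W i" "sp X' i \<subseteq> sp W i" for i
    using sp_mono[OF stableD(2)[OF stX]] sp_mono[OF stableD(2)[OF stX']] by auto
  have "cocycle (sp W) a (sp W) a ?g"
    unfolding cocycle_def
  proof (intro conjI allI impI ballI)
    fix i j assume E: "(i, j) \<in> E"
    then have ij: "i \<in> I" "j \<in> I" using E_I by auto
    show "lin_on (sp W i) (?g i j)"
      by (rule lin_on_comp[OF lin_on_subset[OF q(1)] _ cocycleD(1)[OF g E]]) (use WW[OF ij(1)] qsp[OF ij(1)] in auto)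
    show "?g i j x \<in> sp W j" if "x \<in> sp W i" for x
      using cocycleD(2)[OF g E qsp[OF ij(1) that]] spX(2) by blast
  next
    fix i x assume i: "i \<in> I" and x: "x \<in> sp W i"
    have "(\<Sum>j\<in>nb i. sgn_eps \<Omega> i j *\<^sub>C (a j i (?g i j x) + ?g j i (a i j x)))
        = (\<Sum>j\<in>nb i. sgn_eps \<Omega> i j *\<^sub>C (a j i (g i j (q x)) + g j i (a i j (q x))))"
      using q(5)[OF nbD(1) WW[OF i x]] by (intro sum.cong) auto
    then show "(\<Sum>j\<in>nb i. sgn_eps \<Omega> i j *\<^sub>C (a j i (?g i j x) + ?g j i (a i j x))) = 0"
      using cocycleD(3)[OF g i qsp[OF i x]] by simp
  qed
  then have "coboundary (sp W) a (sp W) a ?g" using o unfolding ext_orth_def by blast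
  then obtain f where f: "maps (sp W) (sp W) f" "\<And>i j x. (i, j) \<in> E \<Longrightarrow> x \<in> sp W i \<Longrightarrow> ?g i j x = f j (a i j x) - a i j (f i x)"
    by (rule coboundaryE) blast
  have "maps (sp X) (sp X') (\<lambda>i x. r (f i x))"
    unfolding maps_def
  proof (intro ballI conjI)
    fix i assume i: "i \<in> I"
    show "lin_on (sp X i) (\<lambda>x. r (f i x))"
      by (rule lin_on_comp[OF lin_on_subset[OF mapsD(1)[OF f(1) i] spX(1)] _ r(1)])
        (use mapsD(2)[OF f(1) i] spX(1) WW[OF i] in blast)
    show "r (f i x) \<in> sp X' i" if "x \<in> sp X i" for x using rsp[OF i mapsD(2)[OF f(1) i]] spX(1) that by blast
  qed
  moreover have "g i j x = r (f j (a i j x)) - a i j (r (f i x))" if E: "(i, j) \<in> E" and x: "x \<in> sp X i" for i j x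
  proof -
    have ij: "i \<in> I" "j \<in> I" using E E_I by auto
    have xW: "x \<in> sp W i" "x \<in> X" using x spX(1) sp_eq(2)[OF stX ij(1)] by auto
    have m: "f i x \<in> W" using WW[OF ij(1) mapsD(2)[OF f(1) ij(1) xW(1)]] .
    have ax: "a i j x \<in> sp W j" using e_a[OF E WW[OF ij(1) xW(1)]] a_W[OF E WW[OF ij(1) xW(1)]] sp_iff[OF stable_W ij(2)] by simp
    have m2: "f j (a i j x) \<in> W" using WW[OF ij(2) mapsD(2)[OF f(1) ij(2) ax]] .
    have "g i j x \<in> X'" using sp_eq(2)[OF stX' ij(2) cocycleD(2)[OF g E x]] .
    then have "g i j x = r (?g i j x)" using r(3) q(3)[OF xW(2)] by simp
    also have "\<dots> = r (f j (a i j x) - a i j (f i x))" using f(2)[OF E xW(1)] by simp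
    also have "\<dots> = r (f j (a i j x)) - r (a i j (f i x))" by (rule lin_on_diff[OF r(1) W m2 a_W[OF E m]])
    also have "r (a i j (f i x)) = a i j (r (f i x))" by (rule r(5)[OF E m])
    finally show ?thesis .
  qed
  ultimately show "coboundary (sp X) a (sp X') a g" unfolding coboundary_def by blast
qed

text \<open>The linear map assembled from the components of a homomorphism of representations.\<close>

definition "total_map f x = (\<Sum>i\<in>I. f i (e i x))"

lemma total_map_props:
  assumes X: "stable X" and Y: "stable Y" and f: "rep_hom (sp X) a (sp Y) a f"
  shows "lin_on X (total_map f)" "x \<in> X \<Longrightarrow> total_map f x \<in> Y" "i \<in> I \<Longrightarrow> x \<in> X \<Longrightarrow> e i (total_map f x) = f i (e i x)"
    "p \<in> carrier P \<Longrightarrow> x \<in> X \<Longrightarrow> total_map f (act p x) = act p (total_map f x)"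
proof -
  note fm = mapsD[OF rep_homD(1)[OF f]]
  have ex: "e i x \<in> sp X i" if "x \<in> X" for i x using e_mem_sp[OF that] .
  have fe: "f i (e i x) \<in> Y" "f i (e i x) \<in> sp Y i" if "i \<in> I" "x \<in> X" for i x
    using fm(2)[OF that(1) ex[OF that(2)]] sp_eq(2)[OF Y that(1)] by auto
  show lin: "lin_on X (total_map f)" unfolding total_map_def
  proof (rule lin_on_sum_fun)
    fix i assume i: "i \<in> I"
    show "lin_on X (\<lambda>x. f i (e i x))"
      by (rule lin_on_comp[OF lin_on_subset[OF e_lin[OF i] stableD(2)[OF X]] ex fm(1)[OF i]])
  qed
  show tY: "total_map f x \<in> Y" if "x \<in> X" for x
    unfolding total_map_def using fe(1) that by (intro cv.subspace_sum[OF stableD(1)[OF Y]])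
  show et: "e i (total_map f x) = f i (e i x)" if i: "i \<in> I" and x: "x \<in> X" for i x
  proof -
    have "e i (total_map f x) = (\<Sum>k\<in>I. e i (f k (e k x)))"
      unfolding total_map_def by (rule lin_on_sum[OF e_lin[OF i] W]) (rule stableD(3)[OF Y fe(1)[OF _ x]])
    also have "\<dots> = (\<Sum>k\<in>I. if k = i then f i (e i x) else 0)"
    proof (rule sum.cong)
      fix k assume k: "k \<in> I"
      have "f k (e k x) \<in> sp W k" using fe(2)[OF k x] sp_mono[OF stableD(2)[OF Y]] by blast
      then show "e i (f k (e k x)) = (if k = i then f i (e i x) else 0)"
        using e_other[OF k i] sp_eq(1)[OF stable_W k] by auto
    qed simp
    finally show ?thesis using i finI by simp
  qed
  have tsp: "total_map f y = f i y" if i: "i \<in> I" and y: "y \<in> sp X i" for i y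
  proof -
    have yW: "y \<in> sp W i" using y sp_mono[OF stableD(2)[OF X]] by blast
    have "total_map f y = (\<Sum>k\<in>I. if k = i then f i y else 0)"
      unfolding total_map_def
    proof (rule sum.cong)
      fix k assume k: "k \<in> I"
      have "f k 0 = 0" using lin_on_zero[OF fm(1)[OF k]] subspace_lin_image[OF lin_on_subset[OF e_lin[OF k] stableD(2)[OF X]] stableD(1)[OF X]]
        by (simp add: sp_def)
      then show "f k (e k y) = (if k = i then f i y else 0)"
        using e_other[OF i k yW] sp_eq(1)[OF X i y] by auto
    qed simp
    then show ?thesis using i finI by simp
  qed
  have te: "total_map f (e i x) = e i (total_map f x)" if "i \<in> I" "x \<in> X" for i x
    using tsp[OF that(1) ex[OF that(2)]] et[OF that] by simp
  have ta: "total_map f (a i j x) = a i j (total_map f x)" if E: "(i, j) \<in> E" and x: "x \<in> X" for i j x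
  proof -
    have ij: "i \<in> I" "j \<in> I" using E E_I by auto
    have "a i j x \<in> sp X j" using stableD(5)[OF X E x] e_a[OF E stableD(3)[OF X x]] sp_iff[OF X ij(2)] by simp
    then have "total_map f (a i j x) = f j (a i j (e i x))" using tsp[OF ij(2)] a_e[OF E stableD(3)[OF X x]] by simp
    also have "\<dots> = a i j (f i (e i x))" using rep_homD(2)[OF f E ex[OF x]] .
    also have "\<dots> = a i j (total_map f x)" using et[OF ij(1) x] a_e[OF E stableD(3)[OF Y tY[OF x]]] by simp
    finally show ?thesis .
  qed
  have tp: "total_map f (pact w x) = pact w (total_map f x)" if "w \<in> DP" "x \<in> X" for w x
    using that
    by (induction w x rule: pact.induct) (auto simp: DP_Cons DP_nonempty te ta stableD(5)[OF X])
  show "total_map f (act p x) = act p (total_map f x)" if p: "p \<in> carrier P" and x: "x \<in> X"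
  proof -
    have D: "w \<in> DP" if "p w \<noteq> 0" for w using p that by (auto simp: path_algebra_simps)
    have px: "pact w x \<in> X" if "p w \<noteq> 0" for w by (rule pact_stable[OF X D[OF that] x])
    have "total_map f (act p x) = (\<Sum>w\<in>{w. p w \<noteq> 0}. total_map f (p w *\<^sub>C pact w x))"
      unfolding act_def using px cv.subspace_scale[OF stableD(1)[OF X]]
      by (intro lin_on_sum[OF lin stableD(1)[OF X]]) auto
    also have "\<dots> = act p (total_map f x)"
      unfolding act_def using lin_on_scale[OF lin px] tp[OF D x] by (intro sum.cong) auto
    finally show ?thesis .
  qed
qed

lemma total_map_bij:
  assumes X: "stable X" and Y: "stable Y" and f: "rep_iso (sp X) a (sp Y) a f"
  shows "bij_betw (total_map f) X Y"
proof -
  have fh: "rep_hom (sp X) a (sp Y) a f" and fb: "\<And>i. i \<in> I \<Longrightarrow> bij_betw (f i) (sp X i) (sp Y i)"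
    using f by (auto simp: rep_iso_def)
  note t = total_map_props[OF X Y fh]
  have spX: "cv.subspace (sp X i)" if "i \<in> I" for i
    unfolding sp_def by (rule subspace_lin_image[OF lin_on_subset[OF e_lin[OF that] stableD(2)[OF X]] stableD(1)[OF X]])
  show ?thesis
    unfolding bij_betw_def
  proof
    show "inj_on (total_map f) X"
      unfolding lin_on_inj_iff[OF t(1) stableD(1)[OF X]]
    proof (intro ballI impI)
      fix x assume x: "x \<in> X" "total_map f x = 0"
      have "e i x = 0" if i: "i \<in> I" for i
      proof -
        have "f i (e i x) = 0" using t(3)[OF i x(1)] x(2) lin_on_zero[OF e_lin[OF i] W] by simp
        then show ?thesis
          using fb[OF i] lin_on_inj_iff[OF mapsD(1)[OF rep_homD(1)[OF fh] i] spX[OF i]] e_mem_sp[OF x(1)]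
          by (auto simp: bij_betw_def)
      qed
      then show "x = 0" using e_sum[OF stableD(3)[OF X x(1)]] by simp
    qed
    show "total_map f ` X = Y"
    proof
      show "total_map f ` X \<subseteq> Y" using t(2) by blast
      show "Y \<subseteq> total_map f ` X"
      proof
        fix y assume y: "y \<in> Y"
        have "\<forall>i\<in>I. \<exists>x\<in>sp X i. f i x = e i y"
        proof
          fix i assume "i \<in> I"
          then have "e i y \<in> f i ` sp X i" using fb e_mem_sp[OF y] by (simp add: bij_betw_def)
          then show "\<exists>x\<in>sp X i. f i x = e i y" by force
        qed
        then obtain x where x: "\<And>i. i \<in> I \<Longrightarrow> x i \<in> sp X i" "\<And>i. i \<in> I \<Longrightarrow> f i (x i) = e i y" by metis
        let ?x = "\<Sum>i\<in>I. x i"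
        have xX: "x i \<in> X" "x i \<in> W" "x i \<in> sp W i" if "i \<in> I" for i
          using sp_eq(2)[OF X that x(1)[OF that]] stableD(3)[OF X] sp_mono[OF stableD(2)[OF X]] x(1)[OF that] by auto
        have xs: "?x \<in> X" using xX(1) by (intro cv.subspace_sum[OF stableD(1)[OF X]])
        have ex: "e i ?x = x i" if i: "i \<in> I" for i
        proof -
          have "e i ?x = (\<Sum>k\<in>I. e i (x k))" using xX(2) by (intro lin_on_sum[OF e_lin[OF i] W])
          also have "\<dots> = (\<Sum>k\<in>I. if k = i then x i else 0)"
            using e_other[OF _ i xX(3)] sp_eq(1)[OF X i x(1)[OF i]] by (intro sum.cong) auto
          finally show ?thesis using i finI by simp
        qed
        have "total_map f ?x = (\<Sum>i\<in>I. e i y)" unfolding total_map_def using ex x(2) by (intro sum.cong) auto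
        also have "\<dots> = y" using e_sum[OF stableD(3)[OF Y y]] .
        finally show "y \<in> total_map f ` X" using xs by blast
      qed
    qed
  qed
qed

end

context coord
begin

lemma complementary_decomp:
  assumes c: "complementary Lam T U U'" shows "is_decomp (pre U) (pre U')"
  unfolding is_decomp_def
proof (intro conjI ballI)
  have U: "submodule U Lam T" "submodule U' Lam T" and int: "U \<inter> U' = {\<zero>\<^bsub>T\<^esub>}" and sum: "U <+>\<^bsub>T\<^esub> U' = carrier T"
    using c by (auto simp: complementary_def)
  note st = stable_of_submodule[OF U(1)] and st' = stable_of_submodule[OF U(2)]
  show "stable (pre U)" "stable (pre U')" using st st' by auto
  show "pre U \<inter> pre U' = {0}"
  proof
    show "pre U \<inter> pre U' \<subseteq> {0}"
    proof
      fix x assume x: "x \<in> pre U \<inter> pre U'"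
      then have "\<Phi> x = \<zero>\<^bsub>T\<^esub>" using int by (auto simp: pre_def)
      then have "x = 0" using x psi_Phi[of x] psi_Phi[OF cv.subspace_0[OF W]] Phi_zero by (simp add: pre_def)
      then show "x \<in> {0}" by simp
    qed
    show "{0} \<subseteq> pre U \<inter> pre U'" using cv.subspace_0 stableD(1)[OF st(1)] stableD(1)[OF st'(1)] by blast
  qed
  fix x assume x: "x \<in> W"
  then have "\<Phi> x \<in> U <+>\<^bsub>T\<^esub> U'" using sum Phi_T by simp
  then obtain u v where uv: "u \<in> U" "v \<in> U'" "\<Phi> x = u \<oplus>\<^bsub>T\<^esub> v" unfolding set_add_def' by blast
  have uT: "u \<in> carrier T" "v \<in> carrier T" using uv submodule_facts(1)[OF lmT U(1)] submodule_facts(1)[OF lmT U(2)] by auto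
  have "x = \<psi> u + \<psi> v" using psi_add[OF uT] uv(3) psi_Phi[OF x] by simp
  moreover have "\<psi> u \<in> pre U" "\<psi> v \<in> pre U'" using uv psi_W Phi_psi uT by (auto simp: pre_def)
  ultimately show "\<exists>u\<in>pre U. \<exists>v\<in>pre U'. x = u + v" by blast
qed

lemma indecomposable_rep_indec:
  assumes U: "submodule U Lam T" and ind: "indecomposable Lam (restrict_module T U)"
  shows "rep_indec (sp (pre U)) a"
proof -
  note st = stable_of_submodule[OF U]
  let ?X = "pre U"
  have ne: "U \<noteq> {\<zero>\<^bsub>T\<^esub>}" and dec: "\<And>A B. complementary Lam (restrict_module T U) A B \<Longrightarrow> A = {\<zero>\<^bsub>T\<^esub>} \<or> B = {\<zero>\<^bsub>T\<^esub>}"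
    using ind by (auto simp: indecomposable_def)
  have inj0: "x = 0" if "x \<in> W" "\<Phi> x = \<zero>\<^bsub>T\<^esub>" for x
    using that psi_Phi[of x] psi_Phi[OF cv.subspace_0[OF W]] Phi_zero by simp
  show ?thesis
    unfolding rep_indec_def
  proof (intro conjI allI impI)
    show "\<exists>i\<in>I. sp ?X i \<noteq> {0}"
    proof (rule ccontr)
      assume "\<not> ?thesis"
      then have z: "e i x = 0" if "i \<in> I" "x \<in> ?X" for i x using that e_mem_sp by blast
      have "x = 0" if "x \<in> ?X" for x using e_sum[OF stableD(3)[OF st(1) that]] z[OF _ that] by simp
      then have "?X = {0}" using cv.subspace_0[OF stableD(1)[OF st(1)]] by blast
      then show False using st(2) ne Phi_zero by auto
    qed
    fix V V' assume V: "subrep (sp ?X) a V" and V': "subrep (sp ?X) a V'"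
      and d: "\<forall>i\<in>I. V i \<inter> V' i = {0} \<and> (\<forall>x\<in>sp ?X i. \<exists>v\<in>V i. \<exists>w\<in>V' i. x = v + w)"
    note t = assembled_stable[OF st(1) V] and t' = assembled_stable[OF st(1) V']
    let ?A = "\<Phi> ` assembled V" and ?B = "\<Phi> ` assembled V'"
    have sA: "submodule ?A Lam T" and sB: "submodule ?B Lam T" using submodule_of_stable t(1) t'(1) by auto
    have AU: "?A \<subseteq> U" "?B \<subseteq> U" using t(2) t'(2) by (auto simp: pre_def)
    have "complementary Lam (restrict_module T U) ?A ?B"
      unfolding complementary_def
    proof (intro conjI)
      show "submodule ?A Lam (restrict_module T U)" "submodule ?B Lam (restrict_module T U)"
        using submodule_restrict[OF lmT sA U AU(1)] submodule_restrict[OF lmT sB U AU(2)] by auto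
      show "?A \<inter> ?B = {\<zero>\<^bsub>restrict_module T U\<^esub>}"
      proof
        show "?A \<inter> ?B \<subseteq> {\<zero>\<^bsub>restrict_module T U\<^esub>}"
        proof
          fix y assume "y \<in> ?A \<inter> ?B"
          then obtain u v where uv: "u \<in> assembled V" "v \<in> assembled V'" "y = \<Phi> u" "y = \<Phi> v" by blast
          have uW: "u \<in> W" "v \<in> W" using uv by (auto simp: assembled_def)
          then have "u = v" using uv psi_Phi by metis
          have "e i u = 0" if i: "i \<in> I" for i
          proof -
            have "e i u \<in> V i \<inter> V' i" using uv i \<open>u = v\<close> by (auto simp: assembled_def)
            then show ?thesis using d i by blast
          qed
          then have "u = 0" using e_sum[OF uW(1)] by simp
          then show "y \<in> {\<zero>\<^bsub>restrict_module T U\<^esub>}" using uv Phi_zero by simp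
        qed
        show "{\<zero>\<^bsub>restrict_module T U\<^esub>} \<subseteq> ?A \<inter> ?B"
          using submodule_facts(2)[OF lmT sA] submodule_facts(2)[OF lmT sB] by simp
      qed
      show "?A <+>\<^bsub>restrict_module T U\<^esub> ?B = carrier (restrict_module T U)"
      proof
        show "?A <+>\<^bsub>restrict_module T U\<^esub> ?B \<subseteq> carrier (restrict_module T U)"
          using AU submodule_facts(3)[OF lmT U] unfolding set_add_def' by auto
        show "carrier (restrict_module T U) \<subseteq> ?A <+>\<^bsub>restrict_module T U\<^esub> ?B"
        proof
          fix y assume "y \<in> carrier (restrict_module T U)"
          then obtain x where x: "x \<in> ?X" "y = \<Phi> x" using st(2) by auto
          have "\<forall>i\<in>I. \<exists>v w. v \<in> V i \<and> w \<in> V' i \<and> e i x = v + w" using d e_mem_sp[OF x(1)] by blast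
          then obtain v w where vw: "\<And>i. i \<in> I \<Longrightarrow> v i \<in> V i" "\<And>i. i \<in> I \<Longrightarrow> w i \<in> V' i" "\<And>i. i \<in> I \<Longrightarrow> e i x = v i + w i" by metis
          have sv: "(\<Sum>i\<in>I. v i) \<in> assembled V" using vw(1) t(4) by (intro cv.subspace_sum[OF stableD(1)[OF t(1)]]) auto
          have sw: "(\<Sum>i\<in>I. w i) \<in> assembled V'" using vw(2) t'(4) by (intro cv.subspace_sum[OF stableD(1)[OF t'(1)]]) auto
          have "x = (\<Sum>i\<in>I. v i + w i)" using e_sum[OF stableD(3)[OF st(1) x(1)]] vw(3) by simp
          then have "x = (\<Sum>i\<in>I. v i) + (\<Sum>i\<in>I. w i)" by (simp add: sum.distrib)
          then have "y = \<Phi> (\<Sum>i\<in>I. v i) \<oplus>\<^bsub>T\<^esub> \<Phi> (\<Sum>i\<in>I. w i)" using x(2) Phi_add sv sw by (simp add: assembled_def)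
          then show "y \<in> ?A <+>\<^bsub>restrict_module T U\<^esub> ?B" unfolding set_add_def' using sv sw by auto
        qed
      qed
    qed
    then consider "?A = {\<zero>\<^bsub>T\<^esub>}" | "?B = {\<zero>\<^bsub>T\<^esub>}" using dec by blast
    then show "(\<forall>i\<in>I. V i = {0}) \<or> (\<forall>i\<in>I. V' i = {0})"
    proof cases
      case 1
      then have "assembled V \<subseteq> {0}" using inj0 by (auto simp: assembled_def)
      then show ?thesis using t(4) cv.subspace_0[OF subrepD(1)[OF V]] by blast
    next
      case 2
      then have "assembled V' \<subseteq> {0}" using inj0 by (auto simp: assembled_def)
      then show ?thesis using t'(4) cv.subspace_0[OF subrepD(1)[OF V']] by blast
    qed
  qed
qed

lemma rep_iso_mod_isomorphic:
  assumes U: "submodule U Lam T" and U': "submodule U' Lam T" and iso: "isomorphic (sp (pre U)) a (sp (pre U')) a"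
  shows "mod_isomorphic Lam (restrict_module T U) (restrict_module T U')"
proof -
  note st = stable_of_submodule[OF U] and st' = stable_of_submodule[OF U']
  obtain f where f: "rep_iso (sp (pre U)) a (sp (pre U')) a f" using iso by (auto simp: isomorphic_def)
  then have fh: "rep_hom (sp (pre U)) a (sp (pre U')) a f" by (simp add: rep_iso_def)
  note t = total_map_props[OF st(1) st'(1) fh] and tb = total_map_bij[OF st(1) st'(1) f]
  have UT: "U \<subseteq> carrier T" "U' \<subseteq> carrier T" using submodule_facts(1)[OF lmT U] submodule_facts(1)[OF lmT U'] by auto
  have psi: "\<psi> u \<in> pre U" if "u \<in> U" for u using that UT psi_W Phi_psi by (auto simp: pre_def)
  let ?H = "\<lambda>u. \<Phi> (total_map f (\<psi> u))"
  have HU: "?H u \<in> U'" if "u \<in> U" for u using t(2)[OF psi[OF that]] by (simp add: pre_def)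
  have tW: "total_map f (\<psi> u) \<in> W" if "u \<in> U" for u using stableD(3)[OF st'(1) t(2)[OF psi[OF that]]] .
  have "?H \<in> mod_hom Lam (restrict_module T U) (restrict_module T U')"
    unfolding mod_hom_def
  proof (intro CollectI conjI ballI)
    show "?H \<in> carrier (restrict_module T U) \<rightarrow> carrier (restrict_module T U')" using HU by auto
    fix u v assume "u \<in> carrier (restrict_module T U)" "v \<in> carrier (restrict_module T U)"
    then have uv: "u \<in> U" "v \<in> U" by auto
    then have uvT: "u \<in> carrier T" "v \<in> carrier T" using UT by auto
    have "total_map f (\<psi> (u \<oplus>\<^bsub>T\<^esub> v)) = total_map f (\<psi> u) + total_map f (\<psi> v)"
      using psi_add[OF uvT] lin_on_add[OF t(1) psi[OF uv(1)] psi[OF uv(2)]] by simp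
    then show "?H (u \<oplus>\<^bsub>restrict_module T U\<^esub> v) = ?H u \<oplus>\<^bsub>restrict_module T U'\<^esub> ?H v"
      using Phi_add[OF tW[OF uv(1)] tW[OF uv(2)]] by simp
  next
    fix r u assume r: "r \<in> carrier Lam" and "u \<in> carrier (restrict_module T U)"
    then have u: "u \<in> U" by simp
    obtain p where p: "p \<in> carrier P" "r = cls p" using cls_surj[OF r] by blast
    have uT: "u \<in> carrier T" using u UT by blast
    have "\<psi> (path_smult T p u) = act p (\<psi> u)" using op_act[OF p(1) psi_W[OF uT]] Phi_psi[OF uT] by (simp add: op_def)
    then have "?H (path_smult T p u) = \<Phi> (act p (total_map f (\<psi> u)))" using t(4)[OF p(1) psi[OF u]] by simp
    also have "\<dots> = path_smult T p (?H u)" using op_act[OF p(1) tW[OF u]] Phi_op[OF p(1) tW[OF u]] by simp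
    finally show "?H (r \<odot>\<^bsub>restrict_module T U\<^esub> u) = r \<odot>\<^bsub>restrict_module T U'\<^esub> ?H u" using p(2) by simp
  qed
  moreover have "bij_betw ?H U U'"
  proof -
    have "bij_betw \<psi> U (pre U)"
    proof (rule bij_betw_byWitness[where f' = \<Phi>])
      show "\<forall>u\<in>U. \<Phi> (\<psi> u) = u" using UT Phi_psi by blast
      show "\<forall>x\<in>pre U. \<psi> (\<Phi> x) = x" using psi_Phi by (auto simp: pre_def)
      show "\<psi> ` U \<subseteq> pre U" using psi by blast
      show "\<Phi> ` pre U \<subseteq> U" using st(2) by blast
    qed
    moreover have "bij_betw \<Phi> (pre U') U'"
    proof (rule bij_betw_byWitness[where f' = \<psi>])
      show "\<forall>u\<in>U'. \<Phi> (\<psi> u) = u" using UT Phi_psi by blast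
      show "\<forall>x\<in>pre U'. \<psi> (\<Phi> x) = x" using psi_Phi by (auto simp: pre_def)
      show "\<psi> ` U' \<subseteq> pre U'" using UT psi_W Phi_psi by (auto simp: pre_def)
      show "\<Phi> ` pre U' \<subseteq> U'" using st'(2) by blast
    qed
    ultimately show ?thesis using bij_betw_trans[OF bij_betw_trans[OF _ tb]] by (fastforce simp: comp_def)
  qed
  ultimately show ?thesis unfolding mod_isomorphic_def by auto
qed

section \<open>The extension defined by a cocycle\<close>

context
  fixes g :: "'i \<Rightarrow> 'i \<Rightarrow> 'u \<Rightarrow> 'u"
  assumes g: "cocycle (sp W) a (sp W) a g"
begin

text \<open>
  Two copies of \<open>W\<close>: the coordinate \<open>False\<close> is the quotient and \<open>True\<close> the submodule. The arrows
  act diagonally, and \<open>g\<close> leads from the quotient to the submodule.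
\<close>

definition "W2 = fam (UNIV :: bool set) (\<lambda>_. W)"
definition "e2 i v = (\<lambda>b :: bool. e i (v b))"
definition "a2 i j v = (\<lambda>b :: bool. a i j (v b) + (if b then g i j (e i (v False)) else 0))"

lemma W2_iff: "v \<in> W2 \<longleftrightarrow> (\<forall>b. v b \<in> W)"
  by (auto simp: W2_def fam_def)

lemma g_mem: assumes "(i, j) \<in> E" "x \<in> W"
  shows "g i j (e i x) \<in> W" "e j (g i j (e i x)) = g i j (e i x)"
proof -
  have "g i j (e i x) \<in> sp W j" by (rule cocycleD(2)[OF g assms(1) e_mem_sp[OF assms(2)]])
  then show "g i j (e i x) \<in> W" "e j (g i j (e i x)) = g i j (e i x)"
    using sp_eq[OF stable_W] E_I[OF assms(1)] by auto
qed

lemma g_lin: assumes "(i, j) \<in> E" shows "lin_on W (\<lambda>x. g i j (e i x))"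
  by (rule lin_on_comp[OF e_lin e_mem_sp cocycleD(1)[OF g assms]]) (use E_I[OF assms] in auto)

lemma opspace2: "opspace I E h \<Omega> W2 e2 a2"
proof
  show "cv.subspace W2" unfolding W2_def by (rule subspace_fam) (rule W)
  show "lin_on W2 (e2 i)" if i: "i \<in> I" for i
    using lin_on_add[OF e_lin[OF i]] lin_on_scale[OF e_lin[OF i]]
    by (auto simp: lin_on_def W2_iff e2_def fun_eq_iff cscale_apply)
  show "e2 i x \<in> W2" if "i \<in> I" "x \<in> W2" for i x using that e_W by (auto simp: W2_iff e2_def)
  show "e2 i (e2 j x) = (if i = j then e2 j x else 0)" if "i \<in> I" "j \<in> I" "x \<in> W2" for i j x
    using that e_e by (auto simp: W2_iff e2_def fun_eq_iff)
  show "(\<Sum>i\<in>I. e2 i x) = x" if "x \<in> W2" for x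
    using that e_sum by (auto simp: W2_iff e2_def fun_eq_iff sum_fun_apply)
  show "lin_on W2 (a2 i j)" if E: "(i, j) \<in> E" for i j
    using lin_on_add[OF a_lin[OF E]] lin_on_scale[OF a_lin[OF E]] lin_on_add[OF g_lin[OF E]] lin_on_scale[OF g_lin[OF E]]
    by (auto simp: lin_on_def W2_iff a2_def fun_eq_iff cscale_apply cscale_add_right)
  show "a2 i j x \<in> W2" if "(i, j) \<in> E" "x \<in> W2" for i j x
    using that a_W g_mem(1) cv.subspace_0[OF W] by (auto simp: W2_iff a2_def intro!: cv.subspace_add[OF W])
  show "e2 j (a2 i j x) = a2 i j x" if E: "(i, j) \<in> E" and x: "x \<in> W2" for i j x
  proof
    fix b
    have j: "j \<in> I" using E E_I by blast
    have x: "x b \<in> W" "x False \<in> W" using x by (auto simp: W2_iff)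
    show "e2 j (a2 i j x) b = a2 i j x b"
      using lin_on_add[OF e_lin[OF j] a_W[OF E x(1)] g_mem(1)[OF E x(2)]] e_a[OF E x(1)] g_mem(2)[OF E x(2)]
      by (cases b) (simp_all add: e2_def a2_def)
  qed
  show "a2 i j (e2 i x) = a2 i j x" if E: "(i, j) \<in> E" and x: "x \<in> W2" for i j x
  proof
    fix b
    have i: "i \<in> I" using E E_I by blast
    have x: "x b \<in> W" "x False \<in> W" using x by (auto simp: W2_iff)
    show "a2 i j (e2 i x) b = a2 i j x b" using a_e[OF E x(1)] e_e[OF i i x(2)] by (simp add: e2_def a2_def)
  qed
qed

interpretation O2: opspace I E h \<Omega> W2 e2 a2 by (rule opspace2)

text \<open>This is where the cocycle condition is used.\<close>

lemma mesh2: assumes k: "k \<in> I" and v: "v \<in> W2" shows "mesh a2 k v = 0"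
proof
  fix b
  have vW: "v b \<in> W" for b using v by (simp add: W2_iff)
  show "mesh a2 k v b = 0 b"
  proof (cases b)
    case False
    have "mesh a2 k v b = mesh a k (v b)" using False by (simp add: mesh_def a2_def sum_fun_apply cscale_apply)
    then show ?thesis using mesh_zero[OF k vW] by simp
  next
    case True
    let ?y = "e k (v False)"
    have "mesh a2 k v True = (\<Sum>l\<in>nb k. sgn_eps \<Omega> k l *\<^sub>C a l k (a k l (v True)) + sgn_eps \<Omega> k l *\<^sub>C (a l k (g k l ?y) + g l k (a k l ?y)))"
      unfolding mesh_def sum_fun_apply
    proof (rule sum.cong)
      fix l assume l: "l \<in> nb k"
      note n = nbD[OF l]
      have "e l (a k l (v False)) = a k l ?y" using e_a[OF n(1) vW] a_e[OF n(1) vW] by simp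
      moreover have "a l k (a k l (v True) + g k l ?y) = a l k (a k l (v True)) + a l k (g k l ?y)"
        by (rule lin_on_add[OF a_lin[OF n(2)] a_W[OF n(1) vW] g_mem(1)[OF n(1) vW]])
      ultimately show "(sgn_eps \<Omega> k l *\<^sub>C a2 l k (a2 k l v)) True
          = sgn_eps \<Omega> k l *\<^sub>C a l k (a k l (v True)) + sgn_eps \<Omega> k l *\<^sub>C (a l k (g k l ?y) + g l k (a k l ?y))"
        by (simp add: a2_def cscale_apply cscale_add_right add.assoc)
    qed simp
    also have "\<dots> = mesh a k (v True) + (\<Sum>l\<in>nb k. sgn_eps \<Omega> k l *\<^sub>C (a l k (g k l ?y) + g l k (a k l ?y)))"
      by (simp add: mesh_def sum.distrib)
    also have "\<dots> = 0" using mesh_zero[OF k vW] cocycleD(3)[OF g k e_mem_sp[OF vW]] by simp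
    finally show ?thesis using True by simp
  qed
qed

lemma pact2_False: "w \<in> DP \<Longrightarrow> v \<in> W2 \<Longrightarrow> O2.pact w v False = pact w (v False)"
proof (induction w v rule: O2.pact.induct)
  case (3 i j r v)
  then have E: "(i, j) \<in> E" and D: "j # r \<in> DP" by (auto simp: DP_Cons)
  have "a2 i j v False = a i j (v False)" by (simp add: a2_def)
  then show ?case using 3(1)[OF D O2.a_W[OF E 3(3)]] by simp
qed (auto simp: DP_nonempty e2_def)

lemma pact2_True: "w \<in> DP \<Longrightarrow> v \<in> W2 \<Longrightarrow> v False = 0 \<Longrightarrow> O2.pact w v True = pact w (v True)"
proof (induction w v rule: O2.pact.induct)
  case (3 i j r v)
  then have E: "(i, j) \<in> E" and D: "j # r \<in> DP" by (auto simp: DP_Cons)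
  have "a2 i j v False = 0" using 3(4) lin_on_zero[OF a_lin[OF E] W] by (simp add: a2_def)
  moreover have "a2 i j v True = a i j (v True)" using 3(4) lin_on_zero[OF g_lin[OF E] W] by (simp add: a2_def)
  ultimately show ?case using 3(1)[OF D O2.a_W[OF E 3(3)]] by simp
qed (auto simp: DP_nonempty e2_def)

lemma DPw: "p \<in> carrier P \<Longrightarrow> p w \<noteq> 0 \<Longrightarrow> w \<in> DP"
  by (auto simp: path_algebra_simps)

lemma act2_False: "p \<in> carrier P \<Longrightarrow> v \<in> W2 \<Longrightarrow> O2.act p v False = act p (v False)"
  unfolding O2.act_def act_def sum_fun_apply cscale_apply using pact2_False DPw by (intro sum.cong) auto

lemma act2_True: "p \<in> carrier P \<Longrightarrow> v \<in> W2 \<Longrightarrow> v False = 0 \<Longrightarrow> O2.act p v True = act p (v True)"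
  unfolding O2.act_def act_def sum_fun_apply cscale_apply using pact2_True DPw by (intro sum.cong) auto

lemma act2_cls:
  assumes "p \<in> carrier P" "q \<in> carrier P" "cls p = cls q" "v \<in> W2"
  shows "O2.act p v = O2.act q v"
proof -
  have "p \<ominus>\<^bsub>P\<^esub> q \<in> Jd" using cls_eq_iff assms by blast
  then have "O2.act (p \<ominus>\<^bsub>P\<^esub> q) v = 0" using O2.act_ideal[of "p \<ominus>\<^bsub>P\<^esub> q" v] mesh2 assms(4) by blast
  then show ?thesis using O2.act_minus[OF assms(1,2), of v] by simp
qed

definition dec2 :: "(bool \<Rightarrow> 'u) \<Rightarrow> 'm \<times> 'm" where "dec2 v = (\<Phi> (v True), \<Phi> (v False))"
definition enc2 :: "'m \<times> 'm \<Rightarrow> bool \<Rightarrow> 'u" where "enc2 z = (\<lambda>b. if b then \<psi> (fst z) else \<psi> (snd z))"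

abbreviation "TT \<equiv> carrier T \<times> carrier T"

lemma enc2_W: "z \<in> TT \<Longrightarrow> enc2 z \<in> W2"
  using psi_W by (auto simp: enc2_def W2_iff)

lemma dec2_TT: "v \<in> W2 \<Longrightarrow> dec2 v \<in> TT"
  using Phi_T by (auto simp: dec2_def W2_iff)

lemma dec2_enc2: "z \<in> TT \<Longrightarrow> dec2 (enc2 z) = z"
  using Phi_psi by (auto simp: dec2_def enc2_def)

lemma enc2_dec2: "v \<in> W2 \<Longrightarrow> enc2 (dec2 v) = v"
  using psi_Phi by (auto simp: dec2_def enc2_def W2_iff fun_eq_iff)

definition rep2 where "rep2 r = (SOME p. p \<in> carrier P \<and> cls p = r)"

text \<open>
  The extension with carrier \<open>carrier T \<times> carrier T\<close>. A class acts through an arbitrary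
  representative, which is harmless by \<open>act2_cls\<close>.
\<close>

definition L2 :: "(('i list \<Rightarrow> complex) set, 'm \<times> 'm) module" where
  "L2 = \<lparr>carrier = TT, mult = undefined, one = undefined, zero = (\<zero>\<^bsub>T\<^esub>, \<zero>\<^bsub>T\<^esub>),
     add = (\<lambda>x y. (fst x \<oplus>\<^bsub>T\<^esub> fst y, snd x \<oplus>\<^bsub>T\<^esub> snd y)),
     smult = (\<lambda>r z. dec2 (O2.act (rep2 r) (enc2 z)))\<rparr>"

lemma L2_simps: "carrier L2 = TT" "\<zero>\<^bsub>L2\<^esub> = (\<zero>\<^bsub>T\<^esub>, \<zero>\<^bsub>T\<^esub>)"
  "x \<oplus>\<^bsub>L2\<^esub> y = (fst x \<oplus>\<^bsub>T\<^esub> fst y, snd x \<oplus>\<^bsub>T\<^esub> snd y)"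
  by (simp_all add: L2_def)

lemma L2_smult:
  assumes p: "p \<in> carrier P" and z: "z \<in> TT"
  shows "path_smult L2 p z = dec2 (O2.act p (enc2 z))"
proof -
  have "rep2 (cls p) \<in> carrier P \<and> cls (rep2 (cls p)) = cls p" unfolding rep2_def by (rule someI[of _ p]) (use p in blast)
  then have "O2.act (rep2 (cls p)) (enc2 z) = O2.act p (enc2 z)" using act2_cls[OF _ p _ enc2_W[OF z]] by blast
  then show ?thesis by (simp add: L2_def)
qed

lemma dec2_add: "u \<in> W2 \<Longrightarrow> v \<in> W2 \<Longrightarrow> dec2 (u + v) = dec2 u \<oplus>\<^bsub>L2\<^esub> dec2 v"
  using Phi_add by (simp add: dec2_def L2_simps W2_iff)

lemma enc2_add: "u \<in> TT \<Longrightarrow> v \<in> TT \<Longrightarrow> enc2 (u \<oplus>\<^bsub>L2\<^esub> v) = enc2 u + enc2 v"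
  using psi_add by (auto simp: enc2_def L2_simps fun_eq_iff)

lemma L2_module: "left_module Lam L2"
proof -
  interpret T: left_module Lam T by (rule lmT)
  have ring: "ring Lam" unfolding Lam_eq by (rule ideal.quotient_is_ring[OF ideal_J])
  have ag: "abelian_group L2"
  proof (rule abelian_groupI)
    fix x assume x: "x \<in> carrier L2"
    show "\<exists>y\<in>carrier L2. y \<oplus>\<^bsub>L2\<^esub> x = \<zero>\<^bsub>L2\<^esub>"
      by (rule bexI[of _ "(\<ominus>\<^bsub>T\<^esub> fst x, \<ominus>\<^bsub>T\<^esub> snd x)"]) (use x in \<open>auto simp: L2_simps T.l_neg\<close>)
  qed (auto simp: L2_simps T.a_ac)
  show ?thesis
  proof (rule left_module.intro[OF ring ag], rule left_module_axioms.intro)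
    fix r s x y assume r: "r \<in> carrier Lam" and x: "x \<in> carrier L2"
    obtain p where p: "p \<in> carrier P" "r = cls p" using cls_surj[OF r] by blast
    have xT: "x \<in> TT" using x by (simp add: L2_simps)
    note ex = enc2_W[OF xT]
    show "r \<odot>\<^bsub>L2\<^esub> x \<in> carrier L2"
      using L2_smult[OF p(1) xT] dec2_TT[OF O2.act_W[OF p(1) ex]] p(2) by (simp add: L2_simps)
    { assume y: "y \<in> carrier L2"
      then have yT: "y \<in> TT" by (simp add: L2_simps)
      have s: "x \<oplus>\<^bsub>L2\<^esub> y \<in> TT" using xT yT by (auto simp: L2_simps)
      show "r \<odot>\<^bsub>L2\<^esub> (x \<oplus>\<^bsub>L2\<^esub> y) = r \<odot>\<^bsub>L2\<^esub> x \<oplus>\<^bsub>L2\<^esub> r \<odot>\<^bsub>L2\<^esub> y"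
        unfolding p(2) L2_smult[OF p(1) xT] L2_smult[OF p(1) yT] L2_smult[OF p(1) s] enc2_add[OF xT yT]
          lin_on_add[OF O2.act_lin[OF p(1)] ex enc2_W[OF yT]]
        by (rule dec2_add[OF O2.act_W[OF p(1) ex] O2.act_W[OF p(1) enc2_W[OF yT]]]) }
    { assume "s \<in> carrier Lam"
      then obtain q where q: "q \<in> carrier P" "s = cls q" using cls_surj by blast
      have pq: "(\<lambda>w. p w + q w) \<in> carrier P" by (rule path_algebra_add_closed[OF p(1) q(1)])
      show "(r \<oplus>\<^bsub>Lam\<^esub> s) \<odot>\<^bsub>L2\<^esub> x = r \<odot>\<^bsub>L2\<^esub> x \<oplus>\<^bsub>L2\<^esub> s \<odot>\<^bsub>L2\<^esub> x"
        unfolding p(2) q(2) cls_add[OF p(1) q(1), symmetric] L2_smult[OF pq xT] L2_smult[OF p(1) xT] L2_smult[OF q(1) xT]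
          O2.act_add[OF p(1) q(1)]
        by (rule dec2_add[OF O2.act_W[OF p(1) ex] O2.act_W[OF q(1) ex]])
      have m: "p \<otimes>\<^bsub>P\<^esub> q \<in> carrier P" by (rule path_algebra_mult_closed[OF p(1) q(1)])
      have dq: "dec2 (O2.act q (enc2 x)) \<in> TT" by (rule dec2_TT[OF O2.act_W[OF q(1) ex]])
      show "(r \<otimes>\<^bsub>Lam\<^esub> s) \<odot>\<^bsub>L2\<^esub> x = r \<odot>\<^bsub>L2\<^esub> (s \<odot>\<^bsub>L2\<^esub> x)"
        unfolding p(2) q(2) cls_mult[OF p(1) q(1), symmetric] L2_smult[OF m xT] L2_smult[OF q(1) xT] L2_smult[OF p(1) dq]
          enc2_dec2[OF O2.act_W[OF q(1) ex]] O2.act_mult[OF p(1) q(1) ex] .. }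
  next
    fix x assume "x \<in> carrier L2"
    then have xT: "x \<in> TT" by (simp add: L2_simps)
    have "path_smult L2 (path_scalar 1) x = x"
      using L2_smult[OF path_scalar_carrier xT, of 1] O2.act_one[OF enc2_W[OF xT]] dec2_enc2[OF xT] by (simp add: path_scalar_one)
    then show "\<one>\<^bsub>Lam\<^esub> \<odot>\<^bsub>L2\<^esub> x = x" by (simp add: path_scalar_one cls_one)
  qed
qed

lemma L2_extension: "(L2, \<lambda>x. (x, \<zero>\<^bsub>T\<^esub>), snd) \<in> extensions Lam T T"
proof -
  interpret T: left_module Lam T by (rule lmT)
  have pT: "path_smult T p x = \<Phi> (act p (\<psi> x))" if "p \<in> carrier P" "x \<in> carrier T" for p x
    using Phi_op[OF that(1) psi_W[OF that(2)]] op_act[OF that(1) psi_W[OF that(2)]] Phi_psi[OF that(2)] by simp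
  have psi0: "\<psi> \<zero>\<^bsub>T\<^esub> = 0" using psi_Phi[OF cv.subspace_0[OF W]] Phi_zero by simp
  have 1: "(\<lambda>x. (x, \<zero>\<^bsub>T\<^esub>)) \<in> mod_hom Lam T L2"
    unfolding mod_hom_def
  proof (intro CollectI conjI ballI)
    fix r x assume r: "r \<in> carrier Lam" and x: "x \<in> carrier T"
    obtain p where p: "p \<in> carrier P" "r = cls p" using cls_surj[OF r] by blast
    have z: "(x, \<zero>\<^bsub>T\<^esub>) \<in> TT" using x by simp
    have e: "enc2 (x, \<zero>\<^bsub>T\<^esub>) True = \<psi> x" "enc2 (x, \<zero>\<^bsub>T\<^esub>) False = 0" using psi0 by (auto simp: enc2_def)
    have "act p 0 = 0" using lin_on_zero[OF act_lin[OF p(1)] W] .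
    then have "path_smult L2 p (x, \<zero>\<^bsub>T\<^esub>) = (path_smult T p x, \<zero>\<^bsub>T\<^esub>)"
      unfolding L2_smult[OF p(1) z] dec2_def act2_True[OF p(1) enc2_W[OF z] e(2)] act2_False[OF p(1) enc2_W[OF z]] e pT[OF p(1) x]
      by (simp add: Phi_zero)
    then show "(r \<odot>\<^bsub>T\<^esub> x, \<zero>\<^bsub>T\<^esub>) = r \<odot>\<^bsub>L2\<^esub> (x, \<zero>\<^bsub>T\<^esub>)" using p(2) by simp
  qed (auto simp: L2_simps)
  have 2: "snd \<in> mod_hom Lam L2 T"
    unfolding mod_hom_def
  proof (intro CollectI conjI ballI)
    fix r z assume r: "r \<in> carrier Lam" and "z \<in> carrier L2"
    then have z: "z \<in> TT" by (simp add: L2_simps)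
    obtain p where p: "p \<in> carrier P" "r = cls p" using cls_surj[OF r] by blast
    have zT: "snd z \<in> carrier T" using z by auto
    show "snd (r \<odot>\<^bsub>L2\<^esub> z) = r \<odot>\<^bsub>T\<^esub> snd z"
      unfolding p(2) L2_smult[OF p(1) z] dec2_def pT[OF p(1) zT]
      by (simp add: act2_False[OF p(1) enc2_W[OF z]]) (simp add: enc2_def)
  qed (auto simp: L2_simps)
  show ?thesis
    unfolding extensions_def using L2_module 1 2 by (auto simp: inj_on_def L2_simps image_iff)
qed

text \<open>
  By rigidity the extension is equivalent to the split one. The image of the second summand under
  the equivalence is the graph of a linear map, and the invariance of the graph says that this map
  bounds the cocycle.
\<close>

lemma rigid_coboundary:
  assumes rig: "rigid Lam T" shows "coboundary (sp W) a (sp W) a g"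
proof -
  interpret T: left_module Lam T by (rule lmT)
  let ?x = "(L2, \<lambda>x. (x, \<zero>\<^bsub>T\<^esub>), snd) :: (('i list \<Rightarrow> complex) set, 'm, 'm) extension"
  have self: "(?x, ?x) \<in> extension_equiv Lam T T"
  proof -
    have "(\<lambda>z. z) \<in> mod_hom Lam L2 L2" by (simp add: mod_hom_def)
    moreover have "bij_betw (\<lambda>z. z) (carrier L2) (carrier L2)" by (simp add: bij_betw_def)
    ultimately show ?thesis unfolding extension_equiv_def using L2_extension by blast
  qed
  have "extension_equiv Lam T T `` {?x} \<in> Ext1 Lam T T" unfolding Ext1_def by (rule quotientI[OF L2_extension])
  then have "extension_equiv Lam T T `` {?x} = Ext1_zero Lam T T" using rig by (simp add: rigid_def)
  then have "?x \<in> Ext1_zero Lam T T" using self by blast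
  then obtain H where H: "H \<in> mod_hom Lam (direct_sum2 T T) L2"
    "\<And>z. z \<in> carrier (direct_sum2 T T) \<Longrightarrow> snd (H z) = snd z"
    unfolding Ext1_zero_def extension_equiv_def by blast
  have HTT: "H z \<in> TT" if "z \<in> TT" for z using H(1) that by (auto simp: mod_hom_def direct_sum2_def L2_simps)
  have Hadd: "H (fst x \<oplus>\<^bsub>T\<^esub> fst y, snd x \<oplus>\<^bsub>T\<^esub> snd y) = H x \<oplus>\<^bsub>L2\<^esub> H y" if "x \<in> TT" "y \<in> TT" for x y
    using H(1) that by (auto simp: mod_hom_def direct_sum2_def)
  have Hsm: "H (path_smult T p (fst x), path_smult T p (snd x)) = path_smult L2 p (H x)" if "x \<in> TT" "p \<in> carrier P" for x p
    using H(1) that cls_carrier by (auto simp: mod_hom_def direct_sum2_def)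
  (* The linear map whose graph is the image of the second summand. *)
  define s where "s = (\<lambda>x. \<psi> (fst (H (\<zero>\<^bsub>T\<^esub>, \<Phi> x))))"
  have z: "(\<zero>\<^bsub>T\<^esub>, \<Phi> x) \<in> TT" if "x \<in> W" for x using Phi_T[OF that] by simp
  have Hs: "H (\<zero>\<^bsub>T\<^esub>, \<Phi> x) = dec2 (\<lambda>b. if b then s x else x)" if x: "x \<in> W" for x
  proof -
    have m: "H (\<zero>\<^bsub>T\<^esub>, \<Phi> x) \<in> TT" using HTT[OF z[OF x]] .
    have "snd (H (\<zero>\<^bsub>T\<^esub>, \<Phi> x)) = \<Phi> x" using H(2)[of "(\<zero>\<^bsub>T\<^esub>, \<Phi> x)"] Phi_T[OF x] by (simp add: direct_sum2_def)
    moreover have "fst (H (\<zero>\<^bsub>T\<^esub>, \<Phi> x)) = \<Phi> (s x)" unfolding s_def using m by (subst Phi_psi) auto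
    ultimately show ?thesis by (simp add: dec2_def prod_eq_iff)
  qed
  have sW: "s x \<in> W" if x: "x \<in> W" for x
  proof -
    have "H (\<zero>\<^bsub>T\<^esub>, \<Phi> x) \<in> TT" using HTT[OF z[OF x]] .
    then show ?thesis unfolding s_def by (intro psi_W) auto
  qed
  have pair: "(\<lambda>b. if b then s x else x) \<in> W2" if "x \<in> W" for x using that sW by (simp add: W2_iff)
  have key: "s (act p x) = O2.act p (\<lambda>b. if b then s x else x) True" if p: "p \<in> carrier P" and x: "x \<in> W" for p x
  proof -
    have "\<Phi> (act p x) = path_smult T p (\<Phi> x)" using Phi_op[OF p x] op_act[OF p x] by simp
    then have "H (\<zero>\<^bsub>T\<^esub>, \<Phi> (act p x)) = path_smult L2 p (H (\<zero>\<^bsub>T\<^esub>, \<Phi> x))"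
      using Hsm[OF z[OF x] p] path_smult_zero_r[OF lmT p] by simp
    also have "\<dots> = dec2 (O2.act p (\<lambda>b. if b then s x else x))"
      using Hs[OF x] L2_smult[OF p dec2_TT[OF pair[OF x]]] enc2_dec2[OF pair[OF x]] by simp
    finally have "fst (H (\<zero>\<^bsub>T\<^esub>, \<Phi> (act p x))) = \<Phi> (O2.act p (\<lambda>b. if b then s x else x) True)"
      by (simp add: dec2_def)
    then have "s (act p x) = \<psi> (\<Phi> (O2.act p (\<lambda>b. if b then s x else x) True))" by (simp add: s_def)
    also have "\<dots> = O2.act p (\<lambda>b. if b then s x else x) True"
      using O2.act_W[OF p pair[OF x]] by (intro psi_Phi) (simp add: W2_iff)
    finally show ?thesis .
  qed
  have sadd: "s (x + y) = s x + s y" if x: "x \<in> W" and y: "y \<in> W" for x y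
  proof -
    have "H (\<zero>\<^bsub>T\<^esub>, \<Phi> (x + y)) = H (\<zero>\<^bsub>T\<^esub>, \<Phi> x) \<oplus>\<^bsub>L2\<^esub> H (\<zero>\<^bsub>T\<^esub>, \<Phi> y)"
      using Hadd[OF z[OF x] z[OF y]] Phi_add[OF x y] by simp
    then have "fst (H (\<zero>\<^bsub>T\<^esub>, \<Phi> (x + y))) = fst (H (\<zero>\<^bsub>T\<^esub>, \<Phi> x)) \<oplus>\<^bsub>T\<^esub> fst (H (\<zero>\<^bsub>T\<^esub>, \<Phi> y))"
      by (simp add: L2_simps)
    moreover have "fst (H (\<zero>\<^bsub>T\<^esub>, \<Phi> x)) \<in> carrier T" "fst (H (\<zero>\<^bsub>T\<^esub>, \<Phi> y)) \<in> carrier T"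
      using HTT[OF z[OF x]] HTT[OF z[OF y]] by auto
    ultimately show ?thesis by (simp add: s_def psi_add)
  qed
  have sscale: "s (c *\<^sub>C x) = c *\<^sub>C s x" if x: "x \<in> W" for c x
    using key[OF path_scalar_carrier x, of c] act_scalar[OF x, of c] O2.act_scalar[OF pair[OF x], of c]
    by (simp add: path_scalar_def cscale_apply)
  have se: "s (e i x) = e i (s x)" if i: "i \<in> I" and x: "x \<in> W" for i x
    using key[OF spath_carrier[OF vertex_DP[OF i]] x, of 1] by (simp add: act_spath O2.act_spath cscale_one e2_def)
  have sa: "s (a i j x) = a i j (s x) + g i j (e i x)" if E: "(i, j) \<in> E" and x: "x \<in> W" for i j x
    using key[OF arrow_carrier[OF E] x] act_arrow[OF E x] O2.act_arrow[OF E pair[OF x]] by (simp add: a2_def)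
  have WW: "x \<in> W" "e i x = x" if "i \<in> I" "x \<in> sp W i" for i x using sp_eq[OF stable_W that] by auto
  have "maps (sp W) (sp W) (\<lambda>i. s)"
    unfolding maps_def
  proof (intro ballI conjI)
    fix i assume i: "i \<in> I"
    show "lin_on (sp W i) s" unfolding lin_on_def using sadd sscale WW(1)[OF i] by blast
    show "s x \<in> sp W i" if x: "x \<in> sp W i" for x
      using se[OF i WW(1)[OF i x]] WW[OF i x] sW sp_iff[OF stable_W i] by simp
  qed
  moreover have "g i j x = s (a i j x) - a i j (s x)" if E: "(i, j) \<in> E" and x: "x \<in> sp W i" for i j x
    using sa[OF E] WW[OF _ x] E_I[OF E] by simp
  ultimately show ?thesis unfolding coboundary_def by (intro exI[of _ "\<lambda>i. s"]) blast
qed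

end

lemma rigid_ext_orth: "rigid Lam T \<Longrightarrow> ext_orth (sp W) a (sp W) a"
  unfolding ext_orth_def using rigid_coboundary by blast

end

section \<open>Socles of modules cogenerated by injective hulls\<close>

context ppalg
begin

text \<open>
  The coefficient at \<open>[j]\<close> is the scalar by which an element acts on the simple representation at
  \<open>j\<close>, where the mesh relations hold.
\<close>

lemma ideal_vertex_coeff:
  assumes p: "p \<in> Jd" and j: "j \<in> I" shows "p [j] = 0"
proof -
  let ?e = "\<lambda>(i :: 'i) x :: complex. if i = j then x else 0" and ?a = "\<lambda>(i :: 'i) (k :: 'i) (x :: complex). 0 :: complex"
  interpret O: opspace I E h \<Omega> UNIV ?e ?a
    by unfold_locales (auto simp: cv.subspace_UNIV lin_on_def j finI)
  have pP: "p \<in> carrier P" using ideal.Icarr[OF ideal_J p] .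
  have z: "O.pact w x = 0" if "x = 0" for w x using that by (induction w x rule: O.pact.induct) auto
  have pw: "O.pact w 1 = (if w = [j] then 1 else 0)" for w
    by (cases "(w, 1 :: complex)" rule: O.pact.cases) (auto simp: z)
  have fin: "finite (insert [j] {w. p w \<noteq> 0})" using pP by (simp add: path_algebra_simps)
  have "O.act p 1 = (\<Sum>w\<in>insert [j] {w. p w \<noteq> 0}. p w *\<^sub>C O.pact w 1)" by (rule O.act_superset[OF fin]) auto
  also have "\<dots> = (\<Sum>w\<in>insert [j] {w. p w \<noteq> 0}. if w = [j] then p [j] else 0)" by (rule sum.cong) (auto simp: pw)
  also have "\<dots> = p [j]" using fin by simp
  finally have "O.act p 1 = p [j]" .
  moreover have "O.act p 1 = 0" by (rule O.act_ideal[OF _ p]) (auto simp: mesh_def)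
  ultimately show ?thesis by simp
qed

lemma simple_module_smult:
  assumes p: "p \<in> carrier P" and j: "j \<in> I"
  shows "path_smult (simple_module j) p z = p [j] * z"
proof -
  have "(\<lambda>f. f [j]) ` cls p = {p [j]}"
  proof -
    have 1: "f [j] = p [j]" if "f \<in> cls p" for f
      using that ideal_vertex_coeff[OF _ j] by (auto simp: cls_def a_r_coset_def' path_algebra_simps(5))
    have 2: "p \<in> cls p" unfolding cls_def
    proof -
      interpret ideal Jd P by (rule ideal_J)
      show "p \<in> Jd +>\<^bsub>P\<^esub> p" by (rule a_rcos_self[OF p])
    qed
    show ?thesis
    proof (intro equalityI image_subsetI)
      show "f [j] \<in> {p [j]}" if "f \<in> cls p" for f using 1[OF that] by simp
      show "{p [j]} \<subseteq> (\<lambda>f. f [j]) ` cls p" using 2 by blast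
    qed
  qed
  then have "the_elem ((\<lambda>f. f [j]) ` cls p) = p [j]" by simp
  then show ?thesis by (simp add: simple_module_def)
qed

text \<open>
  Such an element spans a submodule of dimension at most one on which the trivial path at \<open>j\<close> acts
  as zero. On the image of the simple module it acts as the identity, so the two intersect in
  zero; but the embedding of the simple module is essential.
\<close>

lemma hull_no_socle:
  fixes Q :: "(('i list \<Rightarrow> complex) set, 'q) module"
  assumes hull: "injective_hull Lam (simple_module j) Q" and j: "j \<in> I" and k: "k \<in> I" "k \<noteq> j"
    and q: "q \<in> carrier Q" and ek: "path_smult Q (spath [k] 1) q = q" and ar: "\<And>l. (k, l) \<in> E \<Longrightarrow> path_smult Q (arrow (k, l)) q = \<zero>\<^bsub>Q\<^esub>"
  shows "q = \<zero>\<^bsub>Q\<^esub>"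
proof -
  have lm: "left_module Lam Q" using hull by (simp add: injective_hull_def injective_module_def)
  interpret Q: left_module Lam Q by (rule lm)
  obtain f where f: "f \<in> mod_hom Lam (simple_module j) Q"
    and ess: "\<And>U. submodule U Lam Q \<Longrightarrow> U \<inter> f ` carrier (simple_module j) = {\<zero>\<^bsub>Q\<^esub>} \<Longrightarrow> U = {\<zero>\<^bsub>Q\<^esub>}"
    using hull unfolding injective_hull_def by blast
  have vD: "[i] \<in> DP" if "i \<in> I" for i using that by (simp add: DP_Cons)
  have pz: "path_smult Q p \<zero>\<^bsub>Q\<^esub> = \<zero>\<^bsub>Q\<^esub>" if "p \<in> carrier P" for p by (rule path_smult_zero_r[OF lm that])
  have path: "path_smult Q (spath w c) q = path_smult Q (path_scalar (spath w c [k])) q" if w: "w \<in> DP" for w c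
  proof -
    obtain i r where wi: "w = i # r" using w DP_nonempty by (cases w) auto
    have i: "i \<in> I" using w wi by (simp add: DP_Cons)
    have sk: "spath [k] 1 \<in> carrier P" by (rule spath_carrier[OF vD[OF k(1)]])
    show ?thesis
    proof (cases "i = k")
      case False
      have "spath w c \<otimes>\<^bsub>P\<^esub> spath [k] 1 = (\<lambda>w. 0)" using False by (simp add: wi spath_mult)
      then have "path_smult Q (spath w c) (path_smult Q (spath [k] 1) q) = \<zero>\<^bsub>Q\<^esub>"
        using path_smult_mult[OF lm spath_carrier[OF w] sk q, of c] path_smult_zero[OF lm q] by simp
      then show ?thesis using ek False path_smult_zero[OF lm q] by (simp add: wi spath_def path_scalar_zero)
    next
      case True
      show ?thesis
      proof (cases r)
        case Nil
        have "spath [k] c = path_scalar c \<otimes>\<^bsub>P\<^esub> spath [k] 1" using path_scalar_mult(1)[OF sk] by (auto simp: spath_def fun_eq_iff)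
        then have "path_smult Q (spath [k] c) q = path_smult Q (path_scalar c) q" using path_smult_mult[OF lm path_scalar_carrier sk q] ek by simp
        then show ?thesis using Nil True by (simp add: wi spath_def)
      next
        case (Cons l s)
        have E: "(k, l) \<in> E" and D: "l # s \<in> DP" using w Cons True by (auto simp: wi DP_Cons)
        have "spath w c = spath (l # s) c \<otimes>\<^bsub>P\<^esub> arrow (k, l)" using True Cons by (simp add: wi arrow_spath spath_mult)
        then have "path_smult Q (spath w c) q = \<zero>\<^bsub>Q\<^esub>"
          using path_smult_mult[OF lm spath_carrier[OF D] arrow_carrier[OF E] q] ar[OF E] pz[OF spath_carrier[OF D]] by simp
        moreover have "spath w c [k] = 0" using Cons by (simp add: spath_def wi)
        ultimately show ?thesis using path_smult_zero[OF lm q] by (simp add: path_scalar_zero)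
      qed
    qed
  qed
  have formula: "path_smult Q p q = path_smult Q (path_scalar (p [k])) q" if "p \<in> carrier P" for p
    using that
  proof (induction rule: path_algebra_induct)
    case zero then show ?case using path_smult_zero[OF lm q] by (simp add: path_scalar_zero)
  next
    case (add w c f)
    then show ?case using path_smult_add[OF lm spath_carrier[OF add(1)] add(2) q] path[OF add(1)]
        path_smult_add[OF lm path_scalar_carrier path_scalar_carrier q] by (simp add: path_scalar_add)
  qed
  let ?N = "(\<lambda>c. path_smult Q (path_scalar c) q) ` UNIV"
  have N: "submodule ?N Lam Q"
  proof (rule submodule_intro[OF lm])
    show "?N \<subseteq> carrier Q" using path_smult_closed[OF lm path_scalar_carrier q] by blast
    show "\<zero>\<^bsub>Q\<^esub> \<in> ?N" using path_smult_zero[OF lm q] path_scalar_zero by (metis rangeI)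
    show "x \<oplus>\<^bsub>Q\<^esub> y \<in> ?N" if xy: "x \<in> ?N" "y \<in> ?N" for x y
    proof -
      obtain c d where "x = path_smult Q (path_scalar c) q" "y = path_smult Q (path_scalar d) q" using xy by blast
      then have "x \<oplus>\<^bsub>Q\<^esub> y = path_smult Q (path_scalar (c + d)) q" using path_smult_add[OF lm path_scalar_carrier path_scalar_carrier q] by (simp add: path_scalar_add)
      then show ?thesis by blast
    qed
    show "path_smult Q p x \<in> ?N" if p: "p \<in> carrier P" and x: "x \<in> ?N" for p x
    proof -
      obtain c where c: "x = path_smult Q (path_scalar c) q" using x by blast
      have m: "p \<otimes>\<^bsub>P\<^esub> path_scalar c \<in> carrier P" by (rule path_algebra_mult_closed[OF p path_scalar_carrier])
      have "path_smult Q p x = path_smult Q (p \<otimes>\<^bsub>P\<^esub> path_scalar c) q" using c path_smult_mult[OF lm p path_scalar_carrier q] by simp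
      then show ?thesis using formula[OF m] by simp
    qed
  qed
  have f0: "f 0 = \<zero>\<^bsub>Q\<^esub>"
  proof -
    have "f 0 \<in> carrier Q" using f by (auto simp: mod_hom_def simple_module_def)
    moreover have "f (0 + 0) = f 0 \<oplus>\<^bsub>Q\<^esub> f 0" using f by (simp add: mod_hom_def simple_module_def del: add_0 add_0_right)
    then have "f 0 \<oplus>\<^bsub>Q\<^esub> f 0 = f 0" by simp
    ultimately have "f 0 \<in> carrier Q" "f 0 \<oplus>\<^bsub>Q\<^esub> f 0 = f 0" .
    then show ?thesis using Q.add.l_cancel_one by blast
  qed
  have "?N \<inter> f ` carrier (simple_module j) = {\<zero>\<^bsub>Q\<^esub>}"
  proof
    show "?N \<inter> f ` carrier (simple_module j) \<subseteq> {\<zero>\<^bsub>Q\<^esub>}"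
    proof
      fix n assume "n \<in> ?N \<inter> f ` carrier (simple_module j)"
      then obtain c z where c: "n = path_smult Q (path_scalar c) q" and zz: "n = f z" by blast
      have sj: "spath [j] 1 \<in> carrier P" by (rule spath_carrier[OF vD[OF j]])
      have "f (path_smult (simple_module j) (spath [j] 1) z) = path_smult Q (spath [j] 1) (f z)"
        using f cls_carrier[OF sj] by (auto simp: mod_hom_def simple_module_def)
      then have "path_smult Q (spath [j] 1) n = n" using simple_module_smult[OF sj j, of z] zz by (simp add: spath_def)
      moreover have "path_smult Q (spath [j] 1) n = path_smult Q (spath [j] 1 \<otimes>\<^bsub>P\<^esub> path_scalar c) q" using c path_smult_mult[OF lm sj path_scalar_carrier q] by simp
      moreover have "(spath [j] 1 \<otimes>\<^bsub>P\<^esub> path_scalar c) [k] = 0" using path_scalar_mult(2)[OF sj] k(2) by (simp add: spath_def)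
      ultimately have "n = path_smult Q (path_scalar 0) q" using formula[OF path_algebra_mult_closed[OF sj path_scalar_carrier]] by simp
      then show "n \<in> {\<zero>\<^bsub>Q\<^esub>}" using path_smult_zero[OF lm q] by (simp add: path_scalar_zero)
    qed
    show "{\<zero>\<^bsub>Q\<^esub>} \<subseteq> ?N \<inter> f ` carrier (simple_module j)"
    proof -
      have "\<zero>\<^bsub>Q\<^esub> \<in> f ` carrier (simple_module j)" using f0 by (intro image_eqI[of _ _ 0]) (simp_all add: simple_module_def)
      then show ?thesis using submodule_facts(2)[OF lm N] by blast
    qed
  qed
  then have "?N = {\<zero>\<^bsub>Q\<^esub>}" by (rule ess[OF N])
  moreover have "q \<in> ?N" using path_smult_one[OF lm q] by (metis rangeI)
  ultimately show ?thesis by blast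
qed

text \<open>The components of its image in a sum of copies of the \<open>Q j\<close> vanish by \<open>hull_no_socle\<close>.\<close>

lemma in_Sub_no_socle:
  fixes Q :: "'i \<Rightarrow> (('i list \<Rightarrow> complex) set, 'q) module"
  assumes hull: "\<And>j. j \<in> J \<Longrightarrow> injective_hull Lam (simple_module j) (Q j)" and J: "J \<subseteq> I"
    and sub: "in_Sub I \<Omega> Q J T" and k: "k \<in> I" "k \<notin> J"
    and t: "t \<in> carrier T" and ek: "path_smult T (spath [k] 1) t = t" and ar: "\<And>l. (k, l) \<in> E \<Longrightarrow> path_smult T (arrow (k, l)) t = \<zero>\<^bsub>T\<^esub>"
  shows "t = \<zero>\<^bsub>T\<^esub>"
proof -
  have lmT: "left_module Lam T" using sub by (simp add: in_Sub_def fd_module_def)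
  interpret T: left_module Lam T by (rule lmT)
  obtain n :: nat and U where U: "submodule U Lam (direct_sum {..<n} (\<lambda>_. direct_sum J Q))"
    and "mod_isomorphic Lam T (restrict_module (direct_sum {..<n} (\<lambda>_. direct_sum J Q)) U)"
    using sub unfolding in_Sub_def by blast
  then obtain \<theta> where \<theta>: "\<theta> \<in> mod_hom Lam T (restrict_module (direct_sum {..<n} (\<lambda>_. direct_sum J Q)) U)"
    and inj: "inj_on \<theta> (carrier T)" unfolding mod_isomorphic_def bij_betw_def by auto
  let ?D = "direct_sum {..<n} (\<lambda>_. direct_sum J Q)"
  have UD: "U \<subseteq> carrier ?D" using submodule.axioms(1)[OF U] subgroup.subset by fastforce
  have D: "\<theta> x \<in> carrier ?D" if "x \<in> carrier T" for x using \<theta> that UD by (auto simp: mod_hom_def)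
  have sm: "\<theta> (path_smult T p x) = path_smult ?D p (\<theta> x)" if "p \<in> carrier P" "x \<in> carrier T" for p x
    using \<theta> that cls_carrier by (auto simp: mod_hom_def)
  have comp: "\<theta> (path_smult T p x) s j = path_smult (Q j) p (\<theta> x s j)" if "p \<in> carrier P" "x \<in> carrier T" "s < n" "j \<in> J" for p x s j
    using sm[OF that(1,2)] that(3,4) by (simp add: direct_sum_def)
  have cQ: "\<theta> x s j \<in> carrier (Q j)" if "x \<in> carrier T" "s < n" "j \<in> J" for x s j
    using D[OF that(1)] that by (auto simp: direct_sum_def PiE_iff)
  have sk: "spath [k] 1 \<in> carrier P" using k(1) by (intro spath_carrier) (simp add: DP_Cons)
  have zero: "\<theta> x s j = \<zero>\<^bsub>Q j\<^esub>"
    if x: "x \<in> carrier T" "path_smult T (spath [k] 1) x = x" "\<And>l. (k, l) \<in> E \<Longrightarrow> path_smult T (arrow (k, l)) x = \<zero>\<^bsub>T\<^esub>"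
      and s: "s < n" and j: "j \<in> J" and z: "\<theta> \<zero>\<^bsub>T\<^esub> s j = \<zero>\<^bsub>Q j\<^esub>" for x s j
  proof (rule hull_no_socle[OF hull[OF j] _ k(1) _ cQ[OF x(1) s j]])
    show "j \<in> I" using j J by blast
    show "k \<noteq> j" using j k(2) by blast
    show "path_smult (Q j) (spath [k] 1) (\<theta> x s j) = \<theta> x s j" using comp[OF sk x(1) s j] x(2) by simp
    show "path_smult (Q j) (arrow (k, l)) (\<theta> x s j) = \<zero>\<^bsub>Q j\<^esub>" if "(k, l) \<in> E" for l
      using comp[OF arrow_carrier[OF that] x(1) s j] x(3)[OF that] z by simp
  qed
  have z0: "\<theta> \<zero>\<^bsub>T\<^esub> s j = \<zero>\<^bsub>Q j\<^esub>" if s: "s < n" and j: "j \<in> J" for s j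
  proof -
    interpret Qj: left_module Lam "Q j" using hull[OF j] by (simp add: injective_hull_def injective_module_def)
    have "\<theta> (\<zero>\<^bsub>T\<^esub> \<oplus>\<^bsub>T\<^esub> \<zero>\<^bsub>T\<^esub>) = \<theta> \<zero>\<^bsub>T\<^esub> \<oplus>\<^bsub>?D\<^esub> \<theta> \<zero>\<^bsub>T\<^esub>"
      using \<theta> T.zero_closed unfolding mod_hom_def by (simp del: T.l_zero T.r_zero)
    then have "\<theta> \<zero>\<^bsub>T\<^esub> s j = (\<theta> \<zero>\<^bsub>T\<^esub> \<oplus>\<^bsub>?D\<^esub> \<theta> \<zero>\<^bsub>T\<^esub>) s j" using T.l_zero[OF T.zero_closed] by metis
    then have "\<theta> \<zero>\<^bsub>T\<^esub> s j \<oplus>\<^bsub>Q j\<^esub> \<theta> \<zero>\<^bsub>T\<^esub> s j = \<theta> \<zero>\<^bsub>T\<^esub> s j" using s j by (simp add: direct_sum_def)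
    then show ?thesis using cQ[OF T.zero_closed s j] Qj.add.l_cancel_one by blast
  qed
  have "\<theta> t = \<theta> \<zero>\<^bsub>T\<^esub>"
  proof
    fix s
    have m: "\<theta> t \<in> carrier ?D" "\<theta> \<zero>\<^bsub>T\<^esub> \<in> carrier ?D" using D t by auto
    show "\<theta> t s = \<theta> \<zero>\<^bsub>T\<^esub> s"
    proof (cases "s < n")
      case False
      then show ?thesis using m by (auto simp: direct_sum_def PiE_iff extensional_def)
    next
      case s: True
      show ?thesis
      proof
        fix j
        show "\<theta> t s j = \<theta> \<zero>\<^bsub>T\<^esub> s j"
        proof (cases "j \<in> J")
          case True then show ?thesis using zero[OF t ek ar s True z0[OF s True]] z0[OF s True] by simp
        next
          case False
          have "\<theta> t s \<in> carrier (direct_sum J Q)" "\<theta> \<zero>\<^bsub>T\<^esub> s \<in> carrier (direct_sum J Q)"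
            using m s by (auto simp: direct_sum_def)
          then show ?thesis using False by (auto simp: direct_sum_def PiE_iff extensional_def)
        qed
      qed
    qed
  qed
  then show ?thesis using inj t by (auto dest: inj_onD)
qed

end

section \<open>The bound\<close>

context coord
begin

text \<open>
  One representative is chosen from every isomorphism class. It suffices to bound the finite sets
  of classes, and this also shows that there are finitely many.
\<close>

lemma summand_classes_bound:
  assumes sub: "in_Sub I \<Omega> Q J T" and hull: "\<And>j. j \<in> J \<Longrightarrow> injective_hull Lam (simple_module j) (Q j)"
    and J: "J \<subseteq> I" and rig: "rigid Lam T"
  shows "finite (indecomposable_summand_classes Lam T) \<and>
    num_positive_roots (I - J) (full_subdiagram E (I - J)) + card (indecomposable_summand_classes Lam T) \<le> num_positive_roots I E"
proof -
  let ?K = "I - J"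
  let ?R = "{(U, V). U \<in> indecomposable_summands Lam T \<and> V \<in> indecomposable_summands Lam T \<and>
                mod_isomorphic Lam (restrict_module T U) (restrict_module T V)}"
  obtain w where w: "set w \<subseteq> I" "num_positive_roots I E = num_positive_roots ?K (full_subdiagram E ?K) + length w"
    and full: "\<And>(S :: 'i \<Rightarrow> 'u set) A i. is_rep S A \<Longrightarrow>
      (\<And>k x. k \<in> ?K \<Longrightarrow> x \<in> S k \<Longrightarrow> (\<And>j. j \<in> nb k \<Longrightarrow> A k j x = 0) \<Longrightarrow> x = 0) \<Longrightarrow> i \<in> I \<Longrightarrow> socw S A w zspace i = S i"
    by (rule socle_word[of ?K]) blast+
  have soc: "x = 0" if k: "k \<in> ?K" and x: "x \<in> sp W k" and out: "\<And>j. j \<in> nb k \<Longrightarrow> a k j x = 0" for k x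
  proof -
    have kI: "k \<in> I" using k by blast
    have xW: "x \<in> W" "e k x = x" using sp_eq[OF stable_W kI x] by auto
    have "\<Phi> x = \<zero>\<^bsub>T\<^esub>"
    proof (rule in_Sub_no_socle[OF hull J sub kI _ Phi_T[OF xW(1)]])
      show "k \<notin> J" using k by blast
      show "path_smult T (spath [k] 1) (\<Phi> x) = \<Phi> x"
        using Phi_op[OF spath_carrier[OF vertex_DP[OF kI]] xW(1), of 1] xW(2) by (simp add: e_def)
      show "path_smult T (arrow (k, l)) (\<Phi> x) = \<zero>\<^bsub>T\<^esub>" if "(k, l) \<in> E" for l
        using Phi_op[OF arrow_carrier[OF that] xW(1)] out[of l] that Phi_zero by (simp add: a_def nb_def)
    qed
    then show ?thesis using psi_Phi[OF xW(1)] psi_Phi[OF cv.subspace_0[OF W]] Phi_zero by simp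
  qed
  have bound: "card G \<le> length w" if G: "G \<subseteq> indecomposable_summand_classes Lam T" "finite G" for G
  proof -
    define c where "c = (\<lambda>X. SOME U. U \<in> indecomposable_summands Lam T \<and> X = ?R `` {U})"
    have c: "c X \<in> indecomposable_summands Lam T" "X = ?R `` {c X}" if "X \<in> G" for X
    proof -
      have "\<exists>U. U \<in> indecomposable_summands Lam T \<and> X = ?R `` {U}"
        using G(1) that unfolding indecomposable_summand_classes_def by (blast elim: quotientE)
      from someI_ex[OF this] show "c X \<in> indecomposable_summands Lam T" "X = ?R `` {c X}" by (auto simp: c_def)
    qed
    have U: "submodule U Lam T" "\<exists>U'. complementary Lam T U U'" "indecomposable Lam (restrict_module T U)"
      if "U \<in> indecomposable_summands Lam T" for U
      using that by (auto simp: indecomposable_summands_def complementary_def)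
    show ?thesis
    proof (rule card_rigid_family[where U = "\<lambda>X. sp (pre (c X))" and A = a, OF G(2) w(1)])
      fix X assume X: "X \<in> G"
      note UX = U[OF c(1)[OF X]]
      have st: "stable (pre (c X))" using stable_of_submodule[OF UX(1)] by blast
      show rep: "is_rep (sp (pre (c X))) a" by (rule stable_is_rep[OF st])
      show "rep_indec (sp (pre (c X))) a" by (rule indecomposable_rep_indec[OF UX(1,3)])
      show "socw (sp (pre (c X))) a w zspace i = sp (pre (c X)) i" if i: "i \<in> I" for i
      proof (rule full[OF rep _ i])
        fix k x assume "k \<in> ?K" "x \<in> sp (pre (c X)) k" "\<And>j. j \<in> nb k \<Longrightarrow> a k j x = 0"
        then show "x = 0" using soc sp_mono[OF stableD(2)[OF st]] by blast
      qed
      fix Y assume Y: "Y \<in> G"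
      note UY = U[OF c(1)[OF Y]]
      obtain U1 U2 where "complementary Lam T (c X) U1" "complementary Lam T (c Y) U2" using UX(2) UY(2) by blast
      then show "ext_orth (sp (pre (c X))) a (sp (pre (c Y))) a"
        using summands_ext_orth[OF rigid_ext_orth[OF rig] complementary_decomp complementary_decomp] by blast
      assume XY: "X \<noteq> Y"
      show "\<not> isomorphic (sp (pre (c X))) a (sp (pre (c Y))) a"
      proof
        assume iso: "isomorphic (sp (pre (c X))) a (sp (pre (c Y))) a"
        have iso': "isomorphic (sp (pre (c Y))) a (sp (pre (c X))) a" by (rule isomorphic_sym[OF rep iso])
        have XY: "mod_isomorphic Lam (restrict_module T (c X)) (restrict_module T (c Y))"
          "mod_isomorphic Lam (restrict_module T (c Y)) (restrict_module T (c X))"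
          using rep_iso_mod_isomorphic[OF UX(1) UY(1) iso] rep_iso_mod_isomorphic[OF UY(1) UX(1) iso'] by auto
        have tr: "mod_isomorphic Lam (restrict_module T A) (restrict_module T C)"
          if AB: "mod_isomorphic Lam (restrict_module T A) (restrict_module T B)" and BC: "mod_isomorphic Lam (restrict_module T B) (restrict_module T C)" for A B C
        proof -
          obtain f where f: "f \<in> mod_hom Lam (restrict_module T A) (restrict_module T B)" "bij_betw f A B"
            using AB unfolding mod_isomorphic_def by auto
          obtain g where g: "g \<in> mod_hom Lam (restrict_module T B) (restrict_module T C)" "bij_betw g B C"
            using BC unfolding mod_isomorphic_def by auto
          have "g \<circ> f \<in> mod_hom Lam (restrict_module T A) (restrict_module T C)"
            using f(1) g(1) by (auto simp: mod_hom_def Pi_iff)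
          then show ?thesis using bij_betw_trans[OF f(2) g(2)] unfolding mod_isomorphic_def by auto
        qed
        have "?R `` {c X} = ?R `` {c Y}" using XY tr c(1)[OF X] c(1)[OF Y] by blast
        then show False using c(2)[OF X] c(2)[OF Y] \<open>X \<noteq> Y\<close> by simp
      qed
    qed
  qed
  have "finite (indecomposable_summand_classes Lam T) \<and> card (indecomposable_summand_classes Lam T) \<le> length w"
    by (rule finite_if_finite_subsets_card_bdd) (use bound in blast)
  then show ?thesis using w(2) by simp
qed

end

theorem proposition7p1:
  fixes I J K :: "'i set" and E \<Omega> :: "('i \<times> 'i) set"
    and \<Lambda> :: "('i list \<Rightarrow> complex) set ring"
    and Q :: "'i \<Rightarrow> (('i list \<Rightarrow> complex) set, 'q) module"
    and T :: "(('i list \<Rightarrow> complex) set, 'm) module"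
  assumes "ADE_diagram I E"
    and "orientation E \<Omega>"
    and "\<Lambda> = preprojective_algebra I \<Omega>"
    and "J \<subseteq> I" and "J \<noteq> {}" and "K = I - J"
    and "\<And>j. j \<in> J \<Longrightarrow> injective_hull \<Lambda> (simple_module j) (Q j)"
    and "in_Sub I \<Omega> Q J T"
    and "rigid \<Lambda> T"
  shows "finite (indecomposable_summand_classes \<Lambda> T) \<and>
    int (num_indecomposable_summands \<Lambda> T) \<le>
      int (num_positive_roots I E) - int (num_positive_roots K (full_subdiagram E K))"
proof -
  obtain h where "dynkin I E h" using dynkin_ADE[OF assms(1)] .
  then interpret ppalg I E h \<Omega>
    unfolding ppalg_def ppalg_axioms_def preproj_def preproj_axioms_def
    using assms(2) by (simp add: sgn_eps_def)
  have "fd_module I \<Omega> T" using assms(8) by (simp add: in_Sub_def)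
  then obtain W :: "('m \<Rightarrow> complex) set" and \<Phi> where "cv.subspace W" "fd W" "bij_betw \<Phi> W (carrier T)"
    "\<And>x y. x \<in> W \<Longrightarrow> y \<in> W \<Longrightarrow> \<Phi> (x + y) = \<Phi> x \<oplus>\<^bsub>T\<^esub> \<Phi> y"
    "\<And>c x. x \<in> W \<Longrightarrow> \<Phi> (c *\<^sub>C x) = path_smult T (path_scalar c) (\<Phi> x)"
    by (rule fd_module_coordinates) blast
  moreover have "left_module Lam T" using assms(8) by (simp add: in_Sub_def fd_module_def)
  ultimately interpret coord I E h \<Omega> T W \<Phi> by (intro coord.intro coord_axioms.intro ppalg_axioms)
  show ?thesis
    using summand_classes_bound[OF assms(8) _ assms(4)] assms(7,9) unfolding assms(3,6) num_indecomposable_summands_def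
    by fastforce
qed

end
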